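(* Let $G=N\rtimes H$, $M$, $\mathcal U$, $H^+$, $D$, $\alpha$, $A=D\rtimes_\alpha G$ and $p=\chi_M$ be as in the context, with $\mathcal U$ having finite quotients, and assume that $H$ is abelian and $N=\bigcup_{a\in H^+}a^{-1}Ma$. For $a\in H^+$ and $m\in M$ put $s_a=pap$ and $u(m)=pmp$, elements of $pAp$. Then for every SU-family $\{S_a,U(m):a\in H^+,m\in M\}$ in a unital $C^*$-algebra $B$ there is a unique homomorphism ($*$-homomorphism) $\Pi:pAp\to B$ such that $$\Pi(s_a)=S_a\ \text{ for all } a\in H^+,\qquad \Pi(u(m))=U(m)\ \text{ for all } m\in M.$$
   Context: $G=N\rtimes H$ is a discrete group which is a semidirect product with normal subgroup $N$ and quotient group $H$ (regarded as a subgroup of $G$, acting on $N$ by conjugation), and $M\neq\{e\}$ is a normal subgroup of $N$. Put $\mathcal U=\{aMa^{-1}:a\in H\}$. Standing assumptions: (filter base) for all $U,V\in\mathcal U$ there is $W\in\mathcal U$ with $W\subseteq U\cap V$; (separating) $\bigcap_{U\in\mathcal U}U=\{e\}$; (finite quotients) $|U/V|<\infty$ whenever $V\subseteq U$ in $\mathcal U$. Put $H^+=\{a\in H:aMa^{-1}\subseteq M\}$. For $g=xa\in G$ with $x\in N$, $a\in H$, let $\beta_g(y)=xaya^{-1}$ for $y\in N$, and let $\alpha_g(f)=f\circ\beta_{g^{-1}}$ for $f\in\ell^\infty(N)$. $D$ is the $C^*$-subalgebra of $\ell^\infty(N)$ generated by the characteristic functions $\chi_{xU}$, $x\in N$, $U\in\mathcal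 U$; $\alpha$ restricts to an action of $G$ on $D$. $A=D\rtimes_\alpha G$ is the full crossed product; elements of $D$ and $G$ are identified with their images in the multiplier algebra of $A$. $p=\chi_M$, and $pAp$ is unital with unit $p$. An SU-family in a unital $C^*$-algebra $B$ consists of a set $\{S_a:a\in H^+\}$ of isometries ($S_a^*S_a=1$) in $B$ and a set $\{U(m):m\in M\}$ of unitaries in $B$ satisfying, for all $a,b\in H^+$ and $m,k\in M$: (1) $S_aS_b=S_{ab}$; (2) $S_aU(m)=U(ama^{-1})S_a$; (3) $\sum_{maMa^{-1}\in M/aMa^{-1}}U(m)S_aS_a^*U(m^{-1})=1$ (sum over the finitely many cosets, $m$ a representative of the coset); (4) $U(m)U(k)=U(mk)$. *)

theory Defs
  imports Complex_Main "HOL-Algebra.Module" "HOL-Algebra.Coset" "HOL-Library.FuncSet"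
    "HOL-Library.Indicator_Function"
begin

section \<open>C*-algebras\<close>

definition complex_ring :: "complex ring" where
  "complex_ring = \<lparr>carrier = UNIV, mult = (*), one = 1, zero = 0, add = (+)\<rparr>"

text \<open>The field \<open>one\<close> inherited from \<open>ring\<close> is meaningful only for unital algebras
  (\<open>unital_cstar_algebra\<close>, multiplier algebras, corners); nothing is assumed about it otherwise.
  The zero algebra is not excluded.\<close>

record 'a cstar = "(complex, 'a) module" +
  cs_star :: "'a \<Rightarrow> 'a"
  cs_norm :: "'a \<Rightarrow> real"

locale cstar_algebra = Module.module complex_ring A for A :: "('a, 'x) cstar_scheme" +
  assumes mult_closed: "\<lbrakk>x \<in> carrier A; y \<in> carrier A\<rbrakk> \<Longrightarrow> x \<otimes>\<^bsub>A\<^esub> y \<in> carrier A"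
    and mult_assoc: "\<lbrakk>x \<in> carrier A; y \<in> carrier A; z \<in> carrier A\<rbrakk> \<Longrightarrow>
      (x \<otimes>\<^bsub>A\<^esub> y) \<otimes>\<^bsub>A\<^esub> z = x \<otimes>\<^bsub>A\<^esub> (y \<otimes>\<^bsub>A\<^esub> z)"
    and mult_l_distr: "\<lbrakk>x \<in> carrier A; y \<in> carrier A; z \<in> carrier A\<rbrakk> \<Longrightarrow>
      (x \<oplus>\<^bsub>A\<^esub> y) \<otimes>\<^bsub>A\<^esub> z = (x \<otimes>\<^bsub>A\<^esub> z) \<oplus>\<^bsub>A\<^esub> (y \<otimes>\<^bsub>A\<^esub> z)"
    and mult_r_distr: "\<lbrakk>x \<in> carrier A; y \<in> carrier A; z \<in> carrier A\<rbrakk> \<Longrightarrow>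
      x \<otimes>\<^bsub>A\<^esub> (y \<oplus>\<^bsub>A\<^esub> z) = (x \<otimes>\<^bsub>A\<^esub> y) \<oplus>\<^bsub>A\<^esub> (x \<otimes>\<^bsub>A\<^esub> z)"
    and smult_mult_left: "\<lbrakk>x \<in> carrier A; y \<in> carrier A\<rbrakk> \<Longrightarrow>
      (c \<odot>\<^bsub>A\<^esub> x) \<otimes>\<^bsub>A\<^esub> y = c \<odot>\<^bsub>A\<^esub> (x \<otimes>\<^bsub>A\<^esub> y)"
    and smult_mult_right: "\<lbrakk>x \<in> carrier A; y \<in> carrier A\<rbrakk> \<Longrightarrow>
      x \<otimes>\<^bsub>A\<^esub> (c \<odot>\<^bsub>A\<^esub> y) = c \<odot>\<^bsub>A\<^esub> (x \<otimes>\<^bsub>A\<^esub> y)"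
    and star_closed: "x \<in> carrier A \<Longrightarrow> cs_star A x \<in> carrier A"
    and star_star: "x \<in> carrier A \<Longrightarrow> cs_star A (cs_star A x) = x"
    and star_add: "\<lbrakk>x \<in> carrier A; y \<in> carrier A\<rbrakk> \<Longrightarrow>
      cs_star A (x \<oplus>\<^bsub>A\<^esub> y) = cs_star A x \<oplus>\<^bsub>A\<^esub> cs_star A y"
    and star_smult: "x \<in> carrier A \<Longrightarrow> cs_star A (c \<odot>\<^bsub>A\<^esub> x) = cnj c \<odot>\<^bsub>A\<^esub> cs_star A x"
    and star_mult: "\<lbrakk>x \<in> carrier A; y \<in> carrier A\<rbrakk> \<Longrightarrow>
      cs_star A (x \<otimes>\<^bsub>A\<^esub> y) = cs_star A y \<otimes>\<^bsub>A\<^esub> cs_star A x"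
    and norm_eq_0: "x \<in> carrier A \<Longrightarrow> cs_norm A x = 0 \<longleftrightarrow> x = \<zero>\<^bsub>A\<^esub>"
    and norm_triangle: "\<lbrakk>x \<in> carrier A; y \<in> carrier A\<rbrakk> \<Longrightarrow>
      cs_norm A (x \<oplus>\<^bsub>A\<^esub> y) \<le> cs_norm A x + cs_norm A y"
    and norm_smult: "x \<in> carrier A \<Longrightarrow> cs_norm A (c \<odot>\<^bsub>A\<^esub> x) = cmod c * cs_norm A x"
    and norm_mult: "\<lbrakk>x \<in> carrier A; y \<in> carrier A\<rbrakk> \<Longrightarrow>
      cs_norm A (x \<otimes>\<^bsub>A\<^esub> y) \<le> cs_norm A x * cs_norm A y"
    and norm_star_mult: "x \<in> carrier A \<Longrightarrow> cs_norm A (cs_star A x \<otimes>\<^bsub>A\<^esub> x) = (cs_norm A x)\<^sup>2"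
    and complete: "\<lbrakk>\<And>n. s n \<in> carrier A;
        \<And>e. e > 0 \<Longrightarrow> \<exists>K. \<forall>m\<ge>K. \<forall>n\<ge>K. cs_norm A (s m \<ominus>\<^bsub>A\<^esub> s n) < e\<rbrakk> \<Longrightarrow>
      \<exists>x\<in>carrier A. (\<lambda>n. cs_norm A (s n \<ominus>\<^bsub>A\<^esub> x)) \<longlonglongrightarrow> 0"

locale unital_cstar_algebra = cstar_algebra A for A :: "('a, 'x) cstar_scheme" +
  assumes one_closed: "\<one>\<^bsub>A\<^esub> \<in> carrier A"
    and one_left: "x \<in> carrier A \<Longrightarrow> \<one>\<^bsub>A\<^esub> \<otimes>\<^bsub>A\<^esub> x = x"
    and one_right: "x \<in> carrier A \<Longrightarrow> x \<otimes>\<^bsub>A\<^esub> \<one>\<^bsub>A\<^esub> = x"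

definition star_hom :: "('a, 'x) cstar_scheme \<Rightarrow> ('b, 'y) cstar_scheme \<Rightarrow> ('a \<Rightarrow> 'b) \<Rightarrow> bool" where
  "star_hom A B \<phi> \<longleftrightarrow>
     \<phi> \<in> carrier A \<rightarrow> carrier B \<and>
     (\<forall>x\<in>carrier A. \<forall>y\<in>carrier A. \<phi> (x \<oplus>\<^bsub>A\<^esub> y) = \<phi> x \<oplus>\<^bsub>B\<^esub> \<phi> y) \<and>
     (\<forall>c. \<forall>x\<in>carrier A. \<phi> (c \<odot>\<^bsub>A\<^esub> x) = c \<odot>\<^bsub>B\<^esub> \<phi> x) \<and>
     (\<forall>x\<in>carrier A. \<forall>y\<in>carrier A. \<phi> (x \<otimes>\<^bsub>A\<^esub> y) = \<phi> x \<otimes>\<^bsub>B\<^esub> \<phi> y) \<and>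
     (\<forall>x\<in>carrier A. \<phi> (cs_star A x) = cs_star B (\<phi> x))"

definition isometry_elem :: "('a, 'x) cstar_scheme \<Rightarrow> 'a \<Rightarrow> bool" where
  "isometry_elem A s \<longleftrightarrow> s \<in> carrier A \<and> cs_star A s \<otimes>\<^bsub>A\<^esub> s = \<one>\<^bsub>A\<^esub>"

definition unitary_elem :: "('a, 'x) cstar_scheme \<Rightarrow> 'a \<Rightarrow> bool" where
  "unitary_elem A u \<longleftrightarrow> u \<in> carrier A \<and>
     cs_star A u \<otimes>\<^bsub>A\<^esub> u = \<one>\<^bsub>A\<^esub> \<and> u \<otimes>\<^bsub>A\<^esub> cs_star A u = \<one>\<^bsub>A\<^esub>"

definition closed_subspace :: "('a, 'x) cstar_scheme \<Rightarrow> 'a set \<Rightarrow> bool" where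
  "closed_subspace A S \<longleftrightarrow> S \<subseteq> carrier A \<and> \<zero>\<^bsub>A\<^esub> \<in> S \<and>
     (\<forall>x\<in>S. \<forall>y\<in>S. x \<oplus>\<^bsub>A\<^esub> y \<in> S) \<and> (\<forall>c. \<forall>x\<in>S. c \<odot>\<^bsub>A\<^esub> x \<in> S) \<and>
     (\<forall>s x. (\<forall>n::nat. s n \<in> S) \<and> x \<in> carrier A \<and>
        (\<lambda>n. cs_norm A (s n \<ominus>\<^bsub>A\<^esub> x)) \<longlonglongrightarrow> 0 \<longrightarrow> x \<in> S)"

definition closed_span :: "('a, 'x) cstar_scheme \<Rightarrow> 'a set \<Rightarrow> 'a set" where
  "closed_span A X = \<Inter>{S. closed_subspace A S \<and> X \<subseteq> S}"

definition cstar_subalgebra :: "('a, 'x) cstar_scheme \<Rightarrow> 'a set \<Rightarrow> bool" where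
  "cstar_subalgebra A S \<longleftrightarrow> closed_subspace A S \<and>
     (\<forall>x\<in>S. \<forall>y\<in>S. x \<otimes>\<^bsub>A\<^esub> y \<in> S) \<and> (\<forall>x\<in>S. cs_star A x \<in> S)"

definition cstar_generated :: "('a, 'x) cstar_scheme \<Rightarrow> 'a set \<Rightarrow> 'a set" where
  "cstar_generated A X = \<Inter>{S. cstar_subalgebra A S \<and> X \<subseteq> S}"

section \<open>Multiplier algebras\<close>

text \<open>The multiplier algebra is realised by double centralizers \<open>(L, R)\<close>: \<open>L\<close> and \<open>R\<close> are left and
  right multiplication by the multiplier. Both maps are \<open>undefined\<close> outside the algebra, so that
  equality of pairs is equality of multipliers.\<close>

definition bounded_linear_on :: "('a, 'x) cstar_scheme \<Rightarrow> ('a \<Rightarrow> 'a) \<Rightarrow> bool" where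
  "bounded_linear_on A L \<longleftrightarrow>
     (\<forall>x\<in>carrier A. \<forall>y\<in>carrier A. L (x \<oplus>\<^bsub>A\<^esub> y) = L x \<oplus>\<^bsub>A\<^esub> L y) \<and>
     (\<forall>c. \<forall>x\<in>carrier A. L (c \<odot>\<^bsub>A\<^esub> x) = c \<odot>\<^bsub>A\<^esub> L x) \<and>
     (\<exists>K. \<forall>x\<in>carrier A. cs_norm A (L x) \<le> K * cs_norm A x)"

definition double_centralizers :: "('a, 'x) cstar_scheme \<Rightarrow> (('a \<Rightarrow> 'a) \<times> ('a \<Rightarrow> 'a)) set" where
  "double_centralizers A = {(L, R).
     L \<in> carrier A \<rightarrow>\<^sub>E carrier A \<and> R \<in> carrier A \<rightarrow>\<^sub>E carrier A \<and>
     bounded_linear_on A L \<and> bounded_linear_on A R \<and>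
     (\<forall>x\<in>carrier A. \<forall>y\<in>carrier A. L (x \<otimes>\<^bsub>A\<^esub> y) = L x \<otimes>\<^bsub>A\<^esub> y) \<and>
     (\<forall>x\<in>carrier A. \<forall>y\<in>carrier A. R (x \<otimes>\<^bsub>A\<^esub> y) = x \<otimes>\<^bsub>A\<^esub> R y) \<and>
     (\<forall>x\<in>carrier A. \<forall>y\<in>carrier A. R x \<otimes>\<^bsub>A\<^esub> y = x \<otimes>\<^bsub>A\<^esub> L y)}"

definition multiplier_algebra :: "('a, 'x) cstar_scheme \<Rightarrow> (('a \<Rightarrow> 'a) \<times> ('a \<Rightarrow> 'a)) cstar" where
  "multiplier_algebra A = \<lparr>
     carrier = double_centralizers A,
     mult = (\<lambda>(L, R) (L', R'). (\<lambda>x\<in>carrier A. L (L' x), \<lambda>x\<in>carrier A. R' (R x))),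
     one = (\<lambda>x\<in>carrier A. x, \<lambda>x\<in>carrier A. x),
     zero = (\<lambda>x\<in>carrier A. \<zero>\<^bsub>A\<^esub>, \<lambda>x\<in>carrier A. \<zero>\<^bsub>A\<^esub>),
     add = (\<lambda>(L, R) (L', R'). (\<lambda>x\<in>carrier A. L x \<oplus>\<^bsub>A\<^esub> L' x, \<lambda>x\<in>carrier A. R x \<oplus>\<^bsub>A\<^esub> R' x)),
     smult = (\<lambda>c (L, R). (\<lambda>x\<in>carrier A. c \<odot>\<^bsub>A\<^esub> L x, \<lambda>x\<in>carrier A. c \<odot>\<^bsub>A\<^esub> R x)),
     cs_star = (\<lambda>(L, R). (\<lambda>x\<in>carrier A. cs_star A (R (cs_star A x)),
                          \<lambda>x\<in>carrier A. cs_star A (L (cs_star A x)))),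
     cs_norm = (\<lambda>(L, R). Sup {cs_norm A (L x) |x. x \<in> carrier A \<and> cs_norm A x \<le> 1})\<rparr>"

definition to_multiplier :: "('a, 'x) cstar_scheme \<Rightarrow> 'a \<Rightarrow> ('a \<Rightarrow> 'a) \<times> ('a \<Rightarrow> 'a)" where
  "to_multiplier A z = (\<lambda>x\<in>carrier A. z \<otimes>\<^bsub>A\<^esub> x, \<lambda>x\<in>carrier A. x \<otimes>\<^bsub>A\<^esub> z)"

text \<open>\<open>corner A p\<close> is \<open>pAp\<close> for a projection \<open>p\<close> of the multiplier algebra, where \<open>A\<close> is identified
  with its image in the multiplier algebra.\<close>

definition corner ::
  "('a, 'x) cstar_scheme \<Rightarrow> ('a \<Rightarrow> 'a) \<times> ('a \<Rightarrow> 'a) \<Rightarrow> (('a \<Rightarrow> 'a) \<times> ('a \<Rightarrow> 'a)) cstar" where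
  "corner A p = (multiplier_algebra A)
     \<lparr>carrier := (\<lambda>z. p \<otimes>\<^bsub>multiplier_algebra A\<^esub> to_multiplier A z \<otimes>\<^bsub>multiplier_algebra A\<^esub> p) ` carrier A,
      one := p\<rparr>"

section \<open>Full crossed products by discrete groups\<close>

text \<open>A covariant homomorphism of the system \<open>(D, G, \<alpha>)\<close> into a unital C*-algebra; \<open>\<pi>\<close> may be
  degenerate.\<close>

definition covariant_hom :: "('g, 'm) monoid_scheme \<Rightarrow> ('d, 'x) cstar_scheme \<Rightarrow> ('g \<Rightarrow> 'd \<Rightarrow> 'd) \<Rightarrow>
    ('c, 'y) cstar_scheme \<Rightarrow> ('d \<Rightarrow> 'c) \<Rightarrow> ('g \<Rightarrow> 'c) \<Rightarrow> bool" where
  "covariant_hom G D \<alpha> C \<pi> u \<longleftrightarrow>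
     star_hom D C \<pi> \<and>
     (\<forall>g\<in>carrier G. unitary_elem C (u g)) \<and>
     (\<forall>g\<in>carrier G. \<forall>h\<in>carrier G. u (g \<otimes>\<^bsub>G\<^esub> h) = u g \<otimes>\<^bsub>C\<^esub> u h) \<and>
     (\<forall>g\<in>carrier G. \<forall>d\<in>carrier D. \<pi> (\<alpha> g d) = u g \<otimes>\<^bsub>C\<^esub> \<pi> d \<otimes>\<^bsub>C\<^esub> cs_star C (u g))"

text \<open>\<open>(A, i\<^sub>D, i\<^sub>G)\<close> is a full crossed product of \<open>(D, G, \<alpha>)\<close>: \<open>(i\<^sub>D, i\<^sub>G)\<close> is a covariant homomorphism
  into the multiplier algebra of \<open>A\<close>, the products \<open>i\<^sub>D(d) i\<^sub>G(g)\<close> lie in \<open>A\<close> and span a dense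
  subspace of it, and every covariant homomorphism \<open>(\<pi>, u)\<close> into a unital C*-algebra has an
  integrated form on \<open>A\<close>. This determines \<open>(A, i\<^sub>D, i\<^sub>G)\<close> up to isomorphism.

  HOL cannot quantify over all types of elements for \<open>C\<close>, but the type below is large enough:
  for any \<open>(\<pi>, u)\<close>, the unital C*-subalgebra generated by \<open>\<pi>\<close> and \<open>u\<close> is a completion of a
  quotient of the finitely supported functions from \<open>G\<close> to the unitization of \<open>D\<close>, hence (for
  nonzero \<open>D\<close>) has at most as many elements as there are sequences in \<open>'g \<Rightarrow> 'd\<close>, and so is
  isomorphic to an algebra with elements of this type.\<close>

definition full_crossed_product :: "('g, 'm) monoid_scheme \<Rightarrow> ('d, 'x) cstar_scheme \<Rightarrow>
    ('g \<Rightarrow> 'd \<Rightarrow> 'd) \<Rightarrow> ('a, 'y) cstar_scheme \<Rightarrow>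
    ('d \<Rightarrow> ('a \<Rightarrow> 'a) \<times> ('a \<Rightarrow> 'a)) \<Rightarrow> ('g \<Rightarrow> ('a \<Rightarrow> 'a) \<times> ('a \<Rightarrow> 'a)) \<Rightarrow> bool" where
  "full_crossed_product G D \<alpha> A iD iG \<longleftrightarrow>
     cstar_algebra A \<and>
     covariant_hom G D \<alpha> (multiplier_algebra A) iD iG \<and>
     (\<forall>d\<in>carrier D. \<forall>g\<in>carrier G.
        iD d \<otimes>\<^bsub>multiplier_algebra A\<^esub> iG g \<in> to_multiplier A ` carrier A) \<and>
     closed_span A {z \<in> carrier A. \<exists>d\<in>carrier D. \<exists>g\<in>carrier G.
        to_multiplier A z = iD d \<otimes>\<^bsub>multiplier_algebra A\<^esub> iG g} = carrier A \<and>
     (\<forall>(C :: (nat \<Rightarrow> 'g \<Rightarrow> 'd) set cstar) \<pi> u.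
        unital_cstar_algebra C \<and> covariant_hom G D \<alpha> C \<pi> u \<longrightarrow>
        (\<exists>\<Phi>. star_hom A C \<Phi> \<and>
           (\<forall>d\<in>carrier D. \<forall>g\<in>carrier G. \<forall>z\<in>carrier A.
              to_multiplier A z = iD d \<otimes>\<^bsub>multiplier_algebra A\<^esub> iG g \<longrightarrow>
              \<Phi> z = \<pi> d \<otimes>\<^bsub>C\<^esub> u g)))"

section \<open>The system associated with a semidirect product\<close>

definition conj_set :: "('g, 'm) monoid_scheme \<Rightarrow> 'g \<Rightarrow> 'g set \<Rightarrow> 'g set" where
  "conj_set G a M = (\<lambda>m. a \<otimes>\<^bsub>G\<^esub> m \<otimes>\<^bsub>G\<^esub> inv\<^bsub>G\<^esub> a) ` M"

definition conj_family :: "('g, 'm) monoid_scheme \<Rightarrow> 'g set \<Rightarrow> 'g set \<Rightarrow> 'g set set" where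
  "conj_family G H M = (\<lambda>a. conj_set G a M) ` H"

definition pos_part :: "('g, 'm) monoid_scheme \<Rightarrow> 'g set \<Rightarrow> 'g set \<Rightarrow> 'g set" where
  "pos_part G H M = {a \<in> H. conj_set G a M \<subseteq> M}"

definition left_cosets :: "('g, 'm) monoid_scheme \<Rightarrow> 'g set \<Rightarrow> 'g set \<Rightarrow> 'g set set" where
  "left_cosets G U V = (\<lambda>x. x <#\<^bsub>G\<^esub> V) ` U"

locale semidirect_system = group G for G (structure) +
  fixes N H M
  assumes N_normal: "N \<lhd> G"
    and H_subgroup: "subgroup H G"
    and N_Int_H: "N \<inter> H = {\<one>}"
    and N_mult_H: "N <#> H = carrier G"
    and M_normal: "M \<lhd> G\<lparr>carrier := N\<rparr>"
    and M_nontrivial: "M \<noteq> {\<one>}"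
    and filter_base: "\<lbrakk>U \<in> conj_family G H M; V \<in> conj_family G H M\<rbrakk> \<Longrightarrow>
      \<exists>W\<in>conj_family G H M. W \<subseteq> U \<inter> V"
    and separating: "\<Inter>(conj_family G H M) = {\<one>}"
    and finite_quotients: "\<lbrakk>U \<in> conj_family G H M; V \<in> conj_family G H M; V \<subseteq> U\<rbrakk> \<Longrightarrow>
      finite (left_cosets G U V)"

definition beta :: "('g, 'm) monoid_scheme \<Rightarrow> 'g set \<Rightarrow> 'g set \<Rightarrow> 'g \<Rightarrow> 'g \<Rightarrow> 'g" where
  "beta G N H g y = (THE z. \<exists>x\<in>N. \<exists>a\<in>H. g = x \<otimes>\<^bsub>G\<^esub> a \<and>
     z = x \<otimes>\<^bsub>G\<^esub> a \<otimes>\<^bsub>G\<^esub> y \<otimes>\<^bsub>G\<^esub> inv\<^bsub>G\<^esub> a)"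

lemma (in semidirect_system) beta_eq:
  assumes "x \<in> N" "a \<in> H"
  shows "beta G N H (x \<otimes> a) y = x \<otimes> a \<otimes> y \<otimes> inv a"
proof -
  have "x' = x \<and> a' = a" if "x' \<in> N" "a' \<in> H" "x \<otimes> a = x' \<otimes> a'" for x' a'
  proof -
    interpret N: normal N G by (rule N_normal)
    interpret H: subgroup H G by (rule H_subgroup)
    have c: "x \<in> carrier G" "a \<in> carrier G" "x' \<in> carrier G" "a' \<in> carrier G"
      using assms that by auto
    have "inv x' \<otimes> x = a' \<otimes> inv a"
      using that(3) c by (metis inv_closed inv_solve_left inv_solve_right m_assoc m_closed)
    moreover have "inv x' \<otimes> x \<in> N" "a' \<otimes> inv a \<in> H"
      using assms that by auto
    ultimately have "inv x' \<otimes> x = \<one>" "a' \<otimes> inv a = \<one>"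
      using N_Int_H by auto
    then show ?thesis
      using c by (metis inv_closed inv_equality inv_inv)
  qed
  then show ?thesis
    unfolding beta_def using assms by (intro the_equality) blast+
qed

text \<open>Functions on \<open>N\<close> are represented by functions on the ambient type vanishing outside \<open>N\<close>.\<close>

definition linfty :: "'g set \<Rightarrow> ('g \<Rightarrow> complex) cstar" where
  "linfty N = \<lparr>
     carrier = {f. (\<forall>y. y \<notin> N \<longrightarrow> f y = 0) \<and> (\<exists>K. \<forall>y\<in>N. cmod (f y) \<le> K)},
     mult = (\<lambda>f h y. f y * h y), one = indicator N,
     zero = (\<lambda>y. 0), add = (\<lambda>f h y. f y + h y),
     smult = (\<lambda>c f y. c * f y),
     cs_star = (\<lambda>f y. cnj (f y)),
     cs_norm = (\<lambda>f. SUP y\<in>N. cmod (f y))\<rparr>"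

definition alpha ::
  "('g, 'm) monoid_scheme \<Rightarrow> 'g set \<Rightarrow> 'g set \<Rightarrow> 'g \<Rightarrow> ('g \<Rightarrow> complex) \<Rightarrow> 'g \<Rightarrow> complex" where
  "alpha G N H g f = (\<lambda>y. if y \<in> N then f (beta G N H (inv\<^bsub>G\<^esub> g) y) else 0)"

definition D_alg ::
  "('g, 'm) monoid_scheme \<Rightarrow> 'g set \<Rightarrow> 'g set \<Rightarrow> 'g set \<Rightarrow> ('g \<Rightarrow> complex) cstar" where
  "D_alg G N H M = (linfty N)\<lparr>carrier := cstar_generated (linfty N)
     {indicator (x <#\<^bsub>G\<^esub> U) |x U. x \<in> N \<and> U \<in> conj_family G H M}\<rparr>"

section \<open>SU-families\<close>

text \<open>In the third relation a representative of each coset is chosen by \<open>SOME\<close>; by the other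
  relations the summand does not depend on it.\<close>

definition SU_family :: "('g, 'm) monoid_scheme \<Rightarrow> 'g set \<Rightarrow> 'g set \<Rightarrow> ('b, 'x) cstar_scheme \<Rightarrow>
    ('g \<Rightarrow> 'b) \<Rightarrow> ('g \<Rightarrow> 'b) \<Rightarrow> bool" where
  "SU_family G H M B S U \<longleftrightarrow>
     (\<forall>a\<in>pos_part G H M. isometry_elem B (S a)) \<and>
     (\<forall>m\<in>M. unitary_elem B (U m)) \<and>
     (\<forall>a\<in>pos_part G H M. \<forall>b\<in>pos_part G H M. S a \<otimes>\<^bsub>B\<^esub> S b = S (a \<otimes>\<^bsub>G\<^esub> b)) \<and>
     (\<forall>a\<in>pos_part G H M. \<forall>m\<in>M.
        S a \<otimes>\<^bsub>B\<^esub> U m = U (a \<otimes>\<^bsub>G\<^esub> m \<otimes>\<^bsub>G\<^esub> inv\<^bsub>G\<^esub> a) \<otimes>\<^bsub>B\<^esub> S a) \<and>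
     (\<forall>a\<in>pos_part G H M.
        (\<Oplus>\<^bsub>B\<^esub>c\<in>left_cosets G M (conj_set G a M). let m = (SOME m. m \<in> c) in
           U m \<otimes>\<^bsub>B\<^esub> S a \<otimes>\<^bsub>B\<^esub> cs_star B (S a) \<otimes>\<^bsub>B\<^esub> U (inv\<^bsub>G\<^esub> m)) = \<one>\<^bsub>B\<^esub>) \<and>
     (\<forall>m\<in>M. \<forall>k\<in>M. U m \<otimes>\<^bsub>B\<^esub> U k = U (m \<otimes>\<^bsub>G\<^esub> k))"

end

theory Submission
  imports Defs
begin

text \<open>
  Uniqueness rests on two facts: *-homomorphisms of C*-algebras are contractive
  (\<open>star_hom_contractive\<close>), and the compressed generators are words in \<open>s\<^sub>a\<close>, \<open>u(m)\<close> and their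
  adjoints. Let \<open>W = M H\<^sup>+\<close>, a semigroup with \<open>\<alpha>\<^sub>w(p) \<le>
  p\<close> for all \<open>w \<in> W\<close>, so that \<open>w \<mapsto> p w p\<close> is multiplicative
  on it. Every \<open>g \<in> G\<close> has the form \<open>b\<^sup>-\<^sup>1 w\<close> with \<open>b
  \<in> H\<^sup>+\<close>, \<open>w \<in> W\<close>, because \<open>H\<close> is abelian and
  \<open>N\<close> is the union of the \<open>a\<^sup>-\<^sup>1Ma\<close>; hence \<open>p g p =
  s\<^sub>b\<^sup>* (p w p)\<close>, and the compression of a characteristic function of a coset
  \<open>x h M h\<^sup>-\<^sup>1\<close> is \<open>(p x h p)(p x h p)\<^sup>*\<close>. Two homomorphisms
  that agree on the \<open>s\<^sub>a\<close> and \<open>u(m)\<close> therefore agree on a dense subspace of the corner.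

  Existence is a dilation argument. An SU-family gives an isometric representation
  \<open>T w = U(m) S\<^sub>a\<close> (\<open>w = m a\<close>) of \<open>W\<close>. For fixed \<open>a\<close> the projections \<open>Q w = T w (T w)\<^sup>*\<close>, one for each
  coset of \<open>a M a\<^sup>-\<^sup>1\<close> in \<open>M\<close>, add up to \<open>1\<close>, so they are mutually orthogonal. This is the point where
  positivity is needed; it is replaced by the elementary lemma that a self-adjoint \<open>c\<close> with
  \<open>\<parallel>1 \<plusminus> c\<parallel> \<le> 1\<close> vanishes (\<open>self_adjoint_extreme\<close>). A uniformly continuous function on \<open>M\<close> then
  has Riemann sums \<open>\<Sum> \<phi>(v) Q v\<close>, and their limit \<open>\<rho> \<phi>\<close> is a *-homomorphism with
  \<open>\<rho>(\<phi>) T w = T w \<rho>(\<phi>(w \<cdot>))\<close>.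

  The isometries \<open>T w\<close> become unitaries on the inductive limit \<open>X\<close> of copies of \<open>B\<close> along the maps
  \<open>b \<mapsto> T w b\<close>. It is realised by functions \<open>F\<close> on \<open>G\<close> with \<open>F(k w) = (T w)\<^sup>* F(k)\<close> that from some
  point \<open>g\<close> on satisfy \<open>F(g w\<^sup>-\<^sup>1) = T w F(g)\<close>. Translations by \<open>G\<close> and pointwise multiplication by
  \<open>\<rho>(f(k \<cdot>))\<close> form a covariant pair of adjointable operators on \<open>X\<close>. The function \<open>\<chi>\<^sub>M\<close> acts as the
  rank-one projection onto the vector \<open>F1\<close>, and so the compression \<open>\<kappa> L = \<langle>F1, L F1\<rangle>\<close> satisfies
  \<open>\<kappa>(L P L') = \<kappa>(L) \<kappa>(L')\<close> for that projection \<open>P\<close>, and \<open>\<kappa>(w) = T w\<close>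
  (\<open>dilation\<close>). The homomorphism of \<open>A\<close> that the universal property
  gives for the covariant pair, followed by \<open>\<kappa>\<close>, is multiplicative on \<open>pAp\<close> and is the
  required one.

  The universal property speaks only of algebras whose elements have one fixed type. The operators
  that occur are finite sums of products of functions and translations, so they are determined by
  finitely supported functions \<open>G \<Rightarrow> \<complex>\<^sup>N\<close>; the operator algebra is transported to such codes, and
  its completion consists of classes of sequences of codes.
\<close>

section \<open>Normed *-algebras with the C*-identity\<close>

lemma complex_ring_simps [simp]:
  "carrier complex_ring = UNIV" "mult complex_ring = (*)" "one complex_ring = 1"
  "zero complex_ring = 0" "add complex_ring = (+)"
  by (simp_all add: complex_ring_def)

lemma cring_complex_ring: "cring complex_ring"
proof (rule cringI)
  show "abelian_group complex_ring"
  proof (rule abelian_groupI)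
    fix x show "\<exists>y\<in>carrier complex_ring. y \<oplus>\<^bsub>complex_ring\<^esub> x = \<zero>\<^bsub>complex_ring\<^esub>"
      by (auto intro: exI[of _ "-x"])
  qed auto
  show "comm_monoid complex_ring"
    by (rule comm_monoidI) auto
qed (auto simp: distrib_right)

text \<open>Completeness is left out because the algebra of operators on the module of the dilation is normed
  before it is completed, and the same computations are needed there.\<close>

locale pre_cstar = Module.module complex_ring A for A :: "('a, 'x) cstar_scheme" (structure) +
  assumes times_closed [simp, intro]: "\<lbrakk>x \<in> carrier A; y \<in> carrier A\<rbrakk> \<Longrightarrow> x \<otimes> y \<in> carrier A"
    and times_assoc: "\<lbrakk>x \<in> carrier A; y \<in> carrier A; z \<in> carrier A\<rbrakk> \<Longrightarrow>
      (x \<otimes> y) \<otimes> z = x \<otimes> (y \<otimes> z)"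
    and times_add_l: "\<lbrakk>x \<in> carrier A; y \<in> carrier A; z \<in> carrier A\<rbrakk> \<Longrightarrow>
      (x \<oplus> y) \<otimes> z = (x \<otimes> z) \<oplus> (y \<otimes> z)"
    and times_add_r: "\<lbrakk>x \<in> carrier A; y \<in> carrier A; z \<in> carrier A\<rbrakk> \<Longrightarrow>
      x \<otimes> (y \<oplus> z) = (x \<otimes> y) \<oplus> (x \<otimes> z)"
    and smult_times_l: "\<lbrakk>x \<in> carrier A; y \<in> carrier A\<rbrakk> \<Longrightarrow> (c \<odot> x) \<otimes> y = c \<odot> (x \<otimes> y)"
    and smult_times_r: "\<lbrakk>x \<in> carrier A; y \<in> carrier A\<rbrakk> \<Longrightarrow> x \<otimes> (c \<odot> y) = c \<odot> (x \<otimes> y)"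
    and adj_closed [simp, intro]: "x \<in> carrier A \<Longrightarrow> cs_star A x \<in> carrier A"
    and adj_adj [simp]: "x \<in> carrier A \<Longrightarrow> cs_star A (cs_star A x) = x"
    and adj_add: "\<lbrakk>x \<in> carrier A; y \<in> carrier A\<rbrakk> \<Longrightarrow>
      cs_star A (x \<oplus> y) = cs_star A x \<oplus> cs_star A y"
    and adj_smult: "x \<in> carrier A \<Longrightarrow> cs_star A (c \<odot> x) = cnj c \<odot> cs_star A x"
    and adj_times: "\<lbrakk>x \<in> carrier A; y \<in> carrier A\<rbrakk> \<Longrightarrow>
      cs_star A (x \<otimes> y) = cs_star A y \<otimes> cs_star A x"
    and nrm_eq_0: "x \<in> carrier A \<Longrightarrow> cs_norm A x = 0 \<longleftrightarrow> x = \<zero>"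
    and nrm_add: "\<lbrakk>x \<in> carrier A; y \<in> carrier A\<rbrakk> \<Longrightarrow>
      cs_norm A (x \<oplus> y) \<le> cs_norm A x + cs_norm A y"
    and nrm_smult: "x \<in> carrier A \<Longrightarrow> cs_norm A (c \<odot> x) = cmod c * cs_norm A x"
    and nrm_times: "\<lbrakk>x \<in> carrier A; y \<in> carrier A\<rbrakk> \<Longrightarrow>
      cs_norm A (x \<otimes> y) \<le> cs_norm A x * cs_norm A y"
    and nrm_adj_times: "x \<in> carrier A \<Longrightarrow> cs_norm A (cs_star A x \<otimes> x) = (cs_norm A x)\<^sup>2"

sublocale cstar_algebra \<subseteq> pre: pre_cstar A
  by unfold_locales
    (simp_all add: mult_closed mult_assoc mult_l_distr mult_r_distr smult_mult_left
      smult_mult_right star_closed star_star star_add star_smult star_mult norm_eq_0 norm_triangle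
      norm_smult norm_mult norm_star_mult)

context pre_cstar
begin

abbreviation adj ("_\<^sup>\<star>" [1000] 1000) where "x\<^sup>\<star> \<equiv> cs_star A x"
abbreviation nrm where "nrm \<equiv> cs_norm A"

lemma smult_add: "x \<in> carrier A \<Longrightarrow> (a + b) \<odot> x = a \<odot> x \<oplus> b \<odot> x"
  using smult_l_distr[of a b x] by simp

lemma smult_smult: "x \<in> carrier A \<Longrightarrow> a \<odot> (b \<odot> x) = (a * b) \<odot> x"
  using smult_assoc1[of a b x] by simp

lemma smult_0 [simp]: "x \<in> carrier A \<Longrightarrow> 0 \<odot> x = \<zero>"
  using smult_l_null[of x] by simp

lemma smult_1 [simp]: "x \<in> carrier A \<Longrightarrow> 1 \<odot> x = x"
  using smult_one[of x] by simp

lemma smult_in [simp, intro]: "x \<in> carrier A \<Longrightarrow> c \<odot> x \<in> carrier A"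
  by (rule smult_closed) auto

lemma smult_distr: "\<lbrakk>x \<in> carrier A; y \<in> carrier A\<rbrakk> \<Longrightarrow> c \<odot> (x \<oplus> y) = c \<odot> x \<oplus> c \<odot> y"
  by (rule smult_r_distr) auto

lemma neg_smult: assumes "x \<in> carrier A" shows "\<ominus> x = (-1) \<odot> x"
proof -
  have "(-1) \<odot> x \<oplus> x = \<zero>"
    using smult_add[of x "-1" 1] assms by simp
  then show ?thesis
    using assms by (simp add: M.minus_equality)
qed

lemma minus_smult: "\<lbrakk>x \<in> carrier A; y \<in> carrier A\<rbrakk> \<Longrightarrow> x \<ominus> y = x \<oplus> (-1) \<odot> y"
  by (simp add: M.minus_eq neg_smult)

lemma times_0 [simp]: "x \<in> carrier A \<Longrightarrow> \<zero> \<otimes> x = \<zero>" "x \<in> carrier A \<Longrightarrow> x \<otimes> \<zero> = \<zero>"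
  using smult_times_l[of \<zero> x 0] smult_times_r[of x \<zero> 0] by simp_all

lemma adj_0 [simp]: "\<zero>\<^sup>\<star> = \<zero>"
  using adj_smult[of \<zero> 0] by simp

lemma times_minus_l: "\<lbrakk>x \<in> carrier A; y \<in> carrier A; z \<in> carrier A\<rbrakk> \<Longrightarrow>
    (x \<ominus> y) \<otimes> z = x \<otimes> z \<ominus> y \<otimes> z"
  by (simp add: minus_smult times_add_l smult_times_l)

lemma times_minus_r: "\<lbrakk>x \<in> carrier A; y \<in> carrier A; z \<in> carrier A\<rbrakk> \<Longrightarrow>
    x \<otimes> (y \<ominus> z) = x \<otimes> y \<ominus> x \<otimes> z"
  by (simp add: minus_smult times_add_r smult_times_r)

lemma adj_minus: "\<lbrakk>x \<in> carrier A; y \<in> carrier A\<rbrakk> \<Longrightarrow> (x \<ominus> y)\<^sup>\<star> = x\<^sup>\<star> \<ominus> y\<^sup>\<star>"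
  by (simp add: minus_smult adj_add adj_smult)

lemma smult_minus: "\<lbrakk>x \<in> carrier A; y \<in> carrier A\<rbrakk> \<Longrightarrow> c \<odot> (x \<ominus> y) = c \<odot> x \<ominus> c \<odot> y"
  by (simp add: minus_smult smult_distr smult_smult)

lemma minus_self [simp]: "x \<in> carrier A \<Longrightarrow> x \<ominus> x = \<zero>"
  by (simp add: M.r_neg M.minus_eq)

lemma minus_0 [simp]: "x \<in> carrier A \<Longrightarrow> x \<ominus> \<zero> = x"
  by (simp add: minus_smult)

lemma minus_add_cancel: "\<lbrakk>x \<in> carrier A; y \<in> carrier A\<rbrakk> \<Longrightarrow> (x \<ominus> y) \<oplus> y = x"
  by (simp add: M.minus_eq M.a_assoc M.l_neg)

lemma minus_eq_0: "\<lbrakk>x \<in> carrier A; y \<in> carrier A\<rbrakk> \<Longrightarrow> x \<ominus> y = \<zero> \<longleftrightarrow> x = y"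
  using minus_add_cancel[of x y] by fastforce

lemma add_minus_cancel: "\<lbrakk>x \<in> carrier A; y \<in> carrier A\<rbrakk> \<Longrightarrow> (x \<oplus> y) \<ominus> x = y"
  by (simp add: M.minus_eq M.a_comm[of x y] M.a_assoc M.r_neg)

lemma minus_add_minus: "\<lbrakk>x \<in> carrier A; y \<in> carrier A; z \<in> carrier A\<rbrakk> \<Longrightarrow>
    (x \<ominus> y) \<oplus> (y \<ominus> z) = x \<ominus> z"
  by (simp add: M.minus_eq M.a_assoc M.r_neg1)

lemma add_minus_add: "\<lbrakk>x \<in> carrier A; y \<in> carrier A; z \<in> carrier A; w \<in> carrier A\<rbrakk> \<Longrightarrow>
    (x \<oplus> y) \<ominus> (z \<oplus> w) = (x \<ominus> z) \<oplus> (y \<ominus> w)"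
  by (simp add: minus_smult smult_distr M.a_ac)

lemma times_minus_times: "\<lbrakk>x \<in> carrier A; y \<in> carrier A; z \<in> carrier A; w \<in> carrier A\<rbrakk> \<Longrightarrow>
    x \<otimes> y \<ominus> z \<otimes> w = x \<otimes> (y \<ominus> w) \<oplus> (x \<ominus> z) \<otimes> w"
  by (simp add: times_minus_l times_minus_r minus_add_minus)

lemma nrm_0 [simp]: "nrm (\<zero>) = 0"
  by (simp add: nrm_eq_0)

lemma nrm_add_le: "\<lbrakk>x \<in> carrier A; y \<in> carrier A; nrm x \<le> a; nrm y \<le> b\<rbrakk> \<Longrightarrow> nrm (x \<oplus> y) \<le> a + b"
  using nrm_add[of x y] by linarith

lemma nrm_neg: "x \<in> carrier A \<Longrightarrow> nrm (\<ominus> x) = nrm x"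
  by (simp add: neg_smult nrm_smult)

lemma nrm_ge_0 [simp]: assumes "x \<in> carrier A" shows "0 \<le> nrm x"
proof -
  have "nrm (x \<oplus> \<ominus> x) \<le> nrm x + nrm (\<ominus> x)"
    using assms by (intro nrm_add) auto
  then show ?thesis
    using assms by (simp add: nrm_neg M.r_neg)
qed

lemma nrm_le_0: assumes "x \<in> carrier A" shows "nrm x \<le> 0 \<longleftrightarrow> x = \<zero>"
  using assms nrm_ge_0[OF assms] nrm_eq_0[OF assms] by linarith

lemma nrm_minus: "\<lbrakk>x \<in> carrier A; y \<in> carrier A\<rbrakk> \<Longrightarrow> nrm (x \<ominus> y) \<le> nrm x + nrm y"
  using nrm_add[of x "\<ominus> y"] by (simp add: nrm_neg M.minus_eq)

lemma nrm_minus_commute: assumes "x \<in> carrier A" "y \<in> carrier A" shows "nrm (x \<ominus> y) = nrm (y \<ominus> x)"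
proof -
  have "y \<ominus> x = (-1) \<odot> (x \<ominus> y)"
    using assms by (simp add: minus_smult smult_distr smult_smult M.a_comm)
  then show ?thesis
    using assms by (simp add: nrm_smult)
qed

lemma nrm_triangle: "\<lbrakk>x \<in> carrier A; y \<in> carrier A; z \<in> carrier A\<rbrakk> \<Longrightarrow>
    nrm (x \<ominus> z) \<le> nrm (x \<ominus> y) + nrm (y \<ominus> z)"
  using nrm_add[of "x \<ominus> y" "y \<ominus> z"] by (simp add: minus_add_minus)

lemma nrm_diff: assumes "x \<in> carrier A" "y \<in> carrier A" shows "\<bar>nrm x - nrm y\<bar> \<le> nrm (x \<ominus> y)"
  using nrm_triangle[of x y \<zero>] nrm_triangle[of y x \<zero>] nrm_minus_commute[of x y] assms by simp

lemma nrm_adj [simp]: assumes "x \<in> carrier A" shows "nrm (x\<^sup>\<star>) = nrm x"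
proof -
  have le: "nrm y \<le> nrm (y\<^sup>\<star>)" if y: "y \<in> carrier A" for y
  proof (cases "nrm y = 0")
    case True with y show ?thesis by simp
  next
    case False
    then have "0 < nrm y" using nrm_ge_0[OF y] by linarith
    moreover have "nrm y * nrm y \<le> nrm (y\<^sup>\<star>) * nrm y"
      using nrm_times[of "y\<^sup>\<star>" y] y by (simp add: nrm_adj_times power2_eq_square)
    ultimately show ?thesis by (rule mult_right_le_imp_le[rotated])
  qed
  show ?thesis
    using le[OF assms] le[OF adj_closed[OF assms]] unfolding adj_adj[OF assms] by (rule antisym[rotated])
qed

lemma nrm_times_le: "\<lbrakk>x \<in> carrier A; y \<in> carrier A; nrm x \<le> a; nrm y \<le> b\<rbrakk> \<Longrightarrow> nrm (x \<otimes> y) \<le> a * b"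
  by (rule order_trans[OF nrm_times mult_mono], simp_all) (rule order_trans[OF nrm_ge_0], assumption+)

definition conv where
  "conv s x \<longleftrightarrow> (\<forall>n::nat. s n \<in> carrier A) \<and> x \<in> carrier A \<and> (\<lambda>n. nrm (s n \<ominus> x)) \<longlonglongrightarrow> 0"

definition cauchy where
  "cauchy s \<longleftrightarrow> (\<forall>n::nat. s n \<in> carrier A) \<and>
     (\<forall>e>0. \<exists>K. \<forall>m\<ge>K. \<forall>n\<ge>K. nrm (s m \<ominus> s n) < e)"

lemma conv_bound:
  assumes "\<And>n. s n \<in> carrier A" "x \<in> carrier A" "\<And>n. nrm (s n \<ominus> x) \<le> f n" "f \<longlonglongrightarrow> 0"
  shows "conv s x"
  unfolding conv_def
  using assms tendsto_sandwich[of "\<lambda>_. 0" "\<lambda>n. nrm (s n \<ominus> x)" sequentially f 0] by simp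

lemma conv_const: "x \<in> carrier A \<Longrightarrow> conv (\<lambda>_. x) x"
  by (simp add: conv_def)

lemma conv_unique: assumes "conv s x" "conv s y" shows "x = y"
proof -
  have c: "x \<in> carrier A" "y \<in> carrier A" "\<And>n. s n \<in> carrier A"
    using assms by (auto simp: conv_def)
  have lim: "(\<lambda>n. nrm (s n \<ominus> x) + nrm (s n \<ominus> y)) \<longlonglongrightarrow> 0 + 0"
    using assms by (intro tendsto_add) (auto simp: conv_def)
  have le: "nrm (x \<ominus> y) \<le> nrm (s n \<ominus> x) + nrm (s n \<ominus> y)" for n
    using nrm_triangle[of x "s n" y] unfolding nrm_minus_commute[OF c(1) c(3)[of n]] using c by blast
  have "nrm (x \<ominus> y) \<le> 0 + 0"
    using LIMSEQ_le_const[OF lim] le by blast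
  then have "nrm (x \<ominus> y) = 0"
    using c by (intro antisym) auto
  then show ?thesis
    using c by (simp add: nrm_eq_0 minus_eq_0)
qed

lemma conv_nrm: assumes "conv s x" shows "(\<lambda>n. nrm (s n)) \<longlonglongrightarrow> nrm x"
proof (rule metric_tendsto_imp_tendsto)
  show "(\<lambda>n. nrm (s n \<ominus> x)) \<longlonglongrightarrow> 0"
    using assms by (simp add: conv_def)
  have "dist (nrm (s n)) (nrm x) \<le> dist (nrm (s n \<ominus> x)) 0" for n
    using nrm_diff[of "s n" x] assms by (simp add: conv_def dist_real_def)
  then show "\<forall>\<^sub>F n in sequentially. dist (nrm (s n)) (nrm x) \<le> dist (nrm (s n \<ominus> x)) 0"
    by simp
qed

lemma conv_add: assumes "conv s x" "conv t y" shows "conv (\<lambda>n. s n \<oplus> t n) (x \<oplus> y)"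
proof (rule conv_bound)
  fix n
  show "nrm ((s n \<oplus> t n) \<ominus> (x \<oplus> y)) \<le> nrm (s n \<ominus> x) + nrm (t n \<ominus> y)"
    using assms by (simp add: conv_def add_minus_add nrm_add)
  show "(\<lambda>n. nrm (s n \<ominus> x) + nrm (t n \<ominus> y)) \<longlonglongrightarrow> 0"
    using assms tendsto_add[of "\<lambda>n. nrm (s n \<ominus> x)" 0 _ "\<lambda>n. nrm (t n \<ominus> y)" 0] by (simp add: conv_def)
qed (use assms in \<open>auto simp: conv_def\<close>)

lemma conv_smult: assumes "conv s x" shows "conv (\<lambda>n. c \<odot> s n) (c \<odot> x)"
proof (rule conv_bound)
  fix n
  show "nrm ((c \<odot> s n) \<ominus> (c \<odot> x)) \<le> cmod c * nrm (s n \<ominus> x)"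
    using assms by (simp add: conv_def smult_minus[symmetric] nrm_smult)
  show "(\<lambda>n. cmod c * nrm (s n \<ominus> x)) \<longlonglongrightarrow> 0"
    using assms tendsto_mult_right_zero by (auto simp: conv_def)
qed (use assms in \<open>auto simp: conv_def\<close>)

lemma conv_minus: assumes "conv s x" "conv t y" shows "conv (\<lambda>n. s n \<ominus> t n) (x \<ominus> y)"
  using conv_add[OF assms(1) conv_smult[OF assms(2), of "-1"]] assms
  by (simp add: conv_def minus_smult)

lemma conv_adj: assumes "conv s x" shows "conv (\<lambda>n. (s n)\<^sup>\<star>) (x\<^sup>\<star>)"
  using assms by (auto simp: conv_def adj_minus[symmetric])

lemma conv_times: assumes "conv s x" "conv t y" shows "conv (\<lambda>n. s n \<otimes> t n) (x \<otimes> y)"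
proof (rule conv_bound)
  have c: "\<And>n. s n \<in> carrier A" "\<And>n. t n \<in> carrier A" "x \<in> carrier A" "y \<in> carrier A"
    using assms by (auto simp: conv_def)
  fix n
  have "nrm (s n \<otimes> t n \<ominus> x \<otimes> y) \<le> nrm (s n \<otimes> (t n \<ominus> y)) + nrm ((s n \<ominus> x) \<otimes> y)"
    unfolding times_minus_times[OF c(1,2,3,4), rule_format] using c by (intro nrm_add) auto
  also have "\<dots> \<le> nrm (s n) * nrm (t n \<ominus> y) + nrm (s n \<ominus> x) * nrm y"
    using c by (intro add_mono nrm_times) auto
  finally show "nrm (s n \<otimes> t n \<ominus> x \<otimes> y) \<le> nrm (s n) * nrm (t n \<ominus> y) + nrm (s n \<ominus> x) * nrm y" .
  have "(\<lambda>n. nrm (s n) * nrm (t n \<ominus> y) + nrm (s n \<ominus> x) * nrm y) \<longlonglongrightarrow> nrm x * 0 + 0 * nrm y"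
    using assms conv_nrm[OF assms(1)] unfolding conv_def by (intro tendsto_intros) auto
  then show "(\<lambda>n. nrm (s n) * nrm (t n \<ominus> y) + nrm (s n \<ominus> x) * nrm y) \<longlonglongrightarrow> 0" by simp
qed (use assms in \<open>auto simp: conv_def\<close>)

lemma finsum_eqI:
  "\<lbrakk>\<And>i. i \<in> I \<Longrightarrow> f i = g i; \<And>i. i \<in> I \<Longrightarrow> g i \<in> carrier A\<rbrakk> \<Longrightarrow> (\<Oplus>i\<in>I. f i) = (\<Oplus>i\<in>I. g i)"
  by (rule M.finsum_cong') auto

lemma nrm_finsum_le:
  "\<lbrakk>finite I; \<And>i. i \<in> I \<Longrightarrow> f i \<in> carrier A\<rbrakk> \<Longrightarrow> nrm (\<Oplus>i\<in>I. f i) \<le> (\<Sum>i\<in>I. nrm (f i))"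
proof (induction I rule: finite_induct)
  case (insert x F)
  have "nrm (f x \<oplus> (\<Oplus>i\<in>F. f i)) \<le> nrm (f x) + nrm (\<Oplus>i\<in>F. f i)"
    using insert by (intro nrm_add M.finsum_closed) auto
  then show ?case
    using insert by (simp add: M.finsum_insert Pi_def)
qed simp

lemma smult_finsum:
  "\<lbrakk>finite I; \<And>i. i \<in> I \<Longrightarrow> f i \<in> carrier A\<rbrakk> \<Longrightarrow> c \<odot> (\<Oplus>i\<in>I. f i) = (\<Oplus>i\<in>I. c \<odot> f i)"
proof (induction I rule: finite_induct)
  case empty
  then show ?case using smult_r_null[of c] by simp
next
  case (insert x F)
  then show ?case by (simp add: M.finsum_insert Pi_def smult_distr)
qed

lemma adj_finsum:
  "\<lbrakk>finite I; \<And>i. i \<in> I \<Longrightarrow> f i \<in> carrier A\<rbrakk> \<Longrightarrow> (\<Oplus>i\<in>I. f i)\<^sup>\<star> = (\<Oplus>i\<in>I. (f i)\<^sup>\<star>)"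
  by (induction I rule: finite_induct) (simp_all add: M.finsum_insert Pi_def adj_add)

lemma times_finsum_r:
  "\<lbrakk>finite I; x \<in> carrier A; \<And>i. i \<in> I \<Longrightarrow> f i \<in> carrier A\<rbrakk> \<Longrightarrow> x \<otimes> (\<Oplus>i\<in>I. f i) = (\<Oplus>i\<in>I. x \<otimes> f i)"
  by (induction I rule: finite_induct) (simp_all add: M.finsum_insert Pi_def times_add_r)

lemma times_finsum_l:
  "\<lbrakk>finite I; x \<in> carrier A; \<And>i. i \<in> I \<Longrightarrow> f i \<in> carrier A\<rbrakk> \<Longrightarrow> (\<Oplus>i\<in>I. f i) \<otimes> x = (\<Oplus>i\<in>I. f i \<otimes> x)"
  by (induction I rule: finite_induct) (simp_all add: M.finsum_insert Pi_def times_add_l)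

end

lemma (in cstar_algebra) cauchy_conv: assumes "pre.cauchy s" shows "\<exists>x. pre.conv s x"
proof -
  have "\<exists>x\<in>carrier A. (\<lambda>n. cs_norm A (s n \<ominus>\<^bsub>A\<^esub> x)) \<longlonglongrightarrow> 0"
    by (rule complete) (use assms in \<open>auto simp: pre.cauchy_def\<close>)
  then show ?thesis
    using assms by (auto simp: pre.cauchy_def pre.conv_def)
qed

locale unital_pre_cstar = pre_cstar A for A :: "('a, 'x) cstar_scheme" (structure) +
  assumes unit_closed [simp, intro]: "\<one> \<in> carrier A"
    and unit_l [simp]: "x \<in> carrier A \<Longrightarrow> \<one> \<otimes> x = x"
    and unit_r [simp]: "x \<in> carrier A \<Longrightarrow> x \<otimes> \<one> = x"

sublocale unital_cstar_algebra \<subseteq> pre: unital_pre_cstar A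
  by unfold_locales (simp_all add: one_closed one_left one_right)

context unital_pre_cstar
begin

lemma adj_one [simp]: "\<one>\<^sup>\<star> = \<one>"
  using adj_times[of "\<one>\<^sup>\<star>" \<one>] by simp

lemma nrm_proj: assumes "q \<in> carrier A" "q\<^sup>\<star> = q" "q \<otimes> q = q" shows "nrm q \<le> 1"
proof -
  have "nrm q * nrm q = nrm q"
    using nrm_adj_times[of q] assms by (simp add: power2_eq_square)
  then show ?thesis by auto
qed

lemma nrm_one: "nrm (\<one>) \<le> 1"
  by (rule nrm_proj) auto

lemma nrm_isometry: assumes "t \<in> carrier A" "t\<^sup>\<star> \<otimes> t = \<one>" shows "nrm t \<le> 1"
proof -
  have "(nrm t)\<^sup>2 \<le> 1"
    using nrm_adj_times[of t] assms nrm_one by simp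
  then show ?thesis by (simp add: power2_le_imp_le[of _ 1])
qed

lemma affine_times:
  assumes c: "c \<in> carrier A"
  shows "(\<one> \<oplus> z \<odot> c) \<otimes> (\<one> \<oplus> w \<odot> c) = \<one> \<oplus> (z + w) \<odot> c \<oplus> (z * w) \<odot> (c \<otimes> c)"
  using c by (simp add: times_add_l times_add_r smult_times_l smult_times_r smult_smult smult_add
      smult_distr M.a_ac mult.commute)

text \<open>Averaging the squares of \<open>1 + z c\<close> and \<open>1 + w c\<close> cancels the quadratic
  term when \<open>z\<^sup>2 + w\<^sup>2 = 0\<close> and leaves \<open>1 + (z + w) c\<close>.\<close>

lemma affine_doubling:
  assumes c: "c \<in> carrier A" and z: "z\<^sup>2 + w\<^sup>2 = 0"
    and "nrm (\<one> \<oplus> z \<odot> c) \<le> 1" "nrm (\<one> \<oplus> w \<odot> c) \<le> 1"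
  shows "nrm (\<one> \<oplus> (z + w) \<odot> c) \<le> 1"
proof -
  let ?f = "\<lambda>z. (\<one> \<oplus> z \<odot> c) \<otimes> (\<one> \<oplus> z \<odot> c)"
  have "?f z \<oplus> ?f w = (\<one> \<oplus> \<one>) \<oplus> ((z + z) \<odot> c \<oplus> (w + w) \<odot> c) \<oplus> ((z * z) \<odot> (c \<otimes> c) \<oplus> (w * w) \<odot> (c \<otimes> c))"
    using c by (simp add: affine_times M.a_ac)
  also have "\<dots> = 2 \<odot> \<one> \<oplus> (2 * (z + w)) \<odot> c"
    using c z smult_add[of \<one> 1 1]
    by (simp add: smult_add[symmetric] power2_eq_square algebra_simps)
  finally have "(1/2) \<odot> (?f z \<oplus> ?f w) = \<one> \<oplus> (z + w) \<odot> c"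
    using c by (simp add: smult_distr smult_smult add_divide_distrib)
  moreover have "nrm (?f z \<oplus> ?f w) \<le> 1 * 1 + 1 * 1"
    using c assms by (intro nrm_add_le nrm_times_le) auto
  ultimately show ?thesis
    using c nrm_smult[of "?f z \<oplus> ?f w" "1/2"] by simp
qed

section \<open>Orthogonality of ranges of isometries\<close>

text \<open>The unit is an extreme point of the unit ball; the proof avoids spectral theory. The set of scalars
  \<open>z\<close> with \<open>\<parallel>1 + z c\<parallel> \<le> 1\<close> is bounded unless
  \<open>c = 0\<close>, but it contains powers of \<open>1 + \<i>\<close>, because it is stable
  under \<open>z \<mapsto> z + \<i> z\<close> by the doubling lemma once it contains the fourth
  roots of unity.\<close>

lemma self_adjoint_extreme:
  assumes c: "c \<in> carrier A" "c\<^sup>\<star> = c" and le: "nrm (\<one> \<oplus> c) \<le> 1" "nrm (\<one> \<ominus> c) \<le> 1"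
  shows "c = \<zero>"
proof -
  define K where "K = {z. nrm (\<one> \<oplus> z \<odot> c) \<le> 1}"
  have pm: "1 \<in> K" "-1 \<in> K"
    using c le by (simp_all add: K_def minus_smult)
  have sq: "nrm (\<one> \<oplus> c \<otimes> c) \<le> 1"
  proof -
    let ?f = "\<lambda>z. (\<one> \<oplus> z \<odot> c) \<otimes> (\<one> \<oplus> z \<odot> c)"
    have "?f 1 \<oplus> ?f (-1) = (\<one> \<oplus> \<one>) \<oplus> (2 \<odot> c \<oplus> (-2) \<odot> c) \<oplus> (c \<otimes> c \<oplus> c \<otimes> c)"
      unfolding affine_times[OF c(1)] using c by (simp add: M.a_ac)
    also have "\<dots> = 2 \<odot> \<one> \<oplus> 2 \<odot> (c \<otimes> c)"
      using c smult_add[of \<one> 1 1] smult_add[of "c \<otimes> c" 1 1] by (simp add: smult_add[symmetric])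
    finally have "(1/2) \<odot> (?f 1 \<oplus> ?f (-1)) = \<one> \<oplus> c \<otimes> c"
      using c by (simp add: smult_distr smult_smult)
    moreover have "nrm (?f 1 \<oplus> ?f (-1)) \<le> 1 * 1 + 1 * 1"
      using c pm unfolding K_def
      by (intro nrm_add_le nrm_times_le) (auto simp: minus_smult)
    ultimately show ?thesis
      using c nrm_smult[of "?f 1 \<oplus> ?f (-1)" "1/2"] by simp
  qed
  \<comment> \<open>The C*-identity reduces this to the bound for \<open>1 + c\<^sup>2\<close>, as \<open>(1 + z c)\<^sup>* (1 + z c) = 1 + c\<^sup>2\<close>.\<close>
  have im: "z \<in> K" if z: "z = \<i> \<or> z = -\<i>" for z
  proof -
    have "(\<one> \<oplus> z \<odot> c)\<^sup>\<star> = \<one> \<oplus> (-z) \<odot> c"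
      using c z by (auto simp: adj_add adj_smult)
    then have "(\<one> \<oplus> z \<odot> c)\<^sup>\<star> \<otimes> (\<one> \<oplus> z \<odot> c) = \<one> \<oplus> c \<otimes> c"
      using c z by (auto simp: affine_times)
    then have "(nrm (\<one> \<oplus> z \<odot> c))\<^sup>2 \<le> 1\<^sup>2"
      using nrm_adj_times[of "\<one> \<oplus> z \<odot> c"] c sq by simp
    then show ?thesis
      unfolding K_def by (simp add: power2_le_imp_le[of _ 1])
  qed
  have dbl: "z + w \<in> K" if "z \<in> K" "w \<in> K" "z\<^sup>2 + w\<^sup>2 = 0" for z w
    using affine_doubling[OF c(1) that(3)] that(1,2) by (simp add: K_def)
  have pow: "\<forall>u\<in>{1, \<i>, -1, -\<i>}. u * (1 + \<i>) ^ n \<in> K" for n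
  proof (induction n)
    case 0
    then show ?case using pm im by auto
  next
    case (Suc n)
    show ?case
    proof
      fix u assume u: "u \<in> {1, \<i>, -1, -\<i>}"
      then have "\<i> * u \<in> {1, \<i>, -1, -\<i>}" by auto
      with Suc u have "u * (1 + \<i>) ^ n + (\<i> * u) * (1 + \<i>) ^ n \<in> K"
        by (intro dbl) (auto simp: power_mult_distrib)
      then show "u * (1 + \<i>) ^ Suc n \<in> K"
        by (simp add: algebra_simps)
    qed
  qed
  have bd: "sqrt 2 ^ n * nrm c \<le> 2" for n
  proof -
    let ?z = "(1 + \<i>) ^ n"
    have "?z \<odot> c = (\<one> \<oplus> ?z \<odot> c) \<ominus> \<one>"
      using add_minus_cancel[of \<one> "?z \<odot> c"] c by simp
    then have "nrm (?z \<odot> c) \<le> 1 + 1"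
      using pow[of n] nrm_minus[of "\<one> \<oplus> ?z \<odot> c" \<one>] nrm_one c by (auto simp: K_def)
    then show ?thesis
      using c by (simp add: nrm_smult norm_power cmod_def[of "1 + \<i>"])
  qed
  have "nrm c \<le> 0"
  proof (rule ccontr)
    assume "\<not> ?thesis"
    then have pos: "0 < nrm c" by simp
    obtain n where "2 / nrm c < sqrt 2 ^ n"
      using real_arch_pow[of "sqrt 2" "2 / nrm c"] by auto
    then show False
      using bd[of n] pos by (simp add: field_simps)
  qed
  then show ?thesis
    using c by (simp add: nrm_le_0)
qed

lemma finsum_one_minus:
  "\<lbrakk>finite J; \<And>j. j \<in> J \<Longrightarrow> c j \<in> carrier A\<rbrakk> \<Longrightarrow>
    (\<Oplus>j\<in>J. \<one> \<ominus> c j) = of_nat (card J) \<odot> \<one> \<ominus> (\<Oplus>j\<in>J. c j)"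
proof (induction J rule: finite_induct)
  case (insert x F)
  then show ?case
    by (simp add: M.finsum_insert Pi_def smult_add add_minus_add)
qed simp

text \<open>A substitute for the fact that positive elements with sum zero vanish: \<open>\<parallel>1 -
  c\<parallel> \<le> 1\<close> plays the role of positivity. If \<open>k\<close> other summands are
  moved to the right, \<open>k + c\<^sub>i\<close> is the sum of their \<open>1 - c\<^sub>j\<close>,
  so \<open>c\<^sub>i / k\<close> and its negative both satisfy the bound of the extreme point
  lemma.\<close>

lemma finsum_zero_imp_zero:
  assumes "finite I" and c: "\<And>i. i \<in> I \<Longrightarrow> c i \<in> carrier A" "\<And>i. i \<in> I \<Longrightarrow> (c i)\<^sup>\<star> = c i"
    and le: "\<And>i. i \<in> I \<Longrightarrow> nrm (\<one> \<ominus> c i) \<le> 1" and sum: "(\<Oplus>i\<in>I. c i) = \<zero>" and i: "i \<in> I"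
  shows "c i = \<zero>"
proof -
  define J where "J = I - {i}"
  have J: "finite J" "i \<notin> J" "I = insert i J" and cJ: "\<And>j. j \<in> J \<Longrightarrow> c j \<in> carrier A"
    using assms unfolding J_def by auto
  have ci: "c i \<in> carrier A" using c i by blast
  have cs: "(\<Oplus>j\<in>J. c j) \<in> carrier A" using cJ by (intro M.finsum_closed) auto
  have eq: "c i \<oplus> (\<Oplus>j\<in>J. c j) = \<zero>"
    using sum J cJ ci by (simp add: M.finsum_insert Pi_def)
  then have neg: "c i = \<ominus> (\<Oplus>j\<in>J. c j)"
    using M.minus_equality[OF eq] ci cs by simp
  show ?thesis
  proof (cases "J = {}")
    case True
    then show ?thesis using neg by simp
  next
    case False
    define k where "k = real (card J)"
    have k: "1 \<le> k"
      using False J by (simp add: k_def Suc_le_eq card_gt_0_iff)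
    have "of_real k \<odot> \<one> \<oplus> c i = (\<Oplus>j\<in>J. \<one> \<ominus> c j)"
      using finsum_one_minus[of J c] J cJ neg by (simp add: k_def M.minus_eq)
    also have "nrm (\<dots>) \<le> (\<Sum>j\<in>J. nrm (\<one> \<ominus> c j))"
      using J cJ by (intro nrm_finsum_le) auto
    also have "\<dots> \<le> (\<Sum>j\<in>J. 1)"
      using J le by (intro sum_mono) auto
    finally have up: "nrm (of_real k \<odot> \<one> \<oplus> c i) \<le> k" by (simp add: k_def)
    let ?d = "of_real (1 / k) \<odot> c i"
    have "\<one> \<oplus> ?d = of_real (1 / k) \<odot> (of_real k \<odot> \<one> \<oplus> c i)"
      using k ci by (simp add: smult_distr smult_smult)
    then have 1: "nrm (\<one> \<oplus> ?d) \<le> 1"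
      using up k ci by (simp add: nrm_smult norm_divide)
    have "\<one> \<ominus> ?d = of_real (1 / k) \<odot> (\<one> \<ominus> c i) \<oplus> of_real (1 - 1 / k) \<odot> \<one>"
    proof -
      have "of_real (1 / k) \<odot> (\<one> \<ominus> c i) \<oplus> of_real (1 - 1 / k) \<odot> \<one>
          = (of_real (1 / k) + of_real (1 - 1 / k)) \<odot> \<one> \<ominus> ?d"
        unfolding smult_add[OF unit_closed]
        using ci by (simp add: minus_smult smult_distr smult_smult M.a_ac)
      then show ?thesis by simp
    qed
    also have "nrm (\<dots>) \<le> (1 / k) * 1 + (1 - 1 / k) * 1"
      using k ci le[OF i] nrm_one
      by (intro order_trans[OF nrm_add] add_mono)
        (auto simp: nrm_smult norm_divide simp del: of_real_diff of_real_divide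
          intro!: divide_right_mono mult_left_le)
    finally have 2: "nrm (\<one> \<ominus> ?d) \<le> 1" by simp
    have "?d = \<zero>"
      using self_adjoint_extreme[of ?d] 1 2 ci c(2)[OF i] by (simp add: adj_smult)
    then have "of_real k \<odot> ?d = \<zero>"
      using smult_r_null[of "of_real k"] by simp
    then show ?thesis using k ci by (simp add: smult_smult)
  qed
qed

text \<open>Compressing the sum by \<open>T j\<close> gives \<open>\<Sum>\<^sub>k (T j)\<^sup>* T k (T
  k)\<^sup>* T j = 1\<close>. The term \<open>k = j\<close> is already \<open>1\<close>, so the
  remaining terms \<open>c\<^sub>k\<close> have sum zero, and \<open>1 - c\<^sub>k = (T j)\<^sup>*(1
  - T k (T k)\<^sup>*) T j\<close> is a contraction.\<close>

lemma isometries_orthogonal: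
  assumes "finite I" and T: "\<And>i. i \<in> I \<Longrightarrow> T i \<in> carrier A" "\<And>i. i \<in> I \<Longrightarrow> (T i)\<^sup>\<star> \<otimes> T i = \<one>"
    and sum: "(\<Oplus>i\<in>I. T i \<otimes> (T i)\<^sup>\<star>) = \<one>" and i: "i \<in> I" and j: "j \<in> I" "i \<noteq> j"
  shows "(T i)\<^sup>\<star> \<otimes> T j = \<zero>"
proof -
  define J where "J = I - {j}"
  define c where "c k = ((T k)\<^sup>\<star> \<otimes> T j)\<^sup>\<star> \<otimes> ((T k)\<^sup>\<star> \<otimes> T j)" for k
  have J: "finite J" "j \<notin> J" "I = insert j J" "i \<in> J"
    using assms unfolding J_def by auto
  have Tj [simp]: "T j \<in> carrier A" "(T j)\<^sup>\<star> \<otimes> T j = \<one>" using j T by auto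
  have Tk [simp]: "T k \<in> carrier A" "(T k)\<^sup>\<star> \<otimes> T k = \<one>" if "k \<in> J" for k using T J that by auto
  have ceq: "c k = (T j)\<^sup>\<star> \<otimes> (T k \<otimes> (T k)\<^sup>\<star>) \<otimes> T j" if "k \<in> J" for k
    using that by (simp add: c_def adj_times times_assoc)
  have "c i = \<zero>"
  proof (rule finsum_zero_imp_zero[of J])
    show "nrm (\<one> \<ominus> c k) \<le> 1" if k: "k \<in> J" for k
    proof -
      let ?q = "\<one> \<ominus> T k \<otimes> (T k)\<^sup>\<star>"
      have qq: "(T k \<otimes> (T k)\<^sup>\<star>) \<otimes> (T k \<otimes> (T k)\<^sup>\<star>) = T k \<otimes> (T k)\<^sup>\<star>"
        using k by (metis Tk adj_closed times_assoc times_closed unit_l)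
      have q: "nrm (?q) \<le> 1"
      proof (rule nrm_proj)
        show "?q\<^sup>\<star> = ?q" using k by (simp add: adj_minus adj_times)
        show "?q \<otimes> ?q = ?q"
          using k qq by (simp add: times_minus_l times_minus_r)
      qed (use k in auto)
      have "\<one> \<ominus> c k = (T j)\<^sup>\<star> \<otimes> ?q \<otimes> T j"
        using k by (simp add: ceq times_minus_l times_minus_r)
      also have "nrm (\<dots>) \<le> 1 * 1 * 1"
        using k q nrm_isometry[of "T j"] by (intro nrm_times_le) auto
      finally show ?thesis by simp
    qed
    have s: "(\<Oplus>k\<in>J. T k \<otimes> (T k)\<^sup>\<star>) = \<one> \<ominus> T j \<otimes> (T j)\<^sup>\<star>"
    proof -
      have cl: "(\<Oplus>k\<in>J. T k \<otimes> (T k)\<^sup>\<star>) \<in> carrier A" by (intro M.finsum_closed) auto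
      have "T j \<otimes> (T j)\<^sup>\<star> \<oplus> (\<Oplus>k\<in>J. T k \<otimes> (T k)\<^sup>\<star>) = \<one>"
        using sum J by (simp add: M.finsum_insert Pi_def)
      then show ?thesis
        using cl add_minus_cancel[of "T j \<otimes> (T j)\<^sup>\<star>" "\<Oplus>k\<in>J. T k \<otimes> (T k)\<^sup>\<star>"] by simp
    qed
    have "(\<Oplus>k\<in>J. c k) = (\<Oplus>k\<in>J. (T j)\<^sup>\<star> \<otimes> (T k \<otimes> (T k)\<^sup>\<star>) \<otimes> T j)"
      by (intro finsum_eqI) (auto simp: ceq)
    also have "\<dots> = (T j)\<^sup>\<star> \<otimes> (\<Oplus>k\<in>J. T k \<otimes> (T k)\<^sup>\<star>) \<otimes> T j"
      using J by (subst times_finsum_r, simp_all, subst times_finsum_l, simp_all)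
    also have "\<dots> = \<one> \<ominus> (T j)\<^sup>\<star> \<otimes> (T j \<otimes> (T j)\<^sup>\<star>) \<otimes> T j"
      by (simp add: s times_minus_l times_minus_r)
    also have "(T j)\<^sup>\<star> \<otimes> (T j \<otimes> (T j)\<^sup>\<star>) \<otimes> T j = \<one>"
      by (simp add: times_assoc)
    finally show "(\<Oplus>k\<in>J. c k) = \<zero>" by simp
  qed (use J in \<open>auto simp: c_def adj_times\<close>)
  then have "(nrm ((T i)\<^sup>\<star> \<otimes> T j))\<^sup>2 = 0"
    using nrm_adj_times[of "(T i)\<^sup>\<star> \<otimes> T j"] J by (simp add: c_def)
  then show ?thesis
    using J nrm_eq_0 by simp
qed

end

text \<open>The two points where the perpendicular through \<open>z\<close> to its own direction meets the unit
  circle have midpoint \<open>z\<close>.\<close>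

lemma average_of_unimodular:
  fixes z :: complex assumes "cmod z \<le> 1"
  obtains u v where "cmod u = 1" "cmod v = 1" "z = (u + v) / 2"
proof -
  let ?r = "cmod z" and ?e = "cis (Arg z)"
  have "?r\<^sup>2 + (sqrt (1 - ?r\<^sup>2))\<^sup>2 = 1"
    using assms by (simp add: power_le_one)
  then have n: "cmod (Complex ?r (sqrt (1 - ?r\<^sup>2))) = 1" "cmod (Complex ?r (- sqrt (1 - ?r\<^sup>2))) = 1"
    by (simp_all add: cmod_def)
  have "z = (?e * Complex ?r (sqrt (1 - ?r\<^sup>2)) + ?e * Complex ?r (- sqrt (1 - ?r\<^sup>2))) / 2"
    using rcis_cmod_Arg[of z]
    by (simp add: rcis_def distrib_left[symmetric] complex_eq_iff Complex_eq mult.commute)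
  then show thesis
    using n by (intro that[of "?e * Complex ?r (sqrt (1 - ?r\<^sup>2))" "?e * Complex ?r (- sqrt (1 - ?r\<^sup>2))"])
      (simp_all add: norm_mult)
qed

section \<open>Linear combinations over a partition of unity\<close>

locale projection_partition = unital_pre_cstar A for A :: "('a, 'x) cstar_scheme" (structure) +
  fixes I :: "'i set" and q :: "'i \<Rightarrow> 'a"
  assumes fin [simp, intro]: "finite I"
    and q_closed [simp, intro]: "i \<in> I \<Longrightarrow> q i \<in> carrier A"
    and q_adj [simp]: "i \<in> I \<Longrightarrow> (q i)\<^sup>\<star> = q i"
    and q_idem [simp]: "i \<in> I \<Longrightarrow> q i \<otimes> q i = q i"
    and q_orth: "\<lbrakk>i \<in> I; j \<in> I; i \<noteq> j\<rbrakk> \<Longrightarrow> q i \<otimes> q j = \<zero>"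
    and q_sum: "(\<Oplus>i\<in>I. q i) = \<one>"
begin

lemma comb_closed [simp, intro]: "(\<Oplus>i\<in>I. f i \<odot> q i) \<in> carrier A"
  by (intro M.finsum_closed) auto

lemma q_times_comb: assumes "i \<in> I" shows "q i \<otimes> (\<Oplus>j\<in>I. f j \<odot> q j) = f i \<odot> q i"
proof -
  have "q i \<otimes> (\<Oplus>j\<in>I. f j \<odot> q j) = (\<Oplus>j\<in>I. if i = j then f j \<odot> q j else \<zero>)"
    using assms smult_r_null
    by (intro trans[OF times_finsum_r] finsum_eqI) (auto simp: smult_times_r q_orth)
  also have "\<dots> = f i \<odot> q i"
    using assms by (subst M.finsum_singleton) (auto simp: Pi_def)
  finally show ?thesis .
qed

lemma comb_times: "(\<Oplus>i\<in>I. f i \<odot> q i) \<otimes> (\<Oplus>i\<in>I. g i \<odot> q i) = (\<Oplus>i\<in>I. (f i * g i) \<odot> q i)"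
  by (rule trans[OF times_finsum_l], auto)
    (rule finsum_eqI, auto simp: smult_times_l q_times_comb smult_smult)

lemma comb_adj: "(\<Oplus>i\<in>I. f i \<odot> q i)\<^sup>\<star> = (\<Oplus>i\<in>I. cnj (f i) \<odot> q i)"
  by (rule trans[OF adj_finsum], auto)
    (rule finsum_eqI, auto simp: adj_smult)

lemma comb_add: "(\<Oplus>i\<in>I. f i \<odot> q i) \<oplus> (\<Oplus>i\<in>I. g i \<odot> q i) = (\<Oplus>i\<in>I. (f i + g i) \<odot> q i)"
proof -
  have "(\<Oplus>i\<in>I. f i \<odot> q i) \<oplus> (\<Oplus>i\<in>I. g i \<odot> q i) = (\<Oplus>i\<in>I. f i \<odot> q i \<oplus> g i \<odot> q i)"
    by (rule M.finsum_addf[symmetric]) auto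
  also have "\<dots> = (\<Oplus>i\<in>I. (f i + g i) \<odot> q i)"
    by (rule finsum_eqI) (auto simp: smult_add)
  finally show ?thesis .
qed

lemma comb_smult: "c \<odot> (\<Oplus>i\<in>I. f i \<odot> q i) = (\<Oplus>i\<in>I. (c * f i) \<odot> q i)"
  by (rule trans[OF smult_finsum], auto)
    (rule finsum_eqI, auto simp: smult_smult)

lemma comb_minus: "(\<Oplus>i\<in>I. f i \<odot> q i) \<ominus> (\<Oplus>i\<in>I. g i \<odot> q i) = (\<Oplus>i\<in>I. (f i - g i) \<odot> q i)"
  using comb_smult[of "-1" g] comb_add[of f "\<lambda>i. - g i"] by (simp add: minus_smult)

lemma nrm_comb_unimodular:
  assumes "\<And>i. i \<in> I \<Longrightarrow> cmod (u i) = 1" shows "nrm (\<Oplus>i\<in>I. u i \<odot> q i) \<le> 1"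
proof (rule nrm_isometry)
  have "cnj (u i) * u i = 1" if "i \<in> I" for i
    using assms[OF that] complex_norm_square[of "u i"] by (simp add: mult.commute)
  then have "(\<Oplus>i\<in>I. (cnj (u i) * u i) \<odot> q i) = (\<Oplus>i\<in>I. q i)"
    by (intro finsum_eqI) auto
  then show "(\<Oplus>i\<in>I. u i \<odot> q i)\<^sup>\<star> \<otimes> (\<Oplus>i\<in>I. u i \<odot> q i) = \<one>"
    by (simp add: comb_adj comb_times q_sum)
qed simp

text \<open>For unimodular coefficients the combination is unitary, and every coefficient of modulus at most
  \<open>K\<close> is \<open>K\<close> times the mean of two unimodular ones.\<close>

lemma nrm_comb_le:
  assumes "\<And>i. i \<in> I \<Longrightarrow> cmod (f i) \<le> K" "0 \<le> K" shows "nrm (\<Oplus>i\<in>I. f i \<odot> q i) \<le> K"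
proof -
  have "\<forall>i\<in>I. \<exists>u v. cmod u = 1 \<and> cmod v = 1 \<and> f i = of_real K * ((u + v) / 2)"
  proof
    fix i assume i: "i \<in> I"
    show "\<exists>u v. cmod u = 1 \<and> cmod v = 1 \<and> f i = of_real K * ((u + v) / 2)"
    proof (cases "K = 0")
      case True
      then show ?thesis using assms(1)[OF i] by (auto intro: exI[of _ 1])
    next
      case False
      then have "cmod (f i / of_real K) \<le> 1"
        using assms i by (simp add: norm_divide)
      then obtain u v where "cmod u = 1" "cmod v = 1" "f i / of_real K = (u + v) / 2"
        by (rule average_of_unimodular)
      with False show ?thesis by (auto simp: field_simps)
    qed
  qed
  then obtain u v where "\<forall>i\<in>I. cmod (u i) = 1 \<and> cmod (v i) = 1 \<and> f i = of_real K * ((u i + v i) / 2)"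
    by metis
  then have u: "\<And>i. i \<in> I \<Longrightarrow> cmod (u i) = 1" and v: "\<And>i. i \<in> I \<Longrightarrow> cmod (v i) = 1"
    and f: "\<And>i. i \<in> I \<Longrightarrow> f i = of_real K * ((u i + v i) / 2)"
    by auto
  have "(\<Oplus>i\<in>I. f i \<odot> q i) = of_real (K / 2) \<odot> ((\<Oplus>i\<in>I. u i \<odot> q i) \<oplus> (\<Oplus>i\<in>I. v i \<odot> q i))"
    unfolding comb_add comb_smult by (intro finsum_eqI) (auto simp: f)
  moreover have "nrm ((\<Oplus>i\<in>I. u i \<odot> q i) \<oplus> (\<Oplus>i\<in>I. v i \<odot> q i)) \<le> 1 + 1"
    using u v by (intro nrm_add_le comb_closed nrm_comb_unimodular)
  ultimately show ?thesis
    using assms(2) mult_left_mono[of _ 2 "K / 2"] by (simp add: nrm_smult norm_divide norm_mult)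
qed

end

section \<open>*-homomorphisms are contractive\<close>

context pre_cstar
begin

lemma cauchyI:
  assumes "\<And>n. s n \<in> carrier A" "\<And>m n. m \<le> n \<Longrightarrow> nrm (s n \<ominus> s m) \<le> f m" "f \<longlonglongrightarrow> 0"
  shows "cauchy s"
  unfolding cauchy_def
proof (intro conjI allI impI)
  fix e :: real assume "0 < e"
  then obtain K where K: "\<And>n. n \<ge> K \<Longrightarrow> \<bar>f n\<bar> < e"
    using assms(3) unfolding LIMSEQ_def dist_real_def by fastforce
  have "nrm (s m \<ominus> s n) < e" if "m \<ge> K" "n \<ge> K" for m n
  proof (cases "m \<le> n")
    case True
    then show ?thesis
      using assms(2)[OF True] nrm_minus_commute[OF assms(1)[of m] assms(1)[of n]] K[OF that(1)] by linarith
  next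
    case False
    then show ?thesis
      using assms(2)[of n m] K[OF that(2)] by linarith
  qed
  then show "\<exists>K. \<forall>m\<ge>K. \<forall>n\<ge>K. nrm (s m \<ominus> s n) < e" by blast
qed (rule assms)

lemma geometric_cauchy:
  assumes s: "\<And>n. s n \<in> carrier A" and step: "\<And>n. nrm (s (Suc n) \<ominus> s n) \<le> r ^ n" and r: "0 \<le> r" "r < 1"
  shows "cauchy s"
proof (rule cauchyI[OF s])
  fix m n :: nat assume "m \<le> n"
  then have "nrm (s n \<ominus> s m) \<le> (r ^ m - r ^ n) / (1 - r)"
  proof (induction n rule: dec_induct)
    case base
    then show ?case using s by simp
  next
    case (step n)
    have "nrm (s (Suc n) \<ominus> s m) \<le> nrm (s (Suc n) \<ominus> s n) + nrm (s n \<ominus> s m)"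
      using s by (intro nrm_triangle) auto
    also have "\<dots> \<le> r ^ n + (r ^ m - r ^ n) / (1 - r)"
      using step assms(2)[of n] by linarith
    also have "\<dots> = (r ^ m - r ^ Suc n) / (1 - r)"
      using r by (simp add: field_simps)
    finally show ?case .
  qed
  also have "\<dots> \<le> r ^ m / (1 - r)"
    using r by (intro divide_right_mono) auto
  finally show "nrm (s n \<ominus> s m) \<le> r ^ m / (1 - r)" .
next
  show "(\<lambda>m. r ^ m / (1 - r)) \<longlonglongrightarrow> 0"
    using r LIMSEQ_power_zero[of r] by (intro tendsto_divide_zero) auto
qed

lemma conv_Suc: "conv s x \<Longrightarrow> conv (\<lambda>n. s (Suc n)) x"
  unfolding conv_def by (simp add: LIMSEQ_Suc[of "\<lambda>n. nrm (s n \<ominus> x)"])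

end

text \<open>The element \<open>y\<close> is \<open>1 - \<surd>(1 - x\<^sup>2)\<close>, the fixed point of
  \<open>y \<mapsto> (x\<^sup>2 + y\<^sup>2) / 2\<close>. The iterates stay in the ball of radius
  \<open>\<parallel>x\<parallel> < 1\<close>, where this map is a contraction. The equation for
  \<open>y\<close> makes sense without a unit.\<close>

lemma (in cstar_algebra) sqrt_one_minus_square:
  assumes x: "x \<in> carrier A" "cs_star A x = x" and lt: "cs_norm A x < 1"
  obtains y where "y \<in> carrier A" "cs_star A y = y" "x \<otimes>\<^bsub>A\<^esub> y = y \<otimes>\<^bsub>A\<^esub> x"
    "y \<oplus>\<^bsub>A\<^esub> y = x \<otimes>\<^bsub>A\<^esub> x \<oplus>\<^bsub>A\<^esub> y \<otimes>\<^bsub>A\<^esub> y"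
proof -
  define r where "r = pre.nrm x"
  define s where "s = rec_nat \<zero>\<^bsub>A\<^esub> (\<lambda>_ y. (1/2) \<odot>\<^bsub>A\<^esub> (x \<otimes>\<^bsub>A\<^esub> x \<oplus>\<^bsub>A\<^esub> y \<otimes>\<^bsub>A\<^esub> y))"
  have s0: "s 0 = \<zero>\<^bsub>A\<^esub>"
    and sS: "s (Suc n) = (1/2) \<odot>\<^bsub>A\<^esub> (x \<otimes>\<^bsub>A\<^esub> x \<oplus>\<^bsub>A\<^esub> s n \<otimes>\<^bsub>A\<^esub> s n)" for n
    by (simp_all add: s_def)
  have r: "0 \<le> r" "r < 1" using x lt by (simp_all add: r_def)
  have sc [simp]: "s n \<in> carrier A" for n
    by (induction n) (use x in \<open>auto simp: s0 sS\<close>)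
  have sadj: "cs_star A (s n) = s n" for n
    by (induction n) (use x in \<open>auto simp: s0 sS pre.adj_smult pre.adj_add pre.adj_times\<close>)
  have scom: "x \<otimes>\<^bsub>A\<^esub> s n = s n \<otimes>\<^bsub>A\<^esub> x" for n
  proof (induction n)
    case (Suc n)
    have "x \<otimes>\<^bsub>A\<^esub> (s n \<otimes>\<^bsub>A\<^esub> s n) = s n \<otimes>\<^bsub>A\<^esub> s n \<otimes>\<^bsub>A\<^esub> x"
      using x Suc by (metis pre.times_assoc sc)
    then show ?case
      using x by (simp add: sS pre.smult_times_l pre.smult_times_r pre.times_add_l pre.times_add_r pre.times_assoc)
  qed (use x in \<open>simp add: s0\<close>)
  have sr: "pre.nrm (s n) \<le> r" for n
  proof (induction n)
    case (Suc n)
    have "pre.nrm (x \<otimes>\<^bsub>A\<^esub> x \<oplus>\<^bsub>A\<^esub> s n \<otimes>\<^bsub>A\<^esub> s n) \<le> r * r + r * r"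
      using x Suc by (intro pre.nrm_add_le pre.nrm_times_le) (auto simp: r_def)
    also have "\<dots> \<le> 2 * r"
      using r mult_left_le[of r r] by simp
    finally show ?case
      using x by (simp add: sS pre.nrm_smult)
  qed (use r in \<open>simp add: s0\<close>)
  have step: "pre.nrm (s (Suc n) \<ominus>\<^bsub>A\<^esub> s n) \<le> r ^ n" for n
  proof (induction n)
    case 0
    then show ?case using sr[of 1] r by (simp add: s0)
  next
    case (Suc n)
    have bound: "pre.nrm (s (Suc n) \<otimes>\<^bsub>A\<^esub> (s (Suc n) \<ominus>\<^bsub>A\<^esub> s n)
        \<oplus>\<^bsub>A\<^esub> (s (Suc n) \<ominus>\<^bsub>A\<^esub> s n) \<otimes>\<^bsub>A\<^esub> s n) \<le> r * r ^ n + r ^ n * r"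
      using Suc sr by (intro pre.nrm_add_le pre.nrm_times_le) auto
    have "s (Suc (Suc n)) \<ominus>\<^bsub>A\<^esub> s (Suc n)
        = (1/2) \<odot>\<^bsub>A\<^esub> ((x \<otimes>\<^bsub>A\<^esub> x \<oplus>\<^bsub>A\<^esub> s (Suc n) \<otimes>\<^bsub>A\<^esub> s (Suc n)) \<ominus>\<^bsub>A\<^esub> (x \<otimes>\<^bsub>A\<^esub> x \<oplus>\<^bsub>A\<^esub> s n \<otimes>\<^bsub>A\<^esub> s n))"
      using x by (subst pre.smult_minus) (auto simp: sS[symmetric])
    also have "\<dots> = (1/2) \<odot>\<^bsub>A\<^esub> (s (Suc n) \<otimes>\<^bsub>A\<^esub> s (Suc n) \<ominus>\<^bsub>A\<^esub> s n \<otimes>\<^bsub>A\<^esub> s n)"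
      using x by (simp add: pre.add_minus_add M.l_zero)
    also have "s (Suc n) \<otimes>\<^bsub>A\<^esub> s (Suc n) \<ominus>\<^bsub>A\<^esub> s n \<otimes>\<^bsub>A\<^esub> s n
        = s (Suc n) \<otimes>\<^bsub>A\<^esub> (s (Suc n) \<ominus>\<^bsub>A\<^esub> s n) \<oplus>\<^bsub>A\<^esub> (s (Suc n) \<ominus>\<^bsub>A\<^esub> s n) \<otimes>\<^bsub>A\<^esub> s n"
      by (rule pre.times_minus_times) auto
    also have "pre.nrm ((1/2) \<odot>\<^bsub>A\<^esub> \<dots>) \<le> (1/2) * (r * r ^ n + r ^ n * r)"
      using bound by (simp add: pre.nrm_smult)
    finally show ?case by simp
  qed
  obtain y where y: "pre.conv s y"
    using cauchy_conv[OF pre.geometric_cauchy[OF sc step r]] by blast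
  have yc: "y \<in> carrier A" using y by (simp add: pre.conv_def)
  have "pre.conv (\<lambda>n. s (Suc n)) ((1/2) \<odot>\<^bsub>A\<^esub> (x \<otimes>\<^bsub>A\<^esub> x \<oplus>\<^bsub>A\<^esub> y \<otimes>\<^bsub>A\<^esub> y))"
    unfolding sS using x y by (intro pre.conv_smult pre.conv_add pre.conv_times pre.conv_const) auto
  then have yeq: "y = (1/2) \<odot>\<^bsub>A\<^esub> (x \<otimes>\<^bsub>A\<^esub> x \<oplus>\<^bsub>A\<^esub> y \<otimes>\<^bsub>A\<^esub> y)"
    using pre.conv_unique pre.conv_Suc[OF y] by blast
  show thesis
  proof
    show "y \<in> carrier A" by (rule yc)
    have "pre.conv s (cs_star A y)"
      using pre.conv_adj[OF y] by (simp add: sadj)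
    then show "cs_star A y = y"
      using y by (rule pre.conv_unique)
    have "pre.conv (\<lambda>n. s n \<otimes>\<^bsub>A\<^esub> x) (x \<otimes>\<^bsub>A\<^esub> y)"
      using pre.conv_times[OF pre.conv_const[OF x(1)] y] by (simp add: scom)
    then show "x \<otimes>\<^bsub>A\<^esub> y = y \<otimes>\<^bsub>A\<^esub> x"
      using pre.conv_times[OF y pre.conv_const[OF x(1)]] by (rule pre.conv_unique)
    have "2 \<odot>\<^bsub>A\<^esub> y = x \<otimes>\<^bsub>A\<^esub> x \<oplus>\<^bsub>A\<^esub> y \<otimes>\<^bsub>A\<^esub> y"
      by (subst yeq) (use x yc in \<open>simp add: pre.smult_smult\<close>)
    then show "y \<oplus>\<^bsub>A\<^esub> y = x \<otimes>\<^bsub>A\<^esub> x \<oplus>\<^bsub>A\<^esub> y \<otimes>\<^bsub>A\<^esub> y"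
      using pre.smult_add[OF yc, of 1 1] yc by simp
  qed
qed

context unital_pre_cstar
begin

text \<open>Here \<open>a + \<i> b\<close> is unitary, and \<open>a\<close> is the mean of it and its adjoint.\<close>

lemma nrm_cos_le_1:
  assumes a: "a \<in> carrier A" "a\<^sup>\<star> = a" and b: "b \<in> carrier A" "b\<^sup>\<star> = b"
    and ab: "a \<otimes> b = b \<otimes> a" and sum: "a \<otimes> a \<oplus> b \<otimes> b = \<one>"
  shows "nrm a \<le> 1"
proof -
  let ?u = "a \<oplus> \<i> \<odot> b" and ?v = "a \<oplus> (-\<i>) \<odot> b"
  have adj: "?u\<^sup>\<star> = ?v" using a b by (simp add: adj_add adj_smult)
  have "?v \<otimes> ?u = (a \<otimes> a \<oplus> b \<otimes> b) \<oplus> (\<i> \<odot> (a \<otimes> b) \<oplus> (-\<i>) \<odot> (a \<otimes> b))"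
    using a b by (simp add: times_add_l times_add_r smult_times_l smult_times_r smult_smult ab M.a_ac smult_distr)
  then have "?u\<^sup>\<star> \<otimes> ?u = \<one>"
    using a b sum by (simp add: adj smult_add[symmetric])
  then have u: "nrm ?u \<le> 1" using a b by (intro nrm_isometry) auto
  then have v: "nrm ?v \<le> 1" using a b nrm_adj[of ?u] by (simp add: adj)
  have "?u \<oplus> ?v = (a \<oplus> a) \<oplus> (\<i> \<odot> b \<oplus> (-\<i>) \<odot> b)"
    using a b by (simp add: M.a_ac)
  also have "\<dots> = 2 \<odot> a"
    using a b smult_add[of a 1 1] by (simp add: smult_add[symmetric])
  finally have "2 * nrm a = nrm (?u \<oplus> ?v)"
    using a by (simp add: nrm_smult)
  also have "\<dots> \<le> 1 + 1"
    using a b u v by (intro nrm_add_le) auto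
  finally show ?thesis by simp
qed

lemma square_plus_square:
  assumes x: "x \<in> carrier A" and y: "y \<in> carrier A" and eq: "y \<oplus> y = x \<otimes> x \<oplus> y \<otimes> y"
  shows "x \<otimes> x \<oplus> (\<one> \<ominus> y) \<otimes> (\<one> \<ominus> y) = \<one>"
proof -
  have "x \<otimes> x = 2 \<odot> y \<oplus> (-1) \<odot> (y \<otimes> y)"
    using add_minus_cancel[of "y \<otimes> y" "x \<otimes> x"] eq x y smult_add[OF y, of 1 1]
    by (simp add: minus_smult M.a_comm)
  then have "x \<otimes> x \<oplus> (\<one> \<ominus> y) \<otimes> (\<one> \<ominus> y)
    = \<one> \<oplus> (2 \<odot> y \<oplus> (-2) \<odot> y) \<oplus> ((-1) \<odot> (y \<otimes> y) \<oplus> 1 \<odot> (y \<otimes> y))"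
    unfolding minus_smult[OF unit_closed y] affine_times[OF y] using y by (simp add: M.a_ac)
  then show ?thesis
    using y by (simp only: smult_add[symmetric] times_closed) simp
qed

end

lemma star_homD:
  assumes "star_hom A B \<phi>"
  shows "x \<in> carrier A \<Longrightarrow> \<phi> x \<in> carrier B"
    and "\<lbrakk>x \<in> carrier A; y \<in> carrier A\<rbrakk> \<Longrightarrow> \<phi> (x \<oplus>\<^bsub>A\<^esub> y) = \<phi> x \<oplus>\<^bsub>B\<^esub> \<phi> y"
    and "x \<in> carrier A \<Longrightarrow> \<phi> (c \<odot>\<^bsub>A\<^esub> x) = c \<odot>\<^bsub>B\<^esub> \<phi> x"
    and "\<lbrakk>x \<in> carrier A; y \<in> carrier A\<rbrakk> \<Longrightarrow> \<phi> (x \<otimes>\<^bsub>A\<^esub> y) = \<phi> x \<otimes>\<^bsub>B\<^esub> \<phi> y"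
    and "x \<in> carrier A \<Longrightarrow> \<phi> (cs_star A x) = cs_star B (\<phi> x)"
  using assms by (auto simp: star_hom_def)

text \<open>If \<open>x\<close> is self-adjoint with \<open>\<parallel>x\<parallel> < 1\<close>, the element
  \<open>y\<close> with \<open>2 y = x\<^sup>2 + y\<^sup>2\<close> is carried along, and
  \<open>\<phi>(x)\<^sup>2 + (1 - \<phi>(y))\<^sup>2 = 1\<close> in the target. The general case
  follows by scaling and the C*-identity.\<close>

theorem star_hom_contractive:
  assumes A: "cstar_algebra A" and B: "unital_cstar_algebra B" and \<phi>: "star_hom A B \<phi>"
    and x: "x \<in> carrier A"
  shows "cs_norm B (\<phi> x) \<le> cs_norm A x"
proof -
  interpret A: cstar_algebra A by (rule A)
  interpret B: unital_cstar_algebra B by (rule B)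
  note hom = star_homD[OF \<phi>]
  have lt: "cs_norm B (\<phi> x) \<le> 1"
    if x: "x \<in> carrier A" "cs_star A x = x" "cs_norm A x < 1" for x
  proof -
    obtain y where y: "y \<in> carrier A" "cs_star A y = y" "x \<otimes>\<^bsub>A\<^esub> y = y \<otimes>\<^bsub>A\<^esub> x"
      "y \<oplus>\<^bsub>A\<^esub> y = x \<otimes>\<^bsub>A\<^esub> x \<oplus>\<^bsub>A\<^esub> y \<otimes>\<^bsub>A\<^esub> y"
      by (rule A.sqrt_one_minus_square[OF x])
    have c: "\<phi> x \<in> carrier B" "\<phi> y \<in> carrier B"
      using x y hom(1) by auto
    have com: "\<phi> x \<otimes>\<^bsub>B\<^esub> \<phi> y = \<phi> y \<otimes>\<^bsub>B\<^esub> \<phi> x"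
      using hom(4)[OF x(1) y(1)] hom(4)[OF y(1) x(1)] y(3) by simp
    have eq: "\<phi> y \<oplus>\<^bsub>B\<^esub> \<phi> y = \<phi> x \<otimes>\<^bsub>B\<^esub> \<phi> x \<oplus>\<^bsub>B\<^esub> \<phi> y \<otimes>\<^bsub>B\<^esub> \<phi> y"
      using arg_cong[OF y(4), of \<phi>] x(1) y(1) by (simp add: hom)
    show ?thesis
    proof (rule B.pre.nrm_cos_le_1)
      show "cs_star B (\<phi> x) = \<phi> x" using hom(5)[OF x(1)] x by simp
      show "cs_star B (\<one>\<^bsub>B\<^esub> \<ominus>\<^bsub>B\<^esub> \<phi> y) = \<one>\<^bsub>B\<^esub> \<ominus>\<^bsub>B\<^esub> \<phi> y"
        using hom(5)[OF y(1)] y c by (simp add: B.pre.adj_minus)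
      show "\<phi> x \<otimes>\<^bsub>B\<^esub> (\<one>\<^bsub>B\<^esub> \<ominus>\<^bsub>B\<^esub> \<phi> y) = (\<one>\<^bsub>B\<^esub> \<ominus>\<^bsub>B\<^esub> \<phi> y) \<otimes>\<^bsub>B\<^esub> \<phi> x"
        using c com by (simp add: B.pre.times_minus_l B.pre.times_minus_r)
      show "\<phi> x \<otimes>\<^bsub>B\<^esub> \<phi> x \<oplus>\<^bsub>B\<^esub> (\<one>\<^bsub>B\<^esub> \<ominus>\<^bsub>B\<^esub> \<phi> y) \<otimes>\<^bsub>B\<^esub> (\<one>\<^bsub>B\<^esub> \<ominus>\<^bsub>B\<^esub> \<phi> y) = \<one>\<^bsub>B\<^esub>"
        by (rule B.pre.square_plus_square[OF c eq])
    qed (use c in auto)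
  qed
  have sa: "cs_norm B (\<phi> x) \<le> cs_norm A x" if x: "x \<in> carrier A" "cs_star A x = x" for x
  proof (rule dense_ge)
    fix K assume K: "cs_norm A x < K"
    then have pos: "0 < K" using A.pre.nrm_ge_0[OF x(1)] by linarith
    let ?x = "of_real (1 / K) \<odot>\<^bsub>A\<^esub> x"
    have "cs_norm B (\<phi> ?x) \<le> 1"
    proof (rule lt)
      show "cs_star A ?x = ?x" using x by (simp add: A.pre.adj_smult)
      show "cs_norm A ?x < 1" using x K pos by (simp add: A.pre.nrm_smult norm_divide field_simps)
    qed (use x in auto)
    then show "cs_norm B (\<phi> x) \<le> K"
      using x hom(1)[OF x(1)] pos by (simp add: hom(3) B.pre.nrm_smult norm_divide field_simps)
  qed
  have "(cs_norm B (\<phi> x))\<^sup>2 = cs_norm B (\<phi> (cs_star A x \<otimes>\<^bsub>A\<^esub> x))"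
    using x hom(1)[OF x] by (simp add: hom B.pre.nrm_adj_times)
  also have "\<dots> \<le> cs_norm A (cs_star A x \<otimes>\<^bsub>A\<^esub> x)"
    using x by (intro sa) (auto simp: A.pre.adj_times)
  also have "\<dots> = (cs_norm A x)\<^sup>2"
    using x by (simp add: A.pre.nrm_adj_times)
  finally show ?thesis
    using A.pre.nrm_ge_0[OF x] by (rule power2_le_imp_le)
qed

section \<open>Closed subalgebras\<close>

lemma cstar_algebraI:
  assumes "pre_cstar A" "\<And>s. pre_cstar.cauchy A s \<Longrightarrow> \<exists>x. pre_cstar.conv A s x"
  shows "cstar_algebra A"
proof -
  interpret pre_cstar A by fact
  show ?thesis
  proof
    fix s :: "nat \<Rightarrow> 'a"
    assume "\<And>n. s n \<in> carrier A" "\<And>e. 0 < e \<Longrightarrow> \<exists>K. \<forall>m\<ge>K. \<forall>n\<ge>K. cs_norm A (s m \<ominus>\<^bsub>A\<^esub> s n) < e"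
    then have "cauchy s" by (simp add: cauchy_def)
    then show "\<exists>x\<in>carrier A. (\<lambda>n. cs_norm A (s n \<ominus>\<^bsub>A\<^esub> x)) \<longlonglongrightarrow> 0"
      using assms(2) unfolding conv_def by blast
  qed (simp_all add: times_assoc times_add_l times_add_r smult_times_l smult_times_r adj_add
      adj_smult adj_times nrm_eq_0 nrm_add nrm_smult nrm_times nrm_adj_times)
qed

lemma unital_cstar_algebraI:
  assumes "unital_pre_cstar A" "\<And>s. pre_cstar.cauchy A s \<Longrightarrow> \<exists>x. pre_cstar.conv A s x"
  shows "unital_cstar_algebra A"
proof -
  interpret unital_pre_cstar A by fact
  interpret cstar_algebra A by (rule cstar_algebraI[OF pre_cstar_axioms assms(2)])
  show ?thesis by unfold_locales simp_all
qed

lemma cstar_subalgebra_cstar: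
  assumes A: "cstar_algebra A" and S: "cstar_subalgebra A S"
  shows "cstar_algebra (A\<lparr>carrier := S\<rparr>)"
proof -
  interpret A: cstar_algebra A by (rule A)
  let ?S = "A\<lparr>carrier := S\<rparr>"
  have SD: "x \<in> S \<Longrightarrow> x \<in> carrier A" "\<zero>\<^bsub>A\<^esub> \<in> S" "x \<in> S \<Longrightarrow> y \<in> S \<Longrightarrow> x \<oplus>\<^bsub>A\<^esub> y \<in> S"
    "x \<in> S \<Longrightarrow> c \<odot>\<^bsub>A\<^esub> x \<in> S" "x \<in> S \<Longrightarrow> y \<in> S \<Longrightarrow> x \<otimes>\<^bsub>A\<^esub> y \<in> S" "x \<in> S \<Longrightarrow> cs_star A x \<in> S" for x y c
    using S by (auto simp: cstar_subalgebra_def closed_subspace_def)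
  have module: "Module.module complex_ring ?S"
  proof (rule moduleI)
    show "abelian_group ?S"
    proof (rule abelian_groupI)
      fix x assume "x \<in> carrier ?S"
      then show "\<exists>y\<in>carrier ?S. y \<oplus>\<^bsub>?S\<^esub> x = \<zero>\<^bsub>?S\<^esub>"
        using SD(4)[of x "-1"] SD(1)[of x] A.pre.neg_smult[of x] A.M.l_neg[of x]
        by (auto intro!: bexI[of _ "- 1 \<odot>\<^bsub>A\<^esub> x"])
    qed (auto simp: SD A.M.a_ac)
  qed (auto simp: SD cring_complex_ring A.pre.smult_add A.pre.smult_distr A.pre.smult_smult)
  interpret S: Module.module complex_ring ?S by (rule module)
  have pre: "pre_cstar ?S"
    by unfold_locales
      (auto simp: SD A.pre.times_assoc A.pre.times_add_l A.pre.times_add_r A.pre.smult_times_l A.pre.smult_times_r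
       A.pre.adj_add A.pre.adj_smult A.pre.adj_times A.pre.nrm_eq_0 A.pre.nrm_add A.pre.nrm_smult
       A.pre.nrm_times A.pre.nrm_adj_times)
  interpret S: pre_cstar ?S by (rule pre)
  have minus: "x \<ominus>\<^bsub>?S\<^esub> y = x \<ominus>\<^bsub>A\<^esub> y" if "x \<in> S" "y \<in> S" for x y
    using that SD by (simp add: S.minus_smult A.pre.minus_smult)
  show ?thesis
  proof (rule cstar_algebraI[OF pre])
    fix s assume s: "S.cauchy s"
    have sS: "\<And>n. s n \<in> S" using s by (simp add: S.cauchy_def)
    then have "A.pre.cauchy s"
      using s by (simp add: S.cauchy_def A.pre.cauchy_def minus SD)
    then obtain x where x: "A.pre.conv s x" using A.cauchy_conv by blast
    then have "x \<in> S"
      using S sS unfolding cstar_subalgebra_def closed_subspace_def A.pre.conv_def by blast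
    then show "\<exists>x. S.conv s x"
      using x sS by (auto simp: S.conv_def A.pre.conv_def minus)
  qed
qed

section \<open>Bounded functions\<close>

lemma linfty_simps [simp]:
  "mult (linfty N) = (\<lambda>f h y. f y * h y)" "one (linfty N) = indicator N" "zero (linfty N) = (\<lambda>y. 0)"
  "add (linfty N) = (\<lambda>f h y. f y + h y)" "smult (linfty N) = (\<lambda>c f y. c * f y)"
  "cs_star (linfty N) = (\<lambda>f y. cnj (f y))" "cs_norm (linfty N) = (\<lambda>f. SUP y\<in>N. cmod (f y))"
  by (simp_all add: linfty_def)

lemma linfty_carrier: "f \<in> carrier (linfty N) \<longleftrightarrow> (\<forall>y. y \<notin> N \<longrightarrow> f y = 0) \<and> (\<exists>K. \<forall>y\<in>N. cmod (f y) \<le> K)"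
  by (simp add: linfty_def)

lemma linfty_norm_ge: "\<lbrakk>f \<in> carrier (linfty N); y \<in> N\<rbrakk> \<Longrightarrow> cmod (f y) \<le> cs_norm (linfty N) f"
  by (auto simp: linfty_carrier intro!: cSUP_upper bdd_aboveI2)

lemma linfty_norm_le: "\<lbrakk>N \<noteq> {}; \<And>y. y \<in> N \<Longrightarrow> cmod (f y) \<le> K\<rbrakk> \<Longrightarrow> cs_norm (linfty N) f \<le> K"
  by (auto intro!: cSUP_least)

lemma linfty_pre_cstar: assumes N: "N \<noteq> {}" shows "pre_cstar (linfty N)"
proof -
  let ?L = "linfty N"
  have bd: "\<exists>K\<ge>0. \<forall>y\<in>N. cmod (f y) \<le> K" if "f \<in> carrier ?L" for f
    using that N unfolding linfty_carrier by (meson norm_ge_zero order_trans ex_in_conv)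
  have add: "(\<lambda>y. f y + g y) \<in> carrier ?L" if f: "f \<in> carrier ?L" and g: "g \<in> carrier ?L" for f g
  proof -
    obtain K L where "\<forall>y\<in>N. cmod (f y) \<le> K" "\<forall>y\<in>N. cmod (g y) \<le> L" using f g linfty_carrier by metis
    then have "\<forall>y\<in>N. cmod (f y + g y) \<le> K + L" by (meson add_mono norm_triangle_ineq order_trans)
    then show ?thesis using f g by (auto simp: linfty_carrier)
  qed
  have mult: "(\<lambda>y. f y * g y) \<in> carrier ?L" if f: "f \<in> carrier ?L" and g: "g \<in> carrier ?L" for f g
  proof -
    obtain K L where "\<forall>y\<in>N. cmod (f y) \<le> K" "\<forall>y\<in>N. cmod (g y) \<le> L" "0 \<le> K" "0 \<le> L" using bd f g by metis
    then have "\<forall>y\<in>N. cmod (f y * g y) \<le> K * L" by (simp add: norm_mult mult_mono)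
    then show ?thesis using f by (auto simp: linfty_carrier)
  qed
  have smult: "(\<lambda>y. c * f y) \<in> carrier ?L" if f: "f \<in> carrier ?L" for f c
  proof -
    obtain K where "\<forall>y\<in>N. cmod (f y) \<le> K" using bd f by metis
    then have "\<forall>y\<in>N. cmod (c * f y) \<le> cmod c * K" by (simp add: norm_mult mult_left_mono)
    then show ?thesis using f by (auto simp: linfty_carrier)
  qed
  have le: "cmod (f y) \<le> (SUP y\<in>N. cmod (f y))" if "f \<in> carrier ?L" "y \<in> N" for f y
    using linfty_norm_ge[OF that] by simp
  have SUP_le: "(SUP y\<in>N. cmod (f y)) \<le> K" if "\<And>y. y \<in> N \<Longrightarrow> cmod (f y) \<le> K" for f :: "'a \<Rightarrow> complex" and K
    using linfty_norm_le[OF N that] by simp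
  have SUP_eq0: "(SUP y\<in>N. cmod (f y)) = 0 \<longleftrightarrow> f = (\<lambda>y. 0)" if f: "f \<in> carrier ?L" for f
  proof
    assume 0: "(SUP y\<in>N. cmod (f y)) = 0"
    show "f = (\<lambda>y. 0)"
    proof
      fix y show "f y = 0" using le[OF f, of y] f 0 by (cases "y \<in> N") (auto simp: linfty_carrier)
    qed
  qed (use N in simp)
  have scale: "(SUP y\<in>N. cmod (c * f y)) = cmod c * (SUP y\<in>N. cmod (f y))" if f: "f \<in> carrier ?L" for c f
  proof (cases "c = 0")
    case False
    show ?thesis
    proof (rule antisym)
      show "(SUP y\<in>N. cmod (c * f y)) \<le> cmod c * (SUP y\<in>N. cmod (f y))"
        by (rule SUP_le) (simp add: norm_mult mult_left_mono le[OF f])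
      have "cmod (f y) \<le> (SUP y\<in>N. cmod (c * f y)) / cmod c" if "y \<in> N" for y
        using le[OF smult[OF f] that, of c] False by (simp add: norm_mult field_simps)
      then have "(SUP y\<in>N. cmod (f y)) \<le> (SUP y\<in>N. cmod (c * f y)) / cmod c"
        by (rule SUP_le)
      then show "cmod c * (SUP y\<in>N. cmod (f y)) \<le> (SUP y\<in>N. cmod (c * f y))"
        using False by (simp add: field_simps)
    qed
  qed (use N in simp)
  have ge0: "0 \<le> (SUP y\<in>N. cmod (f y))" if f: "f \<in> carrier ?L" for f
    using N le[OF f] by (meson norm_ge_zero order_trans ex_in_conv)
  have square: "(SUP y\<in>N. cmod (cnj (f y) * f y)) = (SUP y\<in>N. cmod (f y))\<^sup>2" if f: "f \<in> carrier ?L" for f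
  proof (rule antisym)
    show "(SUP y\<in>N. cmod (cnj (f y) * f y)) \<le> (SUP y\<in>N. cmod (f y))\<^sup>2"
      by (rule SUP_le) (simp add: norm_mult power2_eq_square mult_mono le[OF f] ge0[OF f])
    have cf: "(\<lambda>y. cnj (f y)) \<in> carrier ?L" using f by (simp add: linfty_carrier)
    have "cmod (f y) \<le> sqrt (SUP y\<in>N. cmod (cnj (f y) * f y))" if "y \<in> N" for y
      using le[OF mult[OF cf f] that] by (intro real_le_rsqrt) (simp add: norm_mult power2_eq_square)
    then have "(SUP y\<in>N. cmod (f y)) \<le> sqrt (SUP y\<in>N. cmod (cnj (f y) * f y))"
      by (rule SUP_le)
    then have "(SUP y\<in>N. cmod (f y))\<^sup>2 \<le> (sqrt (SUP y\<in>N. cmod (cnj (f y) * f y)))\<^sup>2"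
      using ge0[OF f] by (rule power_mono)
    also have "\<dots> = (SUP y\<in>N. cmod (cnj (f y) * f y))"
      using ge0[OF mult[OF cf f]] by simp
    finally show "(SUP y\<in>N. cmod (f y))\<^sup>2 \<le> (SUP y\<in>N. cmod (cnj (f y) * f y))" .
  qed
  have "Module.module complex_ring ?L"
  proof (rule moduleI)
    show "abelian_group ?L"
    proof (rule abelian_groupI)
      fix f assume "f \<in> carrier ?L"
      then show "\<exists>g\<in>carrier ?L. g \<oplus>\<^bsub>?L\<^esub> f = \<zero>\<^bsub>?L\<^esub>"
        using smult[of f "-1"] by (auto intro!: bexI[of _ "\<lambda>y. - f y"])
    qed (auto simp: add add.assoc add.commute linfty_carrier[of "\<lambda>y. 0"])
  qed (auto simp: smult cring_complex_ring algebra_simps)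
  then interpret Module.module complex_ring ?L .
  show ?thesis
  proof unfold_locales
    fix f g assume fg: "f \<in> carrier ?L" "g \<in> carrier ?L"
    show "cs_norm ?L (f \<oplus>\<^bsub>?L\<^esub> g) \<le> cs_norm ?L f + cs_norm ?L g"
      unfolding linfty_simps
      by (rule SUP_le) (rule order_trans[OF norm_triangle_ineq add_mono], auto intro: le fg)
    show "cs_norm ?L (f \<otimes>\<^bsub>?L\<^esub> g) \<le> cs_norm ?L f * cs_norm ?L g"
      unfolding linfty_simps
      by (rule SUP_le) (simp add: norm_mult mult_mono le fg ge0)
    show "cs_norm ?L (cs_star ?L f \<otimes>\<^bsub>?L\<^esub> f) = (cs_norm ?L f)\<^sup>2"
      unfolding linfty_simps by (rule square[OF fg(1)])
  qed (auto simp: mult smult linfty_carrier[of "\<lambda>y. cnj _"] SUP_eq0 scale algebra_simps,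
      auto simp: linfty_carrier)
qed

lemma linfty_cstar: assumes N: "N \<noteq> {}" shows "cstar_algebra (linfty N)"
proof (rule cstar_algebraI[OF linfty_pre_cstar[OF N]])
  interpret L: pre_cstar "linfty N" by (rule linfty_pre_cstar[OF N])
  have minus: "f \<ominus>\<^bsub>linfty N\<^esub> g = (\<lambda>y. f y - g y)" if "f \<in> carrier (linfty N)" "g \<in> carrier (linfty N)" for f g
    using that by (simp add: L.minus_smult)
  fix s assume s: "L.cauchy s"
  have sc: "s n \<in> carrier (linfty N)" for n using s by (simp add: L.cauchy_def)
  have pt: "cmod (s m y - s n y) \<le> cs_norm (linfty N) (s m \<ominus>\<^bsub>linfty N\<^esub> s n)" if "y \<in> N" for m n y
    using linfty_norm_ge[OF L.minus_closed[OF sc sc] that, of m n] by (simp add: minus sc)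
  have "\<exists>l. (\<lambda>n. s n y) \<longlonglongrightarrow> l" if y: "y \<in> N" for y
    unfolding convergent_def[symmetric] Cauchy_convergent_iff[symmetric] Cauchy_def dist_norm
    using s pt[OF y] unfolding L.cauchy_def by (meson order_le_less_trans)
  then obtain l where l: "\<And>y. y \<in> N \<Longrightarrow> (\<lambda>n. s n y) \<longlonglongrightarrow> l y" by metis
  define f where "f y = (if y \<in> N then l y else 0)" for y
  have lim: "(\<lambda>n. s n y) \<longlonglongrightarrow> f y" if "y \<in> N" for y using l[OF that] that by (simp add: f_def)
  have close: "\<exists>K. \<forall>n\<ge>K. \<forall>y\<in>N. cmod (s n y - f y) \<le> e" if e: "0 < e" for e
  proof -
    obtain K where K: "\<And>m n. m \<ge> K \<Longrightarrow> n \<ge> K \<Longrightarrow> cs_norm (linfty N) (s m \<ominus>\<^bsub>linfty N\<^esub> s n) < e"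
      using s e unfolding L.cauchy_def by meson
    have "cmod (s n y - f y) \<le> e" if "n \<ge> K" "y \<in> N" for n y
    proof (rule LIMSEQ_le_const2)
      show "(\<lambda>m. cmod (s n y - s m y)) \<longlonglongrightarrow> cmod (s n y - f y)"
        using lim[OF that(2)] by (intro tendsto_intros)
      show "\<exists>M. \<forall>m\<ge>M. cmod (s n y - s m y) \<le> e"
        using K[OF that(1)] pt[OF that(2)] by (meson less_imp_le order_trans)
    qed
    then show ?thesis by blast
  qed
  obtain K where K: "\<forall>y\<in>N. cmod (s K y - f y) \<le> 1" using close[of 1] by auto
  obtain b where b: "\<forall>y\<in>N. cmod (s K y) \<le> b" using sc[of K] by (auto simp: linfty_carrier)
  have "cmod (f y) \<le> b + 1" if "y \<in> N" for y
    using norm_triangle_ineq4[of "s K y" "s K y - f y"] b K that by fastforce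
  then have fc: "f \<in> carrier (linfty N)" by (auto simp: linfty_carrier f_def)
  have "L.conv s f"
    unfolding L.conv_def
  proof (intro conjI allI sc fc)
    show "(\<lambda>n. cs_norm (linfty N) (s n \<ominus>\<^bsub>linfty N\<^esub> f)) \<longlonglongrightarrow> 0"
      unfolding LIMSEQ_def
    proof (intro allI impI)
      fix e :: real assume "0 < e"
      then obtain K where "\<forall>n\<ge>K. \<forall>y\<in>N. cmod (s n y - f y) \<le> e / 2" using close[of "e / 2"] by auto
      then have "cs_norm (linfty N) (s n \<ominus>\<^bsub>linfty N\<^esub> f) \<le> e / 2" if "n \<ge> K" for n
        using that unfolding minus[OF sc fc] by (intro linfty_norm_le N) blast
      then show "\<exists>K. \<forall>n\<ge>K. dist (cs_norm (linfty N) (s n \<ominus>\<^bsub>linfty N\<^esub> f)) 0 < e"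
        using \<open>0 < e\<close> L.nrm_ge_0[OF L.minus_closed[OF sc fc]]
        by (intro exI[of _ K] allI impI) (simp only: dist_real_def diff_0_right abs_of_nonneg, fastforce)
    qed
  qed
  then show "\<exists>x. L.conv s x" by blast
qed

section \<open>Completion\<close>

context unital_pre_cstar
begin

definition eqv where "eqv s t \<longleftrightarrow> (\<lambda>n::nat. nrm (s n \<ominus> t n)) \<longlonglongrightarrow> 0"

definition cls where "cls s = {t. cauchy t \<and> eqv t s}"

definition rep where "rep Z = (SOME s. cauchy s \<and> Z = cls s)"

lemma cauchy_closed [simp]: "cauchy s \<Longrightarrow> s n \<in> carrier A"
  by (simp add: cauchy_def)

lemma null_bound:
  assumes "\<And>n. s n \<in> carrier A" "\<And>n. nrm (s n) \<le> f n" "f \<longlonglongrightarrow> 0"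
  shows "(\<lambda>n. nrm (s n)) \<longlonglongrightarrow> 0"
  using assms by (intro tendsto_sandwich[of "\<lambda>_. 0" "\<lambda>n. nrm (s n)" sequentially f 0]) auto

lemma eqv_refl: "cauchy s \<Longrightarrow> eqv s s"
  by (simp add: eqv_def)

lemma eqv_sym: assumes "cauchy s" "cauchy t" "eqv s t" shows "eqv t s"
proof -
  have "nrm (t n \<ominus> s n) = nrm (s n \<ominus> t n)" for n
    using assms by (intro nrm_minus_commute) auto
  then show ?thesis using assms by (simp add: eqv_def)
qed

lemma eqv_trans: assumes "cauchy s" "cauchy t" "cauchy u" "eqv s t" "eqv t u" shows "eqv s u"
  unfolding eqv_def
proof (rule null_bound)
  show "nrm (s n \<ominus> u n) \<le> nrm (s n \<ominus> t n) + nrm (t n \<ominus> u n)" for n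
    using assms by (intro nrm_triangle) auto
  show "(\<lambda>n. nrm (s n \<ominus> t n) + nrm (t n \<ominus> u n)) \<longlonglongrightarrow> 0"
    using tendsto_add[OF assms(4,5)[unfolded eqv_def]] by simp
qed (use assms in auto)

lemma cls_eq: assumes "cauchy s" "cauchy t" shows "cls s = cls t \<longleftrightarrow> eqv s t"
proof
  assume "cls s = cls t"
  then have "s \<in> cls t" using eqv_refl assms unfolding cls_def by blast
  then show "eqv s t" by (simp add: cls_def)
next
  assume "eqv s t"
  then show "cls s = cls t"
    using assms eqv_trans eqv_sym unfolding cls_def by blast
qed

lemma rep: assumes "cauchy s" shows "cauchy (rep (cls s))" "eqv (rep (cls s)) s"
proof -
  have "cauchy (rep (cls s)) \<and> cls s = cls (rep (cls s))"
    unfolding rep_def by (rule someI[of "\<lambda>t. cauchy t \<and> cls s = cls t" s]) (use assms in simp)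
  then show "cauchy (rep (cls s))" "eqv (rep (cls s)) s"
    using cls_eq assms by metis+
qed

lemma cauchyD: "cauchy s \<Longrightarrow> 0 < e \<Longrightarrow> \<exists>K. \<forall>m\<ge>K. \<forall>n\<ge>K. nrm (s m \<ominus> s n) < e"
  by (simp add: cauchy_def)

lemma cauchy_bounded: assumes "cauchy s" obtains K where "0 < K" "\<And>n. nrm (s n) \<le> K"
proof -
  have "Cauchy (\<lambda>n. nrm (s n))"
    unfolding Cauchy_def dist_real_def
  proof (intro allI impI)
    fix e :: real assume "0 < e"
    then obtain K where "\<forall>m\<ge>K. \<forall>n\<ge>K. nrm (s m \<ominus> s n) < e" using cauchyD[OF assms] by blast
    then show "\<exists>K. \<forall>m\<ge>K. \<forall>n\<ge>K. \<bar>nrm (s m) - nrm (s n)\<bar> < e"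
      using nrm_diff[OF cauchy_closed[OF assms] cauchy_closed[OF assms]] by (meson order_le_less_trans)
  qed
  then obtain K where "0 < K" "\<And>n. norm (nrm (s n)) \<le> K"
    using Cauchy_Bseq BseqE by metis
  then show thesis using that[of K] by (metis real_norm_def abs_le_D1)
qed

lemma cauchy_nrm_conv: assumes "cauchy s" shows "convergent (\<lambda>n. nrm (s n))"
  unfolding Cauchy_convergent_iff[symmetric] Cauchy_def dist_real_def
proof (intro allI impI)
  fix e :: real assume "0 < e"
  then obtain K where "\<forall>m\<ge>K. \<forall>n\<ge>K. nrm (s m \<ominus> s n) < e" using cauchyD[OF assms] by blast
  then show "\<exists>K. \<forall>m\<ge>K. \<forall>n\<ge>K. \<bar>nrm (s m) - nrm (s n)\<bar> < e"
    using nrm_diff[OF cauchy_closed[OF assms] cauchy_closed[OF assms]] by (meson order_le_less_trans)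
qed

lemma cauchy_by:
  assumes "\<And>n. u n \<in> carrier A" "cauchy s" "cauchy t" "0 < a" "0 < b"
    and le: "\<And>m n. nrm (u m \<ominus> u n) \<le> a * nrm (s m \<ominus> s n) + b * nrm (t m \<ominus> t n)"
  shows "cauchy u"
  unfolding cauchy_def
proof (intro conjI allI impI assms(1))
  fix e :: real assume e: "0 < e"
  have e2: "0 < e / (2 * a)" "0 < e / (2 * b)" using e assms by simp_all
  obtain K where K: "\<forall>m\<ge>K. \<forall>n\<ge>K. nrm (s m \<ominus> s n) < e / (2 * a)"
    using cauchyD[OF assms(2) e2(1)] by blast
  obtain L where L: "\<forall>m\<ge>L. \<forall>n\<ge>L. nrm (t m \<ominus> t n) < e / (2 * b)"
    using cauchyD[OF assms(3) e2(2)] by blast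
  have "nrm (u m \<ominus> u n) < e" if "m \<ge> max K L" "n \<ge> max K L" for m n
  proof -
    have "a * nrm (s m \<ominus> s n) < e / 2"
      using K[rule_format, of m n] that assms by (simp add: field_simps)
    moreover have "b * nrm (t m \<ominus> t n) < e / 2"
      using L[rule_format, of m n] that assms by (simp add: field_simps)
    ultimately show ?thesis using le[of m n] by linarith
  qed
  then show "\<exists>K. \<forall>m\<ge>K. \<forall>n\<ge>K. nrm (u m \<ominus> u n) < e" by blast
qed

lemma cauchy_const [simp]: "x \<in> carrier A \<Longrightarrow> cauchy (\<lambda>_. x)"
  by (simp add: cauchy_def)

lemma cauchy_add: assumes "cauchy s" "cauchy t" shows "cauchy (\<lambda>n. s n \<oplus> t n)"
  by (rule cauchy_by[OF _ assms, of _ 1 1]) (use assms in \<open>auto simp: add_minus_add intro!: nrm_add\<close>)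

lemma cauchy_smult: assumes "cauchy s" shows "cauchy (\<lambda>n. c \<odot> s n)"
proof (rule cauchy_by[OF _ assms assms, of _ "cmod c + 1" 1])
  fix m n
  have "0 \<le> nrm (s m \<ominus> s n)" using assms by simp
  then show "nrm (c \<odot> s m \<ominus> c \<odot> s n) \<le> (cmod c + 1) * nrm (s m \<ominus> s n) + 1 * nrm (s m \<ominus> s n)"
    using assms by (simp add: smult_minus[symmetric] nrm_smult distrib_right)
qed (use assms in \<open>auto intro: add_nonneg_pos\<close>)

lemma cauchy_adj: assumes "cauchy s" shows "cauchy (\<lambda>n. (s n)\<^sup>\<star>)"
  using assms by (simp add: cauchy_def adj_minus[symmetric])

lemma nrm_times_diff:
  assumes "x \<in> carrier A" "y \<in> carrier A" "z \<in> carrier A" "w \<in> carrier A" "nrm x \<le> K" "nrm w \<le> L"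
  shows "nrm (x \<otimes> y \<ominus> z \<otimes> w) \<le> L * nrm (x \<ominus> z) + K * nrm (y \<ominus> w)"
proof -
  have "nrm (x \<otimes> (y \<ominus> w) \<oplus> (x \<ominus> z) \<otimes> w) \<le> K * nrm (y \<ominus> w) + nrm (x \<ominus> z) * L"
    using assms by (intro nrm_add_le nrm_times_le) auto
  then show ?thesis
    using assms by (simp add: times_minus_times mult.commute add.commute)
qed

lemma cauchy_times: assumes "cauchy s" "cauchy t" shows "cauchy (\<lambda>n. s n \<otimes> t n)"
proof -
  obtain K where K: "0 < K" "\<And>n. nrm (s n) \<le> K" using assms cauchy_bounded by blast
  obtain L where L: "0 < L" "\<And>n. nrm (t n) \<le> L" using assms cauchy_bounded by blast
  show ?thesis
    by (rule cauchy_by[OF _ assms, of _ L K]) (use assms K L in \<open>auto intro!: nrm_times_diff\<close>)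
qed

lemma eqv_add:
  assumes "cauchy s" "cauchy s'" "cauchy t" "cauchy t'" "eqv s s'" "eqv t t'"
  shows "eqv (\<lambda>n. s n \<oplus> t n) (\<lambda>n. s' n \<oplus> t' n)"
  unfolding eqv_def
proof (rule null_bound)
  show "nrm ((s n \<oplus> t n) \<ominus> (s' n \<oplus> t' n)) \<le> nrm (s n \<ominus> s' n) + nrm (t n \<ominus> t' n)" for n
    using assms by (simp add: add_minus_add nrm_add)
  show "(\<lambda>n. nrm (s n \<ominus> s' n) + nrm (t n \<ominus> t' n)) \<longlonglongrightarrow> 0"
    using tendsto_add[OF assms(5,6)[unfolded eqv_def]] by simp
qed (use assms in auto)

lemma eqv_smult: assumes "cauchy s" "cauchy s'" "eqv s s'" shows "eqv (\<lambda>n. c \<odot> s n) (\<lambda>n. c \<odot> s' n)"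
proof -
  have "nrm (c \<odot> s n \<ominus> c \<odot> s' n) = cmod c * nrm (s n \<ominus> s' n)" for n
    using assms by (simp add: smult_minus[symmetric] nrm_smult)
  then show ?thesis
    using assms(3) tendsto_mult_right_zero unfolding eqv_def by auto
qed

lemma eqv_adj: assumes "cauchy s" "cauchy s'" "eqv s s'" shows "eqv (\<lambda>n. (s n)\<^sup>\<star>) (\<lambda>n. (s' n)\<^sup>\<star>)"
proof -
  have "nrm ((s n)\<^sup>\<star> \<ominus> (s' n)\<^sup>\<star>) = nrm (s n \<ominus> s' n)" for n
    using assms by (simp add: adj_minus[symmetric])
  then show ?thesis
    using assms(3) unfolding eqv_def by simp
qed

lemma eqv_times:
  assumes "cauchy s" "cauchy s'" "cauchy t" "cauchy t'" "eqv s s'" "eqv t t'"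
  shows "eqv (\<lambda>n. s n \<otimes> t n) (\<lambda>n. s' n \<otimes> t' n)"
proof -
  obtain K where K: "0 < K" "\<And>n. nrm (s n) \<le> K" using assms cauchy_bounded by blast
  obtain L where L: "0 < L" "\<And>n. nrm (t' n) \<le> L" using assms cauchy_bounded by blast
  show ?thesis
    unfolding eqv_def
  proof (rule null_bound)
    show "nrm (s n \<otimes> t n \<ominus> s' n \<otimes> t' n) \<le> L * nrm (s n \<ominus> s' n) + K * nrm (t n \<ominus> t' n)" for n
      using assms K L by (intro nrm_times_diff) auto
    show "(\<lambda>n. L * nrm (s n \<ominus> s' n) + K * nrm (t n \<ominus> t' n)) \<longlonglongrightarrow> 0"
      using tendsto_add[OF tendsto_mult_right_zero[OF assms(5)[unfolded eqv_def], of L]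
          tendsto_mult_right_zero[OF assms(6)[unfolded eqv_def], of K]] by simp
  qed (use assms in auto)
qed

definition completion :: "(nat \<Rightarrow> 'a) set cstar" where
  "completion = \<lparr>carrier = cls ` {s. cauchy s},
     mult = (\<lambda>Z W. cls (\<lambda>n. rep Z n \<otimes> rep W n)), one = cls (\<lambda>_. \<one>),
     zero = cls (\<lambda>_. \<zero>), add = (\<lambda>Z W. cls (\<lambda>n. rep Z n \<oplus> rep W n)),
     smult = (\<lambda>c Z. cls (\<lambda>n. c \<odot> rep Z n)),
     cs_star = (\<lambda>Z. cls (\<lambda>n. (rep Z n)\<^sup>\<star>)), cs_norm = (\<lambda>Z. lim (\<lambda>n. nrm (rep Z n)))\<rparr>"

lemma completion_carrier: "carrier completion = cls ` {s. cauchy s}"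
  by (simp add: completion_def)

lemma completion_cls [simp]: "cauchy s \<Longrightarrow> cls s \<in> carrier completion"
  by (simp add: completion_carrier)

lemma completion_cases: assumes "Z \<in> carrier completion" obtains s where "cauchy s" "Z = cls s"
  using assms by (auto simp: completion_carrier)

lemma completion_one: "\<one>\<^bsub>completion\<^esub> = cls (\<lambda>_. \<one>)"
  and completion_zero: "\<zero>\<^bsub>completion\<^esub> = cls (\<lambda>_. \<zero>)"
  by (simp_all add: completion_def)

lemma completion_add: assumes "cauchy s" "cauchy t" shows "cls s \<oplus>\<^bsub>completion\<^esub> cls t = cls (\<lambda>n. s n \<oplus> t n)"
  using assms by (simp add: completion_def cls_eq cauchy_add rep eqv_add)

lemma completion_times: assumes "cauchy s" "cauchy t" shows "cls s \<otimes>\<^bsub>completion\<^esub> cls t = cls (\<lambda>n. s n \<otimes> t n)"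
  using assms by (simp add: completion_def cls_eq cauchy_times rep eqv_times)

lemma completion_smult: assumes "cauchy s" shows "c \<odot>\<^bsub>completion\<^esub> cls s = cls (\<lambda>n. c \<odot> s n)"
  using assms by (simp add: completion_def cls_eq cauchy_smult rep eqv_smult)

lemma completion_adj: assumes "cauchy s" shows "cs_star completion (cls s) = cls (\<lambda>n. (s n)\<^sup>\<star>)"
  using assms by (simp add: completion_def cls_eq cauchy_adj rep eqv_adj)

lemma completion_norm_lim: assumes s: "cauchy s" shows "(\<lambda>n. nrm (s n)) \<longlonglongrightarrow> cs_norm completion (cls s)"
proof -
  let ?r = "rep (cls s)"
  have r: "(\<lambda>n. nrm (?r n)) \<longlonglongrightarrow> cs_norm completion (cls s)"
    using cauchy_nrm_conv[OF rep(1)[OF s]] by (simp add: completion_def convergent_LIMSEQ_iff)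
  have "(\<lambda>n. nrm (s n) - nrm (?r n)) \<longlonglongrightarrow> 0"
  proof (rule metric_tendsto_imp_tendsto)
    show "(\<lambda>n. nrm (s n \<ominus> ?r n)) \<longlonglongrightarrow> 0"
      using eqv_sym[OF rep(1)[OF s] s rep(2)[OF s]] by (simp add: eqv_def)
    have "dist (nrm (s n) - nrm (?r n)) 0 \<le> dist (nrm (s n \<ominus> ?r n)) 0" for n
      using nrm_diff[of "s n" "?r n"] s rep(1)[OF s] by (simp add: dist_real_def)
    then show "\<forall>\<^sub>F n in sequentially. dist (nrm (s n) - nrm (?r n)) 0 \<le> dist (nrm (s n \<ominus> ?r n)) 0"
      by simp
  qed
  from tendsto_add[OF this r] show ?thesis by simp
qed

lemma completion_norm: "cauchy s \<Longrightarrow> (\<lambda>n. nrm (s n)) \<longlonglongrightarrow> l \<Longrightarrow> cs_norm completion (cls s) = l"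
  using completion_norm_lim LIMSEQ_unique by blast

lemma completion_norm_le:
  "cauchy s \<Longrightarrow> (\<And>n. n \<ge> K \<Longrightarrow> nrm (s n) \<le> e) \<Longrightarrow> cs_norm completion (cls s) \<le> e"
  using LIMSEQ_le_const2[OF completion_norm_lim] by blast

lemmas completion_ops = completion_one completion_zero completion_add completion_times completion_smult
  completion_adj cauchy_add cauchy_times cauchy_smult cauchy_adj

lemma completion_pre: "unital_pre_cstar completion"
proof -
  have module: "Module.module complex_ring completion"
  proof (rule moduleI)
    show "abelian_group completion"
    proof (rule abelian_groupI)
      fix x assume "x \<in> carrier completion"
      then obtain s where s: "cauchy s" "x = cls s" by (rule completion_cases)
      have eq: "(-1) \<odot> s n \<oplus> s n = \<zero>" for n
        using smult_add[of "s n" "-1" 1] s by simp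
      show "\<exists>y\<in>carrier completion. y \<oplus>\<^bsub>completion\<^esub> x = \<zero>\<^bsub>completion\<^esub>"
        using s by (intro bexI[of _ "cls (\<lambda>n. (-1) \<odot> s n)"]) (simp_all add: completion_ops eq)
    next
      fix x y z assume "x \<in> carrier completion" "y \<in> carrier completion" "z \<in> carrier completion"
      then obtain s t u where "cauchy s" "x = cls s" "cauchy t" "y = cls t" "cauchy u" "z = cls u"
        by (metis completion_cases)
      then show "x \<oplus>\<^bsub>completion\<^esub> y \<oplus>\<^bsub>completion\<^esub> z = x \<oplus>\<^bsub>completion\<^esub> (y \<oplus>\<^bsub>completion\<^esub> z)"
        by (simp add: completion_ops M.a_assoc)
    next
      fix x y assume "x \<in> carrier completion" "y \<in> carrier completion"
      then obtain s t where "cauchy s" "x = cls s" "cauchy t" "y = cls t"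
        by (metis completion_cases)
      then show "x \<oplus>\<^bsub>completion\<^esub> y = y \<oplus>\<^bsub>completion\<^esub> x" "x \<oplus>\<^bsub>completion\<^esub> y \<in> carrier completion"
        by (simp_all add: completion_ops M.a_comm)
    qed (auto simp: completion_ops elim!: completion_cases)
  qed (auto simp: cring_complex_ring completion_ops smult_add smult_smult smult_distr elim!: completion_cases)
  interpret C: Module.module complex_ring completion by (rule module)
  show ?thesis
  proof unfold_locales
    fix x assume "x \<in> carrier completion"
    then obtain s where s: "cauchy s" "x = cls s" by (rule completion_cases)
    show "cs_norm completion x = 0 \<longleftrightarrow> x = \<zero>\<^bsub>completion\<^esub>"
      using s completion_norm_lim[of s] completion_norm[of s 0] by (auto simp: completion_ops cls_eq eqv_def)
    show "cs_norm completion (c \<odot>\<^bsub>completion\<^esub> x) = cmod c * cs_norm completion x" for c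
      using s tendsto_mult_left[OF completion_norm_lim[of s], of "cmod c"]
      by (simp add: completion_ops, intro completion_norm) (auto simp: completion_ops nrm_smult)
    show "cs_norm completion (cs_star completion x \<otimes>\<^bsub>completion\<^esub> x) = (cs_norm completion x)\<^sup>2"
      using s tendsto_power[OF completion_norm_lim[of s], of 2]
      by (simp add: completion_ops, intro completion_norm) (auto simp: completion_ops nrm_adj_times)
    show "cs_star completion (c \<odot>\<^bsub>completion\<^esub> x) = cnj c \<odot>\<^bsub>completion\<^esub> cs_star completion x" for c
      using s by (simp add: completion_ops adj_smult)
    show "cs_star completion x \<in> carrier completion" "cs_star completion (cs_star completion x) = x"
      "\<one>\<^bsub>completion\<^esub> \<otimes>\<^bsub>completion\<^esub> x = x" "x \<otimes>\<^bsub>completion\<^esub> \<one>\<^bsub>completion\<^esub> = x"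
      using s by (simp_all add: completion_ops)
    fix y assume "y \<in> carrier completion"
    then obtain t where t: "cauchy t" "y = cls t" by (rule completion_cases)
    show "cs_norm completion (x \<oplus>\<^bsub>completion\<^esub> y) \<le> cs_norm completion x + cs_norm completion y"
    proof (rule LIMSEQ_le)
      show "(\<lambda>n. nrm (s n \<oplus> t n)) \<longlonglongrightarrow> cs_norm completion (x \<oplus>\<^bsub>completion\<^esub> y)"
        using s t completion_norm_lim[OF cauchy_add] by (simp add: completion_ops)
      show "(\<lambda>n. nrm (s n) + nrm (t n)) \<longlonglongrightarrow> cs_norm completion x + cs_norm completion y"
        using s t by (intro tendsto_add) (simp_all add: completion_norm_lim)
    qed (use s t nrm_add in auto)
    show "cs_norm completion (x \<otimes>\<^bsub>completion\<^esub> y) \<le> cs_norm completion x * cs_norm completion y"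
    proof (rule LIMSEQ_le)
      show "(\<lambda>n. nrm (s n \<otimes> t n)) \<longlonglongrightarrow> cs_norm completion (x \<otimes>\<^bsub>completion\<^esub> y)"
        using s t completion_norm_lim[OF cauchy_times] by (simp add: completion_ops)
      show "(\<lambda>n. nrm (s n) * nrm (t n)) \<longlonglongrightarrow> cs_norm completion x * cs_norm completion y"
        using s t by (intro tendsto_mult) (simp_all add: completion_norm_lim)
    qed (use s t nrm_times in auto)
    show "x \<otimes>\<^bsub>completion\<^esub> y \<in> carrier completion"
      "(c \<odot>\<^bsub>completion\<^esub> x) \<otimes>\<^bsub>completion\<^esub> y = c \<odot>\<^bsub>completion\<^esub> (x \<otimes>\<^bsub>completion\<^esub> y)"
      "x \<otimes>\<^bsub>completion\<^esub> (c \<odot>\<^bsub>completion\<^esub> y) = c \<odot>\<^bsub>completion\<^esub> (x \<otimes>\<^bsub>completion\<^esub> y)"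
      "cs_star completion (x \<oplus>\<^bsub>completion\<^esub> y) = cs_star completion x \<oplus>\<^bsub>completion\<^esub> cs_star completion y"
      "cs_star completion (x \<otimes>\<^bsub>completion\<^esub> y) = cs_star completion y \<otimes>\<^bsub>completion\<^esub> cs_star completion x" for c
      using s t by (simp_all add: completion_ops smult_times_l smult_times_r adj_add adj_times)
    fix z assume "z \<in> carrier completion"
    then obtain u where u: "cauchy u" "z = cls u" by (rule completion_cases)
    show "x \<otimes>\<^bsub>completion\<^esub> y \<otimes>\<^bsub>completion\<^esub> z = x \<otimes>\<^bsub>completion\<^esub> (y \<otimes>\<^bsub>completion\<^esub> z)"
      "(x \<oplus>\<^bsub>completion\<^esub> y) \<otimes>\<^bsub>completion\<^esub> z = (x \<otimes>\<^bsub>completion\<^esub> z) \<oplus>\<^bsub>completion\<^esub> (y \<otimes>\<^bsub>completion\<^esub> z)"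
      "x \<otimes>\<^bsub>completion\<^esub> (y \<oplus>\<^bsub>completion\<^esub> z) = (x \<otimes>\<^bsub>completion\<^esub> y) \<oplus>\<^bsub>completion\<^esub> (x \<otimes>\<^bsub>completion\<^esub> z)"
      using s t u by (simp_all add: completion_ops times_assoc times_add_l times_add_r)
  qed (simp add: completion_ops)
qed

interpretation completion: unital_pre_cstar completion
  by (rule completion_pre)

definition embed where "embed x = cls (\<lambda>_. x)"

lemma embed_star_hom: "star_hom A completion embed"
  by (auto simp: star_hom_def embed_def completion_ops)

lemma embed_closed [simp]: "x \<in> carrier A \<Longrightarrow> embed x \<in> carrier completion"
  by (simp add: embed_def)

lemma embed_norm [simp]: "x \<in> carrier A \<Longrightarrow> cs_norm completion (embed x) = nrm x"
  unfolding embed_def by (rule completion_norm) auto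

lemma completion_minus:
  assumes "cauchy s" "cauchy t" shows "cls s \<ominus>\<^bsub>completion\<^esub> cls t = cls (\<lambda>n. s n \<ominus> t n)"
    "cauchy (\<lambda>n. s n \<ominus> t n)"
  using assms cauchy_add[OF assms(1) cauchy_smult[OF assms(2), of "-1"]]
  by (simp_all add: completion.minus_smult completion_ops minus_smult)

lemma embed_conv_cls: assumes s: "cauchy s" shows "completion.conv (\<lambda>n. embed (s n)) (cls s)"
  unfolding completion.conv_def
proof (intro conjI allI)
  show "(\<lambda>n. cs_norm completion (embed (s n) \<ominus>\<^bsub>completion\<^esub> cls s)) \<longlonglongrightarrow> 0"
    unfolding LIMSEQ_def
  proof (intro allI impI)
    fix e :: real assume e: "0 < e"
    then obtain K where K: "\<forall>m\<ge>K. \<forall>n\<ge>K. nrm (s m \<ominus> s n) < e / 2" using cauchyD[OF s, of "e / 2"] by auto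
    have "cs_norm completion (embed (s n) \<ominus>\<^bsub>completion\<^esub> cls s) \<le> e / 2" if n: "n \<ge> K" for n
      unfolding embed_def completion_minus(1)[OF cauchy_const[OF cauchy_closed[OF s]] s]
      by (rule completion_norm_le[of _ K], rule completion_minus(2))
        (use s K n in \<open>auto intro: less_imp_le\<close>)
    moreover have "0 \<le> cs_norm completion (embed (s n) \<ominus>\<^bsub>completion\<^esub> cls s)" for n
      using s by simp
    ultimately show "\<exists>K. \<forall>n\<ge>K. dist (cs_norm completion (embed (s n) \<ominus>\<^bsub>completion\<^esub> cls s)) 0 < e"
      using e unfolding dist_real_def by (intro exI[of _ K] allI impI) fastforce
  qed
qed (use s in auto)

lemma embed_dense:
  assumes "Z \<in> carrier completion"
  obtains s where "cauchy s" "completion.conv (\<lambda>n. embed (s n)) Z"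
  using assms embed_conv_cls by (metis completion_cases)

theorem completion_cstar: "unital_cstar_algebra completion"
proof (rule unital_cstar_algebraI[OF completion_pre])
  fix Z assume Z: "completion.cauchy Z"
  have Zc: "Z n \<in> carrier completion" for n using Z by (simp add: completion.cauchy_def)
  have "\<exists>x\<in>carrier A. cs_norm completion (embed x \<ominus>\<^bsub>completion\<^esub> Z n) < 1 / (real n + 1)" for n
  proof -
    obtain s where s: "cauchy s" "completion.conv (\<lambda>k. embed (s k)) (Z n)" using embed_dense[OF Zc] by blast
    then obtain k where "\<bar>cs_norm completion (embed (s k) \<ominus>\<^bsub>completion\<^esub> Z n)\<bar> < 1 / (real n + 1)"
      unfolding completion.conv_def LIMSEQ_def dist_real_def
      by (metis diff_0_right divide_pos_pos le_refl of_nat_0_le_iff zero_less_one add_nonneg_pos)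
    then show ?thesis using s by (intro bexI[of _ "s k"]) auto
  qed
  then obtain e where ec: "\<And>n. e n \<in> carrier A"
    and e: "\<And>n. cs_norm completion (embed (e n) \<ominus>\<^bsub>completion\<^esub> Z n) < 1 / (real n + 1)"
    by metis
  have lim0: "(\<lambda>n. 1 / (real n + 1)) \<longlonglongrightarrow> 0"
    using LIMSEQ_inverse_real_of_nat by (simp add: inverse_eq_divide add.commute)
  have "cauchy e"
    unfolding cauchy_def
  proof (intro conjI allI impI ec)
    fix r :: real assume r: "0 < r"
    obtain K where K: "\<forall>m\<ge>K. \<forall>n\<ge>K. cs_norm completion (Z m \<ominus>\<^bsub>completion\<^esub> Z n) < r / 3"
      using Z r unfolding completion.cauchy_def by (meson divide_pos_pos zero_less_numeral)
    obtain L where "\<forall>n\<ge>L. \<bar>1 / (real n + 1)\<bar> < r / 3"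
      using lim0 r unfolding LIMSEQ_def dist_real_def by (metis diff_0_right divide_pos_pos zero_less_numeral)
    then have L: "\<And>n. n \<ge> L \<Longrightarrow> 1 / (real n + 1) < r / 3" by (meson abs_le_D1 abs_less_iff)
    have "nrm (e m \<ominus> e n) < r" if mn: "m \<ge> max K L" "n \<ge> max K L" for m n
    proof -
      let ?n = "cs_norm completion"
      have "embed (e m) \<ominus>\<^bsub>completion\<^esub> embed (e n) = embed (e m \<ominus> e n)"
        using ec by (simp add: embed_def completion_minus)
      then have "nrm (e m \<ominus> e n) = ?n (embed (e m) \<ominus>\<^bsub>completion\<^esub> embed (e n))"
        using ec by simp
      also have "\<dots> \<le> ?n (embed (e m) \<ominus>\<^bsub>completion\<^esub> Z m) + ?n (Z m \<ominus>\<^bsub>completion\<^esub> embed (e n))"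
        using ec Zc by (intro completion.nrm_triangle) auto
      also have "?n (Z m \<ominus>\<^bsub>completion\<^esub> embed (e n)) \<le> ?n (Z m \<ominus>\<^bsub>completion\<^esub> Z n) + ?n (Z n \<ominus>\<^bsub>completion\<^esub> embed (e n))"
        using ec Zc by (intro completion.nrm_triangle) auto
      also have "?n (Z n \<ominus>\<^bsub>completion\<^esub> embed (e n)) = ?n (embed (e n) \<ominus>\<^bsub>completion\<^esub> Z n)"
        using ec Zc by (intro completion.nrm_minus_commute) auto
      finally show ?thesis
        using e[of m] e[of n] L[of m] L[of n] K[rule_format, of m n] mn by simp
    qed
    then show "\<exists>K. \<forall>m\<ge>K. \<forall>n\<ge>K. nrm (e m \<ominus> e n) < r" by blast
  qed
  have "completion.conv Z (cls e)"
  proof (rule completion.conv_bound[OF Zc completion_cls[OF \<open>cauchy e\<close>]])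
    fix n
    let ?n = "cs_norm completion"
    have "?n (Z n \<ominus>\<^bsub>completion\<^esub> cls e) \<le> ?n (Z n \<ominus>\<^bsub>completion\<^esub> embed (e n)) + ?n (embed (e n) \<ominus>\<^bsub>completion\<^esub> cls e)"
      using ec Zc \<open>cauchy e\<close> by (intro completion.nrm_triangle) auto
    also have "?n (Z n \<ominus>\<^bsub>completion\<^esub> embed (e n)) = ?n (embed (e n) \<ominus>\<^bsub>completion\<^esub> Z n)"
      using ec Zc by (intro completion.nrm_minus_commute) auto
    also have "\<dots> \<le> 1 / (real n + 1)" using e[of n] by simp
    finally show "?n (Z n \<ominus>\<^bsub>completion\<^esub> cls e) \<le> 1 / (real n + 1) + ?n (embed (e n) \<ominus>\<^bsub>completion\<^esub> cls e)"
      by simp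
    show "(\<lambda>n. 1 / (real n + 1) + ?n (embed (e n) \<ominus>\<^bsub>completion\<^esub> cls e)) \<longlonglongrightarrow> 0"
      using tendsto_add[OF lim0] embed_conv_cls[OF \<open>cauchy e\<close>] unfolding completion.conv_def by fastforce
  qed
  then show "\<exists>x. completion.conv Z x" by blast
qed

text \<open>The second conclusion says that the extension may be computed along any approximating sequence;
  additivity, homogeneity and the compatibility with products all pass to the limit through it.\<close>

lemma extend_to_completion:
  assumes B: "cstar_algebra B"
    and \<kappa>: "\<And>x. x \<in> carrier A \<Longrightarrow> \<kappa> x \<in> carrier B"
      "\<And>x y. x \<in> carrier A \<Longrightarrow> y \<in> carrier A \<Longrightarrow> \<kappa> (x \<oplus> y) = \<kappa> x \<oplus>\<^bsub>B\<^esub> \<kappa> y"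
      "\<And>c x. x \<in> carrier A \<Longrightarrow> \<kappa> (c \<odot> x) = c \<odot>\<^bsub>B\<^esub> \<kappa> x"
      "\<And>x. x \<in> carrier A \<Longrightarrow> cs_norm B (\<kappa> x) \<le> nrm x"
  obtains \<kappa>' where "\<And>x. x \<in> carrier A \<Longrightarrow> \<kappa>' (embed x) = \<kappa> x"
    "\<And>Z s. cauchy s \<Longrightarrow> completion.conv (\<lambda>n. embed (s n)) Z \<Longrightarrow> pre_cstar.conv B (\<lambda>n. \<kappa> (s n)) (\<kappa>' Z)"
proof -
  interpret B: cstar_algebra B by (rule B)
  have minus: "\<kappa> (x \<ominus> y) = \<kappa> x \<ominus>\<^bsub>B\<^esub> \<kappa> y" if "x \<in> carrier A" "y \<in> carrier A" for x y
    using that \<kappa> by (simp add: minus_smult B.pre.minus_smult)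
  have ex: "\<exists>b. B.pre.conv (\<lambda>n. \<kappa> (s n)) b" if s: "cauchy s" for s
  proof (rule B.cauchy_conv)
    show "B.pre.cauchy (\<lambda>n. \<kappa> (s n))"
      unfolding B.pre.cauchy_def
    proof (intro conjI allI impI)
      fix e :: real assume "0 < e"
      then obtain K where K: "\<forall>m\<ge>K. \<forall>n\<ge>K. nrm (s m \<ominus> s n) < e" using cauchyD[OF s] by blast
      have "cs_norm B (\<kappa> (s m) \<ominus>\<^bsub>B\<^esub> \<kappa> (s n)) \<le> nrm (s m \<ominus> s n)" for m n
        using \<kappa>(4)[of "s m \<ominus> s n"] s by (simp add: minus)
      then show "\<exists>K. \<forall>m\<ge>K. \<forall>n\<ge>K. cs_norm B (\<kappa> (s m) \<ominus>\<^bsub>B\<^esub> \<kappa> (s n)) < e"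
        using K order_le_less_trans by blast
    qed (use s \<kappa> in auto)
  qed
  define \<kappa>' where "\<kappa>' Z = (THE b. \<forall>s. cauchy s \<and> completion.conv (\<lambda>n. embed (s n)) Z \<longrightarrow> B.pre.conv (\<lambda>n. \<kappa> (s n)) b)" for Z
  have main: "B.pre.conv (\<lambda>n. \<kappa> (s n)) (\<kappa>' Z)" if s: "cauchy s" and sZ: "completion.conv (\<lambda>n. embed (s n)) Z" for s Z
  proof -
    obtain b where b: "B.pre.conv (\<lambda>n. \<kappa> (s n)) b" using ex[OF s] by blast
    have "B.pre.conv (\<lambda>n. \<kappa> (t n)) b" if t: "cauchy t" and tZ: "completion.conv (\<lambda>n. embed (t n)) Z" for t
    proof -
      have "cls s = cls t"
        using completion.conv_unique[OF embed_conv_cls[OF s] sZ] completion.conv_unique[OF embed_conv_cls[OF t] tZ] by simp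
      then have st: "eqv t s" using cls_eq[OF t s] by simp
      show ?thesis
      proof (rule B.pre.conv_bound)
        fix n
        have "cs_norm B (\<kappa> (t n) \<ominus>\<^bsub>B\<^esub> b) \<le> cs_norm B (\<kappa> (t n) \<ominus>\<^bsub>B\<^esub> \<kappa> (s n)) + cs_norm B (\<kappa> (s n) \<ominus>\<^bsub>B\<^esub> b)"
          using s t \<kappa>(1) b by (intro B.pre.nrm_triangle) (auto simp: B.pre.conv_def)
        also have "cs_norm B (\<kappa> (t n) \<ominus>\<^bsub>B\<^esub> \<kappa> (s n)) \<le> nrm (t n \<ominus> s n)"
          using \<kappa>(4)[of "t n \<ominus> s n"] s t by (simp add: minus)
        finally show "cs_norm B (\<kappa> (t n) \<ominus>\<^bsub>B\<^esub> b) \<le> nrm (t n \<ominus> s n) + cs_norm B (\<kappa> (s n) \<ominus>\<^bsub>B\<^esub> b)" by simp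
        show "(\<lambda>n. nrm (t n \<ominus> s n) + cs_norm B (\<kappa> (s n) \<ominus>\<^bsub>B\<^esub> b)) \<longlonglongrightarrow> 0"
          using tendsto_add[OF st[unfolded eqv_def]] b unfolding B.pre.conv_def by fastforce
      qed (use t \<kappa>(1) b in \<open>auto simp: B.pre.conv_def\<close>)
    qed
    then have "\<kappa>' Z = b"
      unfolding \<kappa>'_def using b s sZ B.pre.conv_unique by (intro the_equality) blast+
    then show ?thesis using b by simp
  qed
  show thesis
  proof
    fix x assume x: "x \<in> carrier A"
    have "B.pre.conv (\<lambda>_. \<kappa> x) (\<kappa>' (embed x))"
      using x by (intro main completion.conv_const) auto
    then show "\<kappa>' (embed x) = \<kappa> x"
      using B.pre.conv_unique B.pre.conv_const[OF \<kappa>(1)[OF x]] by blast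
  qed (rule main)
qed

end

section \<open>Transport of structure along an injection\<close>

text \<open>The given algebra may live in a type that is too large for the application; an injection of its
  carrier into another type moves it there isometrically.\<close>

definition transport :: "('a \<Rightarrow> 'c) \<Rightarrow> ('a, 'x) cstar_scheme \<Rightarrow> 'c cstar" where
  "transport f A = (let g = inv_into (carrier A) f in
    \<lparr>carrier = f ` carrier A, mult = (\<lambda>x y. f (g x \<otimes>\<^bsub>A\<^esub> g y)), one = f \<one>\<^bsub>A\<^esub>, zero = f \<zero>\<^bsub>A\<^esub>,
     add = (\<lambda>x y. f (g x \<oplus>\<^bsub>A\<^esub> g y)), smult = (\<lambda>c x. f (c \<odot>\<^bsub>A\<^esub> g x)),
     cs_star = (\<lambda>x. f (cs_star A (g x))), cs_norm = (\<lambda>x. cs_norm A (g x))\<rparr>)"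

context unital_pre_cstar
begin

context
  fixes f :: "'a \<Rightarrow> 'c"
  assumes inj: "inj_on f (carrier A)"
begin

lemma transport_simps [simp]:
  "carrier (transport f A) = f ` carrier A"
  "\<one>\<^bsub>transport f A\<^esub> = f \<one>" "\<zero>\<^bsub>transport f A\<^esub> = f \<zero>"
  "x \<in> carrier A \<Longrightarrow> y \<in> carrier A \<Longrightarrow> f x \<otimes>\<^bsub>transport f A\<^esub> f y = f (x \<otimes> y)"
  "x \<in> carrier A \<Longrightarrow> y \<in> carrier A \<Longrightarrow> f x \<oplus>\<^bsub>transport f A\<^esub> f y = f (x \<oplus> y)"
  "x \<in> carrier A \<Longrightarrow> c \<odot>\<^bsub>transport f A\<^esub> f x = f (c \<odot> x)"
  "x \<in> carrier A \<Longrightarrow> cs_star (transport f A) (f x) = f (x\<^sup>\<star>)"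
  "x \<in> carrier A \<Longrightarrow> cs_norm (transport f A) (f x) = nrm x"
  using inj by (simp_all add: transport_def Let_def inv_into_f_f)

lemma transport_unital_pre_cstar: "unital_pre_cstar (transport f A)"
proof -
  have module: "Module.module complex_ring (transport f A)"
  proof (rule moduleI)
    show "abelian_group (transport f A)"
    proof (rule abelian_groupI)
      fix x assume "x \<in> carrier (transport f A)"
      then obtain a where a: "a \<in> carrier A" "x = f a" by auto
      show "\<exists>y\<in>carrier (transport f A). y \<oplus>\<^bsub>transport f A\<^esub> x = \<zero>\<^bsub>transport f A\<^esub>"
        using a by (intro bexI[of _ "f (\<ominus> a)"]) (auto simp: M.l_neg)
    qed (auto simp: M.a_ac)
  qed (auto simp: cring_complex_ring smult_add smult_distr smult_smult)
  interpret T: Module.module complex_ring "transport f A" by (rule module)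
  show ?thesis
    by unfold_locales
      (auto simp: times_assoc times_add_l times_add_r smult_times_l smult_times_r adj_add adj_smult adj_times
        nrm_eq_0 nrm_add nrm_smult nrm_times nrm_adj_times inj_on_eq_iff[OF inj])
qed

lemma transport_star_hom: "star_hom A (transport f A) f"
  by (auto simp: star_hom_def)

end

end

section \<open>The Ore semigroup of the system\<close>

locale abelian_system = semidirect_system G N H M for G (structure) and N H M +
  assumes H_comm: "\<lbrakk>a \<in> H; b \<in> H\<rbrakk> \<Longrightarrow> a \<otimes> b = b \<otimes> a"
    and N_union: "N = (\<Union>a\<in>pos_part G H M. conj_set G (inv a) M)"
begin

sublocale N: normal N G by (rule N_normal)
sublocale H: subgroup H G by (rule H_subgroup)

abbreviation "Hp \<equiv> pos_part G H M"

lemma M_subgroup: "subgroup M G"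
  using group.incl_subgroup[OF is_group N.subgroup_axioms normal_imp_subgroup[OF M_normal]] .

sublocale M: subgroup M G by (rule M_subgroup)

text \<open>Every subset of \<open>G\<close> with a closure rule doubles the work of proving that a product lies in
  the carrier; these rules are therefore applied by name only.\<close>

declare N.m_closed [simp del, rule del] H.m_closed [simp del, rule del] M.m_closed [simp del, rule del]
  N.m_inv_closed [simp del, rule del] H.m_inv_closed [simp del, rule del] M.m_inv_closed [simp del, rule del]

lemmas sub_closed = N.m_closed H.m_closed M.m_closed N.m_inv_closed H.m_inv_closed M.m_inv_closed

lemma M_sub_N: "m \<in> M \<Longrightarrow> m \<in> N"
  using subgroup.subset[OF normal_imp_subgroup[OF M_normal]] by auto

lemma in_G [simp]: "x \<in> N \<Longrightarrow> x \<in> carrier G" "a \<in> H \<Longrightarrow> a \<in> carrier G"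
  "m \<in> M \<Longrightarrow> m \<in> carrier G" "a \<in> Hp \<Longrightarrow> a \<in> carrier G" "a \<in> Hp \<Longrightarrow> a \<in> H"
  by (auto simp: pos_part_def)

lemma conj_N: "\<lbrakk>g \<in> carrier G; x \<in> N\<rbrakk> \<Longrightarrow> g \<otimes> x \<otimes> inv g \<in> N"
  by (rule N.inv_op_closed2)

lemma conj_M: "\<lbrakk>a \<in> Hp; m \<in> M\<rbrakk> \<Longrightarrow> a \<otimes> m \<otimes> inv a \<in> M"
  unfolding pos_part_def conj_set_def by blast

lemma HpI: "\<lbrakk>a \<in> H; \<And>m. m \<in> M \<Longrightarrow> a \<otimes> m \<otimes> inv a \<in> M\<rbrakk> \<Longrightarrow> a \<in> Hp"
  unfolding pos_part_def conj_set_def by blast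

lemma conj_mult: "\<lbrakk>a \<in> carrier G; b \<in> carrier G; m \<in> carrier G\<rbrakk> \<Longrightarrow>
    (a \<otimes> b) \<otimes> m \<otimes> inv (a \<otimes> b) = a \<otimes> (b \<otimes> m \<otimes> inv b) \<otimes> inv a"
  by (simp add: inv_mult_group m_assoc)

lemma Hp_one [simp, intro]: "\<one> \<in> Hp"
  by (rule HpI) auto

lemma Hp_mult: "\<lbrakk>a \<in> Hp; b \<in> Hp\<rbrakk> \<Longrightarrow> a \<otimes> b \<in> Hp"
  by (rule HpI) (simp_all add: conj_mult conj_M H.m_closed)

lemma cancel_inv [simp]:
  "\<lbrakk>x \<in> carrier G; y \<in> carrier G\<rbrakk> \<Longrightarrow> inv x \<otimes> (x \<otimes> y) = y"
  "\<lbrakk>x \<in> carrier G; y \<in> carrier G\<rbrakk> \<Longrightarrow> x \<otimes> (inv x \<otimes> y) = y"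
  by (simp_all add: m_assoc[symmetric])

lemma M_family: "M \<in> conj_family G H M"
proof -
  have "conj_set G \<one> M = M" unfolding conj_set_def by simp
  then show ?thesis unfolding conj_family_def by (metis H.one_closed image_eqI)
qed

text \<open>By the filter base property there is \<open>c\<close> with \<open>c M c\<^sup>-\<^sup>1 \<subseteq>
  M \<inter> a\<^sup>-\<^sup>1 M a\<close>, so both \<open>c\<close> and \<open>a c\<close> map
  \<open>M\<close> into itself.\<close>

lemma Hp_fraction: assumes a: "a \<in> H" obtains c where "c \<in> Hp" "a \<otimes> c \<in> Hp"
proof -
  have fam: "M \<in> conj_family G H M" "conj_set G (inv a) M \<in> conj_family G H M"
    using M_family H.m_inv_closed[OF a] unfolding conj_family_def by blast+
  then obtain c where c: "c \<in> H" "conj_set G c M \<subseteq> M \<inter> conj_set G (inv a) M"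
    using filter_base[OF fam] unfolding conj_family_def by blast
  have "a \<otimes> c \<in> Hp"
  proof (rule HpI)
    fix m assume m: "m \<in> M"
    then obtain k where k: "k \<in> M" "c \<otimes> m \<otimes> inv c = inv a \<otimes> k \<otimes> inv (inv a)"
      using c(2) unfolding conj_set_def by blast
    then have "a \<otimes> c \<otimes> m \<otimes> inv (a \<otimes> c) = a \<otimes> (inv a \<otimes> k \<otimes> a) \<otimes> inv a"
      using a c m by (simp add: conj_mult)
    also have "\<dots> = k" using a k by (simp add: m_assoc)
    finally show "a \<otimes> c \<otimes> m \<otimes> inv (a \<otimes> c) \<in> M" using k by simp
  qed (use a c in \<open>simp add: H.m_closed\<close>)
  moreover have "c \<in> Hp" using c unfolding pos_part_def by blast
  ultimately show thesis using that by blast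
qed

text \<open>The components of \<open>g = x a\<close> with \<open>x \<in> N\<close> and \<open>a \<in> H\<close>:
  \<open>hp g = a\<close> and \<open>np g = x\<close>.\<close>

definition hp where "hp g = (THE a. a \<in> H \<and> (\<exists>x\<in>N. g = x \<otimes> a))"
definition np where "np g = g \<otimes> inv (hp g)"

lemma decomp_unique: assumes "x \<in> N" "a \<in> H" "x' \<in> N" "a' \<in> H" "x \<otimes> a = x' \<otimes> a'" shows "a = a'"
proof -
  have "inv x' \<otimes> x = a' \<otimes> inv a"
    using assms by (metis in_G(1,2) inv_closed inv_solve_left inv_solve_right m_assoc m_closed)
  moreover have "inv x' \<otimes> x \<in> N" "a' \<otimes> inv a \<in> H" using assms by (simp_all add: sub_closed)
  ultimately have "a' \<otimes> inv a = \<one>" using N_Int_H by auto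
  then show ?thesis using assms by (metis in_G(2) inv_closed inv_equality inv_inv)
qed

lemma hp_eq: assumes "x \<in> N" "a \<in> H" shows "hp (x \<otimes> a) = a" "np (x \<otimes> a) = x"
proof -
  show "hp (x \<otimes> a) = a"
    unfolding hp_def using assms decomp_unique by (intro the_equality) blast+
  then show "np (x \<otimes> a) = x" using assms by (simp add: np_def m_assoc)
qed

lemma decomp: assumes "g \<in> carrier G" shows "np g \<in> N" "hp g \<in> H" "g = np g \<otimes> hp g"
proof -
  obtain x a where "x \<in> N" "a \<in> H" "g = x \<otimes> a"
    using assms unfolding N_mult_H[symmetric] set_mult_def by auto
  then show "np g \<in> N" "hp g \<in> H" "g = np g \<otimes> hp g" by (simp_all add: hp_eq)
qed

lemma decomp_in [simp, intro]: "g \<in> carrier G \<Longrightarrow> np g \<in> N" "g \<in> carrier G \<Longrightarrow> hp g \<in> H"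
  "g \<in> carrier G \<Longrightarrow> np g \<in> carrier G" "g \<in> carrier G \<Longrightarrow> hp g \<in> carrier G"
  using decomp by auto

lemma np_mult: assumes "g \<in> carrier G" "k \<in> carrier G"
  shows "hp (g \<otimes> k) = hp g \<otimes> hp k" "np (g \<otimes> k) = np g \<otimes> (hp g \<otimes> np k \<otimes> inv (hp g))"
proof -
  define x a y b where xa: "x = np g" "a = hp g" "y = np k" "b = hp k"
  have in_NH: "x \<in> N" "a \<in> H" "y \<in> N" "b \<in> H" and g: "g = x \<otimes> a" and k: "k = y \<otimes> b"
    using assms decomp by (simp_all add: xa)
  have eq: "x \<otimes> a \<otimes> (y \<otimes> b) = (x \<otimes> (a \<otimes> y \<otimes> inv a)) \<otimes> (a \<otimes> b)"
    using in_NH by (simp add: m_assoc)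
  have "x \<otimes> (a \<otimes> y \<otimes> inv a) \<in> N" "a \<otimes> b \<in> H"
    using in_NH by (simp_all add: sub_closed conj_N)
  from hp_eq[OF this, folded eq]
  show "hp (g \<otimes> k) = hp g \<otimes> hp k" "np (g \<otimes> k) = np g \<otimes> (hp g \<otimes> np k \<otimes> inv (hp g))"
    unfolding g[symmetric] k[symmetric] unfolding xa by this+
qed

lemma np_N [simp]: "x \<in> N \<Longrightarrow> np x = x" "x \<in> N \<Longrightarrow> hp x = \<one>"
  using hp_eq[of x \<one>] by simp_all

lemma np_H [simp]: "a \<in> H \<Longrightarrow> np a = \<one>" "a \<in> H \<Longrightarrow> hp a = a"
  using hp_eq[of \<one> a] by simp_all

lemma np_mult_H: "g \<in> carrier G \<Longrightarrow> a \<in> H \<Longrightarrow> np (g \<otimes> a) = np g"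
  by (simp add: np_mult)

lemma np_mult_np: "g \<in> carrier G \<Longrightarrow> k \<in> carrier G \<Longrightarrow> np (g \<otimes> np k) = np (g \<otimes> k)"
  by (simp add: np_mult)

lemma beta_np: assumes "g \<in> carrier G" "y \<in> N" shows "beta G N H g y = np (g \<otimes> y)"
proof -
  define x a where xa: "x = np g" "a = hp g"
  have in_NH: "x \<in> N" "a \<in> H" and g: "g = x \<otimes> a"
    using assms decomp by (simp_all add: xa)
  have "np (g \<otimes> y) = x \<otimes> (a \<otimes> y \<otimes> inv a)" using assms by (simp add: np_mult xa)
  then show ?thesis
    using beta_eq[OF in_NH, of y] assms in_NH by (simp add: g m_assoc)
qed

lemma hp_inv: assumes "g \<in> carrier G" shows "hp (inv g) = inv (hp g)"
proof -
  have "hp (inv g) \<otimes> hp g = \<one>" using np_mult(1)[of "inv g" g] assms by simp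
  then show ?thesis using assms by (simp add: inv_equality)
qed

text \<open>The elements of \<open>G\<close> whose action \<open>y \<mapsto> x a y a\<^sup>-\<^sup>1\<close> on
  \<open>N\<close> maps \<open>M\<close> into itself.\<close>

definition W where "W = {g \<in> carrier G. np g \<in> M \<and> hp g \<in> Hp}"

lemma W_in_G [simp]: "w \<in> W \<Longrightarrow> w \<in> carrier G" by (simp add: W_def)

lemma W_parts: "w \<in> W \<Longrightarrow> np w \<in> M" "w \<in> W \<Longrightarrow> hp w \<in> Hp" "w \<in> W \<Longrightarrow> w = np w \<otimes> hp w"
  by (simp_all only: W_def mem_Collect_eq) (rule decomp(3), simp)

lemma W_prod: "m \<in> M \<Longrightarrow> a \<in> Hp \<Longrightarrow> m \<otimes> a \<in> W" "m \<in> M \<Longrightarrow> a \<in> Hp \<Longrightarrow> np (m \<otimes> a) = m"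
  "m \<in> M \<Longrightarrow> a \<in> Hp \<Longrightarrow> hp (m \<otimes> a) = a"
  unfolding W_def by (simp_all add: hp_eq M_sub_N)

lemma M_W: "m \<in> M \<Longrightarrow> m \<in> W" using W_prod(1)[of m \<one>] by simp
lemma Hp_W: "a \<in> Hp \<Longrightarrow> a \<in> W" using W_prod(1)[of \<one> a] by simp
lemma np_M [simp]: "m \<in> M \<Longrightarrow> np m = m" "m \<in> M \<Longrightarrow> hp m = \<one>" by (simp_all add: M_sub_N)

lemma W_mult: "\<lbrakk>v \<in> W; w \<in> W\<rbrakk> \<Longrightarrow> v \<otimes> w \<in> W"
  unfolding W_def by (simp add: np_mult conj_M M.m_closed Hp_mult)

text \<open>Conjugation by some \<open>a \<in> H\<^sup>+\<close> moves \<open>np g\<close> into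
  \<open>M\<close>, and multiplication by some \<open>c \<in> H\<^sup>+\<close> makes \<open>hp
  g\<close> positive. Commutativity of \<open>H\<close> allows both to be done from the left.\<close>

lemma W_fraction: assumes g: "g \<in> carrier G" obtains b where "b \<in> Hp" "b \<otimes> g \<in> W"
proof -
  obtain a k where a: "a \<in> Hp" "k \<in> M" "np g = inv a \<otimes> k \<otimes> inv (inv a)"
    using decomp(1)[OF g] by (subst (asm) N_union) (auto simp: conj_set_def)
  obtain c where c: "c \<in> Hp" "hp g \<otimes> c \<in> Hp" using Hp_fraction decomp(2)[OF g] by blast
  have ch: "c \<otimes> hp g \<in> Hp" using c H_comm[of c "hp g"] g by simp
  \<comment> \<open>Here \<open>k = a (np g) a\<^sup>-\<^sup>1\<close> lies in \<open>M\<close>, and \<open>M\<close> is invariant under conjugation by \<open>c\<close>.\<close>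
  have "c \<otimes> a \<otimes> g = (c \<otimes> k \<otimes> inv c) \<otimes> (a \<otimes> (c \<otimes> hp g))"
  proof -
    have "c \<otimes> a \<otimes> (np g \<otimes> hp g) = c \<otimes> k \<otimes> (a \<otimes> hp g)"
      using a c g by (simp add: m_assoc)
    moreover have "(c \<otimes> k \<otimes> inv c) \<otimes> (a \<otimes> (c \<otimes> hp g)) = c \<otimes> k \<otimes> inv c \<otimes> (a \<otimes> c) \<otimes> hp g"
      using a c g by (simp add: m_assoc)
    moreover have "\<dots> = c \<otimes> k \<otimes> (a \<otimes> hp g)"
      unfolding H_comm[OF in_G(5)[OF a(1)] in_G(5)[OF c(1)]] using a c g by (simp add: m_assoc)
    ultimately show ?thesis
      unfolding decomp(3)[OF g, symmetric] by simp
  qed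
  moreover have "(c \<otimes> k \<otimes> inv c) \<otimes> (a \<otimes> (c \<otimes> hp g)) \<in> W"
    by (rule W_prod(1)[OF conj_M[OF c(1) a(2)] Hp_mult[OF a(1) ch]])
  ultimately show thesis using that[of "c \<otimes> a"] a c by (simp add: Hp_mult)
qed

text \<open>Any two elements of \<open>G\<close> have a common predecessor for the order in which \<open>g
  w\<^sup>-\<^sup>1\<close> lies below \<open>g\<close>; the inductive limits below run along this
  order.\<close>

lemma W_ore: assumes "g \<in> carrier G" "g' \<in> carrier G"
  obtains v v' where "v \<in> W" "v' \<in> W" "g \<otimes> inv v = g' \<otimes> inv v'"
proof -
  obtain b where b: "b \<in> Hp" "b \<otimes> (inv g' \<otimes> g) \<in> W" using W_fraction[of "inv g' \<otimes> g"] assms by auto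
  have "g \<otimes> inv (b \<otimes> (inv g' \<otimes> g)) = g' \<otimes> inv b"
    using assms b by (simp add: inv_mult_group m_assoc)
  then show thesis using that b Hp_W by blast
qed

section \<open>Transversals\<close>

text \<open>Elements \<open>m a\<close> and \<open>m' a\<close> of \<open>W\<close> have the same coset of
  \<open>M\<close> exactly if \<open>m\<close> and \<open>m'\<close> lie in the same coset of
  \<open>a M a\<^sup>-\<^sup>1\<close>. A transversal of level \<open>a\<close> lists
  representatives of all cosets of \<open>a M a\<^sup>-\<^sup>1\<close> in \<open>M\<close> in this
  form.\<close>

definition transversal where
  "transversal a V \<longleftrightarrow> a \<in> Hp \<and> finite V \<and> V \<subseteq> W \<and> (\<forall>v\<in>V. hp v = a) \<and>
     (\<forall>w\<in>W. hp w = a \<longrightarrow> (\<exists>!v. v \<in> V \<and> inv v \<otimes> w \<in> M))"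

lemma transversalD: assumes "transversal a V"
  shows "finite V" "v \<in> V \<Longrightarrow> v \<in> W" "v \<in> V \<Longrightarrow> hp v = a"
    "w \<in> W \<Longrightarrow> hp w = a \<Longrightarrow> \<exists>v\<in>V. inv v \<otimes> w \<in> M"
    "\<lbrakk>v \<in> V; v' \<in> V; inv v \<otimes> v' \<in> M\<rbrakk> \<Longrightarrow> v = v'"
proof -
  show "finite V" "v \<in> V \<Longrightarrow> v \<in> W" "v \<in> V \<Longrightarrow> hp v = a" "w \<in> W \<Longrightarrow> hp w = a \<Longrightarrow> \<exists>v\<in>V. inv v \<otimes> w \<in> M"
    using assms by (auto simp: transversal_def)
  assume v: "v \<in> V" "v' \<in> V" "inv v \<otimes> v' \<in> M"
  then have "v' \<in> W" "hp v' = a" "inv v' \<otimes> v' \<in> M" using assms by (auto simp: transversal_def)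
  then show "v = v'" using assms v unfolding transversal_def by blast
qed

lemma rel_sym: assumes "v \<in> carrier G" "w \<in> carrier G" "inv v \<otimes> w \<in> M" shows "inv w \<otimes> v \<in> M"
proof -
  have "inv w \<otimes> v = inv (inv v \<otimes> w)" using assms by (simp add: inv_mult_group)
  then show ?thesis using M.m_inv_closed[OF assms(3)] by simp
qed

lemma rel_trans: assumes "v \<in> carrier G" "w \<in> carrier G" "x \<in> carrier G" "inv v \<otimes> w \<in> M" "inv w \<otimes> x \<in> M"
  shows "inv v \<otimes> x \<in> M"
proof -
  have "inv v \<otimes> x = (inv v \<otimes> w) \<otimes> (inv w \<otimes> x)" using assms by (simp add: m_assoc)
  then show ?thesis using M.m_closed[OF assms(4,5)] by simp
qed

lemma in_coset_iff: assumes "a \<in> Hp" "m \<in> M" "m' \<in> M"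
  shows "m' \<in> m <# conj_set G a M \<longleftrightarrow> inv (m \<otimes> a) \<otimes> (m' \<otimes> a) \<in> M"
proof
  assume "m' \<in> m <# conj_set G a M"
  then obtain k where k: "k \<in> M" "m' = m \<otimes> (a \<otimes> k \<otimes> inv a)" by (auto simp: l_coset_def conj_set_def)
  then have "inv (m \<otimes> a) \<otimes> (m' \<otimes> a) = k" using assms by (simp add: inv_mult_group m_assoc)
  then show "inv (m \<otimes> a) \<otimes> (m' \<otimes> a) \<in> M" using k by simp
next
  let ?k = "inv (m \<otimes> a) \<otimes> (m' \<otimes> a)"
  assume k: "?k \<in> M"
  have "m' = m \<otimes> (a \<otimes> ?k \<otimes> inv a)" using assms by (simp add: inv_mult_group m_assoc)
  then show "m' \<in> m <# conj_set G a M" using k by (auto simp: l_coset_def conj_set_def)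
qed

lemma coset_sub_M: assumes "a \<in> Hp" "m \<in> M" shows "m <# conj_set G a M \<subseteq> M"
  using assms by (auto simp: l_coset_def conj_set_def conj_M sub_closed)

lemma coset_refl: "a \<in> Hp \<Longrightarrow> m \<in> M \<Longrightarrow> m \<in> m <# conj_set G a M"
  by (subst in_coset_iff) auto

lemma coset_eq: assumes a: "a \<in> Hp" and m: "m \<in> M" and m': "m' \<in> m <# conj_set G a M"
  shows "m' <# conj_set G a M = m <# conj_set G a M"
proof -
  have m'M: "m' \<in> M" using coset_sub_M assms by blast
  have r: "inv (m \<otimes> a) \<otimes> (m' \<otimes> a) \<in> M" using in_coset_iff a m m' m'M by blast
  have G: "m \<otimes> a \<in> carrier G" "m' \<otimes> a \<in> carrier G" using a m m'M by auto
  have "x \<in> m' <# conj_set G a M \<longleftrightarrow> x \<in> m <# conj_set G a M" if x: "x \<in> M" for x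
  proof -
    have xG: "x \<otimes> a \<in> carrier G" using x a by auto
    show ?thesis
      unfolding in_coset_iff[OF a m'M x] in_coset_iff[OF a m x]
      using rel_trans[OF G xG r] rel_trans[OF G(2,1) xG rel_sym[OF G r]] by blast
  qed
  then show ?thesis using coset_sub_M[OF a m] coset_sub_M[OF a m'M] by blast
qed

lemma finite_cosets: "a \<in> Hp \<Longrightarrow> finite (left_cosets G M (conj_set G a M))"
  using finite_quotients[OF M_family, of "conj_set G a M"] unfolding pos_part_def conj_family_def by blast

lemma transversal_exists: assumes w: "w \<in> W" obtains V where "transversal (hp w) V" "w \<in> V"
proof -
  define a where "a = hp w"
  have a: "a \<in> Hp" using w by (simp add: a_def W_parts)
  define C where "C = left_cosets G M (conj_set G a M)"
  \<comment> \<open>The coset of \<open>np w\<close> receives \<open>np w\<close> itself as representative.\<close>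
  define r where "r c = (if np w \<in> c then np w else (SOME m. m \<in> c))" for c
  have Cd: "c = m <# conj_set G a M" "m \<in> M" if "c \<in> C" "m \<in> c" for c m
  proof -
    obtain x where x: "x \<in> M" "c = x <# conj_set G a M" using \<open>c \<in> C\<close> unfolding C_def left_cosets_def by blast
    show "c = m <# conj_set G a M" "m \<in> M"
      using coset_eq[OF a x(1)] coset_sub_M[OF a x(1)] \<open>m \<in> c\<close> unfolding x(2) by blast+
  qed
  have ne: "\<exists>m. m \<in> c" if "c \<in> C" for c
    using that coset_refl[OF a] unfolding C_def left_cosets_def by blast
  have r: "r c \<in> c" if "c \<in> C" for c
    using someI_ex[OF ne[OF that]] by (simp add: r_def)
  have rM: "r c \<in> M" if "c \<in> C" for c using Cd r that by blast
  define V where "V = (\<lambda>c. r c \<otimes> a) ` C"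
  have "transversal a V"
    unfolding transversal_def
  proof (intro conjI ballI impI a)
    show "finite V" using finite_cosets[OF a] by (simp add: V_def C_def)
    show "V \<subseteq> W" using rM a by (auto simp: V_def W_prod)
    show "hp v = a" if "v \<in> V" for v using that rM a by (auto simp: V_def W_prod)
    fix x assume x: "x \<in> W" "hp x = a"
    have xM: "np x \<in> M" and xe: "x = np x \<otimes> a" using x W_parts by auto
    let ?c = "np x <# conj_set G a M"
    have c: "?c \<in> C" using xM unfolding C_def left_cosets_def by (rule imageI)
    show "\<exists>!v. v \<in> V \<and> inv v \<otimes> x \<in> M"
    proof (intro ex1I conjI)
      show "r ?c \<otimes> a \<in> V" using c by (auto simp: V_def)
      have "np x \<in> r ?c <# conj_set G a M"
        using Cd(1)[OF c r[OF c]] coset_refl[OF a xM] by simp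
      then show "inv (r ?c \<otimes> a) \<otimes> x \<in> M"
        using in_coset_iff[OF a rM[OF c] xM] xe by simp
      fix v assume v: "v \<in> V \<and> inv v \<otimes> x \<in> M"
      then obtain d where d: "d \<in> C" "v = r d \<otimes> a" by (auto simp: V_def)
      then have "np x \<in> r d <# conj_set G a M"
        using in_coset_iff[OF a rM[OF d(1)] xM] xe v by simp
      then have "?c = d" using coset_eq[OF a rM[OF d(1)]] Cd(1)[OF d(1) r[OF d(1)]] by simp
      then show "v = r ?c \<otimes> a" using d by simp
    qed
  qed
  moreover have "w \<in> V"
  proof -
    have m: "np w \<in> M" "w = np w \<otimes> a" using w W_parts by (auto simp: a_def)
    let ?c = "np w <# conj_set G a M"
    have c: "?c \<in> C" using m(1) unfolding C_def left_cosets_def by (rule imageI)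
    have "r ?c = np w" using coset_refl[OF a m(1)] by (simp add: r_def)
    then show ?thesis using c m(2) unfolding V_def by (metis image_eqI)
  qed
  ultimately show thesis using that by (simp add: a_def)
qed

lemma transversal_mult_inj:
  assumes V: "transversal a V" and V': "transversal b V'" and v: "v \<in> V" "u \<in> V" "v' \<in> V'" "u' \<in> V'"
    and rel: "inv (v \<otimes> v') \<otimes> (u \<otimes> u') \<in> M"
  shows "v = u" "v' = u'"
proof -
  note D = transversalD[OF V] and D' = transversalD[OF V']
  have W: "v \<in> W" "u \<in> W" "v' \<in> W" "u' \<in> W" using v D(2) D'(2) by auto
  have G: "v \<in> carrier G" "u \<in> carrier G" "v' \<in> carrier G" "u' \<in> carrier G" using W by auto
  let ?m = "inv (v \<otimes> v') \<otimes> (u \<otimes> u')"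
  have b: "hp v' = b" "hp u' = b" "b \<in> Hp" using v D'(3) W_parts(2)[OF W(3)] by auto
  define n n' where "n = np v'" and "n' = np u'"
  have n: "n \<in> M" "n' \<in> M"
    using W_parts(1) W by (simp_all add: n_def n'_def)
  have n_eq: "v' = n \<otimes> b" "u' = n' \<otimes> b"
    using W_parts(3)[OF W(3)] W_parts(3)[OF W(4)] unfolding n_def n'_def b(1,2) .
  have "inv v \<otimes> u = v' \<otimes> ?m \<otimes> inv u'" using G by (simp add: inv_mult_group m_assoc)
  also have "\<dots> = n \<otimes> (b \<otimes> ?m \<otimes> inv b) \<otimes> inv n'"
    unfolding n_eq using M.mem_carrier[OF rel[unfolded n_eq]] n b(3) G(1,2) by (simp add: inv_mult_group m_assoc)
  finally have "inv v \<otimes> u \<in> M"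
    using n b rel by (simp add: conj_M sub_closed)
  then show "v = u" using D(5) v by blast
  then have "?m = inv v' \<otimes> u'" using G by (simp add: inv_mult_group m_assoc)
  then show "v' = u'" using D'(5) v rel by simp
qed

text \<open>Refining each coset of \<open>a M a\<^sup>-\<^sup>1\<close> by the cosets of \<open>(a b) M (a
  b)\<^sup>-\<^sup>1\<close> that it contains multiplies transversals.\<close>

lemma transversal_mult:
  assumes V: "transversal a V" and V': "transversal b V'"
  shows "transversal (a \<otimes> b) ((\<lambda>(v, v'). v \<otimes> v') ` (V \<times> V'))"
  unfolding transversal_def
proof (intro conjI ballI impI)
  note D = transversalD[OF V] and D' = transversalD[OF V']
  have a: "a \<in> Hp" and b: "b \<in> Hp" using V V' by (simp_all add: transversal_def)
  show "a \<otimes> b \<in> Hp" using a b by (rule Hp_mult)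
  show "finite ((\<lambda>(v, v'). v \<otimes> v') ` (V \<times> V'))" using D(1) D'(1) by simp
  show "(\<lambda>(v, v'). v \<otimes> v') ` (V \<times> V') \<subseteq> W" using D(2) D'(2) by (auto simp: W_mult)
  show "hp x = a \<otimes> b" if "x \<in> (\<lambda>(v, v'). v \<otimes> v') ` (V \<times> V')" for x
    using that D(2,3) D'(2,3) by (auto simp: np_mult)
  fix w assume w: "w \<in> W" "hp w = a \<otimes> b"
  define w1 where "w1 = np w \<otimes> a"
  have w1: "w1 \<in> W" "hp w1 = a" "w = w1 \<otimes> b"
    using w W_parts[OF w(1)] a b by (auto simp: w1_def W_prod m_assoc)
  obtain v where v: "v \<in> V" "inv v \<otimes> w1 \<in> M" using D(4) w1 by blast
  define k where "k = inv v \<otimes> w1"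
  have k: "k \<otimes> b \<in> W" "hp (k \<otimes> b) = b" using W_prod[OF v(2) b] by (simp_all add: k_def)
  obtain v' where v': "v' \<in> V'" "inv v' \<otimes> (k \<otimes> b) \<in> M" using D'(4) k by blast
  have W: "v \<in> W" "v' \<in> W" using v v' D(2) D'(2) by auto
  show "\<exists>!x. x \<in> (\<lambda>(v, v'). v \<otimes> v') ` (V \<times> V') \<and> inv x \<otimes> w \<in> M"
  proof (intro ex1I conjI)
    show "v \<otimes> v' \<in> (\<lambda>(v, v'). v \<otimes> v') ` (V \<times> V')" using v v' by auto
    show rel: "inv (v \<otimes> v') \<otimes> w \<in> M"
    proof -
      have "inv (v \<otimes> v') \<otimes> (w1 \<otimes> b) = inv v' \<otimes> (k \<otimes> b)"
        using W w1(1) b unfolding k_def by (simp add: inv_mult_group m_assoc)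
      then show ?thesis using v'(2) w1(3) by simp
    qed
    fix x assume x: "x \<in> (\<lambda>(v, v'). v \<otimes> v') ` (V \<times> V') \<and> inv x \<otimes> w \<in> M"
    then obtain u u' where u: "u \<in> V" "u' \<in> V'" "x = u \<otimes> u'" by auto
    have G: "x \<in> carrier G" "v \<otimes> v' \<in> carrier G" "w \<in> carrier G" using D(2)[OF u(1)] D'(2)[OF u(2)] W w(1) u(3) by simp_all
    have "inv x \<otimes> (v \<otimes> v') \<in> M"
      using rel_trans[OF G(1,3,2)] rel_sym[OF G(2,3) rel] x by blast
    then show "x = v \<otimes> v'"
      using transversal_mult_inj[OF V V' u(1) v(1) u(2) v'(1)] u(3) by blast
  qed
qed

end

section \<open>The isometric representation and its Riemann sums\<close>

locale su_rep = abelian_system G N H M + B: unital_cstar_algebra B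
  for G (structure) and N H M and B :: "('b, 'y) cstar_scheme" +
  fixes S U
  assumes SU: "SU_family G H M B S U"
begin

abbreviation "normB \<equiv> cs_norm B"
abbreviation "starB \<equiv> cs_star B"

lemma SU_rules:
  "a \<in> Hp \<Longrightarrow> S a \<in> carrier B" "a \<in> Hp \<Longrightarrow> starB (S a) \<otimes>\<^bsub>B\<^esub> S a = \<one>\<^bsub>B\<^esub>"
  "m \<in> M \<Longrightarrow> U m \<in> carrier B" "m \<in> M \<Longrightarrow> starB (U m) \<otimes>\<^bsub>B\<^esub> U m = \<one>\<^bsub>B\<^esub>" "m \<in> M \<Longrightarrow> U m \<otimes>\<^bsub>B\<^esub> starB (U m) = \<one>\<^bsub>B\<^esub>"
  "\<lbrakk>a \<in> Hp; b \<in> Hp\<rbrakk> \<Longrightarrow> S a \<otimes>\<^bsub>B\<^esub> S b = S (a \<otimes> b)"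
  "\<lbrakk>a \<in> Hp; m \<in> M\<rbrakk> \<Longrightarrow> S a \<otimes>\<^bsub>B\<^esub> U m = U (a \<otimes> m \<otimes> inv a) \<otimes>\<^bsub>B\<^esub> S a"
  "\<lbrakk>m \<in> M; k \<in> M\<rbrakk> \<Longrightarrow> U m \<otimes>\<^bsub>B\<^esub> U k = U (m \<otimes> k)"
  using SU unfolding SU_family_def isometry_elem_def unitary_elem_def by blast+

lemma SU_sum: "a \<in> Hp \<Longrightarrow> (\<Oplus>\<^bsub>B\<^esub>c\<in>left_cosets G M (conj_set G a M). let m = (SOME m. m \<in> c) in
    U m \<otimes>\<^bsub>B\<^esub> S a \<otimes>\<^bsub>B\<^esub> starB (S a) \<otimes>\<^bsub>B\<^esub> U (inv m)) = \<one>\<^bsub>B\<^esub>"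
  using SU unfolding SU_family_def by blast

declare SU_rules(1,3) [simp, intro]

lemma isometry_idem: assumes "t \<in> carrier B" "starB t \<otimes>\<^bsub>B\<^esub> t = \<one>\<^bsub>B\<^esub>" "t \<otimes>\<^bsub>B\<^esub> t = t" shows "t = \<one>\<^bsub>B\<^esub>"
proof -
  have "starB t \<otimes>\<^bsub>B\<^esub> (t \<otimes>\<^bsub>B\<^esub> t) = t" using assms(1,2) by (simp add: B.pre.times_assoc[symmetric])
  then show ?thesis unfolding assms(3) assms(2) by (rule sym)
qed

lemma U_one: "U \<one> = \<one>\<^bsub>B\<^esub>"
  by (rule isometry_idem) (simp_all add: SU_rules(4,8))

lemma S_one: "S \<one> = \<one>\<^bsub>B\<^esub>"
  by (rule isometry_idem) (simp_all add: SU_rules(2,6))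

lemma U_inv: assumes m: "m \<in> M" shows "U (inv m) = starB (U m)"
proof -
  have i: "inv m \<in> M" using m by (rule M.m_inv_closed)
  have "U m \<otimes>\<^bsub>B\<^esub> U (inv m) = \<one>\<^bsub>B\<^esub>" using SU_rules(8)[OF m i] m by (simp add: U_one)
  then have "starB (U m) \<otimes>\<^bsub>B\<^esub> (U m \<otimes>\<^bsub>B\<^esub> U (inv m)) = starB (U m)" using m by simp
  then show ?thesis using m i by (simp add: B.pre.times_assoc[symmetric] SU_rules(4))
qed

text \<open>The relations of an SU-family say that \<open>m a \<mapsto> U m S a\<close> is multiplicative on
  \<open>W\<close>.\<close>

definition T where "T w = U (np w) \<otimes>\<^bsub>B\<^esub> S (hp w)"

lemma T_in [simp, intro]: "w \<in> W \<Longrightarrow> T w \<in> carrier B"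
  using W_parts by (simp add: T_def)

lemma T_iso: assumes "w \<in> W" shows "starB (T w) \<otimes>\<^bsub>B\<^esub> T w = \<one>\<^bsub>B\<^esub>"
proof -
  note [simp] = W_parts(1,2)[OF assms]
  have "starB (T w) \<otimes>\<^bsub>B\<^esub> T w = starB (S (hp w)) \<otimes>\<^bsub>B\<^esub> ((starB (U (np w)) \<otimes>\<^bsub>B\<^esub> U (np w)) \<otimes>\<^bsub>B\<^esub> S (hp w))"
    by (simp add: T_def B.pre.adj_times B.pre.times_assoc)
  then show ?thesis by (simp add: SU_rules)
qed

lemma T_mult: assumes "v \<in> W" "w \<in> W" shows "T (v \<otimes> w) = T v \<otimes>\<^bsub>B\<^esub> T w"
proof -
  define m a n b where d: "m = np v" "a = hp v" "n = np w" "b = hp w"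
  have mem [simp]: "m \<in> M" "a \<in> Hp" "n \<in> M" "b \<in> Hp" "a \<otimes> n \<otimes> inv a \<in> M"
    using assms W_parts by (simp_all add: d conj_M)
  have "T (v \<otimes> w) = U (m \<otimes> (a \<otimes> n \<otimes> inv a)) \<otimes>\<^bsub>B\<^esub> S (a \<otimes> b)"
    using assms by (simp add: T_def np_mult d)
  also have "\<dots> = U m \<otimes>\<^bsub>B\<^esub> ((U (a \<otimes> n \<otimes> inv a) \<otimes>\<^bsub>B\<^esub> S a) \<otimes>\<^bsub>B\<^esub> S b)"
    by (simp add: SU_rules(6,8)[symmetric] B.pre.times_assoc del: SU_rules(6,8))
  also have "\<dots> = U m \<otimes>\<^bsub>B\<^esub> ((S a \<otimes>\<^bsub>B\<^esub> U n) \<otimes>\<^bsub>B\<^esub> S b)" by (simp add: SU_rules(7))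
  also have "\<dots> = T v \<otimes>\<^bsub>B\<^esub> T w" by (simp add: T_def d[symmetric] B.pre.times_assoc)
  finally show ?thesis .
qed

lemma T_M: "m \<in> M \<Longrightarrow> T m = U m" by (simp add: T_def S_one)
lemma T_Hp: "a \<in> Hp \<Longrightarrow> T a = S a" by (simp add: T_def U_one)
lemma T_one: "T \<one> = \<one>\<^bsub>B\<^esub>" by (simp add: T_M U_one)

definition Q where "Q w = T w \<otimes>\<^bsub>B\<^esub> starB (T w)"

lemma Q_in [simp, intro]: "w \<in> W \<Longrightarrow> Q w \<in> carrier B" by (simp add: Q_def)

lemma Q_mult: assumes "v \<in> W" "w \<in> W" shows "Q (v \<otimes> w) = T v \<otimes>\<^bsub>B\<^esub> Q w \<otimes>\<^bsub>B\<^esub> starB (T v)"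
  using assms by (simp add: Q_def T_mult B.pre.adj_times B.pre.times_assoc)

lemma T_rel: assumes "v \<in> W" "w \<in> W" "inv v \<otimes> w \<in> M" shows "T w = T v \<otimes>\<^bsub>B\<^esub> U (inv v \<otimes> w)"
proof -
  have "w = v \<otimes> (inv v \<otimes> w)" using assms by simp
  then show ?thesis using T_mult[OF assms(1) M_W[OF assms(3)]] T_M[OF assms(3)] by simp
qed

lemma Q_rel: assumes "v \<in> W" "w \<in> W" "inv v \<otimes> w \<in> M" shows "Q w = Q v"
proof -
  have "T v \<otimes>\<^bsub>B\<^esub> (U (inv v \<otimes> w) \<otimes>\<^bsub>B\<^esub> starB (U (inv v \<otimes> w))) \<otimes>\<^bsub>B\<^esub> starB (T v) = Q v"
    unfolding SU_rules(5)[OF assms(3)] using assms by (simp add: Q_def)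
  then show ?thesis using assms T_rel[OF assms] by (simp add: Q_def B.pre.adj_times B.pre.times_assoc)
qed

text \<open>The sum relation of the SU-family is written with a fixed choice of representatives;
  \<open>Q\<close> depends only on the coset, so every transversal gives the same sum.\<close>

lemma Q_sum: assumes V: "transversal a V" shows "(\<Oplus>\<^bsub>B\<^esub>v\<in>V. Q v) = \<one>\<^bsub>B\<^esub>"
proof -
  have a: "a \<in> Hp" using V by (simp add: transversal_def)
  note D = transversalD[OF V]
  define h where "h v = np v <# conj_set G a M" for v
  have v: "np v \<in> M" "v = np v \<otimes> a" if "v \<in> V" for v
    using W_parts[OF D(2)[OF that]] D(3)[OF that] by simp_all
  have inj: "inj_on h V"
  proof (rule inj_onI)
    fix v v' assume vv: "v \<in> V" "v' \<in> V" "h v = h v'"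
    have "np v' \<in> np v <# conj_set G a M"
      using coset_refl[OF a v(1)[OF vv(2)]] vv(3) by (simp add: h_def)
    then have "inv v \<otimes> v' \<in> M"
      using in_coset_iff[OF a v(1)[OF vv(1)] v(1)[OF vv(2)]] v(2)[OF vv(1)] v(2)[OF vv(2)] by simp
    then show "v = v'" using D(5) vv by blast
  qed
  have im: "h ` V = left_cosets G M (conj_set G a M)"
  proof
    show "h ` V \<subseteq> left_cosets G M (conj_set G a M)"
      using v(1) unfolding h_def left_cosets_def by blast
    show "left_cosets G M (conj_set G a M) \<subseteq> h ` V"
    proof
      fix c assume "c \<in> left_cosets G M (conj_set G a M)"
      then obtain m where m: "m \<in> M" "c = m <# conj_set G a M" unfolding left_cosets_def by blast
      obtain x where x: "x \<in> V" "inv x \<otimes> (m \<otimes> a) \<in> M" using D(4)[OF W_prod(1,3)[OF m(1) a]] by blast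
      then have "m \<in> np x <# conj_set G a M"
        using in_coset_iff[OF a v(1)[OF x(1)] m(1)] v(2)[OF x(1)] by simp
      then have "c = h x" unfolding h_def m(2) by (rule coset_eq[OF a v(1)[OF x(1)]])
      then show "c \<in> h ` V" using x(1) by blast
    qed
  qed
  define f where "f c = (let m = (SOME m. m \<in> c) in U m \<otimes>\<^bsub>B\<^esub> S a \<otimes>\<^bsub>B\<^esub> starB (S a) \<otimes>\<^bsub>B\<^esub> U (inv m))" for c
  have f: "f (h x) = Q x" if x: "x \<in> V" for x
  proof -
    define m where "m = (SOME m. m \<in> h x)"
    have "m \<in> h x"
      unfolding m_def by (rule someI[of _ "np x"]) (simp add: h_def coset_refl a v(1)[OF x])
    then have mM: "m \<in> M" and rel: "inv x \<otimes> (m \<otimes> a) \<in> M"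
      using coset_sub_M[OF a v(1)[OF x]] in_coset_iff[OF a v(1)[OF x], of m] v(2)[OF x]
      unfolding h_def by auto
    have "f (h x) = U m \<otimes>\<^bsub>B\<^esub> S a \<otimes>\<^bsub>B\<^esub> starB (S a) \<otimes>\<^bsub>B\<^esub> starB (U m)"
      by (simp add: f_def m_def[symmetric] U_inv mM)
    also have "\<dots> = Q (m \<otimes> a)"
      using mM a by (simp add: Q_def T_def W_prod B.pre.adj_times B.pre.times_assoc)
    also have "\<dots> = Q x" by (rule Q_rel[OF D(2)[OF x] W_prod(1)[OF mM a] rel])
    finally show ?thesis .
  qed
  have "\<one>\<^bsub>B\<^esub> = (\<Oplus>\<^bsub>B\<^esub>c\<in>h ` V. f c)" using SU_sum[OF a] unfolding im f_def by simp
  also have "\<dots> = (\<Oplus>\<^bsub>B\<^esub>x\<in>V. f (h x))"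
    by (rule B.M.finsum_reindex) (use inj f D(2) in auto)
  also have "\<dots> = (\<Oplus>\<^bsub>B\<^esub>x\<in>V. Q x)"
    by (rule B.pre.finsum_eqI) (use f D(2) in auto)
  finally show ?thesis by simp
qed

lemma T_orth: assumes V: "transversal a V" and v: "v \<in> V" "v' \<in> V" "v \<noteq> v'"
  shows "starB (T v) \<otimes>\<^bsub>B\<^esub> T v' = \<zero>\<^bsub>B\<^esub>"
  using Q_sum[OF V] transversalD(1,2)[OF V] T_iso v unfolding Q_def
  by (intro B.pre.isometries_orthogonal[of V T]) auto

lemma partition: assumes V: "transversal a V" shows "projection_partition B V Q"
proof (intro projection_partition.intro projection_partition_axioms.intro B.pre.unital_pre_cstar_axioms)
  note D = transversalD(1,2)[OF V]
  show "finite V" "(\<Oplus>\<^bsub>B\<^esub>v\<in>V. Q v) = \<one>\<^bsub>B\<^esub>" using D Q_sum[OF V] by simp_all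
  fix v assume v: "v \<in> V"
  show "Q v \<in> carrier B" "starB (Q v) = Q v" using D(2)[OF v] by (simp_all add: Q_def B.pre.adj_times)
  have eq: "Q v \<otimes>\<^bsub>B\<^esub> Q w = T v \<otimes>\<^bsub>B\<^esub> (starB (T v) \<otimes>\<^bsub>B\<^esub> T w) \<otimes>\<^bsub>B\<^esub> starB (T w)" if w: "w \<in> V" for w
    using D(2)[OF v] D(2)[OF w] by (simp add: Q_def B.pre.times_assoc)
  show "Q v \<otimes>\<^bsub>B\<^esub> Q v = Q v" unfolding eq[OF v] using D(2)[OF v] by (simp add: T_iso Q_def)
  fix w assume w: "w \<in> V" "v \<noteq> w"
  show "Q v \<otimes>\<^bsub>B\<^esub> Q w = \<zero>\<^bsub>B\<^esub>" unfolding eq[OF w(1)] using D(2)[OF v] D(2)[OF w(1)] by (simp add: T_orth[OF V v w])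
qed

text \<open>A Riemann sum: the value \<open>\<phi> v\<close> is attached to the coset of \<open>M\<close>
  represented by \<open>v\<close>.\<close>

definition \<sigma> where "\<sigma> V \<phi> = (\<Oplus>\<^bsub>B\<^esub>v\<in>V. \<phi> v \<odot>\<^bsub>B\<^esub> Q v)"

lemma \<sigma>_in [simp, intro]: assumes "transversal a V" shows "\<sigma> V \<phi> \<in> carrier B"
  unfolding \<sigma>_def by (rule projection_partition.comb_closed[OF partition[OF assms]])

lemma \<sigma>_ops: assumes V: "transversal a V"
  shows "\<sigma> V \<phi> \<oplus>\<^bsub>B\<^esub> \<sigma> V \<psi> = \<sigma> V (\<lambda>v. \<phi> v + \<psi> v)" "c \<odot>\<^bsub>B\<^esub> \<sigma> V \<phi> = \<sigma> V (\<lambda>v. c * \<phi> v)"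
    "\<sigma> V \<phi> \<otimes>\<^bsub>B\<^esub> \<sigma> V \<psi> = \<sigma> V (\<lambda>v. \<phi> v * \<psi> v)" "starB (\<sigma> V \<phi>) = \<sigma> V (\<lambda>v. cnj (\<phi> v))"
    "\<sigma> V \<phi> \<ominus>\<^bsub>B\<^esub> \<sigma> V \<psi> = \<sigma> V (\<lambda>v. \<phi> v - \<psi> v)"
  using partition[OF V] unfolding \<sigma>_def
  by (simp_all only: projection_partition.comb_add projection_partition.comb_smult
      projection_partition.comb_times projection_partition.comb_adj projection_partition.comb_minus)

lemma \<sigma>_norm: assumes "transversal a V" "\<And>v. v \<in> V \<Longrightarrow> cmod (\<phi> v) \<le> K" "0 \<le> K" shows "normB (\<sigma> V \<phi>) \<le> K"
  unfolding \<sigma>_def by (rule projection_partition.nrm_comb_le[OF partition[OF assms(1)] assms(2,3)])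

lemma \<sigma>_cong: assumes "transversal a V" "\<And>v. v \<in> V \<Longrightarrow> \<phi> v = \<psi> v" shows "\<sigma> V \<phi> = \<sigma> V \<psi>"
  unfolding \<sigma>_def by (rule B.pre.finsum_eqI) (use assms transversalD(2)[OF assms(1)] in auto)

lemma \<sigma>_one: assumes "transversal a V" shows "\<sigma> V (\<lambda>_. 1) = \<one>\<^bsub>B\<^esub>"
proof -
  have "\<sigma> V (\<lambda>_. 1) = (\<Oplus>\<^bsub>B\<^esub>v\<in>V. Q v)"
    unfolding \<sigma>_def by (rule B.pre.finsum_eqI) (use transversalD(2)[OF assms] in auto)
  then show ?thesis using Q_sum[OF assms] by simp
qed

definition tmul where "tmul V V' = (\<lambda>(v, v'). v \<otimes> v') ` (V \<times> V')"

lemma tmul_trans: "\<lbrakk>transversal a V; transversal b V'\<rbrakk> \<Longrightarrow> transversal (a \<otimes> b) (tmul V V')"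
  unfolding tmul_def by (rule transversal_mult)

text \<open>Sorting the product transversal by its first factor and pulling out \<open>T v\<close> exhibits the
  finer sum as a sum of conjugated Riemann sums.\<close>

lemma \<sigma>_tmul: assumes V: "transversal a V" and V': "transversal b V'"
  shows "\<sigma> (tmul V V') \<phi> = (\<Oplus>\<^bsub>B\<^esub>v\<in>V. T v \<otimes>\<^bsub>B\<^esub> \<sigma> V' (\<lambda>v'. \<phi> (v \<otimes> v')) \<otimes>\<^bsub>B\<^esub> starB (T v))"
proof -
  note D = transversalD(1,2)[OF V] and D' = transversalD(1,2)[OF V']
  let ?A = "\<lambda>v. (\<lambda>v'. v \<otimes> v') ` V'"
  have im: "tmul V V' = \<Union>(?A ` V)" by (auto simp: tmul_def)
  have inj: "v = u \<and> v' = u'" if "v \<in> V" "u \<in> V" "v' \<in> V'" "u' \<in> V'" "v \<otimes> v' = u \<otimes> u'" for v u v' u'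
  proof -
    have "inv (v \<otimes> v') \<otimes> (u \<otimes> u') \<in> M" using that D(2) D'(2) by simp
    then show ?thesis using transversal_mult_inj[OF V V' that(1-4)] by blast
  qed
  have in_W: "v \<otimes> v' \<in> W" if "v \<in> V" "v' \<in> V'" for v v' using that D D' by (auto intro: W_mult)
  have "\<sigma> (tmul V V') \<phi> = (\<Oplus>\<^bsub>B\<^esub>v\<in>V. (\<Oplus>\<^bsub>B\<^esub>x\<in>?A v. \<phi> x \<odot>\<^bsub>B\<^esub> Q x))"
    unfolding \<sigma>_def im
  proof (rule B.M.add.finprod_UN_disjoint)
    show "pairwise (\<lambda>i j. disjnt (?A i) (?A j)) V"
      using inj unfolding pairwise_def disjnt_def by blast
  qed (use D D' in_W in auto)
  also have "\<dots> = (\<Oplus>\<^bsub>B\<^esub>v\<in>V. T v \<otimes>\<^bsub>B\<^esub> \<sigma> V' (\<lambda>v'. \<phi> (v \<otimes> v')) \<otimes>\<^bsub>B\<^esub> starB (T v))"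
  proof (rule B.pre.finsum_eqI)
    fix v assume v: "v \<in> V"
    have vW: "v \<in> W" using D v by blast
    have "(\<Oplus>\<^bsub>B\<^esub>x\<in>?A v. \<phi> x \<odot>\<^bsub>B\<^esub> Q x) = (\<Oplus>\<^bsub>B\<^esub>v'\<in>V'. \<phi> (v \<otimes> v') \<odot>\<^bsub>B\<^esub> Q (v \<otimes> v'))"
      by (rule B.M.finsum_reindex) (use inj v in_W in \<open>auto simp: inj_on_def\<close>)
    also have "\<dots> = (\<Oplus>\<^bsub>B\<^esub>v'\<in>V'. T v \<otimes>\<^bsub>B\<^esub> (\<phi> (v \<otimes> v') \<odot>\<^bsub>B\<^esub> Q v') \<otimes>\<^bsub>B\<^esub> starB (T v))"
      by (rule B.pre.finsum_eqI)
        (use vW D' in \<open>auto simp: Q_mult B.pre.smult_times_l B.pre.smult_times_r\<close>)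
    also have "\<dots> = (\<Oplus>\<^bsub>B\<^esub>v'\<in>V'. T v \<otimes>\<^bsub>B\<^esub> (\<phi> (v \<otimes> v') \<odot>\<^bsub>B\<^esub> Q v')) \<otimes>\<^bsub>B\<^esub> starB (T v)"
      by (rule B.pre.times_finsum_l[symmetric]) (use vW D' in auto)
    also have "(\<Oplus>\<^bsub>B\<^esub>v'\<in>V'. T v \<otimes>\<^bsub>B\<^esub> (\<phi> (v \<otimes> v') \<odot>\<^bsub>B\<^esub> Q v')) = T v \<otimes>\<^bsub>B\<^esub> \<sigma> V' (\<lambda>v'. \<phi> (v \<otimes> v'))"
      unfolding \<sigma>_def by (rule B.pre.times_finsum_r[symmetric]) (use vW D' in auto)
    finally show "(\<Oplus>\<^bsub>B\<^esub>x\<in>?A v. \<phi> x \<odot>\<^bsub>B\<^esub> Q x) = T v \<otimes>\<^bsub>B\<^esub> \<sigma> V' (\<lambda>v'. \<phi> (v \<otimes> v')) \<otimes>\<^bsub>B\<^esub> starB (T v)" .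
    show "T v \<otimes>\<^bsub>B\<^esub> \<sigma> V' (\<lambda>v'. \<phi> (v \<otimes> v')) \<otimes>\<^bsub>B\<^esub> starB (T v) \<in> carrier B"
      using vW V' by auto
  qed
  finally show ?thesis .
qed

text \<open>Of the terms in the preceding formula only the one for \<open>w\<close> survives multiplication by
  \<open>T w\<close>, as the ranges of the \<open>T v\<close> are orthogonal.\<close>

lemma \<sigma>_tmul_T: assumes V: "transversal a V" and V': "transversal b V'" and w: "w \<in> V"
  shows "\<sigma> (tmul V V') \<phi> \<otimes>\<^bsub>B\<^esub> T w = T w \<otimes>\<^bsub>B\<^esub> \<sigma> V' (\<lambda>v'. \<phi> (w \<otimes> v'))"
proof -
  note D = transversalD(1,2)[OF V]
  have wW: "w \<in> W" using D w by blast
  have s [simp]: "\<sigma> V' f \<in> carrier B" for f using V' by auto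
  have "\<sigma> (tmul V V') \<phi> \<otimes>\<^bsub>B\<^esub> T w = (\<Oplus>\<^bsub>B\<^esub>v\<in>V. T v \<otimes>\<^bsub>B\<^esub> \<sigma> V' (\<lambda>v'. \<phi> (v \<otimes> v')) \<otimes>\<^bsub>B\<^esub> starB (T v) \<otimes>\<^bsub>B\<^esub> T w)"
    unfolding \<sigma>_tmul[OF V V'] by (rule B.pre.times_finsum_l) (use wW D in auto)
  also have "\<dots> = (\<Oplus>\<^bsub>B\<^esub>v\<in>V. if w = v then T v \<otimes>\<^bsub>B\<^esub> \<sigma> V' (\<lambda>v'. \<phi> (v \<otimes> v')) else \<zero>\<^bsub>B\<^esub>)"
  proof (rule B.pre.finsum_eqI)
    fix v assume v: "v \<in> V"
    have vW: "v \<in> W" using D v by blast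
    have "T v \<otimes>\<^bsub>B\<^esub> \<sigma> V' (\<lambda>v'. \<phi> (v \<otimes> v')) \<otimes>\<^bsub>B\<^esub> starB (T v) \<otimes>\<^bsub>B\<^esub> T w
        = T v \<otimes>\<^bsub>B\<^esub> \<sigma> V' (\<lambda>v'. \<phi> (v \<otimes> v')) \<otimes>\<^bsub>B\<^esub> (starB (T v) \<otimes>\<^bsub>B\<^esub> T w)"
      using vW wW by (simp add: B.pre.times_assoc)
    then show "T v \<otimes>\<^bsub>B\<^esub> \<sigma> V' (\<lambda>v'. \<phi> (v \<otimes> v')) \<otimes>\<^bsub>B\<^esub> starB (T v) \<otimes>\<^bsub>B\<^esub> T w
        = (if w = v then T v \<otimes>\<^bsub>B\<^esub> \<sigma> V' (\<lambda>v'. \<phi> (v \<otimes> v')) else \<zero>\<^bsub>B\<^esub>)"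
      using vW wW T_orth[OF V v w] by (auto simp: T_iso)
  qed (use D in auto)
  also have "\<dots> = T w \<otimes>\<^bsub>B\<^esub> \<sigma> V' (\<lambda>v'. \<phi> (w \<otimes> v'))"
    using w D by (subst B.M.finsum_singleton) (auto simp: Pi_def)
  finally show ?thesis .
qed

text \<open>The function varies by at most \<open>e\<close> on each coset of \<open>a M
  a\<^sup>-\<^sup>1\<close> in \<open>M\<close>, for functions on \<open>W\<close> whose value at
  \<open>m a\<close> is a value at the point \<open>m\<close> of \<open>M\<close>.\<close>

definition osc where
  "osc a e \<phi> \<longleftrightarrow> (\<forall>v\<in>W. \<forall>v'\<in>W. hp v = a \<and> hp v' = a \<and> inv v \<otimes> v' \<in> M \<longrightarrow> cmod (\<phi> v - \<phi> v') \<le> e)"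

definition Hinv where "Hinv \<phi> \<longleftrightarrow> (\<forall>w\<in>W. \<forall>b\<in>Hp. \<phi> (w \<otimes> b) = \<phi> w)"

text \<open>Invariance under \<open>H\<^sup>+\<close> from the right expresses that \<open>\<phi>(m a)\<close>
  depends on the point \<open>m\<close> alone, and the last condition is uniform continuity for the
  topology with neighbourhoods \<open>a M a\<^sup>-\<^sup>1\<close>. Functions on \<open>W\<close>
  instead of \<open>M\<close> make the shift \<open>\<phi> \<mapsto> \<phi>(w \<cdot>)\<close> a
  plain translation.\<close>

definition UW :: "('a \<Rightarrow> complex) set" where
  "UW = {\<phi>. (\<exists>K. \<forall>w\<in>W. cmod (\<phi> w) \<le> K) \<and> Hinv \<phi> \<and> (\<forall>e>0. \<exists>a\<in>Hp. osc a e \<phi>)}"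

lemma oscD: "\<lbrakk>osc a e \<phi>; v \<in> W; v' \<in> W; hp v = a; hp v' = a; inv v \<otimes> v' \<in> M\<rbrakk> \<Longrightarrow> cmod (\<phi> v - \<phi> v') \<le> e"
  unfolding osc_def by blast

lemma osc_weaken: "\<lbrakk>osc a e \<phi>; e \<le> e'\<rbrakk> \<Longrightarrow> osc a e' \<phi>"
  unfolding osc_def by (meson order_trans)

lemma osc_mono: assumes osc: "osc a e \<phi>" and a: "a \<in> Hp" and b: "b \<in> Hp" and inv: "Hinv \<phi>"
  shows "osc (a \<otimes> b) e \<phi>"
  unfolding osc_def
proof (intro ballI impI)
  fix v v' assume v: "v \<in> W" "v' \<in> W" and h: "hp v = a \<otimes> b \<and> hp v' = a \<otimes> b \<and> inv v \<otimes> v' \<in> M"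
  define y y' where "y = np v \<otimes> a" and "y' = np v' \<otimes> a"
  have y: "y \<in> W" "y' \<in> W" "hp y = a" "hp y' = a"
    using W_parts(1)[OF v(1)] W_parts(1)[OF v(2)] a by (simp_all add: y_def y'_def W_prod)
  have e1: "v = y \<otimes> b"
    using W_parts(3)[OF v(1)] h W_parts(1)[OF v(1)] a b unfolding y_def by (simp add: m_assoc)
  have e2: "v' = y' \<otimes> b"
    using W_parts(3)[OF v(2)] h W_parts(1)[OF v(2)] a b unfolding y'_def by (simp add: m_assoc)
  have "inv y \<otimes> y' = b \<otimes> (inv v \<otimes> v') \<otimes> inv b"
    using y b unfolding e1 e2 by (simp add: inv_mult_group m_assoc)
  then have "inv y \<otimes> y' \<in> M" using conj_M[OF b] h by simp
  then have "cmod (\<phi> y - \<phi> y') \<le> e" using oscD[OF osc y(1,2)] y(3,4) by blast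
  then show "cmod (\<phi> v - \<phi> v') \<le> e" using inv y b unfolding Hinv_def e1 e2 by simp
qed

lemma \<sigma>_refine: assumes V: "transversal a V" and V': "transversal b V'" and osc: "osc a e \<phi>" and e: "0 \<le> e" and inv: "Hinv \<phi>"
  shows "normB (\<sigma> V \<phi> \<ominus>\<^bsub>B\<^esub> \<sigma> (tmul V V') \<phi>) \<le> e"
proof -
  note D = transversalD(1,2,3)[OF V] and D' = transversalD(1,2,3)[OF V']
  have a: "a \<in> Hp" "b \<in> Hp" using V V' by (simp_all add: transversal_def)
  \<comment> \<open>On the finer partition \<open>\<phi>'\<close> repeats the value of \<open>\<phi>\<close> at the coarser representative, so its Riemann sum is the coarse one.\<close>
  define \<phi>' where "\<phi>' x = \<phi> (SOME v. v \<in> V \<and> (\<exists>v'\<in>V'. x = v \<otimes> v'))" for x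
  have \<phi>': "\<phi>' (v \<otimes> v') = \<phi> v" if v: "v \<in> V" "v' \<in> V'" for v v'
  proof -
    have "u = v" if u: "u \<in> V \<and> (\<exists>u'\<in>V'. v \<otimes> v' = u \<otimes> u')" for u
    proof -
      obtain u' where u': "u' \<in> V'" "v \<otimes> v' = u \<otimes> u'" using u by blast
      have "inv (u \<otimes> u') \<otimes> (v \<otimes> v') \<in> M" using u u' D(2) D'(2) by simp
      then show ?thesis using transversal_mult_inj(1)[OF V V' _ v(1) u'(1) v(2)] u by blast
    qed
    then have "(SOME u. u \<in> V \<and> (\<exists>u'\<in>V'. v \<otimes> v' = u \<otimes> u')) = v"
      using v by (intro some_equality) blast+
    then show ?thesis by (simp add: \<phi>'_def)
  qed
  have "\<sigma> (tmul V V') \<phi>' = (\<Oplus>\<^bsub>B\<^esub>v\<in>V. T v \<otimes>\<^bsub>B\<^esub> \<sigma> V' (\<lambda>v'. \<phi>' (v \<otimes> v')) \<otimes>\<^bsub>B\<^esub> starB (T v))"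
    by (rule \<sigma>_tmul[OF V V'])
  also have "\<dots> = (\<Oplus>\<^bsub>B\<^esub>v\<in>V. \<phi> v \<odot>\<^bsub>B\<^esub> Q v)"
  proof (rule B.pre.finsum_eqI)
    fix v assume v: "v \<in> V"
    have "\<sigma> V' (\<lambda>v'. \<phi>' (v \<otimes> v')) = \<sigma> V' (\<lambda>v'. \<phi> v * 1)"
      by (rule \<sigma>_cong[OF V']) (simp add: \<phi>' v)
    also have "\<dots> = \<phi> v \<odot>\<^bsub>B\<^esub> \<one>\<^bsub>B\<^esub>" unfolding \<sigma>_ops(2)[OF V', symmetric] \<sigma>_one[OF V'] ..
    finally show "T v \<otimes>\<^bsub>B\<^esub> \<sigma> V' (\<lambda>v'. \<phi>' (v \<otimes> v')) \<otimes>\<^bsub>B\<^esub> starB (T v) = \<phi> v \<odot>\<^bsub>B\<^esub> Q v"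
      using D(2)[OF v] by (simp add: Q_def B.pre.smult_times_l B.pre.smult_times_r)
    show "\<phi> v \<odot>\<^bsub>B\<^esub> Q v \<in> carrier B" using D(2)[OF v] by auto
  qed
  finally have "\<sigma> V \<phi> \<ominus>\<^bsub>B\<^esub> \<sigma> (tmul V V') \<phi> = \<sigma> (tmul V V') (\<lambda>x. \<phi>' x - \<phi> x)"
    unfolding \<sigma>_ops(5)[OF tmul_trans[OF V V'], symmetric] \<sigma>_def[of V] by simp
  also have "normB \<dots> \<le> e"
  proof (rule \<sigma>_norm[OF tmul_trans[OF V V'] _ e])
    fix x assume "x \<in> tmul V V'"
    then obtain v v' where v: "v \<in> V" "v' \<in> V'" "x = v \<otimes> v'" by (auto simp: tmul_def)
    have vW: "v \<in> W" "v' \<in> W" using v D D' by blast+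
    have m: "np v' \<in> M" "v' = np v' \<otimes> b" using W_parts[OF vW(2)] D'(3)[OF v(2)] by simp_all
    have vm: "v \<otimes> np v' \<in> W" by (rule W_mult[OF vW(1) M_W[OF m(1)]])
    have "cmod (\<phi> v - \<phi> (v \<otimes> np v')) \<le> e"
      by (rule oscD[OF osc vW(1) vm D(3)[OF v(1)]])
        (use vW m D(3)[OF v(1)] a in \<open>simp_all add: np_mult\<close>)
    also have "\<phi> (v \<otimes> np v') = \<phi> (v \<otimes> np v' \<otimes> b)" using inv vm a unfolding Hinv_def by simp
    also have "v \<otimes> np v' \<otimes> b = x" using m a vW v(3) by (metis m_assoc W_in_G in_G(3,4))
    finally show "cmod (\<phi>' x - \<phi> x) \<le> e" using \<phi>'[OF v(1,2)] v(3) by simp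
  qed
  finally show ?thesis .
qed

lemma \<sigma>_change: assumes V: "transversal a V" and V': "transversal a V'" and osc: "osc a e \<phi>" and e: "0 \<le> e"
  shows "normB (\<sigma> V \<phi> \<ominus>\<^bsub>B\<^esub> \<sigma> V' \<phi>) \<le> e"
proof -
  note D = transversalD[OF V] and D' = transversalD[OF V']
  have "\<exists>x\<in>V'. inv x \<otimes> v \<in> M" if "v \<in> V" for v using D'(4) D(2,3) that by blast
  then obtain h where h: "\<And>v. v \<in> V \<Longrightarrow> h v \<in> V'" "\<And>v. v \<in> V \<Longrightarrow> inv (h v) \<otimes> v \<in> M" by metis
  have in_W: "v \<in> W" "h v \<in> W" if "v \<in> V" for v using D(2) D'(2) h(1) that by blast+
  have inj: "inj_on h V"
  proof (rule inj_onI)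
    fix v v' assume v: "v \<in> V" "v' \<in> V" "h v = h v'"
    have "inv v \<otimes> v' \<in> M"
      using rel_trans[of v "h v" v'] rel_sym[of "h v" v] h(2)[OF v(1)] h(2)[OF v(2)] v in_W by simp
    then show "v = v'" using D(5) v by blast
  qed
  have im: "h ` V = V'"
  proof
    show "V' \<subseteq> h ` V"
    proof
      fix x assume x: "x \<in> V'"
      have xW: "x \<in> W" "hp x = a" using D'(2,3) x by blast+
      obtain v where v: "v \<in> V" "inv v \<otimes> x \<in> M" using D(4)[OF xW] by blast
      have "inv (h v) \<otimes> x \<in> M" using rel_trans[OF _ _ _ h(2)[OF v(1)] v(2)] in_W[OF v(1)] xW by simp
      then have "h v = x" using D'(5) h(1)[OF v(1)] x by blast
      then show "x \<in> h ` V" using v(1) by blast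
    qed
  qed (use h in blast)
  have "\<sigma> V' \<phi> = (\<Oplus>\<^bsub>B\<^esub>v\<in>V. \<phi> (h v) \<odot>\<^bsub>B\<^esub> Q (h v))"
    unfolding \<sigma>_def im[symmetric] by (rule B.M.finsum_reindex) (use inj in_W in auto)
  also have "\<dots> = \<sigma> V (\<lambda>v. \<phi> (h v))"
    unfolding \<sigma>_def by (rule B.pre.finsum_eqI) (use in_W h(2) Q_rel in metis, use in_W in auto)
  finally have "\<sigma> V \<phi> \<ominus>\<^bsub>B\<^esub> \<sigma> V' \<phi> = \<sigma> V (\<lambda>v. \<phi> v - \<phi> (h v))" by (simp add: \<sigma>_ops(5)[OF V])
  also have "normB \<dots> \<le> e"
  proof (rule \<sigma>_norm[OF V _ e])
    fix v assume v: "v \<in> V"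
    show "cmod (\<phi> v - \<phi> (h v)) \<le> e"
      by (rule oscD[OF osc]) (use in_W[OF v] D(3)[OF v] D'(3)[OF h(1)[OF v]] rel_sym[OF _ _ h(2)[OF v]] in simp_all)
  qed
  finally show ?thesis .
qed

text \<open>Both sums are compared with sums over their common refinement of level \<open>a b = b a\<close>,
  taken with the two product transversals: one \<open>e\<close> for each of the two refinements and
  one for the change of representatives.\<close>

lemma \<sigma>_compare: assumes V: "transversal a V" and V': "transversal b V'"
  and osc: "osc a e \<phi>" "osc b e \<phi>" and e: "0 \<le> e" and inv: "Hinv \<phi>"
  shows "normB (\<sigma> V \<phi> \<ominus>\<^bsub>B\<^esub> \<sigma> V' \<phi>) \<le> 3 * e"
proof -
  have a: "a \<in> Hp" "b \<in> Hp" using V V' by (simp_all add: transversal_def)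
  have ba: "b \<otimes> a = a \<otimes> b" using H_comm a by simp
  have t: "transversal (a \<otimes> b) (tmul V V')" "transversal (a \<otimes> b) (tmul V' V)"
    using tmul_trans[OF V V'] tmul_trans[OF V' V] ba by simp_all
  note c = \<sigma>_in[OF V, of \<phi>] \<sigma>_in[OF V', of \<phi>] \<sigma>_in[OF t(1), of \<phi>] \<sigma>_in[OF t(2), of \<phi>]
  have 1: "normB (\<sigma> V \<phi> \<ominus>\<^bsub>B\<^esub> \<sigma> (tmul V V') \<phi>) \<le> e" by (rule \<sigma>_refine[OF V V' osc(1) e inv])
  have 2: "normB (\<sigma> (tmul V V') \<phi> \<ominus>\<^bsub>B\<^esub> \<sigma> (tmul V' V) \<phi>) \<le> e"
    by (rule \<sigma>_change[OF t osc_mono[OF osc(1) a inv] e])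
  have 3: "normB (\<sigma> (tmul V' V) \<phi> \<ominus>\<^bsub>B\<^esub> \<sigma> V' \<phi>) \<le> e"
    using \<sigma>_refine[OF V' V osc(2) e inv] B.pre.nrm_minus_commute[OF c(4,2)] by simp
  have "normB (\<sigma> V \<phi> \<ominus>\<^bsub>B\<^esub> \<sigma> V' \<phi>) \<le> normB (\<sigma> V \<phi> \<ominus>\<^bsub>B\<^esub> \<sigma> (tmul V V') \<phi>) + normB (\<sigma> (tmul V V') \<phi> \<ominus>\<^bsub>B\<^esub> \<sigma> V' \<phi>)"
    using c by (intro B.pre.nrm_triangle)
  moreover have "normB (\<sigma> (tmul V V') \<phi> \<ominus>\<^bsub>B\<^esub> \<sigma> V' \<phi>)
      \<le> normB (\<sigma> (tmul V V') \<phi> \<ominus>\<^bsub>B\<^esub> \<sigma> (tmul V' V) \<phi>) + normB (\<sigma> (tmul V' V) \<phi> \<ominus>\<^bsub>B\<^esub> \<sigma> V' \<phi>)"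
    using c by (intro B.pre.nrm_triangle)
  ultimately show ?thesis using 1 2 3 by linarith
qed

text \<open>The constant is the one with which two Riemann sums of oscillation \<open>e\<close> can be compared;
  the estimate for all levels at once characterises the limit.\<close>

definition \<rho> where
  "\<rho> \<phi> = (THE b. b \<in> carrier B \<and>
     (\<forall>e a V. osc a e \<phi> \<and> 0 \<le> e \<and> transversal a V \<longrightarrow> normB (b \<ominus>\<^bsub>B\<^esub> \<sigma> V \<phi>) \<le> 3 * e))"

lemma UW_D: assumes "\<phi> \<in> UW" shows "Hinv \<phi>" "0 < e \<Longrightarrow> \<exists>a\<in>Hp. osc a e \<phi>" "\<exists>K\<ge>0. \<forall>w\<in>W. cmod (\<phi> w) \<le> K"
proof -
  show "Hinv \<phi>" "0 < e \<Longrightarrow> \<exists>a\<in>Hp. osc a e \<phi>" using assms unfolding UW_def by blast+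
  obtain K where "\<forall>w\<in>W. cmod (\<phi> w) \<le> K" using assms unfolding UW_def by blast
  then have "\<forall>w\<in>W. cmod (\<phi> w) \<le> max K 0" by (simp add: max.coboundedI1)
  then show "\<exists>K\<ge>0. \<forall>w\<in>W. cmod (\<phi> w) \<le> K" by (intro exI[of _ "max K 0"]) simp
qed

lemma transversal_ex: assumes "a \<in> Hp" obtains V where "transversal a V"
  using transversal_exists[OF Hp_W[OF assms]] assms by auto

lemma \<rho>_exists: assumes \<phi>: "\<phi> \<in> UW"
  shows "\<exists>b. b \<in> carrier B \<and> (\<forall>e a V. osc a e \<phi> \<and> 0 \<le> e \<and> transversal a V \<longrightarrow> normB (b \<ominus>\<^bsub>B\<^esub> \<sigma> V \<phi>) \<le> 3 * e)"
proof -
  note inv = UW_D(1)[OF \<phi>]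
  have "\<exists>a V. osc a (1 / real (Suc n)) \<phi> \<and> transversal a V" for n
    using UW_D(2)[OF \<phi>, of "1 / real (Suc n)"] transversal_ex by (metis of_nat_0_less_iff zero_less_Suc zero_less_divide_1_iff)
  then obtain a V where a: "\<And>n. osc (a n) (1 / real (Suc n)) \<phi>" and V: "\<And>n. transversal (a n) (V n)"
    by metis
  define s where "s n = \<sigma> (V n) \<phi>" for n
  have s [simp]: "s n \<in> carrier B" for n unfolding s_def by (rule \<sigma>_in[OF V])
  have close: "normB (s n \<ominus>\<^bsub>B\<^esub> \<sigma> V' \<phi>) \<le> 3 * max (1 / real (Suc n)) e"
    if "osc b e \<phi>" "0 \<le> e" "transversal b V'" for n b e V'
    unfolding s_def
    by (rule \<sigma>_compare[OF V that(3) osc_weaken[OF a] osc_weaken[OF that(1)] _ inv])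
      (use that(2) in \<open>simp_all add: le_max_iff_disj\<close>)
  have lim0: "(\<lambda>n. 1 / real (Suc n)) \<longlonglongrightarrow> 0"
    using LIMSEQ_inverse_real_of_nat by (simp add: inverse_eq_divide)
  have "B.pre.cauchy s"
  proof (rule B.pre.cauchyI[where f = "\<lambda>m. 3 * (1 / real (Suc m))", OF s])
    fix m n :: nat assume mn: "m \<le> n"
    have "normB (s m \<ominus>\<^bsub>B\<^esub> \<sigma> (V n) \<phi>) \<le> 3 * max (1 / real (Suc m)) (1 / real (Suc n))"
      by (rule close[OF a _ V]) simp
    then have "normB (s m \<ominus>\<^bsub>B\<^esub> s n) \<le> 3 * max (1 / real (Suc m)) (1 / real (Suc n))"
      unfolding s_def[of n] .
    also have "max (1 / real (Suc m)) (1 / real (Suc n)) = 1 / real (Suc m)"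
      using mn by (simp add: max_def field_simps)
    finally show "normB (s n \<ominus>\<^bsub>B\<^esub> s m) \<le> 3 * (1 / real (Suc m))"
      using B.pre.nrm_minus_commute[OF s s, of m n] by simp
  next
    show "(\<lambda>m. 3 * (1 / real (Suc m))) \<longlonglongrightarrow> 0" using tendsto_mult_left[OF lim0, of 3] by simp
  qed
  then obtain b where b: "B.pre.conv s b" using B.cauchy_conv by blast
  have bc: "b \<in> carrier B" using b by (simp add: B.pre.conv_def)
  have "normB (b \<ominus>\<^bsub>B\<^esub> \<sigma> V' \<phi>) \<le> 3 * e" if H: "osc c e \<phi>" "0 \<le> e" "transversal c V'" for c e V'
  proof (rule LIMSEQ_le)
    show "(\<lambda>n. normB (s n \<ominus>\<^bsub>B\<^esub> \<sigma> V' \<phi>)) \<longlonglongrightarrow> normB (b \<ominus>\<^bsub>B\<^esub> \<sigma> V' \<phi>)"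
      by (rule B.pre.conv_nrm[OF B.pre.conv_minus[OF b B.pre.conv_const[OF \<sigma>_in[OF H(3)]]]])
    show "(\<lambda>n. 3 * (1 / real (Suc n) + e)) \<longlonglongrightarrow> 3 * e"
      using tendsto_mult_left[OF tendsto_add[OF lim0 tendsto_const[of e]], of 3] by simp
    have "normB (s n \<ominus>\<^bsub>B\<^esub> \<sigma> V' \<phi>) \<le> 3 * (1 / real (Suc n) + e)" for n
    proof -
      have "max (1 / real (Suc n)) e \<le> 1 / real (Suc n) + e"
        using H(2) by (intro max.boundedI add_increasing add_increasing2) auto
      then have "3 * max (1 / real (Suc n)) e \<le> 3 * (1 / real (Suc n) + e)" by (rule mult_left_mono) simp
      with close[OF H, of n] show ?thesis by (rule order_trans)
    qed
    then show "\<exists>K. \<forall>n\<ge>K. normB (s n \<ominus>\<^bsub>B\<^esub> \<sigma> V' \<phi>) \<le> 3 * (1 / real (Suc n) + e)" by blast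
  qed
  then show ?thesis using bc by blast
qed

text \<open>An estimate with any constant \<open>C\<close> along some levels of arbitrarily small oscillation
  already identifies the limit. All algebraic properties of \<open>\<rho>\<close> are obtained by
  exhibiting such an estimate.\<close>

lemma \<rho>_unique: assumes \<phi>: "\<phi> \<in> UW" and b: "b \<in> carrier B" "b' \<in> carrier B" and C: "0 \<le> C"
  and b': "\<And>e a V. \<lbrakk>osc a e \<phi>; 0 \<le> e; transversal a V\<rbrakk> \<Longrightarrow> normB (b' \<ominus>\<^bsub>B\<^esub> \<sigma> V \<phi>) \<le> 3 * e"
  and ex: "\<And>e. 0 < e \<Longrightarrow> \<exists>a V. osc a e \<phi> \<and> transversal a V \<and> normB (b \<ominus>\<^bsub>B\<^esub> \<sigma> V \<phi>) \<le> C * e"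
  shows "b = b'"
proof -
  have le: "normB (b \<ominus>\<^bsub>B\<^esub> b') \<le> (C + 3) * e" if e: "0 < e" for e
  proof -
    obtain a V where V: "osc a e \<phi>" "transversal a V" "normB (b \<ominus>\<^bsub>B\<^esub> \<sigma> V \<phi>) \<le> C * e" using ex[OF e] by blast
    have s: "\<sigma> V \<phi> \<in> carrier B" using V(2) by (rule \<sigma>_in)
    have "normB (b \<ominus>\<^bsub>B\<^esub> b') \<le> normB (b \<ominus>\<^bsub>B\<^esub> \<sigma> V \<phi>) + normB (\<sigma> V \<phi> \<ominus>\<^bsub>B\<^esub> b')" by (rule B.pre.nrm_triangle[OF b(1) s b(2)])
    also have "normB (\<sigma> V \<phi> \<ominus>\<^bsub>B\<^esub> b') \<le> 3 * e"
      using b'[OF V(1) _ V(2)] e B.pre.nrm_minus_commute[OF s b(2)] by simp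
    finally show ?thesis using V(3) by (simp add: algebra_simps)
  qed
  have "normB (b \<ominus>\<^bsub>B\<^esub> b') \<le> 0"
  proof (rule field_le_epsilon)
    fix d :: real assume d: "0 < d"
    have "normB (b \<ominus>\<^bsub>B\<^esub> b') \<le> (C + 3) * (d / (C + 3))" using le[of "d / (C + 3)"] d C by simp
    then show "normB (b \<ominus>\<^bsub>B\<^esub> b') \<le> 0 + d" using C by simp
  qed
  then show ?thesis using b B.pre.nrm_le_0[of "b \<ominus>\<^bsub>B\<^esub> b'"] B.pre.minus_eq_0 by simp
qed

lemma \<rho>: assumes \<phi>: "\<phi> \<in> UW"
  shows "\<rho> \<phi> \<in> carrier B" "\<lbrakk>osc a e \<phi>; 0 \<le> e; transversal a V\<rbrakk> \<Longrightarrow> normB (\<rho> \<phi> \<ominus>\<^bsub>B\<^esub> \<sigma> V \<phi>) \<le> 3 * e"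
proof -
  have "\<exists>!b. b \<in> carrier B \<and> (\<forall>e a V. osc a e \<phi> \<and> 0 \<le> e \<and> transversal a V \<longrightarrow> normB (b \<ominus>\<^bsub>B\<^esub> \<sigma> V \<phi>) \<le> 3 * e)"
  proof (rule ex_ex1I[OF \<rho>_exists[OF \<phi>]])
    fix b b' assume b: "b \<in> carrier B \<and> (\<forall>e a V. osc a e \<phi> \<and> 0 \<le> e \<and> transversal a V \<longrightarrow> normB (b \<ominus>\<^bsub>B\<^esub> \<sigma> V \<phi>) \<le> 3 * e)"
      and b': "b' \<in> carrier B \<and> (\<forall>e a V. osc a e \<phi> \<and> 0 \<le> e \<and> transversal a V \<longrightarrow> normB (b' \<ominus>\<^bsub>B\<^esub> \<sigma> V \<phi>) \<le> 3 * e)"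
    show "b = b'"
    proof (rule \<rho>_unique[OF \<phi>, of _ _ 3])
      fix e :: real assume e: "0 < e"
      obtain a where a: "a \<in> Hp" "osc a e \<phi>" using UW_D(2)[OF \<phi> e] by blast
      obtain V where V: "transversal a V" using transversal_ex a by blast
      have "normB (b \<ominus>\<^bsub>B\<^esub> \<sigma> V \<phi>) \<le> 3 * e" using b a V e by (meson less_imp_le)
      then show "\<exists>a V. osc a e \<phi> \<and> transversal a V \<and> normB (b \<ominus>\<^bsub>B\<^esub> \<sigma> V \<phi>) \<le> 3 * e" using a V by blast
    qed (use b b' in auto)
  qed
  from theI'[OF this, folded \<rho>_def]
  show "\<rho> \<phi> \<in> carrier B" "\<lbrakk>osc a e \<phi>; 0 \<le> e; transversal a V\<rbrakk> \<Longrightarrow> normB (\<rho> \<phi> \<ominus>\<^bsub>B\<^esub> \<sigma> V \<phi>) \<le> 3 * e" by blast+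
qed

lemma \<rho>_eqI: assumes "\<phi> \<in> UW" "b \<in> carrier B" "0 \<le> C"
  "\<And>e. 0 < e \<Longrightarrow> \<exists>a V. osc a e \<phi> \<and> transversal a V \<and> normB (b \<ominus>\<^bsub>B\<^esub> \<sigma> V \<phi>) \<le> C * e"
  shows "\<rho> \<phi> = b"
  using \<rho>_unique[OF assms(1,2) \<rho>(1)[OF assms(1)] assms(3) \<rho>(2)[OF assms(1)] assms(4)] by simp

end

lemma small_scale:
  fixes e K L :: real assumes "0 < e" "0 \<le> K" "0 \<le> L" obtains d where "0 < d" "K * d + d * L \<le> e"
proof
  let ?d = "e / (K + L + 1)"
  show d: "0 < ?d" using assms by simp
  have "(K + L + 1) * ?d = e" using assms by simp
  then show "K * ?d + ?d * L \<le> e" using d by (simp only: distrib_right mult.commute[of ?d L])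
qed

context su_rep
begin

lemma M_mult_iff: assumes "g \<in> carrier G" "k \<in> M" shows "g \<otimes> k \<in> M \<longleftrightarrow> g \<in> M"
proof
  assume "g \<otimes> k \<in> M"
  then have "g \<otimes> k \<otimes> inv k \<in> M" using assms(2) by (simp add: sub_closed)
  then show "g \<in> M" using assms by (simp add: m_assoc)
qed (use assms in \<open>simp add: sub_closed\<close>)

lemma osc_pair: assumes "\<phi> \<in> UW" "\<psi> \<in> UW" "0 < e" obtains a V where "a \<in> Hp" "osc a e \<phi>" "osc a e \<psi>" "transversal a V"
proof -
  obtain a where a: "a \<in> Hp" "osc a e \<phi>" using UW_D(2)[OF assms(1,3)] by blast
  obtain b where b: "b \<in> Hp" "osc b e \<psi>" using UW_D(2)[OF assms(2,3)] by blast
  have "osc (a \<otimes> b) e \<phi>" by (rule osc_mono[OF a(2,1) b(1) UW_D(1)[OF assms(1)]])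
  moreover have "osc (a \<otimes> b) e \<psi>"
    using osc_mono[OF b(2,1) a(1) UW_D(1)[OF assms(2)]] H_comm[of a b] a b by simp
  moreover obtain V where "transversal (a \<otimes> b) V" using transversal_ex[OF Hp_mult[OF a(1) b(1)]] by blast
  ultimately show thesis using that Hp_mult[OF a(1) b(1)] by blast
qed

lemma UW_I: assumes "\<forall>w\<in>W. cmod (\<phi> w) \<le> K" "\<And>w b. w \<in> W \<Longrightarrow> b \<in> Hp \<Longrightarrow> \<phi> (w \<otimes> b) = \<phi> w" "\<And>e. 0 < e \<Longrightarrow> \<exists>a\<in>Hp. osc a e \<phi>"
  shows "\<phi> \<in> UW"
  unfolding UW_def Hinv_def using assms by blast

lemma osc_add: assumes "osc a e \<phi>" "osc a e' \<psi>" shows "osc a (e + e') (\<lambda>v. \<phi> v + \<psi> v)"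
  unfolding osc_def
proof (intro ballI impI)
  fix v v' assume v: "v \<in> W" "v' \<in> W" "hp v = a \<and> hp v' = a \<and> inv v \<otimes> v' \<in> M"
  have "cmod ((\<phi> v + \<psi> v) - (\<phi> v' + \<psi> v')) \<le> cmod (\<phi> v - \<phi> v') + cmod (\<psi> v - \<psi> v')"
    using norm_triangle_ineq[of "\<phi> v - \<phi> v'" "\<psi> v - \<psi> v'"] by (simp add: algebra_simps)
  then show "cmod ((\<phi> v + \<psi> v) - (\<phi> v' + \<psi> v')) \<le> e + e'"
    using oscD[OF assms(1) v(1,2)] oscD[OF assms(2) v(1,2)] v(3) by fastforce
qed

lemma osc_smult: assumes "osc a e \<phi>" shows "osc a (cmod c * e) (\<lambda>v. c * \<phi> v)"
  using assms unfolding osc_def by (auto simp: right_diff_distrib[symmetric] norm_mult mult_left_mono)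

lemma osc_cnj: assumes "osc a e \<phi>" shows "osc a e (\<lambda>v. cnj (\<phi> v))"
  using assms unfolding osc_def by (simp add: complex_cnj_diff[symmetric] del: complex_cnj_diff)

lemma osc_mult: assumes "osc a e \<phi>" "osc a e \<psi>" "\<forall>w\<in>W. cmod (\<phi> w) \<le> K" "\<forall>w\<in>W. cmod (\<psi> w) \<le> L"
  shows "osc a (K * e + e * L) (\<lambda>v. \<phi> v * \<psi> v)"
  unfolding osc_def
proof (intro ballI impI)
  fix v v' assume v: "v \<in> W" "v' \<in> W" "hp v = a \<and> hp v' = a \<and> inv v \<otimes> v' \<in> M"
  have "\<phi> v * \<psi> v - \<phi> v' * \<psi> v' = \<phi> v * (\<psi> v - \<psi> v') + (\<phi> v - \<phi> v') * \<psi> v'" by (simp add: algebra_simps)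
  also have "cmod \<dots> \<le> cmod (\<phi> v) * cmod (\<psi> v - \<psi> v') + cmod (\<phi> v - \<phi> v') * cmod (\<psi> v')"
    by (metis norm_mult norm_triangle_ineq)
  also have "\<dots> \<le> K * e + e * L"
    using oscD[OF assms(1) v(1,2)] oscD[OF assms(2) v(1,2)] v assms(3,4)
    by (intro add_mono mult_mono) (auto intro: order_trans[OF norm_ge_zero])
  finally show "cmod (\<phi> v * \<psi> v - \<phi> v' * \<psi> v') \<le> K * e + e * L" .
qed

lemma UW_add: assumes \<phi>: "\<phi> \<in> UW" and \<psi>: "\<psi> \<in> UW" shows "(\<lambda>v. \<phi> v + \<psi> v) \<in> UW"
proof -
  obtain K where K: "\<forall>w\<in>W. cmod (\<phi> w) \<le> K" using UW_D(3)[OF \<phi>] by blast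
  obtain L where L: "\<forall>w\<in>W. cmod (\<psi> w) \<le> L" using UW_D(3)[OF \<psi>] by blast
  show ?thesis
  proof (rule UW_I)
    show "\<forall>w\<in>W. cmod (\<phi> w + \<psi> w) \<le> K + L" using K L by (meson add_mono norm_triangle_ineq order_trans)
    show "\<phi> (w \<otimes> b) + \<psi> (w \<otimes> b) = \<phi> w + \<psi> w" if "w \<in> W" "b \<in> Hp" for w b
      using that UW_D(1)[OF \<phi>] UW_D(1)[OF \<psi>] by (simp add: Hinv_def)
    fix e :: real assume "0 < e"
    then obtain a where "a \<in> Hp" "osc a (e / 2) \<phi>" "osc a (e / 2) \<psi>" using osc_pair[OF \<phi> \<psi>, of "e / 2"] by auto
    then show "\<exists>a\<in>Hp. osc a e (\<lambda>v. \<phi> v + \<psi> v)" using osc_add[of a "e / 2" \<phi> "e / 2" \<psi>] by auto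
  qed
qed

lemma UW_smult: assumes \<phi>: "\<phi> \<in> UW" shows "(\<lambda>v. c * \<phi> v) \<in> UW"
proof -
  obtain K where K: "\<forall>w\<in>W. cmod (\<phi> w) \<le> K" using UW_D(3)[OF \<phi>] by blast
  show ?thesis
  proof (rule UW_I)
    show "\<forall>w\<in>W. cmod (c * \<phi> w) \<le> cmod c * K" using K by (simp add: norm_mult mult_left_mono)
    show "c * \<phi> (w \<otimes> b) = c * \<phi> w" if "w \<in> W" "b \<in> Hp" for w b
      using that UW_D(1)[OF \<phi>] by (simp add: Hinv_def)
    fix e :: real assume e: "0 < e"
    have p: "0 < cmod c + 1" by (simp add: add_nonneg_pos)
    then obtain a where a: "a \<in> Hp" "osc a (e / (cmod c + 1)) \<phi>" using UW_D(2)[OF \<phi>, of "e / (cmod c + 1)"] e by auto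
    have "cmod c * (e / (cmod c + 1)) \<le> e" using e p by (simp add: field_simps)
    then show "\<exists>a\<in>Hp. osc a e (\<lambda>v. c * \<phi> v)" using osc_weaken[OF osc_smult[OF a(2), of c]] a(1) by blast
  qed
qed

lemma UW_cnj: assumes \<phi>: "\<phi> \<in> UW" shows "(\<lambda>v. cnj (\<phi> v)) \<in> UW"
proof -
  obtain K where K: "\<forall>w\<in>W. cmod (\<phi> w) \<le> K" using UW_D(3)[OF \<phi>] by blast
  show ?thesis
  proof (rule UW_I)
    show "\<forall>w\<in>W. cmod (cnj (\<phi> w)) \<le> K" using K by simp
    show "cnj (\<phi> (w \<otimes> b)) = cnj (\<phi> w)" if "w \<in> W" "b \<in> Hp" for w b
      using that UW_D(1)[OF \<phi>] by (simp add: Hinv_def)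
    show "\<exists>a\<in>Hp. osc a e (\<lambda>v. cnj (\<phi> v))" if "0 < e" for e
      using UW_D(2)[OF \<phi> that] osc_cnj by blast
  qed
qed

lemma UW_mult: assumes \<phi>: "\<phi> \<in> UW" and \<psi>: "\<psi> \<in> UW" shows "(\<lambda>v. \<phi> v * \<psi> v) \<in> UW"
proof -
  obtain K where K: "0 \<le> K" "\<forall>w\<in>W. cmod (\<phi> w) \<le> K" using UW_D(3)[OF \<phi>] by blast
  obtain L where L: "0 \<le> L" "\<forall>w\<in>W. cmod (\<psi> w) \<le> L" using UW_D(3)[OF \<psi>] by blast
  show ?thesis
  proof (rule UW_I)
    show "\<forall>w\<in>W. cmod (\<phi> w * \<psi> w) \<le> K * L" using K L by (simp add: norm_mult mult_mono)
    show "\<phi> (w \<otimes> b) * \<psi> (w \<otimes> b) = \<phi> w * \<psi> w" if "w \<in> W" "b \<in> Hp" for w b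
      using that UW_D(1)[OF \<phi>] UW_D(1)[OF \<psi>] by (simp add: Hinv_def)
    fix e :: real assume e: "0 < e"
      obtain d where d: "0 < d" "K * d + d * L \<le> e" using small_scale[OF e K(1) L(1)] by blast
    obtain a where a: "a \<in> Hp" "osc a d \<phi>" "osc a d \<psi>" using osc_pair[OF \<phi> \<psi> d(1)] by blast
    show "\<exists>a\<in>Hp. osc a e (\<lambda>v. \<phi> v * \<psi> v)" using osc_weaken[OF osc_mult[OF a(2,3) K(2) L(2)] d(2)] a(1) by blast
  qed
qed

lemma UW_one: "(\<lambda>_. 1) \<in> UW"
  by (rule UW_I[of _ 1]) (auto simp: osc_def)

lemma \<rho>_norm: assumes \<phi>: "\<phi> \<in> UW" and K: "0 \<le> K" "\<And>w. w \<in> W \<Longrightarrow> cmod (\<phi> w) \<le> K" shows "normB (\<rho> \<phi>) \<le> K"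
proof (rule field_le_epsilon)
  fix e :: real assume e: "0 < e"
  then have p: "0 < e / 3" by simp
  obtain a V where V: "osc a (e / 3) \<phi>" "transversal a V" using osc_pair[OF \<phi> \<phi> p] by blast
  note c = \<rho>(1)[OF \<phi>] \<sigma>_in[OF V(2), of \<phi>]
  have "normB (\<rho> \<phi>) = normB ((\<rho> \<phi> \<ominus>\<^bsub>B\<^esub> \<sigma> V \<phi>) \<oplus>\<^bsub>B\<^esub> \<sigma> V \<phi>)" using c by (simp add: B.pre.minus_add_cancel)
  also have "\<dots> \<le> 3 * (e / 3) + K"
    using c \<rho>(2)[OF \<phi> V(1) _ V(2)] e \<sigma>_norm[OF V(2) K(2) K(1)] transversalD(2)[OF V(2)]
    by (intro B.pre.nrm_add_le) auto
  finally show "normB (\<rho> \<phi>) \<le> K + e" by simp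
qed

lemma \<rho>_add: assumes \<phi>: "\<phi> \<in> UW" and \<psi>: "\<psi> \<in> UW" shows "\<rho> (\<lambda>v. \<phi> v + \<psi> v) = \<rho> \<phi> \<oplus>\<^bsub>B\<^esub> \<rho> \<psi>"
proof (rule \<rho>_eqI[OF UW_add[OF \<phi> \<psi>], of _ 3])
  fix e :: real assume e: "0 < e"
  then have p: "0 < e / 2" by simp
  obtain a V where V: "osc a (e / 2) \<phi>" "osc a (e / 2) \<psi>" "transversal a V" using osc_pair[OF \<phi> \<psi> p] by blast
  note c = \<rho>(1)[OF \<phi>] \<rho>(1)[OF \<psi>] \<sigma>_in[OF V(3), of \<phi>] \<sigma>_in[OF V(3), of \<psi>]
  have "normB ((\<rho> \<phi> \<ominus>\<^bsub>B\<^esub> \<sigma> V \<phi>) \<oplus>\<^bsub>B\<^esub> (\<rho> \<psi> \<ominus>\<^bsub>B\<^esub> \<sigma> V \<psi>)) \<le> 3 * (e / 2) + 3 * (e / 2)"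
    using c \<rho>(2)[OF \<phi> V(1) _ V(3)] \<rho>(2)[OF \<psi> V(2) _ V(3)] e by (intro B.pre.nrm_add_le) auto
  then have "normB ((\<rho> \<phi> \<oplus>\<^bsub>B\<^esub> \<rho> \<psi>) \<ominus>\<^bsub>B\<^esub> \<sigma> V (\<lambda>v. \<phi> v + \<psi> v)) \<le> 3 * e"
    using c by (simp add: \<sigma>_ops(1)[OF V(3), symmetric] B.pre.add_minus_add)
  then show "\<exists>a V. osc a e (\<lambda>v. \<phi> v + \<psi> v) \<and> transversal a V \<and> normB ((\<rho> \<phi> \<oplus>\<^bsub>B\<^esub> \<rho> \<psi>) \<ominus>\<^bsub>B\<^esub> \<sigma> V (\<lambda>v. \<phi> v + \<psi> v)) \<le> 3 * e"
    using osc_add[OF V(1,2)] V(3) by auto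
qed (use \<rho>(1) \<phi> \<psi> in auto)

lemma \<rho>_smult: assumes \<phi>: "\<phi> \<in> UW" shows "\<rho> (\<lambda>v. c * \<phi> v) = c \<odot>\<^bsub>B\<^esub> \<rho> \<phi>"
proof (rule \<rho>_eqI[OF UW_smult[OF \<phi>], of _ 3])
  fix e :: real assume e: "0 < e"
  define d where "d = e / (cmod c + 1)"
  have p: "0 < cmod c + 1" by (simp add: add_nonneg_pos)
  have d: "0 < d" "cmod c * d \<le> e" using e p by (auto simp: d_def field_simps)
  obtain a V where V: "osc a d \<phi>" "transversal a V" using osc_pair[OF \<phi> \<phi> d(1)] by blast
  note k = \<rho>(1)[OF \<phi>] \<sigma>_in[OF V(2), of \<phi>]
  have "normB (c \<odot>\<^bsub>B\<^esub> \<rho> \<phi> \<ominus>\<^bsub>B\<^esub> \<sigma> V (\<lambda>v. c * \<phi> v)) = cmod c * normB (\<rho> \<phi> \<ominus>\<^bsub>B\<^esub> \<sigma> V \<phi>)"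
    using k by (simp add: \<sigma>_ops(2)[OF V(2), symmetric] B.pre.smult_minus[symmetric] B.pre.nrm_smult)
  also have "\<dots> \<le> cmod c * (3 * d)" using \<rho>(2)[OF \<phi> V(1) _ V(2)] d(1) by (intro mult_left_mono) auto
  also have "\<dots> \<le> 3 * e" using d(2) by simp
  finally show "\<exists>a V. osc a e (\<lambda>v. c * \<phi> v) \<and> transversal a V \<and> normB (c \<odot>\<^bsub>B\<^esub> \<rho> \<phi> \<ominus>\<^bsub>B\<^esub> \<sigma> V (\<lambda>v. c * \<phi> v)) \<le> 3 * e"
    using osc_weaken[OF osc_smult[OF V(1)] d(2)] V(2) by blast
qed (use \<rho>(1) \<phi> in auto)

lemma \<rho>_cnj: assumes \<phi>: "\<phi> \<in> UW" shows "\<rho> (\<lambda>v. cnj (\<phi> v)) = starB (\<rho> \<phi>)"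
proof (rule \<rho>_eqI[OF UW_cnj[OF \<phi>], of _ 3])
  fix e :: real assume e: "0 < e"
  obtain a V where V: "osc a e \<phi>" "transversal a V" using osc_pair[OF \<phi> \<phi> e] by blast
  note c = \<rho>(1)[OF \<phi>] \<sigma>_in[OF V(2), of \<phi>]
  have "normB (starB (\<rho> \<phi>) \<ominus>\<^bsub>B\<^esub> \<sigma> V (\<lambda>v. cnj (\<phi> v))) = normB (\<rho> \<phi> \<ominus>\<^bsub>B\<^esub> \<sigma> V \<phi>)"
    using c by (simp add: \<sigma>_ops(4)[OF V(2), symmetric] B.pre.adj_minus[symmetric])
  then show "\<exists>a V. osc a e (\<lambda>v. cnj (\<phi> v)) \<and> transversal a V \<and> normB (starB (\<rho> \<phi>) \<ominus>\<^bsub>B\<^esub> \<sigma> V (\<lambda>v. cnj (\<phi> v))) \<le> 3 * e"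
    using \<rho>(2)[OF \<phi> V(1) _ V(2)] e osc_cnj[OF V(1)] V(2) by (intro exI[of _ a] exI[of _ V]) simp
qed (use \<rho>(1) \<phi> in auto)

text \<open>Riemann sums over one transversal multiply exactly, so only the boundedness of both functions is
  needed to pass to the limit.\<close>

lemma \<rho>_mult: assumes \<phi>: "\<phi> \<in> UW" and \<psi>: "\<psi> \<in> UW" shows "\<rho> (\<lambda>v. \<phi> v * \<psi> v) = \<rho> \<phi> \<otimes>\<^bsub>B\<^esub> \<rho> \<psi>"
proof (rule \<rho>_eqI[OF UW_mult[OF \<phi> \<psi>], of _ 3])
  fix e :: real assume e: "0 < e"
  obtain K where K: "0 \<le> K" "\<forall>w\<in>W. cmod (\<phi> w) \<le> K" using UW_D(3)[OF \<phi>] by blast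
  obtain L where L: "0 \<le> L" "\<forall>w\<in>W. cmod (\<psi> w) \<le> L" using UW_D(3)[OF \<psi>] by blast
  obtain d where d: "0 < d" "K * d + d * L \<le> e" using small_scale[OF e K(1) L(1)] by blast
  obtain a V where V: "osc a d \<phi>" "osc a d \<psi>" "transversal a V" using osc_pair[OF \<phi> \<psi> d(1)] by blast
  note c = \<rho>(1)[OF \<phi>] \<rho>(1)[OF \<psi>] \<sigma>_in[OF V(3), of \<phi>] \<sigma>_in[OF V(3), of \<psi>]
  have "normB (\<rho> \<phi> \<otimes>\<^bsub>B\<^esub> \<rho> \<psi> \<ominus>\<^bsub>B\<^esub> \<sigma> V \<phi> \<otimes>\<^bsub>B\<^esub> \<sigma> V \<psi>) \<le> L * normB (\<rho> \<phi> \<ominus>\<^bsub>B\<^esub> \<sigma> V \<phi>) + K * normB (\<rho> \<psi> \<ominus>\<^bsub>B\<^esub> \<sigma> V \<psi>)"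
    using c K L transversalD(2)[OF V(3)]
    by (intro B.pre.nrm_times_diff) (auto intro!: \<rho>_norm \<phi> \<sigma>_norm[OF V(3)])
  also have "\<dots> \<le> L * (3 * d) + K * (3 * d)"
    using \<rho>(2)[OF \<phi> V(1) _ V(3)] \<rho>(2)[OF \<psi> V(2) _ V(3)] d(1) K L by (intro add_mono mult_left_mono) auto
  also have "\<dots> \<le> 3 * e" using d(2) by (simp add: algebra_simps)
  finally have "normB (\<rho> \<phi> \<otimes>\<^bsub>B\<^esub> \<rho> \<psi> \<ominus>\<^bsub>B\<^esub> \<sigma> V (\<lambda>v. \<phi> v * \<psi> v)) \<le> 3 * e" by (simp add: \<sigma>_ops(3)[OF V(3)])
  then show "\<exists>a V. osc a e (\<lambda>v. \<phi> v * \<psi> v) \<and> transversal a V \<and> normB (\<rho> \<phi> \<otimes>\<^bsub>B\<^esub> \<rho> \<psi> \<ominus>\<^bsub>B\<^esub> \<sigma> V (\<lambda>v. \<phi> v * \<psi> v)) \<le> 3 * e"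
    using osc_weaken[OF osc_mult[OF V(1,2) K(2) L(2)] d(2)] V(3) by blast
qed (use \<rho>(1) \<phi> \<psi> in auto)

lemma \<rho>_exact: assumes "\<phi> \<in> UW" "osc a 0 \<phi>" "transversal a V" shows "\<rho> \<phi> = \<sigma> V \<phi>"
  using \<rho>(2)[OF assms(1,2) _ assms(3)] \<rho>(1)[OF assms(1)] \<sigma>_in[OF assms(3), of \<phi>]
    B.pre.nrm_le_0[of "\<rho> \<phi> \<ominus>\<^bsub>B\<^esub> \<sigma> V \<phi>"] B.pre.minus_eq_0[of "\<rho> \<phi>" "\<sigma> V \<phi>"] by simp

lemma \<rho>_one: "\<rho> (\<lambda>_. 1) = \<one>\<^bsub>B\<^esub>"
proof -
  obtain V where V: "transversal \<one> V" using transversal_ex[OF Hp_one] by blast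
  have "osc \<one> 0 (\<lambda>_. 1)" by (simp add: osc_def)
  then show ?thesis using \<rho>_exact[OF UW_one _ V] \<sigma>_one[OF V] by simp
qed

lemma osc_shift: assumes osc: "osc a e \<phi>" and inv: "Hinv \<phi>" and a: "a \<in> Hp" and w: "w \<in> W"
  shows "osc a e (\<lambda>v. \<phi> (w \<otimes> v))"
  unfolding osc_def
proof (intro ballI impI)
  fix v v' assume v: "v \<in> W" "v' \<in> W" "hp v = a \<and> hp v' = a \<and> inv v \<otimes> v' \<in> M"
  have h: "hp w \<in> Hp" using W_parts(2)[OF w] .
  have osc': "osc (hp w \<otimes> a) e \<phi>"
    using osc_mono[OF osc a h inv] H_comm[of a "hp w"] a h by simp
  show "cmod (\<phi> (w \<otimes> v) - \<phi> (w \<otimes> v')) \<le> e"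
    by (rule oscD[OF osc' W_mult[OF w v(1)] W_mult[OF w v(2)]])
      (use v w in \<open>simp_all add: np_mult inv_mult_group m_assoc\<close>)
qed

lemma UW_shift: assumes \<phi>: "\<phi> \<in> UW" and w: "w \<in> W" shows "(\<lambda>v. \<phi> (w \<otimes> v)) \<in> UW"
proof -
  obtain K where K: "\<forall>w\<in>W. cmod (\<phi> w) \<le> K" using UW_D(3)[OF \<phi>] by blast
  show ?thesis
  proof (rule UW_I)
    show "\<forall>v\<in>W. cmod (\<phi> (w \<otimes> v)) \<le> K" using K w W_mult by blast
    show "\<phi> (w \<otimes> (v \<otimes> b)) = \<phi> (w \<otimes> v)" if "v \<in> W" "b \<in> Hp" for v b
      using UW_D(1)[OF \<phi>] W_mult[OF w that(1)] that w by (simp add: Hinv_def m_assoc[symmetric])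
    show "\<exists>a\<in>Hp. osc a e (\<lambda>v. \<phi> (w \<otimes> v))" if "0 < e" for e
      using UW_D(2)[OF \<phi> that] osc_shift[OF _ UW_D(1)[OF \<phi>] _ w] by blast
  qed
qed

text \<open>The identity holds for Riemann sums when the transversal on the left is a product whose first factor
  contains \<open>w\<close>.\<close>

lemma \<rho>_covariant: assumes \<phi>: "\<phi> \<in> UW" and w: "w \<in> W"
  shows "\<rho> \<phi> \<otimes>\<^bsub>B\<^esub> T w = T w \<otimes>\<^bsub>B\<^esub> \<rho> (\<lambda>v. \<phi> (w \<otimes> v))"
proof -
  note \<phi>w = UW_shift[OF \<phi> w] and Tw = T_in[OF w]
  have nT: "normB (T w) \<le> 1" using Tw T_iso[OF w] by (rule B.pre.nrm_isometry)
  let ?x = "\<rho> \<phi> \<otimes>\<^bsub>B\<^esub> T w" and ?y = "T w \<otimes>\<^bsub>B\<^esub> \<rho> (\<lambda>v. \<phi> (w \<otimes> v))"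
  have c: "?x \<in> carrier B" "?y \<in> carrier B" using \<rho>(1)[OF \<phi>] \<rho>(1)[OF \<phi>w] Tw by auto
  have "normB (?x \<ominus>\<^bsub>B\<^esub> ?y) \<le> 0"
  proof (rule field_le_epsilon)
    fix e :: real assume e: "0 < e"
    have p: "0 < e / 6" using e by simp
    obtain a V' where a: "a \<in> Hp" "osc a (e / 6) \<phi>" "transversal a V'" using osc_pair[OF \<phi> \<phi> p] by blast
    obtain V where V: "transversal (hp w) V" "w \<in> V" using transversal_exists[OF w] by blast
    note h = W_parts(2)[OF w]
    have osc: "osc (hp w \<otimes> a) (e / 6) \<phi>"
      using osc_mono[OF a(2,1) h UW_D(1)[OF \<phi>]] H_comm[of a "hp w"] a h by simp
    note t = tmul_trans[OF V(1) a(3)]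
    let ?s = "\<sigma> (tmul V V') \<phi>" and ?r = "\<sigma> V' (\<lambda>v. \<phi> (w \<otimes> v))"
    note k = \<sigma>_in[OF t, of \<phi>] \<sigma>_in[OF a(3), of "\<lambda>v. \<phi> (w \<otimes> v)"]
    have eq: "?s \<otimes>\<^bsub>B\<^esub> T w = T w \<otimes>\<^bsub>B\<^esub> ?r" by (rule \<sigma>_tmul_T[OF V(1) a(3) V(2)])
    have 1: "normB ((\<rho> \<phi> \<ominus>\<^bsub>B\<^esub> ?s) \<otimes>\<^bsub>B\<^esub> T w) \<le> (3 * (e / 6)) * 1"
      using \<rho>(2)[OF \<phi> osc _ t] e k \<rho>(1)[OF \<phi>] Tw nT by (intro B.pre.nrm_times_le) auto
    have 2: "normB (T w \<otimes>\<^bsub>B\<^esub> (?r \<ominus>\<^bsub>B\<^esub> \<rho> (\<lambda>v. \<phi> (w \<otimes> v)))) \<le> 1 * (3 * (e / 6))"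
      using \<rho>(2)[OF \<phi>w osc_shift[OF a(2) UW_D(1)[OF \<phi>] a(1) w] _ a(3)] e k \<rho>(1)[OF \<phi>w] Tw nT
        B.pre.nrm_minus_commute[OF k(2) \<rho>(1)[OF \<phi>w]]
      by (intro B.pre.nrm_times_le) auto
    have "?x \<ominus>\<^bsub>B\<^esub> ?y = (?x \<ominus>\<^bsub>B\<^esub> ?s \<otimes>\<^bsub>B\<^esub> T w) \<oplus>\<^bsub>B\<^esub> (T w \<otimes>\<^bsub>B\<^esub> ?r \<ominus>\<^bsub>B\<^esub> ?y)"
      using c k Tw unfolding eq by (intro B.pre.minus_add_minus[symmetric]) auto
    also have "\<dots> = (\<rho> \<phi> \<ominus>\<^bsub>B\<^esub> ?s) \<otimes>\<^bsub>B\<^esub> T w \<oplus>\<^bsub>B\<^esub> T w \<otimes>\<^bsub>B\<^esub> (?r \<ominus>\<^bsub>B\<^esub> \<rho> (\<lambda>v. \<phi> (w \<otimes> v)))"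
      using k Tw \<rho>(1)[OF \<phi>] \<rho>(1)[OF \<phi>w] by (simp add: B.pre.times_minus_l B.pre.times_minus_r)
    also have "normB \<dots> \<le> (3 * (e / 6)) * 1 + 1 * (3 * (e / 6))"
      using 1 2 k Tw \<rho>(1)[OF \<phi>] \<rho>(1)[OF \<phi>w] by (intro B.pre.nrm_add_le) auto
    finally show "normB (?x \<ominus>\<^bsub>B\<^esub> ?y) \<le> 0 + e" by simp
  qed
  then show ?thesis using c B.pre.nrm_le_0[of "?x \<ominus>\<^bsub>B\<^esub> ?y"] B.pre.minus_eq_0[of ?x ?y] by simp
qed

lemma \<rho>_covariant_adj: assumes \<phi>: "\<phi> \<in> UW" and w: "w \<in> W"
  shows "starB (T w) \<otimes>\<^bsub>B\<^esub> \<rho> \<phi> = \<rho> (\<lambda>v. \<phi> (w \<otimes> v)) \<otimes>\<^bsub>B\<^esub> starB (T w)"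
proof -
  note \<phi>' = UW_cnj[OF \<phi>]
  have "starB (\<rho> (\<lambda>v. cnj (\<phi> v)) \<otimes>\<^bsub>B\<^esub> T w) = starB (T w \<otimes>\<^bsub>B\<^esub> \<rho> (\<lambda>v. cnj (\<phi> (w \<otimes> v))))"
    using \<rho>_covariant[OF \<phi>' w] by simp
  then show ?thesis
    using T_in[OF w] \<rho>(1)[OF \<phi>] \<rho>(1)[OF UW_shift[OF \<phi> w]]
    by (simp add: B.pre.adj_times \<rho>_cnj[OF \<phi>] \<rho>_cnj[OF UW_shift[OF \<phi> w]])
qed

section \<open>Uniformly continuous functions on N\<close>

text \<open>Bounded functions on \<open>N\<close> that are uniformly continuous for the group topology with
  neighbourhoods \<open>a M a\<^sup>-\<^sup>1\<close>, extended by zero outside \<open>N\<close>.\<close>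

definition UCN :: "('a \<Rightarrow> complex) set" where
  "UCN = {f \<in> carrier (linfty N). \<forall>e>0. \<exists>a\<in>Hp. \<forall>x\<in>N. \<forall>y\<in>N. inv x \<otimes> y \<in> conj_set G a M \<longrightarrow> cmod (f x - f y) \<le> e}"

text \<open>The function seen from \<open>k\<close>: for \<open>v = m a\<close> it is the value of
  \<open>f\<close> at \<open>\<beta>\<^sub>k(m)\<close>.\<close>

definition lift where "lift f k = (\<lambda>v. f (np (k \<otimes> v)))"

lemma lift_UW: assumes f: "f \<in> UCN" and k: "k \<in> carrier G" shows "lift f k \<in> UW"
proof -
  obtain K where K: "\<forall>y\<in>N. cmod (f y) \<le> K" using f unfolding UCN_def linfty_carrier by blast
  show ?thesis
  proof (rule UW_I)
    show "\<forall>w\<in>W. cmod (lift f k w) \<le> K" using K k by (simp add: lift_def)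
    show "lift f k (w \<otimes> b) = lift f k w" if "w \<in> W" "b \<in> Hp" for w b
      using that k np_mult_H[of "k \<otimes> w" b] by (simp add: lift_def m_assoc)
    fix e :: real assume "0 < e"
    then obtain a where a: "a \<in> Hp" "\<forall>x\<in>N. \<forall>y\<in>N. inv x \<otimes> y \<in> conj_set G a M \<longrightarrow> cmod (f x - f y) \<le> e"
      using f unfolding UCN_def by blast
    define h where "h = hp k"
    have h: "h \<in> H" using k by (simp add: h_def)
    obtain c where c: "c \<in> Hp" "inv a \<otimes> h \<otimes> c \<in> Hp"
      using Hp_fraction[of "inv a \<otimes> h"] h a by (metis H.m_closed H.m_inv_closed in_G(5))
    have "osc c e (lift f k)"
      unfolding osc_def
    proof (intro ballI impI)
      fix v v' assume v: "v \<in> W" "v' \<in> W" and hv: "hp v = c \<and> hp v' = c \<and> inv v \<otimes> v' \<in> M"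
      define m where "m = inv v \<otimes> v'"
      define d where "d = inv a \<otimes> h \<otimes> c"
      have m: "m \<in> M" "v' = v \<otimes> m" using hv v by (simp_all add: m_def)
      have x: "np (k \<otimes> v') = np (k \<otimes> v) \<otimes> ((h \<otimes> c) \<otimes> m \<otimes> inv (h \<otimes> c))"
        using np_mult(2)[of "k \<otimes> v" m] np_mult(1)[of k v] k v hv m by (simp add: m_assoc[symmetric] h_def)
      have hc: "h \<otimes> c = a \<otimes> d" using a h c by (simp add: d_def m_assoc)
      have dG: "d \<in> carrier G" using c(2) by (simp add: d_def)
      define q where "q = d \<otimes> m \<otimes> inv d"
      have q: "q \<in> M" using conj_M[OF c(2) m(1)] by (simp add: q_def d_def)
      have "(h \<otimes> c) \<otimes> m \<otimes> inv (h \<otimes> c) = a \<otimes> q \<otimes> inv a"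
        unfolding hc q_def using a dG m by (intro conj_mult) auto
      then have "inv (np (k \<otimes> v)) \<otimes> np (k \<otimes> v') = a \<otimes> q \<otimes> inv a"
        unfolding x using k v a q by simp
      then have "inv (np (k \<otimes> v)) \<otimes> np (k \<otimes> v') \<in> conj_set G a M"
        unfolding conj_set_def using q by blast
      then show "cmod (lift f k v - lift f k v') \<le> e"
        using a(2) k v by (simp add: lift_def)
    qed
    then show "\<exists>a\<in>Hp. osc a e (lift f k)" using c(1) by blast
  qed
qed

lemma UCN_subalgebra: "cstar_subalgebra (linfty N) UCN"
proof -
  have one: "\<lbrakk>a \<in> Hp; b \<in> Hp; x \<in> conj_set G (a \<otimes> b) M\<rbrakk> \<Longrightarrow> x \<in> conj_set G a M" for a b x
  proof -
    assume ab: "a \<in> Hp" "b \<in> Hp" "x \<in> conj_set G (a \<otimes> b) M"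
    then obtain m where "m \<in> M" "x = (a \<otimes> b) \<otimes> m \<otimes> inv (a \<otimes> b)" by (auto simp: conj_set_def)
    then have "x = a \<otimes> (b \<otimes> m \<otimes> inv b) \<otimes> inv a" "b \<otimes> m \<otimes> inv b \<in> M" using ab conj_M by (simp_all add: conj_mult)
    then show ?thesis unfolding conj_set_def by blast
  qed
  let ?P = "\<lambda>f e a. \<forall>x\<in>N. \<forall>y\<in>N. inv x \<otimes> y \<in> conj_set G a M \<longrightarrow> cmod (f x - f y) \<le> e"
  have pair: "\<exists>a\<in>Hp. ?P f e a \<and> ?P g e a" if "f \<in> UCN" "g \<in> UCN" "0 < e" for f g e
  proof -
    note hyps = that
    obtain a where a: "a \<in> Hp" "?P f e a"
      using hyps(1)[unfolded UCN_def mem_Collect_eq, THEN conjunct2, THEN spec, THEN mp, OF hyps(3)] by (elim bexE)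
    obtain b where b: "b \<in> Hp" "?P g e b"
      using hyps(2)[unfolded UCN_def mem_Collect_eq, THEN conjunct2, THEN spec, THEN mp, OF hyps(3)] by (elim bexE)
    note ab = a(1) b(1) a(2) b(2)
    have "b \<otimes> a = a \<otimes> b" using H_comm ab by simp
    then have "x \<in> conj_set G (a \<otimes> b) M \<Longrightarrow> x \<in> conj_set G a M \<and> x \<in> conj_set G b M" for x
      using one[OF ab(1,2), of x] one[OF ab(2,1), of x] by simp
    then have "?P f e (a \<otimes> b)" "?P g e (a \<otimes> b)" using ab(3,4) by blast+
    then show ?thesis using Hp_mult[OF ab(1,2)] by blast
  qed
  have N: "N \<noteq> {}" using N.one_closed by blast
  interpret L: cstar_algebra "linfty N" by (rule linfty_cstar[OF N])
  have UCN_D: "f \<in> carrier (linfty N)" "\<exists>K\<ge>0. \<forall>y\<in>N. cmod (f y) \<le> K" if "f \<in> UCN" for f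
  proof -
    show f: "f \<in> carrier (linfty N)" using that by (simp add: UCN_def)
    show "\<exists>K\<ge>0. \<forall>y\<in>N. cmod (f y) \<le> K"
      using L.pre.nrm_ge_0[OF f] linfty_norm_ge[OF f] by blast
  qed
  have UCN_I: "f \<in> UCN" if "f \<in> carrier (linfty N)" "\<And>e. 0 < e \<Longrightarrow> \<exists>a\<in>Hp. ?P f e a" for f
    unfolding UCN_def mem_Collect_eq using that by (intro conjI allI impI)
  show ?thesis
    unfolding cstar_subalgebra_def closed_subspace_def
  proof (intro conjI ballI allI impI)
    show "UCN \<subseteq> carrier (linfty N)" by (auto simp: UCN_def)
    show "\<zero>\<^bsub>linfty N\<^esub> \<in> UCN"
    proof (rule UCN_I[OF L.M.zero_closed])
      fix e :: real assume "0 < e"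
      then show "\<exists>a\<in>Hp. ?P \<zero>\<^bsub>linfty N\<^esub> e a" by (intro bexI[of _ \<one>]) auto
    qed
  next
    fix f g assume fg: "f \<in> UCN" "g \<in> UCN"
    show "f \<oplus>\<^bsub>linfty N\<^esub> g \<in> UCN"
    proof (rule UCN_I[OF L.M.a_closed[OF UCN_D(1)[OF fg(1)] UCN_D(1)[OF fg(2)]]])
      fix e :: real assume "0 < e"
      then obtain a where a: "a \<in> Hp" "?P f (e / 2) a" "?P g (e / 2) a" using pair[OF fg, of "e / 2"] by auto
      have "cmod ((f x + g x) - (f y + g y)) \<le> e" if "x \<in> N" "y \<in> N" "inv x \<otimes> y \<in> conj_set G a M" for x y
      proof -
        have "cmod (f x - f y) \<le> e / 2" "cmod (g x - g y) \<le> e / 2" using a that by blast+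
        then show ?thesis using norm_triangle_ineq[of "f x - f y" "g x - g y"] by (simp add: algebra_simps)
      qed
      then show "\<exists>a\<in>Hp. ?P (f \<oplus>\<^bsub>linfty N\<^esub> g) e a" using a(1) by auto
    qed
    show "f \<otimes>\<^bsub>linfty N\<^esub> g \<in> UCN"
    proof (rule UCN_I[OF L.pre.times_closed[OF UCN_D(1)[OF fg(1)] UCN_D(1)[OF fg(2)]]])
      fix e :: real assume e: "0 < e"
      obtain K where K: "0 \<le> K" "\<forall>y\<in>N. cmod (f y) \<le> K" using UCN_D(2)[OF fg(1)] by blast
      obtain L where L: "0 \<le> L" "\<forall>y\<in>N. cmod (g y) \<le> L" using UCN_D(2)[OF fg(2)] by blast
          obtain d where d: "0 < d" "K * d + d * L \<le> e" using small_scale[OF e K(1) L(1)] by blast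
      obtain a where a: "a \<in> Hp" "?P f d a" "?P g d a" using pair[OF fg d(1)] by blast
      have "cmod (f x * g x - f y * g y) \<le> e" if xy: "x \<in> N" "y \<in> N" "inv x \<otimes> y \<in> conj_set G a M" for x y
      proof -
        have "f x * g x - f y * g y = f x * (g x - g y) + (f x - f y) * g y" by (simp add: algebra_simps)
        also have "cmod \<dots> \<le> cmod (f x) * cmod (g x - g y) + cmod (f x - f y) * cmod (g y)"
          by (metis norm_mult norm_triangle_ineq)
        also have "\<dots> \<le> K * d + d * L"
          using a K L xy d(1) by (intro add_mono mult_mono) auto
        finally show ?thesis using d(2) by simp
      qed
      then show "\<exists>a\<in>Hp. ?P (f \<otimes>\<^bsub>linfty N\<^esub> g) e a" using a(1) by auto
    qed
  next
    fix c f assume f: "f \<in> UCN"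
    show "c \<odot>\<^bsub>linfty N\<^esub> f \<in> UCN"
    proof (rule UCN_I[OF L.pre.smult_in[OF UCN_D(1)[OF f]]])
      fix e :: real assume e: "0 < e"
      define d where "d = e / (cmod c + 1)"
      have p: "0 < cmod c + 1" by (simp add: add_nonneg_pos)
      have d: "0 < d" "cmod c * d \<le> e" using e p by (auto simp: d_def field_simps)
      obtain a where a: "a \<in> Hp" "?P f d a" using pair[OF f f d(1)] by blast
      have "cmod (c * f x - c * f y) \<le> e" if "x \<in> N" "y \<in> N" "inv x \<otimes> y \<in> conj_set G a M" for x y
      proof -
        have "cmod (f x - f y) \<le> d" using a that by blast
        then have "cmod c * cmod (f x - f y) \<le> cmod c * d" by (intro mult_left_mono) auto
        then show ?thesis using d(2) by (simp add: right_diff_distrib[symmetric] norm_mult)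
      qed
      then show "\<exists>a\<in>Hp. ?P (c \<odot>\<^bsub>linfty N\<^esub> f) e a" using a(1) by auto
    qed
  next
    fix f assume f: "f \<in> UCN"
    show "cs_star (linfty N) f \<in> UCN"
    proof (rule UCN_I[OF L.pre.adj_closed[OF UCN_D(1)[OF f]]])
      fix e :: real assume e: "0 < e"
      obtain a where a: "a \<in> Hp" "?P f e a" using pair[OF f f e] by blast
      then show "\<exists>a\<in>Hp. ?P (cs_star (linfty N) f) e a"
        by (intro bexI[of _ a]) (simp_all add: complex_cnj_diff[symmetric] del: complex_cnj_diff)
    qed
  next
    fix s f assume A: "(\<forall>n::nat. s n \<in> UCN) \<and> f \<in> carrier (linfty N) \<and> (\<lambda>n. cs_norm (linfty N) (s n \<ominus>\<^bsub>linfty N\<^esub> f)) \<longlonglongrightarrow> 0"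
    show "f \<in> UCN"
    proof (rule UCN_I)
      show f: "f \<in> carrier (linfty N)" using A by blast
      fix e :: real assume e: "0 < e"
      have sc: "s n \<in> carrier (linfty N)" for n using A UCN_D by blast
      obtain n where "\<bar>cs_norm (linfty N) (s n \<ominus>\<^bsub>linfty N\<^esub> f)\<bar> < e / 3"
        using A e unfolding LIMSEQ_def dist_real_def by (metis diff_0_right divide_pos_pos le_refl zero_less_numeral)
      then have n: "cs_norm (linfty N) (s n \<ominus>\<^bsub>linfty N\<^esub> f) < e / 3" by (rule abs_less_iff[THEN iffD1, THEN conjunct1])
      have near: "cmod (s n x - f x) \<le> e / 3" if "x \<in> N" for x
        using linfty_norm_ge[OF L.M.minus_closed[OF sc[of n] f] that] n sc[of n] f
        by (simp add: L.pre.minus_smult)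
      have "s n \<in> UCN" using A by blast
      then obtain a where a: "a \<in> Hp" "?P (s n) (e / 3) a" using pair[of "s n" "s n" "e / 3"] e by auto
      have "cmod (f x - f y) \<le> e" if xy: "x \<in> N" "y \<in> N" "inv x \<otimes> y \<in> conj_set G a M" for x y
      proof -
        have "f x - f y = (s n x - s n y) - (s n x - f x) + (s n y - f y)" by simp
        also have "cmod \<dots> \<le> cmod (s n x - s n y) + cmod (s n x - f x) + cmod (s n y - f y)"
          by (meson add_mono norm_triangle_ineq norm_triangle_ineq4 order_refl order_trans)
        also have "\<dots> \<le> e / 3 + e / 3 + e / 3"
          using near[OF xy(1)] near[OF xy(2)] a(2) xy by (intro add_mono) blast+
        finally show ?thesis by simp
      qed
      then show "\<exists>a\<in>Hp. ?P f e a" using a(1) by blast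
    qed
  qed
qed

lemma coset_mem: assumes x: "x \<in> N" and y: "y \<in> N" and h: "h \<in> H"
  shows "y \<in> x <# conj_set G h M \<longleftrightarrow> inv h \<otimes> (inv x \<otimes> y) \<otimes> h \<in> M"
proof
  assume "y \<in> x <# conj_set G h M"
  then obtain m where m: "m \<in> M" "y = x \<otimes> (h \<otimes> m \<otimes> inv h)" by (auto simp: l_coset_def conj_set_def)
  then have "inv h \<otimes> (inv x \<otimes> y) \<otimes> h = m" using x h by (simp add: m_assoc)
  then show "inv h \<otimes> (inv x \<otimes> y) \<otimes> h \<in> M" using m by simp
next
  assume m: "inv h \<otimes> (inv x \<otimes> y) \<otimes> h \<in> M"
  have "y = x \<otimes> (h \<otimes> (inv h \<otimes> (inv x \<otimes> y) \<otimes> h) \<otimes> inv h)" using x y h by (simp add: m_assoc)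
  then show "y \<in> x <# conj_set G h M" using m by (auto simp: l_coset_def conj_set_def)
qed

text \<open>The uniformly continuous functions form a C*-algebra that contains the characteristic functions
  generating \<open>D\<close>, since \<open>x U\<close> is a union of cosets of any smaller group of
  the family.\<close>

lemma D_sub_UCN: "carrier (D_alg G N H M) \<subseteq> UCN"
proof -
  have "indicator (x <# V) \<in> UCN" if x: "x \<in> N" and V: "V \<in> conj_family G H M" for x V
  proof -
    obtain h where h: "h \<in> H" "V = conj_set G h M" using V by (auto simp: conj_family_def)
    \<comment> \<open>Then \<open>c M c\<^sup>-\<^sup>1 \<subseteq> h M h\<^sup>-\<^sup>1\<close>, so the characteristic function is constant on cosets of \<open>c M c\<^sup>-\<^sup>1\<close>.\<close>
    obtain c where c: "c \<in> Hp" "inv h \<otimes> c \<in> Hp" using Hp_fraction[OF H.m_inv_closed[OF h(1)]] by blast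
    have VN: "x <# V \<subseteq> N"
      using x h by (auto simp: l_coset_def conj_set_def conj_N M_sub_N N.m_closed)
    have mem: "y \<in> x <# V \<longleftrightarrow> inv h \<otimes> (inv x \<otimes> y) \<otimes> h \<in> M" if y: "y \<in> N" for y
      unfolding h(2) by (rule coset_mem[OF x y h(1)])
    have eq: "indicator (x <# V) y = (indicator (x <# V) z :: complex)"
      if yz: "y \<in> N" "z \<in> N" "inv y \<otimes> z \<in> conj_set G c M" for y z
    proof -
      define d where "d = inv h \<otimes> c"
      obtain m where m: "m \<in> M" "inv y \<otimes> z = c \<otimes> m \<otimes> inv c" using yz(3) by (auto simp: conj_set_def)
      have "c = h \<otimes> d" using h c by (simp add: d_def)
      then have "inv y \<otimes> z = (h \<otimes> d) \<otimes> m \<otimes> inv (h \<otimes> d)" using m(2) by simp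
      also have "\<dots> = h \<otimes> (d \<otimes> m \<otimes> inv d) \<otimes> inv h" using h c m by (intro conj_mult) (simp_all add: d_def)
      finally have k: "inv y \<otimes> z = h \<otimes> (d \<otimes> m \<otimes> inv d) \<otimes> inv h" .
      define k where "k = d \<otimes> m \<otimes> inv d"
      have kM: "k \<in> M" using conj_M[OF c(2) m(1)] by (simp add: k_def d_def)
      have z: "z = y \<otimes> (h \<otimes> k \<otimes> inv h)" using cancel_inv(2)[of y z] k yz by (simp add: k_def)
      have "inv h \<otimes> (inv x \<otimes> z) \<otimes> h = (inv h \<otimes> (inv x \<otimes> y) \<otimes> h) \<otimes> k"
        unfolding z using x yz(1) h kM by (simp add: m_assoc)
      then have "inv h \<otimes> (inv x \<otimes> z) \<otimes> h \<in> M \<longleftrightarrow> inv h \<otimes> (inv x \<otimes> y) \<otimes> h \<in> M"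
        using M_mult_iff[OF _ kM] x yz h by simp
      then show ?thesis using mem yz by (simp add: indicator_def)
    qed
    show ?thesis
      unfolding UCN_def mem_Collect_eq
    proof (intro conjI allI impI)
      show "(indicator (x <# V) :: 'a \<Rightarrow> complex) \<in> carrier (linfty N)"
        using VN by (auto simp: linfty_carrier indicator_def intro!: exI[of _ 1])
      fix e :: real assume "0 < e"
      then show "\<exists>a\<in>Hp. \<forall>y\<in>N. \<forall>z\<in>N. inv y \<otimes> z \<in> conj_set G a M \<longrightarrow>
          cmod (indicator (x <# V) y - indicator (x <# V) z) \<le> e"
        using c(1) eq by (intro bexI[of _ c]) auto
    qed
  qed
  then show ?thesis
    unfolding D_alg_def cstar_generated_def using UCN_subalgebra by auto
qed

lemma UCN_one: "indicator N \<in> UCN"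
  unfolding UCN_def by (auto simp: linfty_carrier indicator_def intro!: exI[of _ 1] bexI[of _ \<one>])

end

context su_rep
begin

section \<open>The module of the dilation\<close>

text \<open>Below a level \<open>g\<close> the function is determined by \<open>F g\<close>; a vector of the
  inductive limit is a pair of a level and an element of \<open>B\<close>.\<close>

definition lev where "lev F g \<longleftrightarrow> g \<in> carrier G \<and> (\<forall>w\<in>W. F (g \<otimes> inv w) = T w \<otimes>\<^bsub>B\<^esub> F g)"

text \<open>The inductive limit of copies of \<open>B\<close> along \<open>b \<mapsto> T w b\<close>. A pair
  \<open>(g, b)\<close> becomes the function with \<open>F(g w\<^sup>-\<^sup>1 v) = (T v)\<^sup>* T
  w b\<close>, defined on all of \<open>G\<close> because every element is of the form \<open>g
  w\<^sup>-\<^sup>1 v\<close>. This avoids quotients.\<close>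

definition X where
  "X = {F \<in> carrier G \<rightarrow>\<^sub>E carrier B.
     (\<forall>k\<in>carrier G. \<forall>w\<in>W. F (k \<otimes> w) = starB (T w) \<otimes>\<^bsub>B\<^esub> F k) \<and> (\<exists>g. lev F g)}"

lemma X_in [simp]: assumes "F \<in> X" "k \<in> carrier G" shows "F k \<in> carrier B"
proof -
  have "F \<in> carrier G \<rightarrow>\<^sub>E carrier B" using assms(1) unfolding X_def by blast
  then show ?thesis using assms(2) by (rule PiE_mem)
qed

lemma X_extensional: "F \<in> X \<Longrightarrow> F \<in> extensional (carrier G)"
  unfolding X_def PiE_def by blast

lemma X_equiv: "\<lbrakk>F \<in> X; k \<in> carrier G; w \<in> W\<rbrakk> \<Longrightarrow> F (k \<otimes> w) = starB (T w) \<otimes>\<^bsub>B\<^esub> F k"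
  by (simp add: X_def)

lemma lev_G [simp]: "lev F g \<Longrightarrow> g \<in> carrier G" by (simp add: lev_def)

lemma levD: "\<lbrakk>lev F g; w \<in> W\<rbrakk> \<Longrightarrow> F (g \<otimes> inv w) = T w \<otimes>\<^bsub>B\<^esub> F g" by (simp add: lev_def)

lemma X_I: assumes "\<And>k. k \<in> carrier G \<Longrightarrow> F k \<in> carrier B" "F \<in> extensional (carrier G)"
  "\<And>k w. \<lbrakk>k \<in> carrier G; w \<in> W\<rbrakk> \<Longrightarrow> F (k \<otimes> w) = starB (T w) \<otimes>\<^bsub>B\<^esub> F k" "lev F g"
  shows "F \<in> X"
  using assms unfolding X_def by (auto simp: PiE_def)

lemma lev_mono: assumes F: "F \<in> X" and g: "lev F g" and v: "v \<in> W" shows "lev F (g \<otimes> inv v)"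
  unfolding lev_def
proof (intro conjI ballI)
  note gG = lev_G[OF g]
  show "g \<otimes> inv v \<in> carrier G" using gG v by simp
  fix w assume w: "w \<in> W"
  have "g \<otimes> inv v \<otimes> inv w = g \<otimes> inv (w \<otimes> v)" using gG v w by (simp add: inv_mult_group m_assoc)
  then have "F (g \<otimes> inv v \<otimes> inv w) = T w \<otimes>\<^bsub>B\<^esub> T v \<otimes>\<^bsub>B\<^esub> F g"
    using levD[OF g W_mult[OF w v]] by (simp add: T_mult[OF w v])
  then show "F (g \<otimes> inv v \<otimes> inv w) = T w \<otimes>\<^bsub>B\<^esub> F (g \<otimes> inv v)"
    using levD[OF g v] F gG v w by (simp add: B.pre.times_assoc)
qed

lemma common_level: assumes "F \<in> X" "F' \<in> X" obtains g where "lev F g" "lev F' g"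
proof -
  obtain g g' where g: "lev F g" "lev F' g'" using assms unfolding X_def by blast
  obtain v v' where v: "v \<in> W" "v' \<in> W" "g \<otimes> inv v = g' \<otimes> inv v'" using W_ore[OF lev_G[OF g(1)] lev_G[OF g(2)]] by blast
  have "lev F (g \<otimes> inv v)" "lev F' (g \<otimes> inv v)"
    using lev_mono[OF assms(1) g(1) v(1)] lev_mono[OF assms(2) g(2) v(2)] v(3) by simp_all
  then show thesis by (rule that)
qed

lemma common_level3: assumes "F \<in> X" "F' \<in> X" "F'' \<in> X" obtains g where "lev F g" "lev F' g" "lev F'' g"
proof -
  obtain g where g: "lev F g" "lev F' g" using common_level assms by blast
  obtain g' where g': "lev F'' g'" using assms unfolding X_def by blast
  obtain v v' where v: "v \<in> W" "v' \<in> W" "g \<otimes> inv v = g' \<otimes> inv v'" using W_ore[OF lev_G[OF g(1)] lev_G[OF g']] by blast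
  have "lev F (g \<otimes> inv v)" "lev F' (g \<otimes> inv v)" "lev F'' (g \<otimes> inv v)"
    using lev_mono[OF assms(1) g(1) v(1)] lev_mono[OF assms(2) g(2) v(1)] lev_mono[OF assms(3) g' v(2)] v(3) by simp_all
  then show thesis by (rule that)
qed

text \<open>Every \<open>k\<close> is of the form \<open>g b\<^sup>-\<^sup>1 w\<close>, so the value at one
  common level determines the function.\<close>

lemma X_eqI: assumes F: "F \<in> X" "F' \<in> X" and g: "lev F g" "lev F' g" and eq: "F g = F' g" shows "F = F'"
proof (rule extensionalityI[of _ "carrier G"])
  fix k assume k: "k \<in> carrier G"
  note gG = lev_G[OF g(1)]
  obtain b where b: "b \<in> Hp" "b \<otimes> (inv g \<otimes> k) \<in> W" using W_fraction[of "inv g \<otimes> k"] k gG by auto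
  have kk: "k = g \<otimes> inv b \<otimes> (b \<otimes> (inv g \<otimes> k))" using b gG k by (simp add: m_assoc)
  have "H k = starB (T (b \<otimes> (inv g \<otimes> k))) \<otimes>\<^bsub>B\<^esub> (T b \<otimes>\<^bsub>B\<^esub> H g)" if "H \<in> X" "lev H g" for H
    using X_equiv[OF that(1) _ b(2), of "g \<otimes> inv b"] levD[OF that(2) Hp_W[OF b(1)]] kk gG b by simp
  from this[OF F(1) g(1)] this[OF F(2) g(2)] show "F k = F' k" by (simp only: eq)
qed (use F in \<open>simp_all add: X_extensional\<close>)

definition ip where "ip F F' = (let g = SOME g. lev F g \<and> lev F' g in starB (F g) \<otimes>\<^bsub>B\<^esub> F' g)"

text \<open>The product \<open>(F g)\<^sup>* (F' g)\<close> is the same at all common levels, because \<open>T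
  w\<close> is isometric and any two levels have a common predecessor.\<close>

lemma ip_eq: assumes F: "F \<in> X" "F' \<in> X" and g: "lev F g" "lev F' g" shows "ip F F' = starB (F g) \<otimes>\<^bsub>B\<^esub> F' g"
proof -
  define g' where "g' = (SOME g. lev F g \<and> lev F' g)"
  have g': "lev F g'" "lev F' g'" unfolding g'_def using someI[of "\<lambda>g. lev F g \<and> lev F' g" g] g by blast+
  obtain v v' where v: "v \<in> W" "v' \<in> W" "g \<otimes> inv v = g' \<otimes> inv v'" using W_ore[OF lev_G[OF g(1)] lev_G[OF g'(1)]] by blast
  have "starB (F (x \<otimes> inv y)) \<otimes>\<^bsub>B\<^esub> F' (x \<otimes> inv y) = starB (F x) \<otimes>\<^bsub>B\<^esub> F' x" if x: "lev F x" "lev F' x" and y: "y \<in> W" for x y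
  proof -
    have "starB (T y \<otimes>\<^bsub>B\<^esub> F x) \<otimes>\<^bsub>B\<^esub> (T y \<otimes>\<^bsub>B\<^esub> F' x) = starB (F x) \<otimes>\<^bsub>B\<^esub> ((starB (T y) \<otimes>\<^bsub>B\<^esub> T y) \<otimes>\<^bsub>B\<^esub> F' x)"
      using F x y by (simp add: B.pre.adj_times B.pre.times_assoc)
    then show ?thesis using F x y by (simp add: levD T_iso)
  qed
  from this[OF g v(1)] this[OF g' v(2)] v(3)
  have "starB (F g) \<otimes>\<^bsub>B\<^esub> F' g = starB (F g') \<otimes>\<^bsub>B\<^esub> F' g'" by simp
  then show ?thesis by (simp add: ip_def Let_def g'_def)
qed

lemma ip_in [simp]: assumes "F \<in> X" "F' \<in> X" shows "ip F F' \<in> carrier B"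
proof -
  obtain g where "lev F g" "lev F' g" using common_level[OF assms] by blast
  then show ?thesis using ip_eq[OF assms] assms by simp
qed

lemma ip_adj: assumes "F \<in> X" "F' \<in> X" shows "starB (ip F F') = ip F' F"
proof -
  obtain g where g: "lev F g" "lev F' g" using common_level[OF assms] by blast
  then show ?thesis using ip_eq[OF assms g] ip_eq[OF assms(2,1) g(2,1)] assms by (simp add: B.pre.adj_times)
qed

definition nX where "nX F = sqrt (normB (ip F F))"

lemma nX_eq: assumes "F \<in> X" "lev F g" shows "nX F = normB (F g)"
  using ip_eq[OF assms(1,1) assms(2,2)] assms by (simp add: nX_def B.pre.nrm_adj_times)

lemma nX_sq: "F \<in> X \<Longrightarrow> (nX F)\<^sup>2 = normB (ip F F)" by (simp add: nX_def)
lemma nX_ge_0 [simp]: "F \<in> X \<Longrightarrow> 0 \<le> nX F" by (simp add: nX_def)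

text \<open>At a common level this is submultiplicativity of the norm of \<open>B\<close>.\<close>

lemma cauchy_schwarz: assumes "F \<in> X" "F' \<in> X" shows "normB (ip F F') \<le> nX F * nX F'"
proof -
  obtain g where g: "lev F g" "lev F' g" using common_level[OF assms] by blast
  have "normB (starB (F g) \<otimes>\<^bsub>B\<^esub> F' g) \<le> normB (starB (F g)) * normB (F' g)"
    using assms g by (intro B.pre.nrm_times) auto
  then show ?thesis using ip_eq[OF assms g] nX_eq[OF assms(1) g(1)] nX_eq[OF assms(2) g(2)] assms g by simp
qed

definition addX where "addX F F' = (\<lambda>k\<in>carrier G. F k \<oplus>\<^bsub>B\<^esub> F' k)"
definition smX where "smX c F = (\<lambda>k\<in>carrier G. c \<odot>\<^bsub>B\<^esub> F k)"
definition rX where "rX F b = (\<lambda>k\<in>carrier G. F k \<otimes>\<^bsub>B\<^esub> b)"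
definition zX where "zX = (\<lambda>k\<in>carrier G. \<zero>\<^bsub>B\<^esub>)"

lemma X_app [simp]: "k \<in> carrier G \<Longrightarrow> addX F F' k = F k \<oplus>\<^bsub>B\<^esub> F' k" "k \<in> carrier G \<Longrightarrow> smX c F k = c \<odot>\<^bsub>B\<^esub> F k"
  "k \<in> carrier G \<Longrightarrow> rX F b k = F k \<otimes>\<^bsub>B\<^esub> b" "k \<in> carrier G \<Longrightarrow> zX k = \<zero>\<^bsub>B\<^esub>"
  by (simp_all add: addX_def smX_def rX_def zX_def)

lemma X_ext [simp]: "addX F F' \<in> extensional (carrier G)" "smX c F \<in> extensional (carrier G)"
  "rX F b \<in> extensional (carrier G)" "zX \<in> extensional (carrier G)"
  by (simp_all add: addX_def smX_def rX_def zX_def)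

lemma lev_ops: assumes F: "F \<in> X" "F' \<in> X" and b: "b \<in> carrier B"
  shows "\<lbrakk>lev F g; lev F' g\<rbrakk> \<Longrightarrow> lev (addX F F') g" "lev F g \<Longrightarrow> lev (smX c F) g" "lev F g \<Longrightarrow> lev (rX F b) g"
    "g \<in> carrier G \<Longrightarrow> lev zX g"
proof -
  show "\<lbrakk>lev F g; lev F' g\<rbrakk> \<Longrightarrow> lev (addX F F') g"
    unfolding lev_def using F by (simp add: B.pre.times_add_r)
  show "lev F g \<Longrightarrow> lev (smX c F) g"
    unfolding lev_def using F(1) by (simp add: B.pre.smult_times_r)
  show "lev F g \<Longrightarrow> lev (rX F b) g"
    unfolding lev_def using F(1) b by (simp add: B.pre.times_assoc)
  show "g \<in> carrier G \<Longrightarrow> lev zX g"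
    unfolding lev_def by simp
qed

lemma X_ops [simp]: "\<lbrakk>F \<in> X; F' \<in> X\<rbrakk> \<Longrightarrow> addX F F' \<in> X" "F \<in> X \<Longrightarrow> smX c F \<in> X"
  "\<lbrakk>F \<in> X; b \<in> carrier B\<rbrakk> \<Longrightarrow> rX F b \<in> X" "zX \<in> X"
proof -
  show "addX F F' \<in> X" if F: "F \<in> X" "F' \<in> X"
  proof -
    obtain g where g: "lev F g" "lev F' g" using common_level[OF F] by blast
    show ?thesis
      by (rule X_I[OF _ _ _ lev_ops(1)[OF F B.one_closed g]])
        (use F in \<open>simp_all add: X_equiv B.pre.times_add_r\<close>)
  qed
  show "smX c F \<in> X" if F: "F \<in> X"
  proof -
    obtain g where g: "lev F g" using common_level[OF F F] by blast
    show ?thesis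
      by (rule X_I[OF _ _ _ lev_ops(2)[OF F F B.one_closed g]])
        (use F in \<open>simp_all add: X_equiv B.pre.smult_times_r\<close>)
  qed
  show "rX F b \<in> X" if F: "F \<in> X" and b: "b \<in> carrier B"
  proof -
    obtain g where g: "lev F g" using common_level[OF F F] by blast
    show ?thesis
      by (rule X_I[OF _ _ _ lev_ops(3)[OF F F b g]])
        (use F b in \<open>simp_all add: X_equiv B.pre.times_assoc\<close>)
  qed
  show "zX \<in> X"
    by (rule X_I[of _ \<one>]) (simp_all add: lev_def)
qed

lemma X_fun_eqI: "\<lbrakk>F \<in> X; F' \<in> X; \<And>k. k \<in> carrier G \<Longrightarrow> F k = F' k\<rbrakk> \<Longrightarrow> F = F'"
  by (rule extensionalityI[of _ "carrier G"]) (simp_all add: X_extensional)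

lemma ip_linear: assumes F: "F \<in> X" "F' \<in> X" "F'' \<in> X"
  shows "ip F (addX F' F'') = ip F F' \<oplus>\<^bsub>B\<^esub> ip F F''" "ip F (smX c F') = c \<odot>\<^bsub>B\<^esub> ip F F'"
    "b \<in> carrier B \<Longrightarrow> ip F (rX F' b) = ip F F' \<otimes>\<^bsub>B\<^esub> b"
proof -
  obtain g where g: "lev F g" "lev F' g" "lev F'' g" using common_level3[OF F] by blast
  note l = lev_ops[OF F(2,3)]
  show "ip F (addX F' F'') = ip F F' \<oplus>\<^bsub>B\<^esub> ip F F''"
    using ip_eq[OF F(1) X_ops(1)[OF F(2,3)] g(1) l(1)[OF B.one_closed g(2,3)]]
      ip_eq[OF F(1,2) g(1,2)] ip_eq[OF F(1,3) g(1,3)] F g by (simp add: B.pre.times_add_r)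
  show "ip F (smX c F') = c \<odot>\<^bsub>B\<^esub> ip F F'"
    using ip_eq[OF F(1) X_ops(2)[OF F(2)] g(1) l(2)[OF B.one_closed g(2)]]
      ip_eq[OF F(1,2) g(1,2)] F g by (simp add: B.pre.smult_times_r)
  assume b: "b \<in> carrier B"
  show "ip F (rX F' b) = ip F F' \<otimes>\<^bsub>B\<^esub> b"
    using ip_eq[OF F(1) X_ops(3)[OF F(2) b] g(1) l(3)[OF b g(2)]]
      ip_eq[OF F(1,2) g(1,2)] F g b by (simp add: B.pre.times_assoc)
qed

lemma nX_0: assumes "F \<in> X" shows "nX F = 0 \<longleftrightarrow> F = zX"
proof
  obtain g where g: "lev F g" using common_level[OF assms assms] by blast
  assume "nX F = 0"
  then have "F g = \<zero>\<^bsub>B\<^esub>" using nX_eq[OF assms g] assms g by (simp add: B.pre.nrm_eq_0)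
  then show "F = zX" using X_eqI[OF assms X_ops(4) g lev_ops(4)[OF assms assms B.one_closed]] g by simp
next
  assume "F = zX"
  then show "nX F = 0" using nX_eq[OF X_ops(4) lev_ops(4)[OF assms assms B.one_closed one_closed]] by simp
qed

lemma nX_ops: assumes F: "F \<in> X" "F' \<in> X" shows "nX (addX F F') \<le> nX F + nX F'" "nX (smX c F) = cmod c * nX F"
proof -
  obtain g where g: "lev F g" "lev F' g" using common_level[OF F] by blast
  note l = lev_ops[OF F B.one_closed]
  show "nX (addX F F') \<le> nX F + nX F'"
    using nX_eq[OF X_ops(1)[OF F] l(1)[OF g]] nX_eq[OF F(1) g(1)] nX_eq[OF F(2) g(2)] F g by (simp add: B.pre.nrm_add)
  show "nX (smX c F) = cmod c * nX F"
    using nX_eq[OF X_ops(2)[OF F(1)] l(2)[OF g(1)]] nX_eq[OF F(1) g(1)] F g by (simp add: B.pre.nrm_smult)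
qed

lemma ip_nondegenerate: assumes F: "F \<in> X" "F' \<in> X" and eq: "\<And>K. K \<in> X \<Longrightarrow> ip K F = ip K F'" shows "F = F'"
proof -
  define D where "D = addX F (smX (-1) F')"
  have D: "D \<in> X" using F by (simp add: D_def)
  have "ip D (addX F (smX (-1) F')) = ip D F \<oplus>\<^bsub>B\<^esub> ip D (smX (-1) F')"
    by (rule ip_linear(1)[OF D F(1) X_ops(2)[OF F(2)]])
  also have "ip D (smX (-1) F') = (-1) \<odot>\<^bsub>B\<^esub> ip D F'" by (rule ip_linear(2)[OF D F(2) F(2)])
  finally have "ip D D = ip D F \<oplus>\<^bsub>B\<^esub> (-1) \<odot>\<^bsub>B\<^esub> ip D F'" by (simp only: D_def[symmetric])
  also have "\<dots> = \<zero>\<^bsub>B\<^esub>" using eq[OF D] F D B.pre.minus_smult[of "ip D F'" "ip D F'"] by simp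
  finally have "nX D = 0" by (simp add: nX_def)
  then have "D = zX" using nX_0[OF D] by simp
  then have z: "D k = zX k" for k by simp
  have "F k \<ominus>\<^bsub>B\<^esub> F' k = \<zero>\<^bsub>B\<^esub>" if "k \<in> carrier G" for k
    using z[of k] that F unfolding D_def by (simp add: B.pre.minus_smult)
  then show ?thesis using F by (intro X_fun_eqI) (simp_all add: B.pre.minus_eq_0)
qed

section \<open>Adjointable operators\<close>

definition adjoint_pair where
  "adjoint_pair L L' \<longleftrightarrow> L \<in> X \<rightarrow>\<^sub>E X \<and> L' \<in> X \<rightarrow>\<^sub>E X \<and> (\<forall>F\<in>X. \<forall>F'\<in>X. ip (L F) F' = ip F (L' F'))"

definition op_bound where "op_bound L K \<longleftrightarrow> 0 \<le> K \<and> (\<forall>F\<in>X. nX (L F) \<le> K * nX F)"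

text \<open>The bounded adjointable operators on the uncompleted module; the Cauchy-Schwarz inequality alone
  gives the C*-identity for them.\<close>

definition Ops where "Ops = {L. (\<exists>L'. adjoint_pair L L') \<and> (\<exists>K. op_bound L K)}"

definition adjoint where "adjoint L = (THE L'. adjoint_pair L L')"

definition op_norm where "op_norm L = Inf {K. op_bound L K}"

lemma adjoint_pair_sym: assumes "adjoint_pair L L'" shows "adjoint_pair L' L"
  unfolding adjoint_pair_def
proof (intro conjI ballI)
  show L: "L' \<in> X \<rightarrow>\<^sub>E X" "L \<in> X \<rightarrow>\<^sub>E X" using assms by (simp_all add: adjoint_pair_def)
  fix F F' assume F: "F \<in> X" "F' \<in> X"
  have m: "L' F \<in> X" "L F' \<in> X" using L F by blast+
  have "ip (L' F) F' = starB (ip F' (L' F))" using F m by (simp add: ip_adj)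
  also have "\<dots> = starB (ip (L F') F)" using assms F by (simp add: adjoint_pair_def)
  also have "\<dots> = ip F (L F')" using F m by (simp add: ip_adj)
  finally show "ip (L' F) F' = ip F (L F')" .
qed

lemma op_ext: "\<lbrakk>L \<in> X \<rightarrow>\<^sub>E X; L' \<in> X \<rightarrow>\<^sub>E X; \<And>F. F \<in> X \<Longrightarrow> L F = L' F\<rbrakk> \<Longrightarrow> L = L'"
  by (rule extensionalityI[of _ X]) (auto simp: PiE_def)

lemma adjoint_unique: assumes "adjoint_pair L L'" "adjoint_pair L L''" shows "L' = L''"
proof (rule op_ext)
  show "L' \<in> X \<rightarrow>\<^sub>E X" "L'' \<in> X \<rightarrow>\<^sub>E X" using assms by (simp_all add: adjoint_pair_def)
  then have m: "L' F \<in> X" "L'' F \<in> X" if "F \<in> X" for F using that by blast+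
  fix F assume F: "F \<in> X"
  show "L' F = L'' F"
    by (rule ip_nondegenerate[OF m(1)[OF F] m(2)[OF F]]) (use assms F in \<open>simp add: adjoint_pair_def\<close>)
qed

lemma adjoint_eq: "adjoint_pair L L' \<Longrightarrow> adjoint L = L'"
  unfolding adjoint_def by (rule the_equality) (blast intro: adjoint_unique)+

lemma Ops_D: assumes "L \<in> Ops" shows "adjoint_pair L (adjoint L)" "L \<in> X \<rightarrow>\<^sub>E X" "F \<in> X \<Longrightarrow> L F \<in> X"
proof -
  obtain L' where L': "adjoint_pair L L'" using assms by (auto simp: Ops_def)
  then show "adjoint_pair L (adjoint L)" using adjoint_eq by simp
  show L: "L \<in> X \<rightarrow>\<^sub>E X" using L' by (simp add: adjoint_pair_def)
  show "F \<in> X \<Longrightarrow> L F \<in> X" using L by blast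
qed

lemma Ops_linear: assumes L: "L \<in> Ops" and F: "F \<in> X" "F' \<in> X"
  shows "L (addX F F') = addX (L F) (L F')" "L (smX c F) = smX c (L F)" "b \<in> carrier B \<Longrightarrow> L (rX F b) = rX (L F) b"
proof -
  note m = Ops_D(3)[OF L]
  have ap: "adjoint_pair (adjoint L) L" by (rule adjoint_pair_sym[OF Ops_D(1)[OF L]])
  have a: "ip K (L Y) = ip (adjoint L K) Y" "adjoint L K \<in> X" if "K \<in> X" "Y \<in> X" for K Y
    using ap that unfolding adjoint_pair_def by auto
  show "L (addX F F') = addX (L F) (L F')"
    by (rule ip_nondegenerate) (use F m in \<open>simp_all add: a ip_linear\<close>)
  show "L (smX c F) = smX c (L F)"
    by (rule ip_nondegenerate) (use F m in \<open>simp_all add: a ip_linear(2)[OF _ _ F(1)] ip_linear(2)[OF _ _ m[OF F(1)]]\<close>)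
  assume b: "b \<in> carrier B"
  show "L (rX F b) = rX (L F) b"
    by (rule ip_nondegenerate)
      (use F m b in \<open>simp_all add: a ip_linear(3)[OF _ _ F(1)] ip_linear(3)[OF _ _ m[OF F(1)]]\<close>)
qed

lemma op_norm_bound: assumes "L \<in> Ops" shows "op_bound L (op_norm L)"
proof -
  obtain K where K: "op_bound L K" using assms by (auto simp: Ops_def)
  have ge: "0 \<le> op_norm L"
    unfolding op_norm_def using K by (intro cInf_greatest) (auto simp: op_bound_def)
  moreover have "nX (L F) \<le> op_norm L * nX F" if F: "F \<in> X" for F
  proof (cases "nX F = 0")
    case True
    then show ?thesis using K F by (auto simp: op_bound_def)
  next
    case False
    then have p: "0 < nX F" using nX_ge_0[OF F] by linarith
    have "nX (L F) / nX F \<le> op_norm L"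
      unfolding op_norm_def
    proof (rule cInf_greatest)
      show "{K. op_bound L K} \<noteq> {}" using K by blast
      fix k assume "k \<in> {K. op_bound L K}"
      then have "nX (L F) \<le> k * nX F" using F by (simp add: op_bound_def)
      then show "nX (L F) / nX F \<le> k" using p by (simp add: field_simps)
    qed
    then show ?thesis using p by (simp add: field_simps)
  qed
  ultimately show ?thesis by (simp add: op_bound_def)
qed

lemma op_norm_le: "op_bound L K \<Longrightarrow> op_norm L \<le> K"
  unfolding op_norm_def by (rule cInf_lower) (auto simp: op_bound_def intro!: bdd_belowI[of _ 0])

lemma op_bound_adjoint: assumes "adjoint_pair L L'" "op_bound L K" shows "op_bound L' K"
  unfolding op_bound_def
proof (intro conjI ballI)
  show K: "0 \<le> K" using assms by (simp add: op_bound_def)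
  fix F assume F: "F \<in> X"
  have m: "L' F \<in> X" "L (L' F) \<in> X" using assms(1) F unfolding adjoint_pair_def by auto
  show "nX (L' F) \<le> K * nX F"
  proof (cases "nX (L' F) = 0")
    case True
    then show ?thesis using K F by simp
  next
    case False
    then have p: "0 < nX (L' F)" using nX_ge_0[OF m(1)] by linarith
    have "ip (L' F) (L' F) = ip (L (L' F)) F" using assms(1) F m by (simp add: adjoint_pair_def)
    then have "(nX (L' F))\<^sup>2 \<le> nX (L (L' F)) * nX F"
      using cauchy_schwarz[OF m(2) F] nX_sq[OF m(1)] by simp
    also have "\<dots> \<le> (K * nX (L' F)) * nX F"
      using assms(2) m F by (intro mult_right_mono) (auto simp: op_bound_def)
    finally have "nX (L' F) * nX (L' F) \<le> (K * nX F) * nX (L' F)" by (simp add: power2_eq_square mult.commute mult.left_commute)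
    then show ?thesis using p by (rule mult_right_le_imp_le)
  qed
qed

lemma adjoint_Ops: assumes "L \<in> Ops" shows "adjoint L \<in> Ops" "adjoint (adjoint L) = L" "op_norm (adjoint L) \<le> op_norm L"
proof -
  note p = Ops_D(1)[OF assms]
  have b: "op_bound (adjoint L) (op_norm L)" by (rule op_bound_adjoint[OF p op_norm_bound[OF assms]])
  show "adjoint L \<in> Ops" using adjoint_pair_sym[OF p] b unfolding Ops_def by blast
  show "adjoint (adjoint L) = L" by (rule adjoint_eq[OF adjoint_pair_sym[OF p]])
  show "op_norm (adjoint L) \<le> op_norm L" by (rule op_norm_le[OF b])
qed

definition addO where "addO L L' = (\<lambda>F\<in>X. addX (L F) (L' F))"
definition smO where "smO c L = (\<lambda>F\<in>X. smX c (L F))"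
definition mulO where "mulO L L' = (\<lambda>F\<in>X. L (L' F))"
definition idO where "idO = (\<lambda>F\<in>X. F)"
definition zO where "zO = (\<lambda>F\<in>X. zX)"

lemmas O_defs = addO_def smO_def mulO_def idO_def zO_def

lemma Ops_addO: assumes L: "L \<in> Ops" "L' \<in> Ops"
  shows "addO L L' \<in> Ops" "adjoint (addO L L') = addO (adjoint L) (adjoint L')" "op_norm (addO L L') \<le> op_norm L + op_norm L'"
proof -
  note a = adjoint_Ops(1)[OF L(1)] adjoint_Ops(1)[OF L(2)]
  note m = Ops_D(3)[OF L(1)] Ops_D(3)[OF L(2)] Ops_D(3)[OF a(1)] Ops_D(3)[OF a(2)]
  have ip1: "ip (addX F F') K = ip F K \<oplus>\<^bsub>B\<^esub> ip F' K" if "F \<in> X" "F' \<in> X" "K \<in> X" for F F' K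
  proof -
    have "ip (addX F F') K = starB (ip K (addX F F'))" using that by (simp add: ip_adj)
    also have "\<dots> = ip F K \<oplus>\<^bsub>B\<^esub> ip F' K" using that by (simp add: ip_linear B.pre.adj_add ip_adj)
    finally show ?thesis .
  qed
  have p: "adjoint_pair (addO L L') (addO (adjoint L) (adjoint L'))"
    using m Ops_D(1)[OF L(1)] Ops_D(1)[OF L(2)] unfolding adjoint_pair_def addO_def
    by (simp add: ip1 ip_linear)
  have b: "op_bound (addO L L') (op_norm L + op_norm L')"
    unfolding op_bound_def
  proof (intro conjI ballI)
    note n = op_norm_bound[OF L(1)] op_norm_bound[OF L(2)]
    show "0 \<le> op_norm L + op_norm L'" using n by (simp add: op_bound_def)
    fix F assume F: "F \<in> X"
    have "nX (addX (L F) (L' F)) \<le> op_norm L * nX F + op_norm L' * nX F"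
      using n F by (intro order_trans[OF nX_ops(1)[OF m(1)[OF F] m(2)[OF F]]] add_mono) (auto simp: op_bound_def)
    then show "nX (addO L L' F) \<le> (op_norm L + op_norm L') * nX F" using F by (simp add: addO_def distrib_right)
  qed
  show "addO L L' \<in> Ops" using p b unfolding Ops_def by blast
  show "adjoint (addO L L') = addO (adjoint L) (adjoint L')" by (rule adjoint_eq[OF p])
  show "op_norm (addO L L') \<le> op_norm L + op_norm L'" by (rule op_norm_le[OF b])
qed

lemma Ops_smO: assumes L: "L \<in> Ops"
  shows "smO c L \<in> Ops" "adjoint (smO c L) = smO (cnj c) (adjoint L)" "op_norm (smO c L) \<le> cmod c * op_norm L"
proof -
  note a = adjoint_Ops(1)[OF L]
  note m = Ops_D(3)[OF L] Ops_D(3)[OF a]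
  have ip1: "ip (smX c F) K = cnj c \<odot>\<^bsub>B\<^esub> ip F K" if "F \<in> X" "K \<in> X" for F K c
  proof -
    have "ip (smX c F) K = starB (ip K (smX c F))" using that by (simp add: ip_adj)
    also have "\<dots> = cnj c \<odot>\<^bsub>B\<^esub> ip F K" using that by (simp add: ip_linear(2)[OF that(2,1,1)] B.pre.adj_smult ip_adj)
    finally show ?thesis .
  qed
  have ip2: "ip K (smX c F) = c \<odot>\<^bsub>B\<^esub> ip K F" if "F \<in> X" "K \<in> X" for F K c
    using that ip_linear(2)[OF that(2,1,1)] by simp
  have p: "adjoint_pair (smO c L) (smO (cnj c) (adjoint L))"
    using m Ops_D(1)[OF L] unfolding adjoint_pair_def smO_def by (simp add: ip1 ip2)
  have b: "op_bound (smO c L) (cmod c * op_norm L)"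
    unfolding op_bound_def
  proof (intro conjI ballI)
    note n = op_norm_bound[OF L]
    show "0 \<le> cmod c * op_norm L" using n by (simp add: op_bound_def)
    fix F assume F: "F \<in> X"
    have "cmod c * nX (L F) \<le> cmod c * (op_norm L * nX F)"
      using n F by (intro mult_left_mono) (auto simp: op_bound_def)
    then show "nX (smO c L F) \<le> cmod c * op_norm L * nX F"
      using F nX_ops(2)[OF m(1)[OF F] m(1)[OF F]] by (simp add: smO_def mult.assoc)
  qed
  show "smO c L \<in> Ops" using p b unfolding Ops_def by blast
  show "adjoint (smO c L) = smO (cnj c) (adjoint L)" by (rule adjoint_eq[OF p])
  show "op_norm (smO c L) \<le> cmod c * op_norm L" by (rule op_norm_le[OF b])
qed

lemma Ops_mulO: assumes L: "L \<in> Ops" "L' \<in> Ops"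
  shows "mulO L L' \<in> Ops" "adjoint (mulO L L') = mulO (adjoint L') (adjoint L)" "op_norm (mulO L L') \<le> op_norm L * op_norm L'"
proof -
  note a = adjoint_Ops(1)[OF L(1)] adjoint_Ops(1)[OF L(2)]
  note m = Ops_D(3)[OF L(1)] Ops_D(3)[OF L(2)] Ops_D(3)[OF a(1)] Ops_D(3)[OF a(2)]
  have p: "adjoint_pair (mulO L L') (mulO (adjoint L') (adjoint L))"
    using m Ops_D(1)[OF L(1)] Ops_D(1)[OF L(2)] unfolding adjoint_pair_def mulO_def by simp
  have b: "op_bound (mulO L L') (op_norm L * op_norm L')"
    unfolding op_bound_def
  proof (intro conjI ballI)
    note n = op_norm_bound[OF L(1)] op_norm_bound[OF L(2)]
    show "0 \<le> op_norm L * op_norm L'" using n by (simp add: op_bound_def)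
    fix F assume F: "F \<in> X"
    have "nX (L (L' F)) \<le> op_norm L * nX (L' F)" using n m F by (simp add: op_bound_def)
    also have "\<dots> \<le> op_norm L * (op_norm L' * nX F)" using n F by (intro mult_left_mono) (auto simp: op_bound_def)
    finally show "nX (mulO L L' F) \<le> op_norm L * op_norm L' * nX F" using F by (simp add: mulO_def mult.assoc)
  qed
  show "mulO L L' \<in> Ops" using p b unfolding Ops_def by blast
  show "adjoint (mulO L L') = mulO (adjoint L') (adjoint L)" by (rule adjoint_eq[OF p])
  show "op_norm (mulO L L') \<le> op_norm L * op_norm L'" by (rule op_norm_le[OF b])
qed

lemma Ops_id: "idO \<in> Ops" "zO \<in> Ops"
proof -
  have "adjoint_pair idO idO" "op_bound idO 1" by (simp_all add: adjoint_pair_def idO_def op_bound_def)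
  then show id: "idO \<in> Ops" unfolding Ops_def by blast
  have "smO 0 idO = zO"
    unfolding O_defs by (rule restrict_ext) (rule X_fun_eqI, simp_all)
  then show "zO \<in> Ops" using Ops_smO(1)[OF id, of 0] by simp
qed

lemma op_norm_eq_0: assumes L: "L \<in> Ops" shows "op_norm L = 0 \<longleftrightarrow> L = zO"
proof
  assume 0: "op_norm L = 0"
  show "L = zO"
  proof (rule op_ext[OF Ops_D(2)[OF L] Ops_D(2)[OF Ops_id(2)]])
    fix F assume F: "F \<in> X"
    have "nX (L F) \<le> 0" using op_norm_bound[OF L] F 0 by (simp add: op_bound_def)
    then have "nX (L F) = 0" using nX_ge_0[OF Ops_D(3)[OF L F]] by linarith
    then show "L F = zO F" using nX_0[OF Ops_D(3)[OF L F]] F by (simp add: zO_def)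
  qed
next
  assume "L = zO"
  moreover have "op_bound zO 0" using nX_0[OF X_ops(4)] by (simp add: op_bound_def zO_def)
  ultimately show "op_norm L = 0" using op_norm_le[of L 0] op_norm_bound[OF L] by (simp add: op_bound_def)
qed

lemma op_norm_smO: assumes L: "L \<in> Ops" shows "op_norm (smO c L) = cmod c * op_norm L"
proof (cases "c = 0")
  case True
  then show ?thesis using Ops_smO(3)[OF L, of c] op_norm_bound[OF Ops_smO(1)[OF L, of c]] by (simp add: op_bound_def)
next
  case False
  have "smO (inverse c) (smO c L) = L"
  proof (rule op_ext[OF Ops_D(2)[OF Ops_smO(1)[OF Ops_smO(1)[OF L]]] Ops_D(2)[OF L]])
    fix F assume F: "F \<in> X"
    have "smX (inverse c) (smX c (L F)) = L F"
      by (rule X_fun_eqI) (use Ops_D(3)[OF L F] False in \<open>simp_all add: B.pre.smult_smult\<close>)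
    then show "smO (inverse c) (smO c L) F = L F" using F by (simp add: smO_def)
  qed
  then have "op_norm L \<le> inverse (cmod c) * op_norm (smO c L)"
    using Ops_smO(3)[OF Ops_smO(1)[OF L], of "inverse c" c] by (simp add: norm_inverse)
  then have "cmod c * op_norm L \<le> op_norm (smO c L)" using False by (simp add: field_simps)
  then show ?thesis using Ops_smO(3)[OF L, of c] by linarith
qed

text \<open>The usual argument: \<open>\<parallel>L F\<parallel>\<^sup>2 = \<parallel>\<langle>F, L\<^sup>* L
  F\<rangle>\<parallel> \<le> \<parallel>L\<^sup>* L\<parallel>
  \<parallel>F\<parallel>\<^sup>2\<close>.\<close>

lemma op_norm_cstar: assumes L: "L \<in> Ops" shows "op_norm (mulO (adjoint L) L) = (op_norm L)\<^sup>2"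
proof (rule antisym)
  note a = adjoint_Ops[OF L]
  note n = op_norm_bound[OF L] op_norm_bound[OF a(1)]
  have n0: "0 \<le> op_norm L" using n by (simp add: op_bound_def)
  show "op_norm (mulO (adjoint L) L) \<le> (op_norm L)\<^sup>2"
    using Ops_mulO(3)[OF a(1) L] mult_right_mono[OF a(3) n0] by (simp add: power2_eq_square)
  let ?K = "op_norm (mulO (adjoint L) L)"
  note nK = op_norm_bound[OF Ops_mulO(1)[OF a(1) L]]
  have "op_bound L (sqrt ?K)"
    unfolding op_bound_def
  proof (intro conjI ballI)
    show "0 \<le> sqrt ?K" using nK by (simp add: op_bound_def)
    fix F assume F: "F \<in> X"
    note LF = Ops_D(3)[OF L F]
    have "(nX (L F))\<^sup>2 = normB (ip F (adjoint L (L F)))"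
      using Ops_D(1)[OF L] F LF by (simp add: nX_sq adjoint_pair_def)
    also have "\<dots> \<le> nX F * nX (mulO (adjoint L) L F)"
      using cauchy_schwarz[OF F Ops_D(3)[OF a(1) LF]] F by (simp add: mulO_def)
    also have "\<dots> \<le> nX F * (?K * nX F)"
      using nK F by (intro mult_left_mono) (auto simp: op_bound_def)
    also have "\<dots> = (sqrt ?K * nX F)\<^sup>2"
      using nK by (simp add: op_bound_def power_mult_distrib power2_eq_square)
    finally show "nX (L F) \<le> sqrt ?K * nX F"
      by (rule power2_le_imp_le) (use nK F in \<open>simp add: op_bound_def\<close>)
  qed
  then have "op_norm L \<le> sqrt ?K" by (rule op_norm_le)
  then have "(op_norm L)\<^sup>2 \<le> (sqrt ?K)\<^sup>2" using n0 by (rule power_mono)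
  then show "(op_norm L)\<^sup>2 \<le> ?K" using nK by (simp add: op_bound_def)
qed

definition op_alg :: "(('a \<Rightarrow> 'b) \<Rightarrow> 'a \<Rightarrow> 'b) set \<Rightarrow> (('a \<Rightarrow> 'b) \<Rightarrow> 'a \<Rightarrow> 'b) cstar" where
  "op_alg R = \<lparr>carrier = R, mult = mulO, one = idO, zero = zO, add = addO, smult = smO,
     cs_star = adjoint, cs_norm = op_norm\<rparr>"

lemma op_alg_simps [simp]: "carrier (op_alg R) = R" "mult (op_alg R) = mulO" "one (op_alg R) = idO"
  "zero (op_alg R) = zO" "add (op_alg R) = addO" "smult (op_alg R) = smO" "cs_star (op_alg R) = adjoint"
  "cs_norm (op_alg R) = op_norm"
  by (simp_all add: op_alg_def)

lemma op_alg_pre_cstar: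
  assumes R: "R \<subseteq> Ops" and one: "idO \<in> R" and add: "\<And>L L'. L \<in> R \<Longrightarrow> L' \<in> R \<Longrightarrow> addO L L' \<in> R"
    and sm: "\<And>L c. L \<in> R \<Longrightarrow> smO c L \<in> R" and mul: "\<And>L L'. L \<in> R \<Longrightarrow> L' \<in> R \<Longrightarrow> mulO L L' \<in> R"
    and adj: "\<And>L. L \<in> R \<Longrightarrow> adjoint L \<in> R"
  shows "unital_pre_cstar (op_alg R)"
proof -
  have RO: "L \<in> Ops" if "L \<in> R" for L using R that by blast
  have eq: "L = L'" if "L \<in> R" "L' \<in> R" "\<And>F k. F \<in> X \<Longrightarrow> k \<in> carrier G \<Longrightarrow> L F k = L' F k" for L L'
  proof (rule op_ext[OF Ops_D(2)[OF RO[OF that(1)]] Ops_D(2)[OF RO[OF that(2)]]])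
    fix F assume F: "F \<in> X"
    show "L F = L' F"
      by (rule X_fun_eqI[OF Ops_D(3)[OF RO[OF that(1)] F] Ops_D(3)[OF RO[OF that(2)] F] that(3)[OF F]])
  qed
  have m [simp]: "L F \<in> X" if "L \<in> R" "F \<in> X" for L F using Ops_D(3)[OF RO] that by blast
  have z: "zO \<in> R"
  proof -
    have "smO 0 idO = zO" unfolding O_defs by (rule restrict_ext) (rule X_fun_eqI, simp_all)
    then show ?thesis using sm[OF one, of 0] by simp
  qed
  have app: "F \<in> X \<Longrightarrow> addO L L' F = addX (L F) (L' F)" "F \<in> X \<Longrightarrow> smO c L F = smX c (L F)"
    "F \<in> X \<Longrightarrow> mulO L L' F = L (L' F)" "F \<in> X \<Longrightarrow> idO F = F" "F \<in> X \<Longrightarrow> zO F = zX" for F L L' c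
    by (simp_all add: O_defs)
  note lin = Ops_linear[OF RO]
  have module: "Module.module complex_ring (op_alg R)"
  proof (rule moduleI)
    show "abelian_group (op_alg R)"
    proof (rule abelian_groupI, unfold op_alg_simps)
      fix L L' L'' assume L: "L \<in> R" "L' \<in> R" "L'' \<in> R"
      show "addO (addO L L') L'' = addO L (addO L' L'')"
        by (rule eq) (use L in \<open>simp_all add: add app B.M.a_assoc\<close>)
    next
      fix L L' assume L: "L \<in> R" "L' \<in> R"
      show "addO L L' = addO L' L"
        by (rule eq) (use L in \<open>simp_all add: add app B.M.a_comm\<close>)
    next
      fix L assume L: "L \<in> R"
      show "addO zO L = L" by (rule eq) (use L in \<open>simp_all add: add app z\<close>)
      have "addO (smO (-1) L) L = zO"
      proof (rule eq)
        fix F k assume "F \<in> X" "k \<in> carrier G"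
        then show "addO (smO (-1) L) L F k = zO F k"
          using L B.pre.smult_add[of "L F k" "-1" 1] by (simp add: app)
      qed (use L in \<open>simp_all add: add sm z\<close>)
      then show "\<exists>y\<in>R. addO y L = zO" using sm[OF L] by blast
    qed (simp_all add: add z)
  next
    fix a b :: complex and L assume L: "L \<in> carrier (op_alg R)"
    show "(a \<oplus>\<^bsub>complex_ring\<^esub> b) \<odot>\<^bsub>op_alg R\<^esub> L = a \<odot>\<^bsub>op_alg R\<^esub> L \<oplus>\<^bsub>op_alg R\<^esub> b \<odot>\<^bsub>op_alg R\<^esub> L"
      by (simp, rule eq) (use L in \<open>simp_all add: add sm app B.pre.smult_add\<close>)
    show "(a \<otimes>\<^bsub>complex_ring\<^esub> b) \<odot>\<^bsub>op_alg R\<^esub> L = a \<odot>\<^bsub>op_alg R\<^esub> (b \<odot>\<^bsub>op_alg R\<^esub> L)"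
      by (simp, rule eq) (use L in \<open>simp_all add: add sm app B.pre.smult_smult\<close>)
  next
    fix L assume L: "L \<in> carrier (op_alg R)"
    show "\<one>\<^bsub>complex_ring\<^esub> \<odot>\<^bsub>op_alg R\<^esub> L = L"
      by (simp, rule eq) (use L in \<open>simp_all add: sm app\<close>)
  next
    fix a and L L' assume L: "L \<in> carrier (op_alg R)" "L' \<in> carrier (op_alg R)"
    show "a \<odot>\<^bsub>op_alg R\<^esub> (L \<oplus>\<^bsub>op_alg R\<^esub> L') = a \<odot>\<^bsub>op_alg R\<^esub> L \<oplus>\<^bsub>op_alg R\<^esub> a \<odot>\<^bsub>op_alg R\<^esub> L'"
      by (simp, rule eq) (use L in \<open>simp_all add: add sm app B.pre.smult_distr\<close>)
  qed (simp_all add: sm cring_complex_ring)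
  interpret Module.module complex_ring "op_alg R" by (rule module)
  show ?thesis
  proof (unfold_locales, unfold op_alg_simps)
    fix L L' L'' assume L: "L \<in> R" "L' \<in> R" "L'' \<in> R"
    show "mulO (mulO L L') L'' = mulO L (mulO L' L'')"
      by (rule eq) (use L in \<open>simp_all add: mul app\<close>)
    show "mulO (addO L L') L'' = addO (mulO L L'') (mulO L' L'')"
      by (rule eq) (use L in \<open>simp_all add: mul add app\<close>)
    show "mulO L (addO L' L'') = addO (mulO L L') (mulO L L'')"
      by (rule eq) (use L in \<open>simp_all add: mul add app lin(1)\<close>)
  next
    fix c and L L' assume L: "L \<in> R" "L' \<in> R"
    show "mulO (smO c L) L' = smO c (mulO L L')"
      by (rule eq) (use L in \<open>simp_all add: mul sm app\<close>)
    have "L (smX c (L' F)) = smX c (L (L' F))" if "F \<in> X" for F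
      using lin(2)[OF L(1) m[OF L(2) that] m[OF L(2) that]] .
    then show "mulO L (smO c L') = smO c (mulO L L')"
      by (intro eq) (use L in \<open>simp_all add: mul sm app\<close>)
  next
    fix L assume L: "L \<in> R"
    show "mulO idO L = L" "mulO L idO = L"
      by (rule eq; use L in \<open>simp add: mul one app\<close>)+
  qed (use mul adj one RO in \<open>simp_all add: adjoint_Ops Ops_addO Ops_smO Ops_mulO op_norm_eq_0 op_norm_smO op_norm_cstar\<close>)
qed

end

context su_rep
begin

section \<open>The covariant representation\<close>

lemma \<rho>_cong: assumes \<phi>: "\<phi> \<in> UW" and eq: "\<And>v. v \<in> W \<Longrightarrow> \<phi> v = \<psi> v" shows "\<rho> \<psi> = \<rho> \<phi>"
proof -
  have osc: "osc a e \<psi>" if "osc a e \<phi>" for a e using that eq unfolding osc_def by simp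
  have \<psi>: "\<psi> \<in> UW"
  proof -
    obtain K where K: "\<forall>w\<in>W. cmod (\<phi> w) \<le> K" using UW_D(3)[OF \<phi>] by blast
    show ?thesis
    proof (rule UW_I)
      show "\<forall>w\<in>W. cmod (\<psi> w) \<le> K" using K eq by simp
      show "\<psi> (w \<otimes> b) = \<psi> w" if "w \<in> W" "b \<in> Hp" for w b
        using UW_D(1)[OF \<phi>] eq[OF that(1)] eq[OF W_mult[OF that(1) Hp_W[OF that(2)]]] that by (simp add: Hinv_def)
      show "\<exists>a\<in>Hp. osc a e \<psi>" if "0 < e" for e using UW_D(2)[OF \<phi> that] osc by blast
    qed
  qed
  show ?thesis
  proof (rule \<rho>_eqI[OF \<psi> \<rho>(1)[OF \<phi>], of 3])
    fix e :: real assume e: "0 < e"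
    obtain a V where V: "osc a e \<phi>" "transversal a V" using osc_pair[OF \<phi> \<phi> e] by blast
    have "\<sigma> V \<psi> = \<sigma> V \<phi>" by (rule \<sigma>_cong[OF V(2)]) (simp add: eq transversalD(2)[OF V(2)])
    then have "normB (\<rho> \<phi> \<ominus>\<^bsub>B\<^esub> \<sigma> V \<psi>) \<le> 3 * e" using \<rho>(2)[OF \<phi> V(1) _ V(2)] e by simp
    then show "\<exists>a V. osc a e \<psi> \<and> transversal a V \<and> normB (\<rho> \<phi> \<ominus>\<^bsub>B\<^esub> \<sigma> V \<psi>) \<le> 3 * e" using V osc by blast
  qed simp
qed

lemma conj_shift: assumes "a \<in> Hp" "c \<in> Hp" "h \<in> H" "inv a \<otimes> h \<otimes> c \<in> Hp" and x: "x \<in> conj_set G c M"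
  shows "h \<otimes> x \<otimes> inv h \<in> conj_set G a M"
proof -
  define d where "d = inv a \<otimes> h \<otimes> c"
  obtain m where m: "m \<in> M" "x = c \<otimes> m \<otimes> inv c" using x unfolding conj_set_def by blast
  have d: "d \<in> Hp" using assms by (simp add: d_def)
  have hc: "h \<otimes> c = a \<otimes> d" using assms(1-3) by (simp add: d_def m_assoc)
  have "h \<otimes> x \<otimes> inv h = (h \<otimes> c) \<otimes> m \<otimes> inv (h \<otimes> c)" unfolding m(2) using assms m(1) by (intro conj_mult[symmetric]) auto
  also have "\<dots> = a \<otimes> (d \<otimes> m \<otimes> inv d) \<otimes> inv a" unfolding hc using assms(1) d m(1) by (intro conj_mult) auto
  finally show ?thesis unfolding conj_set_def using conj_M[OF d m(1)] by blast
qed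

abbreviation "act \<equiv> alpha G N H"

lemma alpha_eq: "\<lbrakk>h \<in> carrier G; y \<in> N\<rbrakk> \<Longrightarrow> act h f y = f (np (inv h \<otimes> y))"
  by (simp add: alpha_def beta_np)

lemma alpha_UCN: assumes f: "f \<in> UCN" and h: "h \<in> carrier G" shows "act h f \<in> UCN"
  unfolding UCN_def mem_Collect_eq
proof (intro conjI allI impI)
  obtain K where K: "\<forall>y\<in>N. cmod (f y) \<le> K" using f unfolding UCN_def linfty_carrier by blast
  have "\<forall>y\<in>N. cmod (act h f y) \<le> K" using K h by (simp add: alpha_eq)
  moreover have "act h f y = 0" if "y \<notin> N" for y using that by (simp add: alpha_def)
  ultimately show "act h f \<in> carrier (linfty N)" unfolding linfty_carrier by blast
  fix e :: real assume e: "0 < e"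
  obtain a where a: "a \<in> Hp" "\<forall>x\<in>N. \<forall>y\<in>N. inv x \<otimes> y \<in> conj_set G a M \<longrightarrow> cmod (f x - f y) \<le> e"
    using f[unfolded UCN_def mem_Collect_eq, THEN conjunct2, THEN spec, THEN mp, OF e] by (elim bexE)
  define k where "k = hp (inv h)"
  have k: "k \<in> H" using h by (simp add: k_def)
  have ak: "inv a \<otimes> k \<in> H" using H.m_closed[OF H.m_inv_closed[OF in_G(5)[OF a(1)]] k] .
  obtain c where c: "c \<in> Hp" "inv a \<otimes> k \<otimes> c \<in> Hp" using Hp_fraction[OF ak] by blast
  have "cmod (act h f x - act h f y) \<le> e" if xy: "x \<in> N" "y \<in> N" "inv x \<otimes> y \<in> conj_set G c M" for x y
  proof -
    define t where "t = inv x \<otimes> y"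
    have t: "t \<in> N" "y = x \<otimes> t" using xy by (simp_all add: t_def sub_closed)
    have "np (inv h \<otimes> y) = np (inv h \<otimes> x \<otimes> t)" using h xy t by (simp add: m_assoc)
    also have "\<dots> = np (inv h \<otimes> x) \<otimes> (k \<otimes> t \<otimes> inv k)"
      using np_mult(2)[of "inv h \<otimes> x" t] np_mult(1)[of "inv h" x] h xy t(1) by (simp add: k_def)
    finally have "inv (np (inv h \<otimes> x)) \<otimes> np (inv h \<otimes> y) = k \<otimes> t \<otimes> inv k"
      using h xy t(1) k by simp
    also have "\<dots> \<in> conj_set G a M" by (rule conj_shift[OF a(1) c(1) k c(2)]) (use xy in \<open>simp add: t_def\<close>)
    finally show ?thesis using a(2) xy h by (simp add: alpha_eq)
  qed
  then show "\<exists>c\<in>Hp. \<forall>x\<in>N. \<forall>y\<in>N. inv x \<otimes> y \<in> conj_set G c M \<longrightarrow> cmod (act h f x - act h f y) \<le> e"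
    using c(1) by blast
qed

lemma lift_alpha: assumes "f \<in> UCN" "h \<in> carrier G" "k \<in> carrier G"
  shows "\<rho> (lift (act h f) k) = \<rho> (lift f (inv h \<otimes> k))"
  by (rule \<rho>_cong[OF lift_UW]) (use assms in \<open>simp_all add: lift_def alpha_eq np_mult_np m_assoc\<close>)

lemma lift_shift: assumes "f \<in> UCN" "k \<in> carrier G" "w \<in> W"
  shows "\<rho> (\<lambda>v. lift f k (w \<otimes> v)) = \<rho> (lift f (k \<otimes> w))"
  by (rule \<rho>_cong[OF lift_UW]) (use assms in \<open>simp_all add: lift_def m_assoc\<close>)

lemmas UCN_closed = UCN_subalgebra[unfolded cstar_subalgebra_def closed_subspace_def]

lemma UCN_ops: "\<lbrakk>f \<in> UCN; g \<in> UCN\<rbrakk> \<Longrightarrow> (\<lambda>y. f y + g y) \<in> UCN" "f \<in> UCN \<Longrightarrow> (\<lambda>y. c * f y) \<in> UCN"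
  "\<lbrakk>f \<in> UCN; g \<in> UCN\<rbrakk> \<Longrightarrow> (\<lambda>y. f y * g y) \<in> UCN" "f \<in> UCN \<Longrightarrow> (\<lambda>y. cnj (f y)) \<in> UCN" "(\<lambda>y. 0) \<in> UCN"
  using UCN_closed unfolding linfty_simps by blast+

text \<open>The unitary representation of \<open>G\<close> and the representation of functions on
  \<open>N\<close> that form the covariant pair.\<close>

definition uop where "uop h = (\<lambda>F\<in>X. \<lambda>k\<in>carrier G. F (inv h \<otimes> k))"
definition piop where "piop f = (\<lambda>F\<in>X. \<lambda>k\<in>carrier G. \<rho> (lift f k) \<otimes>\<^bsub>B\<^esub> F k)"

lemma uop_app [simp]: "\<lbrakk>F \<in> X; k \<in> carrier G\<rbrakk> \<Longrightarrow> uop h F k = F (inv h \<otimes> k)" by (simp add: uop_def)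
lemma piop_app [simp]: "\<lbrakk>F \<in> X; k \<in> carrier G\<rbrakk> \<Longrightarrow> piop f F k = \<rho> (lift f k) \<otimes>\<^bsub>B\<^esub> F k" by (simp add: piop_def)

lemma uop_lev: assumes "F \<in> X" "h \<in> carrier G" "lev F g" shows "lev (uop h F) (h \<otimes> g)"
  unfolding lev_def
proof (intro conjI ballI)
  note g = lev_G[OF assms(3)]
  show "h \<otimes> g \<in> carrier G" using assms g by simp
  fix w assume w: "w \<in> W"
  have e: "inv h \<otimes> (h \<otimes> g \<otimes> inv w) = g \<otimes> inv w" "inv h \<otimes> (h \<otimes> g) = g" using assms g w by (simp_all add: m_assoc)
  show "uop h F (h \<otimes> g \<otimes> inv w) = T w \<otimes>\<^bsub>B\<^esub> uop h F (h \<otimes> g)"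
    using assms g w levD[OF assms(3) w] by (simp add: e del: cancel_inv)
qed

lemma uop_X: assumes F: "F \<in> X" and h: "h \<in> carrier G" shows "uop h F \<in> X"
proof -
  obtain g where g: "lev F g" using common_level[OF F F] by blast
  show ?thesis
  proof (rule X_I[OF _ _ _ uop_lev[OF F h g]])
    fix k assume k: "k \<in> carrier G"
    show "uop h F k \<in> carrier B" using F h k by simp
    fix w assume w: "w \<in> W"
    have "inv h \<otimes> (k \<otimes> w) = (inv h \<otimes> k) \<otimes> w" using h k w by (simp add: m_assoc)
    then show "uop h F (k \<otimes> w) = starB (T w) \<otimes>\<^bsub>B\<^esub> uop h F k" using F h k w by (simp add: X_equiv)
  qed (simp add: uop_def F)
qed

text \<open>Covariance of \<open>\<rho>\<close> is what makes multiplication by \<open>\<rho>(lift f k)\<close>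
  compatible with the two defining conditions of \<open>X\<close>.\<close>

lemma piop_equiv: assumes f: "f \<in> UCN" and k: "k \<in> carrier G" and w: "w \<in> W"
  shows "starB (T w) \<otimes>\<^bsub>B\<^esub> \<rho> (lift f k) = \<rho> (lift f (k \<otimes> w)) \<otimes>\<^bsub>B\<^esub> starB (T w)"
    "\<rho> (lift f (k \<otimes> inv w)) \<otimes>\<^bsub>B\<^esub> T w = T w \<otimes>\<^bsub>B\<^esub> \<rho> (lift f k)"
proof -
  show "starB (T w) \<otimes>\<^bsub>B\<^esub> \<rho> (lift f k) = \<rho> (lift f (k \<otimes> w)) \<otimes>\<^bsub>B\<^esub> starB (T w)"
    using \<rho>_covariant_adj[OF lift_UW[OF f k] w] lift_shift[OF f k w] by simp
  have kw: "k \<otimes> inv w \<in> carrier G" "k \<otimes> inv w \<otimes> w = k" using k w by (simp_all add: m_assoc)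
  show "\<rho> (lift f (k \<otimes> inv w)) \<otimes>\<^bsub>B\<^esub> T w = T w \<otimes>\<^bsub>B\<^esub> \<rho> (lift f k)"
    using \<rho>_covariant[OF lift_UW[OF f kw(1)] w] lift_shift[OF f kw(1) w] kw(2) by simp
qed

lemma \<rho>l [simp]: "\<lbrakk>f \<in> UCN; k \<in> carrier G\<rbrakk> \<Longrightarrow> \<rho> (lift f k) \<in> carrier B"
  by (rule \<rho>(1)[OF lift_UW])

lemma piop_lev: assumes F: "F \<in> X" and f: "f \<in> UCN" and g: "lev F g" shows "lev (piop f F) g"
  unfolding lev_def
proof (intro conjI ballI)
  note gG = lev_G[OF g]
  show "g \<in> carrier G" by (rule gG)
  fix w assume w: "w \<in> W"
  have "\<rho> (lift f (g \<otimes> inv w)) \<otimes>\<^bsub>B\<^esub> (T w \<otimes>\<^bsub>B\<^esub> F g) = T w \<otimes>\<^bsub>B\<^esub> (\<rho> (lift f g) \<otimes>\<^bsub>B\<^esub> F g)"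
    using piop_equiv(2)[OF f gG w] F f gG w by (simp add: B.pre.times_assoc[symmetric])
  then show "piop f F (g \<otimes> inv w) = T w \<otimes>\<^bsub>B\<^esub> piop f F g" using F gG w by (simp add: levD[OF g w])
qed

lemma piop_X: assumes F: "F \<in> X" and f: "f \<in> UCN" shows "piop f F \<in> X"
proof -
  obtain g where g: "lev F g" using common_level[OF F F] by blast
  show ?thesis
  proof (rule X_I[OF _ _ _ piop_lev[OF F f g]])
    fix k assume k: "k \<in> carrier G"
    show "piop f F k \<in> carrier B" using F f k by simp
    fix w assume w: "w \<in> W"
    have "\<rho> (lift f (k \<otimes> w)) \<otimes>\<^bsub>B\<^esub> (starB (T w) \<otimes>\<^bsub>B\<^esub> F k) = starB (T w) \<otimes>\<^bsub>B\<^esub> (\<rho> (lift f k) \<otimes>\<^bsub>B\<^esub> F k)"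
      using piop_equiv(1)[OF f k w] F f k w by (simp add: B.pre.times_assoc[symmetric])
    then show "piop f F (k \<otimes> w) = starB (T w) \<otimes>\<^bsub>B\<^esub> piop f F k" using F k w by (simp add: X_equiv)
  qed (simp add: piop_def F)
qed

lemma uop_ext: "h \<in> carrier G \<Longrightarrow> uop h \<in> X \<rightarrow>\<^sub>E X"
  using uop_X unfolding PiE_def by (auto simp: uop_def)

lemma piop_ext: "f \<in> UCN \<Longrightarrow> piop f \<in> X \<rightarrow>\<^sub>E X"
  using piop_X unfolding PiE_def by (auto simp: piop_def)

lemma uop_pair: assumes h: "h \<in> carrier G" shows "adjoint_pair (uop h) (uop (inv h))"
  unfolding adjoint_pair_def
proof (intro conjI ballI)
  show "uop h \<in> X \<rightarrow>\<^sub>E X" "uop (inv h) \<in> X \<rightarrow>\<^sub>E X" using h by (simp_all add: uop_ext)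
  fix F F' assume F: "F \<in> X" "F' \<in> X"
  obtain g where g: "lev F g" "lev F' (h \<otimes> g)"
  proof -
    obtain g g' where g: "lev F g" "lev F' g'" using common_level[OF F(1,1)] common_level[OF F(2,2)] by metis
    have G: "h \<otimes> g \<in> carrier G" "g' \<in> carrier G" using g h by auto
    obtain v v' where v: "v \<in> W" "v' \<in> W" "h \<otimes> g \<otimes> inv v = g' \<otimes> inv v'" using W_ore[OF G] by blast
    have "lev F (g \<otimes> inv v)" by (rule lev_mono[OF F(1) g(1) v(1)])
    moreover have "lev F' (h \<otimes> (g \<otimes> inv v))"
      using lev_mono[OF F(2) g(2) v(2)] v(3) h lev_G[OF g(1)] v(1) by (simp add: m_assoc)
    ultimately show thesis by (rule that)
  qed
  have g': "lev (uop (inv h) F') g"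
    using uop_lev[OF F(2) inv_closed[OF h] g(2)] h lev_G[OF g(1)] by simp
  show "ip (uop h F) F' = ip F (uop (inv h) F')"
    using ip_eq[OF uop_X[OF F(1) h] F(2) uop_lev[OF F(1) h g(1)] g(2)]
      ip_eq[OF F(1) uop_X[OF F(2) inv_closed[OF h]] g(1) g'] F h lev_G[OF g(1)] by simp
qed

lemma uop_Ops: assumes h: "h \<in> carrier G" shows "uop h \<in> Ops" "adjoint (uop h) = uop (inv h)"
proof -
  have "op_bound (uop h) 1"
    unfolding op_bound_def
  proof (intro conjI ballI)
    fix F assume F: "F \<in> X"
    obtain g where g: "lev F g" using common_level[OF F F] by blast
    show "nX (uop h F) \<le> 1 * nX F"
      using nX_eq[OF uop_X[OF F h] uop_lev[OF F h g]] nX_eq[OF F g] F h lev_G[OF g] by simp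
  qed simp
  then show "uop h \<in> Ops" using uop_pair[OF h] unfolding Ops_def by blast
  show "adjoint (uop h) = uop (inv h)" by (rule adjoint_eq[OF uop_pair[OF h]])
qed

lemma \<rho>_lift_ops: assumes f: "f \<in> UCN" "g \<in> UCN" and k: "k \<in> carrier G"
  shows "\<rho> (lift (\<lambda>y. f y + g y) k) = \<rho> (lift f k) \<oplus>\<^bsub>B\<^esub> \<rho> (lift g k)"
    "\<rho> (lift (\<lambda>y. f y * g y) k) = \<rho> (lift f k) \<otimes>\<^bsub>B\<^esub> \<rho> (lift g k)"
    "\<rho> (lift (\<lambda>y. c * f y) k) = c \<odot>\<^bsub>B\<^esub> \<rho> (lift f k)"
    "\<rho> (lift (\<lambda>y. cnj (f y)) k) = starB (\<rho> (lift f k))"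
  using \<rho>_add[OF lift_UW[OF f(1) k] lift_UW[OF f(2) k]] \<rho>_mult[OF lift_UW[OF f(1) k] lift_UW[OF f(2) k]]
    \<rho>_smult[OF lift_UW[OF f(1) k]] \<rho>_cnj[OF lift_UW[OF f(1) k]]
  by (simp_all add: lift_def)

lemma \<rho>_lift_one: assumes k: "k \<in> carrier G" shows "\<rho> (lift (indicator N) k) = \<one>\<^bsub>B\<^esub>"
proof -
  have "\<rho> (lift (indicator N) k) = \<rho> (\<lambda>_. 1)"
    by (rule \<rho>_cong[OF UW_one]) (use k in \<open>simp add: lift_def\<close>)
  then show ?thesis by (simp add: \<rho>_one)
qed

lemma \<rho>_lift_zero: assumes k: "k \<in> carrier G" shows "\<rho> (lift (\<lambda>_. 0) k) = \<zero>\<^bsub>B\<^esub>"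
  using \<rho>_lift_ops(3)[OF UCN_ops(5) UCN_ops(5) k, of 0] k UCN_ops(5) by simp

lemma piop_Ops: assumes f: "f \<in> UCN" shows "piop f \<in> Ops" "adjoint (piop f) = piop (\<lambda>y. cnj (f y))"
proof -
  note f' = UCN_ops(4)[OF f]
  have p: "adjoint_pair (piop f) (piop (\<lambda>y. cnj (f y)))"
    unfolding adjoint_pair_def
  proof (intro conjI ballI)
    show "piop f \<in> X \<rightarrow>\<^sub>E X" "piop (\<lambda>y. cnj (f y)) \<in> X \<rightarrow>\<^sub>E X" using f f' by (simp_all add: piop_ext)
    fix F F' assume F: "F \<in> X" "F' \<in> X"
    obtain g where g: "lev F g" "lev F' g" using common_level[OF F] by blast
    note gG = lev_G[OF g(1)]
    show "ip (piop f F) F' = ip F (piop (\<lambda>y. cnj (f y)) F')"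
      using ip_eq[OF piop_X[OF F(1) f] F(2) piop_lev[OF F(1) f g(1)] g(2)]
        ip_eq[OF F(1) piop_X[OF F(2) f'] g(1) piop_lev[OF F(2) f' g(2)]] F gG f
      by (simp add: \<rho>_lift_ops(4)[OF f f gG] B.pre.adj_times B.pre.times_assoc)
  qed
  obtain K where K: "0 \<le> K" "\<forall>y\<in>N. cmod (f y) \<le> K"
    using f linfty_norm_ge[of f N] pre_cstar.nrm_ge_0[OF linfty_pre_cstar[of N], of f] N.one_closed
    unfolding UCN_def by blast
  have "op_bound (piop f) K"
    unfolding op_bound_def
  proof (intro conjI ballI K(1))
    fix F assume F: "F \<in> X"
    obtain g where g: "lev F g" using common_level[OF F F] by blast
    note gG = lev_G[OF g]
    have "normB (\<rho> (lift f g)) \<le> K" by (rule \<rho>_norm[OF lift_UW[OF f gG] K(1)]) (use K gG in \<open>simp add: lift_def\<close>)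
    then have "normB (\<rho> (lift f g) \<otimes>\<^bsub>B\<^esub> F g) \<le> K * normB (F g)"
      using F f gG by (intro B.pre.nrm_times_le) auto
    then show "nX (piop f F) \<le> K * nX F"
      using nX_eq[OF piop_X[OF F f] piop_lev[OF F f g]] nX_eq[OF F g] F gG by simp
  qed
  then show "piop f \<in> Ops" using p unfolding Ops_def by blast
  show "adjoint (piop f) = piop (\<lambda>y. cnj (f y))" by (rule adjoint_eq[OF p])
qed

lemma Ops_eqI: assumes "L \<in> Ops" "L' \<in> Ops" "\<And>F k. F \<in> X \<Longrightarrow> k \<in> carrier G \<Longrightarrow> L F k = L' F k" shows "L = L'"
proof (rule op_ext[OF Ops_D(2)[OF assms(1)] Ops_D(2)[OF assms(2)]])
  fix F assume F: "F \<in> X"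
  show "L F = L' F"
    by (rule X_fun_eqI[OF Ops_D(3)[OF assms(1) F] Ops_D(3)[OF assms(2) F] assms(3)[OF F]])
qed

lemma O_app: "F \<in> X \<Longrightarrow> addO L L' F = addX (L F) (L' F)" "F \<in> X \<Longrightarrow> smO c L F = smX c (L F)"
  "F \<in> X \<Longrightarrow> mulO L L' F = L (L' F)" "F \<in> X \<Longrightarrow> idO F = F" "F \<in> X \<Longrightarrow> zO F = zX"
  by (simp_all add: O_defs)

lemma op_rel:
  shows "\<lbrakk>h \<in> carrier G; k \<in> carrier G\<rbrakk> \<Longrightarrow> mulO (uop h) (uop k) = uop (h \<otimes> k)"
    "uop \<one> = idO"
    "\<lbrakk>f \<in> UCN; g \<in> UCN\<rbrakk> \<Longrightarrow> mulO (piop f) (piop g) = piop (\<lambda>y. f y * g y)"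
    "\<lbrakk>f \<in> UCN; g \<in> UCN\<rbrakk> \<Longrightarrow> addO (piop f) (piop g) = piop (\<lambda>y. f y + g y)"
    "f \<in> UCN \<Longrightarrow> smO c (piop f) = piop (\<lambda>y. c * f y)"
    "piop (indicator N) = idO"
    "\<lbrakk>f \<in> UCN; h \<in> carrier G\<rbrakk> \<Longrightarrow> mulO (uop h) (piop f) = mulO (piop (act h f)) (uop h)"
proof -
  show "mulO (uop h) (uop k) = uop (h \<otimes> k)" if "h \<in> carrier G" "k \<in> carrier G"
    by (rule Ops_eqI) (use that in \<open>simp_all add: uop_Ops Ops_mulO O_app uop_X inv_mult_group m_assoc\<close>)
  show "uop \<one> = idO"
    by (rule Ops_eqI) (simp_all add: uop_Ops Ops_id O_app)
  show "mulO (piop f) (piop g) = piop (\<lambda>y. f y * g y)" if "f \<in> UCN" "g \<in> UCN"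
    by (rule Ops_eqI) (use that in \<open>simp_all add: piop_Ops UCN_ops Ops_mulO O_app piop_X \<rho>_lift_ops B.pre.times_assoc\<close>)
  show "addO (piop f) (piop g) = piop (\<lambda>y. f y + g y)" if "f \<in> UCN" "g \<in> UCN"
    by (rule Ops_eqI) (use that in \<open>simp_all add: piop_Ops UCN_ops Ops_addO O_app piop_X \<rho>_lift_ops B.pre.times_add_l\<close>)
  show "smO c (piop f) = piop (\<lambda>y. c * f y)" if "f \<in> UCN"
    by (rule Ops_eqI) (use that in \<open>simp_all add: piop_Ops UCN_ops Ops_smO O_app piop_X \<rho>_lift_ops(3)[OF that that] B.pre.smult_times_l\<close>)
  show "piop (indicator N) = idO"
    by (rule Ops_eqI) (simp_all add: piop_Ops UCN_one Ops_id O_app \<rho>_lift_one)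
  show "mulO (uop h) (piop f) = mulO (piop (act h f)) (uop h)" if "f \<in> UCN" "h \<in> carrier G"
    by (rule Ops_eqI) (use that in \<open>simp_all add: piop_Ops uop_Ops alpha_UCN Ops_mulO O_app piop_X uop_X lift_alpha\<close>)
qed

text \<open>The linear span of the products of functions and translations is closed under products and adjoints
  by covariance.\<close>

inductive_set EE where
  gen: "\<lbrakk>f \<in> UCN; h \<in> carrier G\<rbrakk> \<Longrightarrow> mulO (piop f) (uop h) \<in> EE"
| add: "\<lbrakk>L \<in> EE; L' \<in> EE\<rbrakk> \<Longrightarrow> addO L L' \<in> EE"

lemma Ops_pre: "unital_pre_cstar (op_alg Ops)"
  by (rule op_alg_pre_cstar) (simp_all add: Ops_id Ops_addO Ops_smO Ops_mulO adjoint_Ops)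

lemma EE_Ops: "L \<in> EE \<Longrightarrow> L \<in> Ops"
  by (induction rule: EE.induct) (simp_all add: piop_Ops uop_Ops Ops_mulO Ops_addO)

lemma EE_closed: "idO \<in> EE" "L \<in> EE \<Longrightarrow> smO c L \<in> EE" "\<lbrakk>L \<in> EE; L' \<in> EE\<rbrakk> \<Longrightarrow> mulO L L' \<in> EE" "L \<in> EE \<Longrightarrow> adjoint L \<in> EE"
  "f \<in> UCN \<Longrightarrow> piop f \<in> EE" "h \<in> carrier G \<Longrightarrow> uop h \<in> EE"
proof -
  interpret O: unital_pre_cstar "op_alg Ops" by (rule Ops_pre)
  note O = O.times_assoc[simplified] O.smult_times_l[simplified] O.smult_distr[simplified] O.times_add_l[simplified]
    O.times_add_r[simplified] O.unit_l[simplified] O.unit_r[simplified]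
  note mem = piop_Ops(1) uop_Ops(1) Ops_mulO(1) Ops_addO(1) EE_Ops UCN_ops alpha_UCN
  show pi: "piop f \<in> EE" if f: "f \<in> UCN" for f
    using EE.gen[OF f one_closed] f by (simp add: op_rel(2) O mem)
  show u: "uop h \<in> EE" if h: "h \<in> carrier G" for h
    using EE.gen[OF UCN_one h] h by (simp add: op_rel(6) O mem)
  show "idO \<in> EE" using pi[OF UCN_one] by (simp add: op_rel(6))
  show "smO c L \<in> EE" if "L \<in> EE" for L c
    using that
  proof (induction rule: EE.induct)
    case (gen f h)
    have "smO c (mulO (piop f) (uop h)) = mulO (piop (\<lambda>y. c * f y)) (uop h)"
      using gen by (simp add: O(2)[symmetric] mem op_rel(5))
    then show ?case using gen EE.gen[OF UCN_ops(2)[OF gen(1)] gen(2)] by simp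
  next
    case (add L L')
    then show ?case using O(3)[of L L' c] by (simp add: mem EE.add)
  qed
  have mul1: "mulO (mulO (piop f) (uop h)) L \<in> EE" if f: "f \<in> UCN" and h: "h \<in> carrier G" and L: "L \<in> EE" for f h L
    using L
  proof (induction rule: EE.induct)
    case (gen g k)
    have "mulO (mulO (piop f) (uop h)) (mulO (piop g) (uop k)) = mulO (mulO (piop f) (mulO (uop h) (piop g))) (uop k)"
      using f h gen by (simp add: O(1) mem)
    also have "\<dots> = mulO (mulO (piop f) (piop (act h g))) (mulO (uop h) (uop k))"
      using f h gen by (simp add: O(1) mem op_rel(7))
    also have "\<dots> = mulO (piop (\<lambda>y. f y * act h g y)) (uop (h \<otimes> k))"
      using f h gen by (simp add: op_rel(1,3) mem)
    finally show ?case using EE.gen[OF UCN_ops(3)[OF f alpha_UCN[OF gen(1) h]] m_closed[OF h gen(2)]] by simp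
  next
    case (add L L')
    then show ?case using f h O(5)[of "mulO (piop f) (uop h)" L L'] by (simp add: mem EE.add)
  qed
  show "mulO L L' \<in> EE" if "L \<in> EE" "L' \<in> EE" for L L'
    using that(1)
  proof (induction rule: EE.induct)
    case (gen f h)
    then show ?case by (rule mul1[OF _ _ that(2)])
  next
    case (add K K')
    then show ?case using that(2) O(4)[of K K' L'] by (simp add: mem EE.add)
  qed
  then have mul: "mulO L L' \<in> EE" if "L \<in> EE" "L' \<in> EE" for L L' using that by blast
  show "adjoint L \<in> EE" if "L \<in> EE" for L
    using that
  proof (induction rule: EE.induct)
    case (gen f h)
    then show ?case
      by (simp add: Ops_mulO(2) mem piop_Ops(2) uop_Ops(2) mul u pi)
  next
    case (add L L')
    then show ?case by (simp add: Ops_addO(2) mem EE.add)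
  qed
qed

lemma EE_pre: "unital_pre_cstar (op_alg EE)"
  by (rule op_alg_pre_cstar) (auto simp: EE_closed EE_Ops intro: EE.add)

section \<open>Codes for the operators\<close>

definition supp where "supp y = {h \<in> carrier G. y h \<noteq> (\<lambda>_. 0 :: complex)}"

text \<open>An operator in the span is a sum over finitely many translations \<open>h\<close>, each with a
  coefficient function \<open>y h\<close>. Such a code has the type for which the universal property
  of the crossed product is available.\<close>

definition coded where
  "coded L y \<longleftrightarrow> finite (supp y) \<and> (\<forall>h\<in>carrier G. y h \<in> UCN) \<and>
     (\<forall>F\<in>X. \<forall>k\<in>carrier G. L F k = (\<Oplus>\<^bsub>B\<^esub>h\<in>supp y. \<rho> (lift (y h) k) \<otimes>\<^bsub>B\<^esub> F (inv h \<otimes> k)))"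

lemma coded_sum:
  assumes y: "\<forall>h\<in>carrier G. y h \<in> UCN" and I: "finite I" "supp y \<subseteq> I" "I \<subseteq> carrier G" and F: "F \<in> X" and k: "k \<in> carrier G"
  shows "(\<Oplus>\<^bsub>B\<^esub>h\<in>supp y. \<rho> (lift (y h) k) \<otimes>\<^bsub>B\<^esub> F (inv h \<otimes> k)) = (\<Oplus>\<^bsub>B\<^esub>h\<in>I. \<rho> (lift (y h) k) \<otimes>\<^bsub>B\<^esub> F (inv h \<otimes> k))"
proof (rule B.M.add.finprod_mono_neutral_cong_left[OF I(1,2)])
  fix h assume h: "h \<in> I - supp y"
  then have hG: "h \<in> carrier G" "y h = (\<lambda>_. 0)" using I(3) by (auto simp: supp_def)
  show "\<rho> (lift (y h) k) \<otimes>\<^bsub>B\<^esub> F (inv h \<otimes> k) = \<zero>\<^bsub>B\<^esub>" unfolding hG(2) using F k hG(1) by (simp add: \<rho>_lift_zero)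
next
  show "(\<lambda>h. \<rho> (lift (y h) k) \<otimes>\<^bsub>B\<^esub> F (inv h \<otimes> k)) \<in> I \<rightarrow> carrier B"
    using y I(3) F k by (intro funcsetI B.pre.times_closed \<rho>l X_in) auto
qed simp

lemma EE_coded: "L \<in> EE \<Longrightarrow> \<exists>y. coded L y"
proof (induction rule: EE.induct)
  case (gen f h)
  define y where "y = (\<lambda>g. if g = h then f else (\<lambda>_. 0))"
  have y: "\<forall>g\<in>carrier G. y g \<in> UCN" using gen by (simp add: y_def UCN_ops)
  have s: "supp y \<subseteq> {h}" by (auto simp: supp_def y_def)
  have "mulO (piop f) (uop h) F k = (\<Oplus>\<^bsub>B\<^esub>g\<in>supp y. \<rho> (lift (y g) k) \<otimes>\<^bsub>B\<^esub> F (inv g \<otimes> k))"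
    if F: "F \<in> X" and k: "k \<in> carrier G" for F k
  proof -
    have "(\<Oplus>\<^bsub>B\<^esub>g\<in>supp y. \<rho> (lift (y g) k) \<otimes>\<^bsub>B\<^esub> F (inv g \<otimes> k)) = (\<Oplus>\<^bsub>B\<^esub>g\<in>{h}. \<rho> (lift (y g) k) \<otimes>\<^bsub>B\<^esub> F (inv g \<otimes> k))"
      by (rule coded_sum[OF y _ s _ F k]) (use gen in auto)
    also have "\<dots> = \<rho> (lift f k) \<otimes>\<^bsub>B\<^esub> F (inv h \<otimes> k)"
      using gen F k by (subst B.M.finsum_insert) (simp_all add: y_def)
    finally show ?thesis using gen F k by (simp add: O_app uop_X)
  qed
  then show ?case using y finite_subset[OF s] unfolding coded_def by blast
next
  case (add L L')
  then obtain y z where y: "coded L y" and z: "coded L' z" by blast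
  define x where "x = (\<lambda>h v. y h v + z h v)"
  have yU: "\<forall>h\<in>carrier G. y h \<in> UCN" and zU: "\<forall>h\<in>carrier G. z h \<in> UCN" using y z by (simp_all add: coded_def)
  have xU: "\<forall>h\<in>carrier G. x h \<in> UCN" using yU zU by (simp add: x_def UCN_ops)
  define I where "I = supp y \<union> supp z"
  have I: "finite I" "supp y \<subseteq> I" "supp z \<subseteq> I" "I \<subseteq> carrier G" using y z by (auto simp: I_def coded_def supp_def)
  have s: "supp x \<subseteq> I" by (auto simp: supp_def x_def I_def)
  have "addO L L' F k = (\<Oplus>\<^bsub>B\<^esub>h\<in>supp x. \<rho> (lift (x h) k) \<otimes>\<^bsub>B\<^esub> F (inv h \<otimes> k))" if F: "F \<in> X" and k: "k \<in> carrier G" for F k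
  proof -
    let ?t = "\<lambda>y h. \<rho> (lift (y h) k) \<otimes>\<^bsub>B\<^esub> F (inv h \<otimes> k)"
    have tin: "?t w h \<in> carrier B" if "\<forall>h\<in>carrier G. w h \<in> UCN" "h \<in> I" for w h
      using that I(4) F k by (intro B.pre.times_closed \<rho>l X_in) auto
    have "addO L L' F k = (\<Oplus>\<^bsub>B\<^esub>h\<in>I. ?t y h) \<oplus>\<^bsub>B\<^esub> (\<Oplus>\<^bsub>B\<^esub>h\<in>I. ?t z h)"
      using y z F k by (simp add: O_app coded_def coded_sum[OF yU I(1,2,4) F k, symmetric] coded_sum[OF zU I(1,3,4) F k, symmetric])
    also have "\<dots> = (\<Oplus>\<^bsub>B\<^esub>h\<in>I. ?t y h \<oplus>\<^bsub>B\<^esub> ?t z h)"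
      by (rule B.M.finsum_addf[symmetric]) (use tin yU zU in auto)
    also have "\<dots> = (\<Oplus>\<^bsub>B\<^esub>h\<in>I. ?t x h)"
    proof (rule B.pre.finsum_eqI)
      fix h assume h: "h \<in> I"
      then have hG: "h \<in> carrier G" using I(4) by blast
      show "?t y h \<oplus>\<^bsub>B\<^esub> ?t z h = ?t x h"
        using yU zU hG F k by (simp add: x_def \<rho>_lift_ops(1) B.pre.times_add_l)
      show "?t x h \<in> carrier B" by (rule tin[OF xU h])
    qed
    also have "\<dots> = (\<Oplus>\<^bsub>B\<^esub>h\<in>supp x. ?t x h)" by (rule coded_sum[OF xU I(1) s I(4) F k, symmetric])
    finally show ?thesis .
  qed
  then show ?case using xU finite_subset[OF s I(1)] unfolding coded_def by blast
qed

definition enc where "enc L = (SOME y. coded L y)"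

text \<open>A code determines its operator, so choosing one code for each operator is injective.\<close>

lemma enc_inj: "inj_on enc EE"
proof (rule inj_onI)
  fix L L' assume L: "L \<in> EE" "L' \<in> EE" "enc L = enc L'"
  have "coded L (enc L)" "coded L' (enc L')" unfolding enc_def by (rule someI_ex[OF EE_coded[OF L(1)]], rule someI_ex[OF EE_coded[OF L(2)]])
  then show "L = L'" using L EE_Ops by (intro Ops_eqI) (simp_all add: coded_def)
qed

section \<open>The cyclic vector and the compression\<close>

text \<open>The vector \<open>1\<close> at level \<open>1\<close>; the value at \<open>b\<^sup>-\<^sup>1
  w\<close> is \<open>(T w)\<^sup>* T b\<close>.\<close>

definition F1 where "F1 = (\<lambda>k\<in>carrier G. let b = (SOME b. b \<in> Hp \<and> b \<otimes> k \<in> W) in starB (T (b \<otimes> k)) \<otimes>\<^bsub>B\<^esub> T b)"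

lemma F1_eq: assumes k: "k \<in> carrier G" and b: "b \<in> Hp" "b \<otimes> k \<in> W" shows "F1 k = starB (T (b \<otimes> k)) \<otimes>\<^bsub>B\<^esub> T b"
proof -
  define c where "c = (SOME b. b \<in> Hp \<and> b \<otimes> k \<in> W)"
  have c: "c \<in> Hp" "c \<otimes> k \<in> W" unfolding c_def using someI[of "\<lambda>b. b \<in> Hp \<and> b \<otimes> k \<in> W" b] b by blast+
  have *: "starB (T (a \<otimes> k)) \<otimes>\<^bsub>B\<^esub> T a = starB (T (d \<otimes> a \<otimes> k)) \<otimes>\<^bsub>B\<^esub> T (d \<otimes> a)"
    if a: "a \<in> Hp" "a \<otimes> k \<in> W" and d: "d \<in> Hp" for a d
  proof -
    have "T (d \<otimes> a \<otimes> k) = T d \<otimes>\<^bsub>B\<^esub> T (a \<otimes> k)" using T_mult[OF Hp_W[OF d] a(2)] a d k by (simp add: m_assoc)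
    moreover have "T (d \<otimes> a) = T d \<otimes>\<^bsub>B\<^esub> T a" by (rule T_mult[OF Hp_W[OF d] Hp_W[OF a(1)]])
    moreover have "starB (T d \<otimes>\<^bsub>B\<^esub> T (a \<otimes> k)) \<otimes>\<^bsub>B\<^esub> (T d \<otimes>\<^bsub>B\<^esub> T a) = starB (T (a \<otimes> k)) \<otimes>\<^bsub>B\<^esub> ((starB (T d) \<otimes>\<^bsub>B\<^esub> T d) \<otimes>\<^bsub>B\<^esub> T a)"
      using a Hp_W[OF a(1)] Hp_W[OF d] by (simp add: B.pre.adj_times B.pre.times_assoc)
    ultimately show ?thesis using T_iso[OF Hp_W[OF d]] Hp_W[OF a(1)] by simp
  qed
  have "b \<otimes> c = c \<otimes> b" using H_comm b c by simp
  then show ?thesis using *[OF b c(1)] *[OF c b(1)] k by (simp add: F1_def Let_def c_def)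
qed

lemma F1_inv: assumes w: "w \<in> W" shows "F1 (inv w) = T w"
proof -
  obtain b where b: "b \<in> Hp" "b \<otimes> inv w \<in> W" using W_fraction[of "inv w"] w by auto
  have "b = (b \<otimes> inv w) \<otimes> w" using b(1) w by (simp add: m_assoc)
  then have "T b = T (b \<otimes> inv w) \<otimes>\<^bsub>B\<^esub> T w" using T_mult[OF b(2) w] by simp
  then show ?thesis using F1_eq[OF _ b] b w T_iso[OF b(2)] by (simp add: B.pre.times_assoc[symmetric])
qed

lemma F1_one: "F1 \<one> = \<one>\<^bsub>B\<^esub>"
  using F1_inv[of \<one>] M_W[OF M.one_closed] by (simp add: T_one)

lemma F1_lev: "lev F1 \<one>"
  unfolding lev_def using F1_inv F1_one by simp

lemma F1_X: "F1 \<in> X"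
proof (rule X_I[OF _ _ _ F1_lev])
  fix k assume k: "k \<in> carrier G"
  obtain b where b: "b \<in> Hp" "b \<otimes> k \<in> W" using W_fraction[OF k] by blast
  note bW = Hp_W[OF b(1)]
  show "F1 k \<in> carrier B" using F1_eq[OF k b] b bW by simp
  fix w assume w: "w \<in> W"
  have bkw: "b \<otimes> (k \<otimes> w) = (b \<otimes> k) \<otimes> w" using b(1) k w by (simp add: m_assoc)
  have "b \<otimes> (k \<otimes> w) \<in> W" unfolding bkw by (rule W_mult[OF b(2) w])
  then show "F1 (k \<otimes> w) = starB (T w) \<otimes>\<^bsub>B\<^esub> F1 k"
    using F1_eq[OF _ b(1), of "k \<otimes> w"] F1_eq[OF k b] k w b bW T_mult[OF b(2) w]
    by (simp add: bkw B.pre.adj_times B.pre.times_assoc)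
qed (simp add: F1_def)

lemma lev_inv: assumes F: "F \<in> X" obtains b where "b \<in> Hp" "lev F (inv b)"
proof -
  obtain g where g: "lev F g" using common_level[OF F F] by blast
  note gG = lev_G[OF g]
  obtain b where b: "b \<in> Hp" "b \<otimes> g \<in> W" using W_fraction[OF gG] by blast
  have "g \<otimes> inv (b \<otimes> g) = inv b" using b(1) gG by (simp add: inv_mult_group)
  then show thesis using that[OF b(1)] lev_mono[OF F g b(2)] by simp
qed

lemma F1_lev_inv: "w \<in> W \<Longrightarrow> lev F1 (inv w)"
  using lev_mono[OF F1_X F1_lev] by fastforce

lemma ip_F1: assumes F: "F \<in> X" shows "ip F1 F = F \<one>"
proof -
  obtain b where b: "b \<in> Hp" "lev F (inv b)" using lev_inv[OF F] by blast
  note bW = Hp_W[OF b(1)]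
  have "ip F1 F = starB (T b) \<otimes>\<^bsub>B\<^esub> F (inv b)"
    using ip_eq[OF F1_X F F1_lev_inv[OF bW] b(2)] F1_inv[OF bW] by simp
  also have "\<dots> = F (inv b \<otimes> b)" using X_equiv[OF F inv_closed[OF in_G(4)[OF b(1)]] bW] by simp
  finally show ?thesis using b(1) by simp
qed

lemma indicator_coset_D:
  "\<lbrakk>x \<in> N; V \<in> conj_family G H M\<rbrakk> \<Longrightarrow> indicator (x <# V) \<in> carrier (D_alg G N H M)"
  unfolding D_alg_def cstar_generated_def by simp blast

lemma indicator_M_D: "indicator M \<in> carrier (D_alg G N H M)"
proof -
  have "\<one> <# M = M" by (rule lcos_mult_one) (rule M.subset)
  then show ?thesis
    using indicator_coset_D[OF N.one_closed M_family] by simp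
qed

lemma \<chi>M: "indicator M \<in> UCN" using indicator_M_D D_sub_UCN by blast

text \<open>Seen from \<open>w\<^sup>-\<^sup>1\<close>, the characteristic function of \<open>M\<close> is the
  indicator of the coset \<open>w M\<close>, which is a single cell of the partition of level
  \<open>hp w\<close>.\<close>

lemma \<rho>_\<chi>M: assumes w: "w \<in> W" shows "\<rho> (lift (indicator M) (inv w)) = Q w"
proof -
  obtain V where V: "transversal (hp w) V" "w \<in> V" using transversal_exists[OF w] by blast
  note D = transversalD[OF V(1)]
  let ?\<phi> = "lift (indicator M) (inv w) :: 'a \<Rightarrow> complex"
  have val: "?\<phi> v = indicator M (inv w \<otimes> v)" if v: "v \<in> W" "hp v = hp w" for v
  proof -
    have "hp (inv w \<otimes> v) = \<one>" using v w by (simp add: np_mult hp_inv)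
    then have "np (inv w \<otimes> v) = inv w \<otimes> v" using decomp(3)[of "inv w \<otimes> v"] v w by simp
    then show ?thesis by (simp add: lift_def)
  qed
  have "osc (hp w) 0 ?\<phi>"
    unfolding osc_def
  proof (intro ballI impI)
    fix v v' assume v: "v \<in> W" "v' \<in> W" "hp v = hp w \<and> hp v' = hp w \<and> inv v \<otimes> v' \<in> M"
    have "inv w \<otimes> v' = (inv w \<otimes> v) \<otimes> (inv v \<otimes> v')" using v w by (simp add: m_assoc)
    then have "inv w \<otimes> v' \<in> M \<longleftrightarrow> inv w \<otimes> v \<in> M" using M_mult_iff[of "inv w \<otimes> v" "inv v \<otimes> v'"] v w by simp
    then show "cmod (?\<phi> v - ?\<phi> v') \<le> 0" using v by (simp add: val indicator_def)
  qed
  then have "\<rho> ?\<phi> = \<sigma> V ?\<phi>" using \<rho>_exact[OF lift_UW[OF \<chi>M]] V(1) w by simp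
  also have "\<dots> = (\<Oplus>\<^bsub>B\<^esub>v\<in>V. if w = v then Q v else \<zero>\<^bsub>B\<^esub>)"
    unfolding \<sigma>_def
  proof (rule B.pre.finsum_eqI)
    fix v assume v: "v \<in> V"
    have vW: "v \<in> W" "hp v = hp w" using D v by blast+
    have "inv w \<otimes> v \<in> M \<longleftrightarrow> w = v" using D(5)[OF V(2) v] w by auto
    then show "?\<phi> v \<odot>\<^bsub>B\<^esub> Q v = (if w = v then Q v else \<zero>\<^bsub>B\<^esub>)" using vW by (simp add: val indicator_def)
  qed (use D in auto)
  also have "\<dots> = Q w" using V(2) D(1,2) by (subst B.M.finsum_singleton) (auto simp: Pi_def)
  finally show ?thesis .
qed

text \<open>At a level \<open>b\<^sup>-\<^sup>1\<close> of \<open>F\<close> the projection multiplies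
  \<open>F(b\<^sup>-\<^sup>1)\<close> by \<open>T b (T b)\<^sup>*\<close>, and \<open>(T b)\<^sup>*
  F(b\<^sup>-\<^sup>1) = F(1)\<close>.\<close>

lemma piop_M_rank_one: assumes F: "F \<in> X" shows "piop (indicator M) F = rX F1 (F \<one>)"
proof -
  obtain b where b: "b \<in> Hp" "lev F (inv b)" using lev_inv[OF F] by blast
  note bW = Hp_W[OF b(1)]
  have G: "inv b \<in> carrier G" using b(1) by simp
  have F1b: "F \<one> \<in> carrier B" using F by simp
  show ?thesis
  proof (rule X_eqI[OF piop_X[OF F \<chi>M] X_ops(3)[OF F1_X F1b] piop_lev[OF F \<chi>M b(2)]])
    show "lev (rX F1 (F \<one>)) (inv b)" by (rule lev_ops(3)[OF F1_X F1_X F1b F1_lev_inv[OF bW]])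
    have "starB (T b) \<otimes>\<^bsub>B\<^esub> F (inv b) = F \<one>" using X_equiv[OF F G bW] b(1) by simp
    then show "piop (indicator M) F (inv b) = rX F1 (F \<one>) (inv b)"
      using F G bW by (simp add: \<rho>_\<chi>M F1_inv Q_def B.pre.times_assoc)
  qed
qed

text \<open>This is \<open>\<langle>F1, L F1\<rangle>\<close>, since pairing with \<open>F1\<close> is
  evaluation at the unit.\<close>

definition \<kappa> where "\<kappa> L = L F1 \<one>"

lemma \<kappa>_props: assumes L: "L \<in> Ops" "L' \<in> Ops"
  shows "\<kappa> L \<in> carrier B" "\<kappa> (addO L L') = \<kappa> L \<oplus>\<^bsub>B\<^esub> \<kappa> L'" "\<kappa> (smO c L) = c \<odot>\<^bsub>B\<^esub> \<kappa> L" "\<kappa> (adjoint L) = starB (\<kappa> L)"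
    "normB (\<kappa> L) \<le> op_norm L" "\<kappa> (mulO (mulO L (piop (indicator M))) L') = \<kappa> L \<otimes>\<^bsub>B\<^esub> \<kappa> L'"
proof -
  note m = Ops_D(3)[OF L(1) F1_X] Ops_D(3)[OF L(2) F1_X]
  show c: "\<kappa> L \<in> carrier B" using m by (simp add: \<kappa>_def)
  show "\<kappa> (addO L L') = \<kappa> L \<oplus>\<^bsub>B\<^esub> \<kappa> L'" "\<kappa> (smO c L) = c \<odot>\<^bsub>B\<^esub> \<kappa> L" using F1_X m by (simp_all add: \<kappa>_def O_app)
  note a = Ops_D(3)[OF adjoint_Ops(1)[OF L(1)] F1_X]
  have "\<kappa> (adjoint L) = ip (L F1) F1"
    using Ops_D(1)[OF L(1)] F1_X ip_F1[OF a] unfolding adjoint_pair_def \<kappa>_def by simp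
  also have "\<dots> = starB (\<kappa> L)" using ip_adj[OF F1_X m(1)] by (simp add: \<kappa>_def ip_F1[OF m(1)])
  finally show "\<kappa> (adjoint L) = starB (\<kappa> L)" .
  have n1: "nX F1 \<le> 1" using nX_eq[OF F1_X F1_lev] B.pre.nrm_one by (simp add: F1_one)
  have "normB (\<kappa> L) \<le> nX F1 * nX (L F1)" using cauchy_schwarz[OF F1_X m(1)] by (simp add: \<kappa>_def ip_F1[OF m(1)])
  also have "\<dots> \<le> 1 * nX (L F1)" using n1 m(1) by (intro mult_right_mono) auto
  also have "\<dots> \<le> op_norm L * nX F1" using op_norm_bound[OF L(1)] F1_X by (simp add: op_bound_def)
  also have "\<dots> \<le> op_norm L * 1" using n1 op_norm_bound[OF L(1)] by (intro mult_left_mono) (auto simp: op_bound_def)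
  finally show "normB (\<kappa> L) \<le> op_norm L" by simp
  have b: "\<kappa> L' \<in> carrier B" using m by (simp add: \<kappa>_def)
  have "\<kappa> (mulO (mulO L (piop (indicator M))) L') = L (rX F1 (\<kappa> L')) \<one>"
    using F1_X m piop_M_rank_one[OF m(2)] by (simp add: \<kappa>_def O_app)
  also have "L (rX F1 (\<kappa> L')) = rX (L F1) (\<kappa> L')" by (rule Ops_linear(3)[OF L(1) F1_X F1_X b])
  finally show "\<kappa> (mulO (mulO L (piop (indicator M))) L') = \<kappa> L \<otimes>\<^bsub>B\<^esub> \<kappa> L'" by (simp add: \<kappa>_def)
qed

lemma \<kappa>_uop: "w \<in> W \<Longrightarrow> \<kappa> (uop w) = T w"
  using F1_X F1_inv by (simp add: \<kappa>_def)

lemma \<kappa>_id: "\<kappa> idO = \<one>\<^bsub>B\<^esub>"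
  using F1_X F1_one by (simp add: \<kappa>_def O_app)

section \<open>The dilation theorem\<close>

definition Ecode :: "('a \<Rightarrow> 'a \<Rightarrow> complex) cstar" where "Ecode = transport enc (op_alg EE)"

lemma Ecode_pre: "unital_pre_cstar Ecode" and Ecode_hom: "star_hom (op_alg EE) Ecode enc"
proof -
  interpret E: unital_pre_cstar "op_alg EE" by (rule EE_pre)
  have inj: "inj_on enc (carrier (op_alg EE))" using enc_inj by simp
  show "unital_pre_cstar Ecode" "star_hom (op_alg EE) Ecode enc"
    unfolding Ecode_def by (rule E.transport_unital_pre_cstar[OF inj], rule E.transport_star_hom[OF inj])
qed

lemma Ecode_simps:
  "carrier Ecode = enc ` EE" "\<one>\<^bsub>Ecode\<^esub> = enc idO" "L \<in> EE \<Longrightarrow> cs_norm Ecode (enc L) = op_norm L"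
proof -
  interpret E: unital_pre_cstar "op_alg EE" by (rule EE_pre)
  have inj: "inj_on enc (carrier (op_alg EE))" using enc_inj by simp
  show "carrier Ecode = enc ` EE" "\<one>\<^bsub>Ecode\<^esub> = enc idO" "L \<in> EE \<Longrightarrow> cs_norm Ecode (enc L) = op_norm L"
    unfolding Ecode_def using E.transport_simps[OF inj] by simp_all
qed

text \<open>The operators are replaced by their codes and completed; all relations are proved for operators and
  pass to the limit. The compression of a unitary \<open>uC w\<close> is the isometry \<open>T
  w\<close>, which gives the name.\<close>

theorem dilation:
  obtains C :: "(nat \<Rightarrow> 'a \<Rightarrow> 'a \<Rightarrow> complex) set cstar" and \<pi>C uC \<kappa>C where
    "unital_cstar_algebra C" "covariant_hom G (D_alg G N H M) (alpha G N H) C \<pi>C uC"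
    "\<And>z. z \<in> carrier C \<Longrightarrow> \<kappa>C z \<in> carrier B"
    "\<And>z z'. \<lbrakk>z \<in> carrier C; z' \<in> carrier C\<rbrakk> \<Longrightarrow> \<kappa>C (z \<oplus>\<^bsub>C\<^esub> z') = \<kappa>C z \<oplus>\<^bsub>B\<^esub> \<kappa>C z'"
    "\<And>c z. z \<in> carrier C \<Longrightarrow> \<kappa>C (c \<odot>\<^bsub>C\<^esub> z) = c \<odot>\<^bsub>B\<^esub> \<kappa>C z"
    "\<And>z. z \<in> carrier C \<Longrightarrow> \<kappa>C (cs_star C z) = starB (\<kappa>C z)"
    "\<And>z z'. \<lbrakk>z \<in> carrier C; z' \<in> carrier C\<rbrakk> \<Longrightarrow> \<kappa>C (z \<otimes>\<^bsub>C\<^esub> \<pi>C (indicator M) \<otimes>\<^bsub>C\<^esub> z') = \<kappa>C z \<otimes>\<^bsub>B\<^esub> \<kappa>C z'"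
    "\<And>w. w \<in> W \<Longrightarrow> \<kappa>C (uC w) = T w" "\<kappa>C \<one>\<^bsub>C\<^esub> = \<one>\<^bsub>B\<^esub>"
proof -
  interpret E: unital_pre_cstar Ecode by (rule Ecode_pre)
  define C where "C = E.completion"
  interpret C: unital_cstar_algebra C unfolding C_def by (rule E.completion_cstar)
  define j where "j L = E.embed (enc L)" for L
  note eh = star_homD[OF Ecode_hom, simplified] and bh = star_homD[OF E.embed_star_hom]
  have Ein: "enc L \<in> carrier Ecode" if "L \<in> EE" for L using that by (simp add: Ecode_simps)
  have j_in: "j L \<in> carrier C" if "L \<in> EE" for L using Ein[OF that] bh(1) by (simp add: j_def C_def)
  have j_add: "j (addO L L') = j L \<oplus>\<^bsub>C\<^esub> j L'" and j_mul: "j (mulO L L') = j L \<otimes>\<^bsub>C\<^esub> j L'" if "L \<in> EE" "L' \<in> EE" for L L'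
    using that Ein eh(2,4) bh(2,4) by (simp_all add: j_def C_def)
  have j_sm: "j (smO c L) = c \<odot>\<^bsub>C\<^esub> j L" and j_adj: "j (adjoint L) = cs_star C (j L)" if "L \<in> EE" for L c
    using that Ein eh(3,5) bh(3,5) by (simp_all add: j_def C_def)
  have j_one: "j idO = \<one>\<^bsub>C\<^esub>" by (simp add: j_def C_def E.embed_def E.completion_one Ecode_simps(2)[symmetric])
  define \<pi>C where "\<pi>C f = j (piop f)" for f
  define uC where "uC h = j (uop h)" for h
  define \<kappa>1 where "\<kappa>1 x = \<kappa> (inv_into EE enc x)" for x
  have \<kappa>1: "\<kappa>1 (enc L) = \<kappa> L" if "L \<in> EE" for L using that enc_inj by (simp add: \<kappa>1_def)
  have k_in: "\<kappa>1 x \<in> carrier B" and k_nrm: "normB (\<kappa>1 x) \<le> cs_norm Ecode x" and k_sm: "\<kappa>1 (c \<odot>\<^bsub>Ecode\<^esub> x) = c \<odot>\<^bsub>B\<^esub> \<kappa>1 x"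
    and k_adj: "\<kappa>1 (cs_star Ecode x) = starB (\<kappa>1 x)"
    if x: "x \<in> carrier Ecode" for x c
  proof -
    obtain L where L: "L \<in> EE" "x = enc L" using x by (auto simp: Ecode_simps)
    note p = \<kappa>_props[OF EE_Ops[OF L(1)] EE_Ops[OF L(1)]]
    show "\<kappa>1 x \<in> carrier B" "normB (\<kappa>1 x) \<le> cs_norm Ecode x" using L p by (simp_all add: \<kappa>1 Ecode_simps)
    show "\<kappa>1 (c \<odot>\<^bsub>Ecode\<^esub> x) = c \<odot>\<^bsub>B\<^esub> \<kappa>1 x" using L p(3) by (simp add: eh(3)[symmetric] \<kappa>1 EE_closed)
    show "\<kappa>1 (cs_star Ecode x) = starB (\<kappa>1 x)" using L p(4) by (simp add: eh(5)[symmetric] \<kappa>1 EE_closed)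
  qed
  let ?P = "enc (piop (indicator M))"
  have P: "piop (indicator M) \<in> EE" by (rule EE_closed(5)[OF \<chi>M])
  have k_add: "\<kappa>1 (x \<oplus>\<^bsub>Ecode\<^esub> y) = \<kappa>1 x \<oplus>\<^bsub>B\<^esub> \<kappa>1 y" and k_mul: "\<kappa>1 (x \<otimes>\<^bsub>Ecode\<^esub> ?P \<otimes>\<^bsub>Ecode\<^esub> y) = \<kappa>1 x \<otimes>\<^bsub>B\<^esub> \<kappa>1 y"
    if x: "x \<in> carrier Ecode" and y: "y \<in> carrier Ecode" for x y
  proof -
    obtain L where L: "L \<in> EE" "x = enc L" using x by (auto simp: Ecode_simps)
    obtain K where K: "K \<in> EE" "y = enc K" using y by (auto simp: Ecode_simps)
    note p = \<kappa>_props[OF EE_Ops[OF L(1)] EE_Ops[OF K(1)]]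
    show "\<kappa>1 (x \<oplus>\<^bsub>Ecode\<^esub> y) = \<kappa>1 x \<oplus>\<^bsub>B\<^esub> \<kappa>1 y" using L K p(2) by (simp add: eh(2)[symmetric] \<kappa>1 EE.add)
    show "\<kappa>1 (x \<otimes>\<^bsub>Ecode\<^esub> ?P \<otimes>\<^bsub>Ecode\<^esub> y) = \<kappa>1 x \<otimes>\<^bsub>B\<^esub> \<kappa>1 y" using L K P p(6) by (simp add: eh(4)[symmetric] \<kappa>1 EE_closed)
  qed
  obtain \<kappa>C where \<kappa>e: "\<And>x. x \<in> carrier Ecode \<Longrightarrow> \<kappa>C (E.embed x) = \<kappa>1 x"
    and \<kappa>l: "\<And>Z s. \<lbrakk>E.cauchy s; pre_cstar.conv E.completion (\<lambda>n. E.embed (s n)) Z\<rbrakk> \<Longrightarrow> B.pre.conv (\<lambda>n. \<kappa>1 (s n)) (\<kappa>C Z)"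
    using E.extend_to_completion[OF B.cstar_algebra_axioms k_in k_add k_sm k_nrm] by blast
  have dense: "\<exists>s. E.cauchy s \<and> C.pre.conv (\<lambda>n. E.embed (s n)) z \<and> B.pre.conv (\<lambda>n. \<kappa>1 (s n)) (\<kappa>C z)" if z: "z \<in> carrier C" for z
    using E.embed_dense[of z] z \<kappa>l unfolding C_def by metis
  have \<kappa>lim: "\<kappa>C z = b" if s: "E.cauchy s" "C.pre.conv (\<lambda>n. E.embed (s n)) z" "B.pre.conv (\<lambda>n. \<kappa>1 (s n)) b" for s z b
    using B.pre.conv_unique[OF \<kappa>l[OF s(1) s(2)[unfolded C_def]] s(3)] .
  show thesis
  proof (rule that[of C \<pi>C uC \<kappa>C])
    show "unital_cstar_algebra C" by (rule C.unital_cstar_algebra_axioms)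
    show "covariant_hom G (D_alg G N H M) act C \<pi>C uC"
      unfolding covariant_hom_def
    proof (intro conjI ballI)
      have D: "d \<in> UCN" if "d \<in> carrier (D_alg G N H M)" for d using D_sub_UCN that by blast
      have ops: "add (D_alg G N H M) = (\<lambda>f h y. f y + h y)" "mult (D_alg G N H M) = (\<lambda>f h y. f y * h y)"
        "smult (D_alg G N H M) = (\<lambda>c f y. c * f y)" "cs_star (D_alg G N H M) = (\<lambda>f y. cnj (f y))"
        by (simp_all add: D_alg_def)
      show "star_hom (D_alg G N H M) C \<pi>C"
        unfolding star_hom_def ops \<pi>C_def
        by (auto simp: D EE_closed j_in op_rel(3-5)[symmetric] piop_Ops(2)[symmetric] j_add j_mul j_sm j_adj)
      fix g assume g: "g \<in> carrier G"
      have gi: "mulO (uop g) (uop (inv g)) = idO" "mulO (uop (inv g)) (uop g) = idO"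
        using g by (simp_all add: op_rel(1,2))
      show "unitary_elem C (uC g)"
        using g gi unfolding unitary_elem_def uC_def
        by (simp add: EE_closed j_in j_adj[symmetric] j_mul[symmetric] uop_Ops(2) j_one)
      show "uC (g \<otimes> h) = uC g \<otimes>\<^bsub>C\<^esub> uC h" if "h \<in> carrier G" for h
        using g that by (simp add: uC_def EE_closed j_mul[symmetric] op_rel(1))
      fix d assume d: "d \<in> carrier (D_alg G N H M)"
      note dU = D[OF d]
      interpret O: unital_pre_cstar "op_alg Ops" by (rule Ops_pre)
      have "mulO (mulO (uop g) (piop d)) (uop (inv g)) = mulO (piop (act g d)) (mulO (uop g) (uop (inv g)))"
        using g dU by (simp add: op_rel(7) O.times_assoc[simplified] alpha_UCN piop_Ops(1) uop_Ops(1))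
      also have "\<dots> = piop (act g d)" using O.unit_r[simplified] g dU by (simp add: gi alpha_UCN piop_Ops(1))
      finally show "\<pi>C (act g d) = uC g \<otimes>\<^bsub>C\<^esub> \<pi>C d \<otimes>\<^bsub>C\<^esub> cs_star C (uC g)"
        using g dU by (simp add: \<pi>C_def uC_def EE_closed j_mul[symmetric] j_adj[symmetric] uop_Ops(2))
    qed
    fix z assume z: "z \<in> carrier C"
    obtain s where s: "E.cauchy s" "C.pre.conv (\<lambda>n. E.embed (s n)) z" "B.pre.conv (\<lambda>n. \<kappa>1 (s n)) (\<kappa>C z)" using dense[OF z] by blast
    have sE: "s n \<in> carrier Ecode" for n using s(1) by (rule E.cauchy_closed)
    show "\<kappa>C z \<in> carrier B" using s(3) by (simp add: B.pre.conv_def)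
    show "\<kappa>C (c \<odot>\<^bsub>C\<^esub> z) = c \<odot>\<^bsub>B\<^esub> \<kappa>C z" for c
    proof (rule \<kappa>lim[OF E.cauchy_smult[OF s(1), of c]])
      show "C.pre.conv (\<lambda>n. E.embed (c \<odot>\<^bsub>Ecode\<^esub> s n)) (c \<odot>\<^bsub>C\<^esub> z)"
        using C.pre.conv_smult[OF s(2), of c] sE bh(3) by (simp add: C_def)
      show "B.pre.conv (\<lambda>n. \<kappa>1 (c \<odot>\<^bsub>Ecode\<^esub> s n)) (c \<odot>\<^bsub>B\<^esub> \<kappa>C z)"
        using B.pre.conv_smult[OF s(3), of c] sE by (simp add: k_sm)
    qed
    show "\<kappa>C (cs_star C z) = starB (\<kappa>C z)"
    proof (rule \<kappa>lim[OF E.cauchy_adj[OF s(1)]])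
      show "C.pre.conv (\<lambda>n. E.embed (cs_star Ecode (s n))) (cs_star C z)"
        using C.pre.conv_adj[OF s(2)] sE bh(5) by (simp add: C_def)
      show "B.pre.conv (\<lambda>n. \<kappa>1 (cs_star Ecode (s n))) (starB (\<kappa>C z))"
        using B.pre.conv_adj[OF s(3)] sE by (simp add: k_adj)
    qed
    fix z' assume z': "z' \<in> carrier C"
    obtain t where t: "E.cauchy t" "C.pre.conv (\<lambda>n. E.embed (t n)) z'" "B.pre.conv (\<lambda>n. \<kappa>1 (t n)) (\<kappa>C z')" using dense[OF z'] by blast
    have tE: "t n \<in> carrier Ecode" for n using t(1) by (rule E.cauchy_closed)
    show "\<kappa>C (z \<oplus>\<^bsub>C\<^esub> z') = \<kappa>C z \<oplus>\<^bsub>B\<^esub> \<kappa>C z'"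
    proof (rule \<kappa>lim[OF E.cauchy_add[OF s(1) t(1)]])
      show "C.pre.conv (\<lambda>n. E.embed (s n \<oplus>\<^bsub>Ecode\<^esub> t n)) (z \<oplus>\<^bsub>C\<^esub> z')"
        using C.pre.conv_add[OF s(2) t(2)] sE tE bh(2) by (simp add: C_def)
      show "B.pre.conv (\<lambda>n. \<kappa>1 (s n \<oplus>\<^bsub>Ecode\<^esub> t n)) (\<kappa>C z \<oplus>\<^bsub>B\<^esub> \<kappa>C z')"
        using B.pre.conv_add[OF s(3) t(3)] sE tE by (simp add: k_add)
    qed
    have PE: "?P \<in> carrier Ecode" by (rule Ein[OF P])
    show "\<kappa>C (z \<otimes>\<^bsub>C\<^esub> \<pi>C (indicator M) \<otimes>\<^bsub>C\<^esub> z') = \<kappa>C z \<otimes>\<^bsub>B\<^esub> \<kappa>C z'"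
    proof (rule \<kappa>lim[OF E.cauchy_times[OF E.cauchy_times[OF s(1) E.cauchy_const[OF PE]] t(1)]])
      have "C.pre.conv (\<lambda>n. E.embed (s n) \<otimes>\<^bsub>C\<^esub> E.embed ?P \<otimes>\<^bsub>C\<^esub> E.embed (t n)) (z \<otimes>\<^bsub>C\<^esub> E.embed ?P \<otimes>\<^bsub>C\<^esub> z')"
        by (intro C.pre.conv_times C.pre.conv_const s(2) t(2)) (use bh(1)[OF PE] in \<open>simp add: C_def\<close>)
      then show "C.pre.conv (\<lambda>n. E.embed (s n \<otimes>\<^bsub>Ecode\<^esub> ?P \<otimes>\<^bsub>Ecode\<^esub> t n)) (z \<otimes>\<^bsub>C\<^esub> \<pi>C (indicator M) \<otimes>\<^bsub>C\<^esub> z')"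
        using sE tE PE bh(4) by (simp add: C_def \<pi>C_def j_def)
      show "B.pre.conv (\<lambda>n. \<kappa>1 (s n \<otimes>\<^bsub>Ecode\<^esub> ?P \<otimes>\<^bsub>Ecode\<^esub> t n)) (\<kappa>C z \<otimes>\<^bsub>B\<^esub> \<kappa>C z')"
        using B.pre.conv_times[OF s(3) t(3)] sE tE by (simp add: k_mul)
    qed
  next
    have "\<kappa>C (j L) = \<kappa> L" if "L \<in> EE" for L using \<kappa>e[OF Ein[OF that]] \<kappa>1[OF that] by (simp add: j_def)
    then show "\<kappa>C (uC w) = T w" if "w \<in> W" for w using that by (simp add: uC_def EE_closed \<kappa>_uop)
    show "\<kappa>C \<one>\<^bsub>C\<^esub> = \<one>\<^bsub>B\<^esub>" using \<kappa>e[OF Ein[OF EE_closed(1)]] \<kappa>1[OF EE_closed(1)] j_one by (simp add: j_def \<kappa>_id)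
  qed
qed

end

section \<open>Multipliers\<close>

context cstar_algebra
begin

abbreviation "MA \<equiv> multiplier_algebra A"
abbreviation "tm \<equiv> to_multiplier A"

lemma MA_carrier: "carrier MA = double_centralizers A"
  by (simp add: multiplier_algebra_def)

lemma MA_D: assumes "(L, R) \<in> carrier MA"
  shows "L \<in> carrier A \<rightarrow>\<^sub>E carrier A" "R \<in> carrier A \<rightarrow>\<^sub>E carrier A" "bounded_linear_on A L" "bounded_linear_on A R"
    "\<lbrakk>x \<in> carrier A; y \<in> carrier A\<rbrakk> \<Longrightarrow> L (x \<otimes>\<^bsub>A\<^esub> y) = L x \<otimes>\<^bsub>A\<^esub> y"
    "\<lbrakk>x \<in> carrier A; y \<in> carrier A\<rbrakk> \<Longrightarrow> R (x \<otimes>\<^bsub>A\<^esub> y) = x \<otimes>\<^bsub>A\<^esub> R y"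
    "\<lbrakk>x \<in> carrier A; y \<in> carrier A\<rbrakk> \<Longrightarrow> R x \<otimes>\<^bsub>A\<^esub> y = x \<otimes>\<^bsub>A\<^esub> L y"
    "x \<in> carrier A \<Longrightarrow> L x \<in> carrier A" "x \<in> carrier A \<Longrightarrow> R x \<in> carrier A"
  using assms unfolding MA_carrier double_centralizers_def by auto

lemma MA_I: assumes "\<And>x. x \<in> carrier A \<Longrightarrow> L x \<in> carrier A" "\<And>x. x \<in> carrier A \<Longrightarrow> R x \<in> carrier A"
    "bounded_linear_on A L" "bounded_linear_on A R"
    "\<And>x y. \<lbrakk>x \<in> carrier A; y \<in> carrier A\<rbrakk> \<Longrightarrow> L (x \<otimes>\<^bsub>A\<^esub> y) = L x \<otimes>\<^bsub>A\<^esub> y"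
    "\<And>x y. \<lbrakk>x \<in> carrier A; y \<in> carrier A\<rbrakk> \<Longrightarrow> R (x \<otimes>\<^bsub>A\<^esub> y) = x \<otimes>\<^bsub>A\<^esub> R y"
    "\<And>x y. \<lbrakk>x \<in> carrier A; y \<in> carrier A\<rbrakk> \<Longrightarrow> R x \<otimes>\<^bsub>A\<^esub> y = x \<otimes>\<^bsub>A\<^esub> L y"
  shows "(restrict L (carrier A), restrict R (carrier A)) \<in> carrier MA"
proof -
  have "bounded_linear_on A (restrict F (carrier A))" if "bounded_linear_on A F" for F
    using that unfolding bounded_linear_on_def by simp
  then show ?thesis using assms unfolding MA_carrier double_centralizers_def by simp
qed

lemma bounded_linear_D: assumes "bounded_linear_on A L"
  obtains K where "\<And>x y. \<lbrakk>x \<in> carrier A; y \<in> carrier A\<rbrakk> \<Longrightarrow> L (x \<oplus>\<^bsub>A\<^esub> y) = L x \<oplus>\<^bsub>A\<^esub> L y"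
    "\<And>c x. x \<in> carrier A \<Longrightarrow> L (c \<odot>\<^bsub>A\<^esub> x) = c \<odot>\<^bsub>A\<^esub> L x" "\<And>x. x \<in> carrier A \<Longrightarrow> cs_norm A (L x) \<le> K * cs_norm A x"
  using assms unfolding bounded_linear_on_def by blast

lemma bounded_linear_I:
  assumes "\<And>x y. \<lbrakk>x \<in> carrier A; y \<in> carrier A\<rbrakk> \<Longrightarrow> L (x \<oplus>\<^bsub>A\<^esub> y) = L x \<oplus>\<^bsub>A\<^esub> L y"
    "\<And>c x. x \<in> carrier A \<Longrightarrow> L (c \<odot>\<^bsub>A\<^esub> x) = c \<odot>\<^bsub>A\<^esub> L x" "\<And>x. x \<in> carrier A \<Longrightarrow> cs_norm A (L x) \<le> K * cs_norm A x"
  shows "bounded_linear_on A L"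
  unfolding bounded_linear_on_def using assms by blast

lemma bounded_linear_comp:
  assumes L: "bounded_linear_on A L" "\<And>x. x \<in> carrier A \<Longrightarrow> L x \<in> carrier A"
    and L': "bounded_linear_on A L'" "\<And>x. x \<in> carrier A \<Longrightarrow> L' x \<in> carrier A"
  shows "bounded_linear_on A (\<lambda>x. L (L' x))"
proof -
  obtain K where K: "\<And>x y. \<lbrakk>x \<in> carrier A; y \<in> carrier A\<rbrakk> \<Longrightarrow> L (x \<oplus>\<^bsub>A\<^esub> y) = L x \<oplus>\<^bsub>A\<^esub> L y"
    "\<And>c x. x \<in> carrier A \<Longrightarrow> L (c \<odot>\<^bsub>A\<^esub> x) = c \<odot>\<^bsub>A\<^esub> L x" "\<And>x. x \<in> carrier A \<Longrightarrow> cs_norm A (L x) \<le> K * cs_norm A x"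
    using L(1) by (rule bounded_linear_D) (rule that)
  obtain K' where K': "\<And>x y. \<lbrakk>x \<in> carrier A; y \<in> carrier A\<rbrakk> \<Longrightarrow> L' (x \<oplus>\<^bsub>A\<^esub> y) = L' x \<oplus>\<^bsub>A\<^esub> L' y"
    "\<And>c x. x \<in> carrier A \<Longrightarrow> L' (c \<odot>\<^bsub>A\<^esub> x) = c \<odot>\<^bsub>A\<^esub> L' x" "\<And>x. x \<in> carrier A \<Longrightarrow> cs_norm A (L' x) \<le> K' * cs_norm A x"
    using L'(1) by (rule bounded_linear_D) (rule that)
  show ?thesis
  proof (rule bounded_linear_I[where K = "max K 0 * K'"])
    fix x assume x: "x \<in> carrier A"
    have "cs_norm A (L (L' x)) \<le> K * cs_norm A (L' x)" by (rule K(3)[OF L'(2)[OF x]])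
    also have "\<dots> \<le> max K 0 * cs_norm A (L' x)" using L'(2)[OF x] by (intro mult_right_mono) auto
    also have "\<dots> \<le> max K 0 * (K' * cs_norm A x)" using K'(3)[OF x] by (intro mult_left_mono) auto
    finally show "cs_norm A (L (L' x)) \<le> max K 0 * K' * cs_norm A x" by (simp add: mult.assoc)
  qed (simp_all only: K K' L'(2))
qed

lemma MA_mult: "(L, R) \<otimes>\<^bsub>MA\<^esub> (L', R') = (\<lambda>x\<in>carrier A. L (L' x), \<lambda>x\<in>carrier A. R' (R x))"
  by (simp add: multiplier_algebra_def)

lemma MA_star: "cs_star MA (L, R) = (\<lambda>x\<in>carrier A. cs_star A (R (cs_star A x)), \<lambda>x\<in>carrier A. cs_star A (L (cs_star A x)))"
  by (simp add: multiplier_algebra_def)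

lemma MA_one: "\<one>\<^bsub>MA\<^esub> = (\<lambda>x\<in>carrier A. x, \<lambda>x\<in>carrier A. x)"
  by (simp add: multiplier_algebra_def)

lemma MA_mult_closed: assumes "x \<in> carrier MA" "y \<in> carrier MA" shows "x \<otimes>\<^bsub>MA\<^esub> y \<in> carrier MA"
proof -
  obtain L R L' R' where xy: "x = (L, R)" "y = (L', R')" by (cases x, cases y) blast
  note X = MA_D[OF assms(1)[unfolded xy]] and Y = MA_D[OF assms(2)[unfolded xy]]
  show ?thesis
    unfolding xy MA_mult
    by (rule MA_I) (use X Y in \<open>simp_all add: bounded_linear_comp\<close>)
qed

lemma MA_monoid: "monoid MA"
proof (rule monoidI)
  show "\<one>\<^bsub>MA\<^esub> \<in> carrier MA"
    unfolding MA_one by (rule MA_I) (auto simp: bounded_linear_on_def intro: exI[of _ 1])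
  fix x assume x: "x \<in> carrier MA"
  obtain L R where x': "x = (L, R)" by (cases x) blast
  note X = MA_D[OF x[unfolded x']]
  have "(\<lambda>y\<in>carrier A. L y) = L" "(\<lambda>y\<in>carrier A. R y) = R"
    by (rule PiE_restrict[OF X(1)], rule PiE_restrict[OF X(2)])
  moreover have "(\<lambda>y\<in>carrier A. (\<lambda>z\<in>carrier A. z) (L y)) = (\<lambda>y\<in>carrier A. L y)"
    "(\<lambda>y\<in>carrier A. R ((\<lambda>z\<in>carrier A. z) y)) = (\<lambda>y\<in>carrier A. R y)"
    "(\<lambda>y\<in>carrier A. (\<lambda>z\<in>carrier A. z) (R y)) = (\<lambda>y\<in>carrier A. R y)"
    "(\<lambda>y\<in>carrier A. L ((\<lambda>z\<in>carrier A. z) y)) = (\<lambda>y\<in>carrier A. L y)"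
    by (rule restrict_ext, simp add: X(8,9))+
  ultimately show "\<one>\<^bsub>MA\<^esub> \<otimes>\<^bsub>MA\<^esub> x = x" "x \<otimes>\<^bsub>MA\<^esub> \<one>\<^bsub>MA\<^esub> = x" unfolding x' MA_one MA_mult by simp_all
next
  fix x y z assume "x \<in> carrier MA" "y \<in> carrier MA" "z \<in> carrier MA"
  moreover obtain L R where x: "x = (L, R)" by (cases x) blast
  moreover obtain L' R' where y: "y = (L', R')" by (cases y) blast
  moreover obtain L'' R'' where z: "z = (L'', R'')" by (cases z) blast
  ultimately have c: "\<And>v. v \<in> carrier A \<Longrightarrow> L'' v \<in> carrier A" "\<And>v. v \<in> carrier A \<Longrightarrow> R v \<in> carrier A"
    "\<And>v. v \<in> carrier A \<Longrightarrow> L' v \<in> carrier A" "\<And>v. v \<in> carrier A \<Longrightarrow> R' v \<in> carrier A"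
    using MA_D(8,9) by blast+
  show "x \<otimes>\<^bsub>MA\<^esub> y \<otimes>\<^bsub>MA\<^esub> z = x \<otimes>\<^bsub>MA\<^esub> (y \<otimes>\<^bsub>MA\<^esub> z)"
    unfolding x y z MA_mult
    by (intro arg_cong2[where f = Pair] restrict_ext) (simp_all add: c)
qed (rule MA_mult_closed)

lemma bounded_linear_star:
  assumes L: "bounded_linear_on A L" "\<And>x. x \<in> carrier A \<Longrightarrow> L x \<in> carrier A"
  shows "bounded_linear_on A (\<lambda>x. cs_star A (L (cs_star A x)))"
proof -
  obtain K where K: "\<And>x y. \<lbrakk>x \<in> carrier A; y \<in> carrier A\<rbrakk> \<Longrightarrow> L (x \<oplus>\<^bsub>A\<^esub> y) = L x \<oplus>\<^bsub>A\<^esub> L y"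
    "\<And>c x. x \<in> carrier A \<Longrightarrow> L (c \<odot>\<^bsub>A\<^esub> x) = c \<odot>\<^bsub>A\<^esub> L x" "\<And>x. x \<in> carrier A \<Longrightarrow> cs_norm A (L x) \<le> K * cs_norm A x"
    using L(1) by (rule bounded_linear_D) (rule that)
  show ?thesis
  proof (rule bounded_linear_I)
    fix x assume x: "x \<in> carrier A"
    show "cs_norm A (cs_star A (L (cs_star A x))) \<le> K * cs_norm A x"
      using K(3)[OF pre.adj_closed[OF x]] by (simp only: pre.nrm_adj x L(2) pre.adj_closed)
  qed (simp_all only: pre.adj_add pre.adj_smult K L(2) pre.adj_closed complex_cnj_cnj)
qed

lemma MA_star_closed: assumes "x \<in> carrier MA" shows "cs_star MA x \<in> carrier MA"
proof -
  obtain L R where x: "x = (L, R)" by (cases x) blast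
  note X = MA_D[OF assms[unfolded x]]
  show ?thesis
    unfolding x MA_star
  proof (rule MA_I)
    fix a b assume ab: "a \<in> carrier A" "b \<in> carrier A"
    show "cs_star A (L (cs_star A a)) \<otimes>\<^bsub>A\<^esub> b = a \<otimes>\<^bsub>A\<^esub> cs_star A (R (cs_star A b))"
      using X(7)[of "cs_star A b" "cs_star A a"] X(8,9) ab
      by (metis pre.adj_adj pre.adj_closed pre.adj_times)
  qed (use X in \<open>simp_all add: bounded_linear_star pre.adj_times\<close>)
qed

lemma MA_star_mult: assumes "x \<in> carrier MA" "y \<in> carrier MA" shows "cs_star MA (x \<otimes>\<^bsub>MA\<^esub> y) = cs_star MA y \<otimes>\<^bsub>MA\<^esub> cs_star MA x"
proof -
  obtain L R where x: "x = (L, R)" by (cases x) blast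
  obtain L' R' where y: "y = (L', R')" by (cases y) blast
  note X = MA_D(8,9)[OF assms(1)[unfolded x]] and Y = MA_D(8,9)[OF assms(2)[unfolded y]]
  show ?thesis unfolding x y MA_mult MA_star
    by (intro arg_cong2[where f = Pair] restrict_ext) (simp_all add: X Y)
qed

lemma tm_closed [simp]: assumes z: "z \<in> carrier A" shows "tm z \<in> carrier MA"
  unfolding to_multiplier_def
proof (rule MA_I)
  have "\<exists>K. \<forall>x\<in>carrier A. cs_norm A (z \<otimes>\<^bsub>A\<^esub> x) \<le> K * cs_norm A x"
    using z pre.nrm_times by blast
  then show "bounded_linear_on A (\<lambda>x. z \<otimes>\<^bsub>A\<^esub> x)"
    using z unfolding bounded_linear_on_def by (simp add: pre.times_add_r pre.smult_times_r)
  have "\<exists>K. \<forall>x\<in>carrier A. cs_norm A (x \<otimes>\<^bsub>A\<^esub> z) \<le> K * cs_norm A x"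
    using z pre.nrm_times by (metis mult.commute)
  then show "bounded_linear_on A (\<lambda>x. x \<otimes>\<^bsub>A\<^esub> z)"
    using z unfolding bounded_linear_on_def by (simp add: pre.times_add_l pre.smult_times_l)
qed (use z in \<open>simp_all add: pre.times_assoc\<close>)

lemma tm_ops: assumes "z \<in> carrier A" "w \<in> carrier A"
  shows "tm (z \<otimes>\<^bsub>A\<^esub> w) = tm z \<otimes>\<^bsub>MA\<^esub> tm w" "tm (z \<oplus>\<^bsub>A\<^esub> w) = tm z \<oplus>\<^bsub>MA\<^esub> tm w" "tm (c \<odot>\<^bsub>A\<^esub> z) = c \<odot>\<^bsub>MA\<^esub> tm z"
    "tm (cs_star A z) = cs_star MA (tm z)"
  using assms unfolding to_multiplier_def multiplier_algebra_def
  by (auto intro!: restrict_ext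
      simp: pre.times_assoc pre.times_add_l pre.times_add_r pre.smult_times_l pre.smult_times_r pre.adj_times)

text \<open>An element that annihilates everything from the left annihilates its own adjoint, and the
  C*-identity applies.\<close>

lemma tm_inj: assumes "z \<in> carrier A" "w \<in> carrier A" "tm z = tm w" shows "z = w"
proof -
  define d where "d = z \<ominus>\<^bsub>A\<^esub> w"
  have d: "d \<in> carrier A" using assms by (simp add: d_def)
  have "z \<otimes>\<^bsub>A\<^esub> x = w \<otimes>\<^bsub>A\<^esub> x" if "x \<in> carrier A" for x
    using fun_cong[OF arg_cong[OF assms(3), of fst], of x] that by (simp add: to_multiplier_def)
  then have "d \<otimes>\<^bsub>A\<^esub> cs_star A d = \<zero>\<^bsub>A\<^esub>" using assms d by (simp add: d_def pre.times_minus_l)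
  then have "(cs_norm A (cs_star A d))\<^sup>2 = 0" using pre.nrm_adj_times[of "cs_star A d"] d by simp
  then have "d = \<zero>\<^bsub>A\<^esub>" using d pre.nrm_eq_0 by simp
  then show ?thesis using assms by (simp add: d_def pre.minus_eq_0)
qed

section \<open>Generated subalgebras\<close>

lemma whole_subalgebra: "cstar_subalgebra A (carrier A)"
  by (auto simp: cstar_subalgebra_def closed_subspace_def)

lemma generated_subalgebra: assumes "X \<subseteq> carrier A" shows "cstar_subalgebra A (cstar_generated A X)"
proof -
  have sub: "cstar_generated A X \<subseteq> carrier A"
    unfolding cstar_generated_def by (rule Inter_lower) (simp add: whole_subalgebra assms)
  have mem: "x \<in> cstar_generated A X \<longleftrightarrow> (\<forall>S. cstar_subalgebra A S \<and> X \<subseteq> S \<longrightarrow> x \<in> S)" for x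
    by (auto simp: cstar_generated_def)
  have c: "cstar_subalgebra A S \<Longrightarrow> \<zero>\<^bsub>A\<^esub> \<in> S" "cstar_subalgebra A S \<Longrightarrow> x \<in> S \<Longrightarrow> y \<in> S \<Longrightarrow> x \<oplus>\<^bsub>A\<^esub> y \<in> S"
    "cstar_subalgebra A S \<Longrightarrow> x \<in> S \<Longrightarrow> y \<in> S \<Longrightarrow> x \<otimes>\<^bsub>A\<^esub> y \<in> S" "cstar_subalgebra A S \<Longrightarrow> x \<in> S \<Longrightarrow> c \<odot>\<^bsub>A\<^esub> x \<in> S"
    "cstar_subalgebra A S \<Longrightarrow> x \<in> S \<Longrightarrow> cs_star A x \<in> S"
    "cstar_subalgebra A S \<Longrightarrow> \<forall>n. s n \<in> S \<Longrightarrow> x \<in> carrier A \<Longrightarrow> (\<lambda>n. cs_norm A (s n \<ominus>\<^bsub>A\<^esub> x)) \<longlonglongrightarrow> 0 \<Longrightarrow> x \<in> S" for S x y c s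
    unfolding cstar_subalgebra_def closed_subspace_def by blast+
  show ?thesis
    unfolding cstar_subalgebra_def closed_subspace_def
  proof (intro conjI ballI allI impI sub)
    fix s x assume *: "(\<forall>n::nat. s n \<in> cstar_generated A X) \<and> x \<in> carrier A \<and> (\<lambda>n. cs_norm A (s n \<ominus>\<^bsub>A\<^esub> x)) \<longlonglongrightarrow> 0"
    show "x \<in> cstar_generated A X"
      unfolding mem
    proof (intro allI impI)
      fix S assume S: "cstar_subalgebra A S \<and> X \<subseteq> S"
      then have "\<forall>n. s n \<in> S" using * unfolding mem by blast
      then show "x \<in> S" using c(6)[of S s x] S * by blast
    qed
  qed (unfold mem, (meson c)+)
qed

text \<open>The set where two *-homomorphisms agree is a subalgebra, and it is closed because they are
  contractive.\<close>

lemma star_hom_eq_on_generated: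
  assumes X: "X \<subseteq> carrier A" and B: "unital_cstar_algebra B"
    and h: "star_hom (A\<lparr>carrier := cstar_generated A X\<rparr>) B \<phi>" "star_hom (A\<lparr>carrier := cstar_generated A X\<rparr>) B \<psi>"
    and eq: "\<And>x. x \<in> X \<Longrightarrow> \<phi> x = \<psi> x" and x: "x \<in> cstar_generated A X"
  shows "\<phi> x = \<psi> x"
proof -
  interpret B: unital_cstar_algebra B by (rule B)
  let ?S = "cstar_generated A X"
  note gen = generated_subalgebra[OF X]
  note SD = gen[unfolded cstar_subalgebra_def closed_subspace_def]
  have Sc: "cstar_algebra (A\<lparr>carrier := ?S\<rparr>)" by (rule cstar_subalgebra_cstar[OF cstar_algebra_axioms gen])
  interpret S: cstar_algebra "A\<lparr>carrier := ?S\<rparr>" by (rule Sc)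
  have SA: "y \<in> ?S \<Longrightarrow> y \<in> carrier A" for y using SD by blast
  have minus: "y \<ominus>\<^bsub>A\<lparr>carrier := ?S\<rparr>\<^esub> z = y \<ominus>\<^bsub>A\<^esub> z" if "y \<in> ?S" "z \<in> ?S" for y z
    using that SA by (simp add: S.pre.minus_smult pre.minus_smult)
  have conv: "B.pre.conv (\<lambda>n. f (s n)) (f y)"
    if f: "star_hom (A\<lparr>carrier := ?S\<rparr>) B f" and s: "\<forall>n. s n \<in> ?S" "y \<in> ?S" "(\<lambda>n. cs_norm A (s n \<ominus>\<^bsub>A\<^esub> y)) \<longlonglongrightarrow> 0" for f s y
  proof (rule B.pre.conv_bound[where f = "\<lambda>n. cs_norm A (s n \<ominus>\<^bsub>A\<^esub> y)"])
    fix n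
    have "f (s n \<ominus>\<^bsub>A\<^esub> y) = f (s n) \<ominus>\<^bsub>B\<^esub> f y"
    proof -
      have "f (s n \<oplus>\<^bsub>A\<^esub> (-1) \<odot>\<^bsub>A\<^esub> y) = f (s n) \<oplus>\<^bsub>B\<^esub> (-1) \<odot>\<^bsub>B\<^esub> f y"
        using star_homD(2)[OF f, of "s n" "(-1) \<odot>\<^bsub>A\<^esub> y"] star_homD(3)[OF f, of y "-1"] s SD by simp
      then show ?thesis using s SA star_homD(1)[OF f] by (simp add: pre.minus_smult B.pre.minus_smult)
    qed
    moreover have "cs_norm B (f (s n \<ominus>\<^bsub>A\<^esub> y)) \<le> cs_norm A (s n \<ominus>\<^bsub>A\<^esub> y)"
      using star_hom_contractive[OF Sc B f, of "s n \<ominus>\<^bsub>A\<^esub> y"] s minus[of "s n" y] S.M.minus_closed[of "s n" y] by simp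
    ultimately show "cs_norm B (f (s n) \<ominus>\<^bsub>B\<^esub> f y) \<le> cs_norm A (s n \<ominus>\<^bsub>A\<^esub> y)" by simp
  qed (use s star_homD(1)[OF f] in auto)
  have "cstar_subalgebra A {y \<in> ?S. \<phi> y = \<psi> y}"
    unfolding cstar_subalgebra_def closed_subspace_def
  proof (intro conjI ballI allI impI)
    show "{y \<in> ?S. \<phi> y = \<psi> y} \<subseteq> carrier A" using SA by blast
    have z: "\<zero>\<^bsub>A\<^esub> \<in> ?S" using SD by blast
    have "f \<zero>\<^bsub>A\<^esub> = \<zero>\<^bsub>B\<^esub>" if f: "star_hom (A\<lparr>carrier := ?S\<rparr>) B f" for f
      using star_homD(3)[OF f, of "\<zero>\<^bsub>A\<^esub>" 0] star_homD(1)[OF f, of "\<zero>\<^bsub>A\<^esub>"] z by simp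
    from this[OF h(1)] this[OF h(2)] show "\<zero>\<^bsub>A\<^esub> \<in> {y \<in> ?S. \<phi> y = \<psi> y}" using z by simp
  next
    fix y z assume yz: "y \<in> {y \<in> ?S. \<phi> y = \<psi> y}" "z \<in> {y \<in> ?S. \<phi> y = \<psi> y}"
    show "y \<oplus>\<^bsub>A\<^esub> z \<in> {y \<in> ?S. \<phi> y = \<psi> y}" "y \<otimes>\<^bsub>A\<^esub> z \<in> {y \<in> ?S. \<phi> y = \<psi> y}"
      using yz SD star_homD(2,4)[OF h(1), of y z] star_homD(2,4)[OF h(2), of y z] by auto
  next
    fix y c assume y: "y \<in> {y \<in> ?S. \<phi> y = \<psi> y}"
    show "c \<odot>\<^bsub>A\<^esub> y \<in> {y \<in> ?S. \<phi> y = \<psi> y}" using y SD star_homD(3)[OF h(1), of y c] star_homD(3)[OF h(2), of y c] by auto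
    show "cs_star A y \<in> {y \<in> ?S. \<phi> y = \<psi> y}" using y SD star_homD(5)[OF h(1), of y] star_homD(5)[OF h(2), of y] by auto
  next
    fix s y assume H: "(\<forall>n::nat. s n \<in> {y \<in> ?S. \<phi> y = \<psi> y}) \<and> y \<in> carrier A \<and> (\<lambda>n. cs_norm A (s n \<ominus>\<^bsub>A\<^esub> y)) \<longlonglongrightarrow> 0"
    then have s: "\<forall>n. s n \<in> ?S" "\<forall>n. \<phi> (s n) = \<psi> (s n)" "(\<lambda>n. cs_norm A (s n \<ominus>\<^bsub>A\<^esub> y)) \<longlonglongrightarrow> 0" by auto
    have y: "y \<in> ?S" using H SD s(1) by blast
    have "\<phi> y = \<psi> y"
      using B.pre.conv_unique[OF conv[OF h(1) s(1) y s(3)]] conv[OF h(2) s(1) y s(3)] s(2) by simp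
    then show "y \<in> {y \<in> ?S. \<phi> y = \<psi> y}" using y by simp
  qed
  moreover have "X \<subseteq> {y \<in> ?S. \<phi> y = \<psi> y}" using eq unfolding cstar_generated_def by blast
  ultimately have "?S \<subseteq> {y \<in> ?S. \<phi> y = \<psi> y}" unfolding cstar_generated_def[of A X] by (intro Inter_lower) simp
  then show ?thesis using x by blast
qed

end

section \<open>The corner of the crossed product\<close>

locale crossed_su = su_rep G N H M B S U
  for G :: "('a, 'm) monoid_scheme" (structure) and N H M and B :: "'b cstar" and S U +
  fixes A :: "'c cstar" and iD iG
  assumes crossed: "full_crossed_product G (D_alg G N H M) (alpha G N H) A iD iG"
begin

abbreviation "D \<equiv> D_alg G N H M"
abbreviation "\<chi> \<equiv> indicator M :: 'a \<Rightarrow> complex"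

sublocale A: cstar_algebra A
  using crossed by (simp add: full_crossed_product_def)

abbreviation "MA \<equiv> multiplier_algebra A"
abbreviation "tm \<equiv> to_multiplier A"

sublocale Q: monoid MA by (rule A.MA_monoid)

lemmas crossed_parts = crossed[unfolded full_crossed_product_def]

lemmas cov = crossed_parts[THEN conjunct2, THEN conjunct1, unfolded covariant_hom_def unitary_elem_def]

lemma covariant:
  "star_hom D MA iD" "g \<in> carrier G \<Longrightarrow> iG g \<in> carrier MA"
  "g \<in> carrier G \<Longrightarrow> cs_star MA (iG g) \<otimes>\<^bsub>MA\<^esub> iG g = \<one>\<^bsub>MA\<^esub>" "g \<in> carrier G \<Longrightarrow> iG g \<otimes>\<^bsub>MA\<^esub> cs_star MA (iG g) = \<one>\<^bsub>MA\<^esub>"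
  "\<lbrakk>g \<in> carrier G; h \<in> carrier G\<rbrakk> \<Longrightarrow> iG (g \<otimes> h) = iG g \<otimes>\<^bsub>MA\<^esub> iG h"
  "\<lbrakk>g \<in> carrier G; d \<in> carrier D\<rbrakk> \<Longrightarrow> iD (act g d) = iG g \<otimes>\<^bsub>MA\<^esub> iD d \<otimes>\<^bsub>MA\<^esub> cs_star MA (iG g)"
  by (rule cov[THEN conjunct1]) (simp_all only: cov[THEN conjunct2, THEN conjunct1, rule_format]
      cov[THEN conjunct2, THEN conjunct2, THEN conjunct1, rule_format]
      cov[THEN conjunct2, THEN conjunct2, THEN conjunct2, rule_format])

lemma generators: assumes "d \<in> carrier D" "g \<in> carrier G" obtains z where "z \<in> carrier A" "tm z = iD d \<otimes>\<^bsub>MA\<^esub> iG g"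
proof -
  have "iD d \<otimes>\<^bsub>MA\<^esub> iG g \<in> tm ` carrier A" 
    by (rule crossed_parts[THEN conjunct2, THEN conjunct2, THEN conjunct1, rule_format, OF assms])
  then show thesis using that by (auto simp: image_iff)
qed

lemma spanning: "closed_span A {z \<in> carrier A. \<exists>d\<in>carrier D. \<exists>g\<in>carrier G. tm z = iD d \<otimes>\<^bsub>MA\<^esub> iG g} = carrier A"
  by (rule crossed_parts[THEN conjunct2, THEN conjunct2, THEN conjunct2, THEN conjunct1])

lemmas iD_hom = star_homD[OF covariant(1)]

lemma D_ops: "add D = (\<lambda>f h y. f y + h y)" "mult D = (\<lambda>f h y. f y * h y)"
  "smult D = (\<lambda>c f y. c * f y)" "cs_star D = (\<lambda>f y. cnj (f y))"
  by (simp_all add: D_alg_def)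

lemma gens_sub: "{indicator (x <# V) |x V. x \<in> N \<and> V \<in> conj_family G H M} \<subseteq> carrier (linfty N)"
  using D_sub_UCN indicator_coset_D unfolding UCN_def by blast

lemma N_ne: "N \<noteq> {}" using N.one_closed by blast

lemma D_cstar: "cstar_algebra D"
proof -
  interpret L: cstar_algebra "linfty N" by (rule linfty_cstar[OF N_ne])
  show ?thesis unfolding D_alg_def
    by (rule cstar_subalgebra_cstar[OF L.cstar_algebra_axioms L.generated_subalgebra[OF gens_sub]])
qed

lemma D_mult: "\<lbrakk>d \<in> carrier D; e \<in> carrier D\<rbrakk> \<Longrightarrow> (\<lambda>y. d y * e y) \<in> carrier D"
  using cstar_algebra.mult_closed[OF D_cstar] by (simp add: D_ops)

lemma iD_mult: "\<lbrakk>d \<in> carrier D; e \<in> carrier D\<rbrakk> \<Longrightarrow> iD d \<otimes>\<^bsub>MA\<^esub> iD e = iD (\<lambda>y. d y * e y)"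
  using iD_hom(4) by (simp add: D_ops)

lemma iD_commute: "\<lbrakk>d \<in> carrier D; e \<in> carrier D\<rbrakk> \<Longrightarrow> iD d \<otimes>\<^bsub>MA\<^esub> iD e = iD e \<otimes>\<^bsub>MA\<^esub> iD d"
  by (simp add: iD_mult mult.commute)

definition p where "p = iD \<chi>"

lemma p_in [simp]: "p \<in> carrier MA" unfolding p_def by (rule iD_hom(1)[OF indicator_M_D])

lemma p_idem: "p \<otimes>\<^bsub>MA\<^esub> p = p"
proof -
  have "(\<lambda>y. \<chi> y * \<chi> y) = \<chi>" by (auto simp: indicator_def)
  then show ?thesis unfolding p_def iD_mult[OF indicator_M_D indicator_M_D] by simp
qed

lemma p_star: "cs_star MA p = p"
proof -
  have "(\<lambda>y. cnj (\<chi> y)) = \<chi>" by (auto simp: indicator_def)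
  then show ?thesis using iD_hom(5)[OF indicator_M_D] by (simp add: p_def D_ops)
qed

lemma unitary_idem: assumes "x \<in> carrier MA" "cs_star MA x \<otimes>\<^bsub>MA\<^esub> x = \<one>\<^bsub>MA\<^esub>" "x \<otimes>\<^bsub>MA\<^esub> x = x" shows "x = \<one>\<^bsub>MA\<^esub>"
proof -
  have "cs_star MA x \<otimes>\<^bsub>MA\<^esub> (x \<otimes>\<^bsub>MA\<^esub> x) = x" using assms(1,2) A.MA_star_closed by (simp add: Q.m_assoc[symmetric])
  then show ?thesis unfolding assms(3) assms(2) by (rule sym)
qed

text \<open>A unitary idempotent is the unit.\<close>

lemma iG_one: "iG \<one> = \<one>\<^bsub>MA\<^esub>"
  by (rule unitary_idem) (simp_all add: covariant(2,3) covariant(5)[symmetric])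

lemma iG_inv: assumes g: "g \<in> carrier G" shows "iG (inv g) = cs_star MA (iG g)"
proof -
  have e: "iG g \<otimes>\<^bsub>MA\<^esub> iG (inv g) = \<one>\<^bsub>MA\<^esub>" using g covariant(5)[of g "inv g"] by (simp add: iG_one)
  have "cs_star MA (iG g) \<otimes>\<^bsub>MA\<^esub> (iG g \<otimes>\<^bsub>MA\<^esub> iG (inv g)) = cs_star MA (iG g)"
    unfolding e by (rule Q.r_one[OF A.MA_star_closed[OF covariant(2)[OF g]]])
  then show ?thesis
    using g A.MA_star_closed[OF covariant(2)[OF g]] by (simp add: Q.m_assoc[symmetric] covariant(2,3))
qed

definition p' where "p' = (SOME z. z \<in> carrier A \<and> tm z = p)"

text \<open>The compression \<open>p\<close> is a multiplier that comes from the algebra itself, because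
  \<open>p = \<chi>\<^sub>M 1\<close> is one of the generators of the crossed product; so the corner
  can be computed inside \<open>A\<close>.\<close>

lemma p': "p' \<in> carrier A" "tm p' = p"
proof -
  obtain z where "z \<in> carrier A" "tm z = iD \<chi> \<otimes>\<^bsub>MA\<^esub> iG \<one>" using generators[OF indicator_M_D one_closed] by blast
  then have "z \<in> carrier A \<and> tm z = p" using p_in by (simp add: iG_one p_def)
  then have "p' \<in> carrier A \<and> tm p' = p" unfolding p'_def by (rule someI)
  then show "p' \<in> carrier A" "tm p' = p" by simp_all
qed

lemma p'_idem: "p' \<otimes>\<^bsub>A\<^esub> p' = p'" "cs_star A p' = p'"
  by (rule A.tm_inj, use p' in \<open>simp_all add: A.tm_ops(1,4)[OF p'(1) p'(1)] p_idem p_star\<close>)+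

definition Ap where "Ap = {z \<in> carrier A. p' \<otimes>\<^bsub>A\<^esub> z = z \<and> z \<otimes>\<^bsub>A\<^esub> p' = z}"

lemma Ap_compress: "z \<in> carrier A \<Longrightarrow> p' \<otimes>\<^bsub>A\<^esub> z \<otimes>\<^bsub>A\<^esub> p' \<in> Ap"
proof -
  assume z: "z \<in> carrier A"
  have "p' \<otimes>\<^bsub>A\<^esub> (p' \<otimes>\<^bsub>A\<^esub> z \<otimes>\<^bsub>A\<^esub> p') = (p' \<otimes>\<^bsub>A\<^esub> p') \<otimes>\<^bsub>A\<^esub> z \<otimes>\<^bsub>A\<^esub> p'" using z p'(1) by (simp add: A.pre.times_assoc)
  moreover have "(p' \<otimes>\<^bsub>A\<^esub> z \<otimes>\<^bsub>A\<^esub> p') \<otimes>\<^bsub>A\<^esub> p' = p' \<otimes>\<^bsub>A\<^esub> z \<otimes>\<^bsub>A\<^esub> (p' \<otimes>\<^bsub>A\<^esub> p')" using z p'(1) by (simp add: A.pre.times_assoc)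
  ultimately show ?thesis using z p'(1) by (simp add: Ap_def p'_idem)
qed

lemma tm_compress: "z \<in> carrier A \<Longrightarrow> p \<otimes>\<^bsub>MA\<^esub> tm z \<otimes>\<^bsub>MA\<^esub> p = tm (p' \<otimes>\<^bsub>A\<^esub> z \<otimes>\<^bsub>A\<^esub> p')"
  using p' by (simp add: A.tm_ops(1))

lemma corner_carrier: "carrier (corner A p) = tm ` Ap"
proof -
  have "carrier (corner A p) = (\<lambda>z. tm (p' \<otimes>\<^bsub>A\<^esub> z \<otimes>\<^bsub>A\<^esub> p')) ` carrier A"
    by (simp add: corner_def tm_compress)
  also have "\<dots> = tm ` Ap"
  proof
    show "(\<lambda>z. tm (p' \<otimes>\<^bsub>A\<^esub> z \<otimes>\<^bsub>A\<^esub> p')) ` carrier A \<subseteq> tm ` Ap" using Ap_compress by blast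
    have "tm z = tm (p' \<otimes>\<^bsub>A\<^esub> z \<otimes>\<^bsub>A\<^esub> p')" "z \<in> carrier A" if "z \<in> Ap" for z using that by (simp_all add: Ap_def)
    then show "tm ` Ap \<subseteq> (\<lambda>z. tm (p' \<otimes>\<^bsub>A\<^esub> z \<otimes>\<^bsub>A\<^esub> p')) ` carrier A" by blast
  qed
  finally show ?thesis .
qed

lemma corner_ops: "mult (corner A p) = mult MA" "add (corner A p) = add MA" "smult (corner A p) = smult MA"
  "cs_star (corner A p) = cs_star MA"
  by (simp_all add: corner_def)

lemma Ap_A: "z \<in> Ap \<Longrightarrow> z \<in> carrier A" by (simp add: Ap_def)

lemma Ap_subalgebra: "cstar_subalgebra A Ap"
  unfolding cstar_subalgebra_def closed_subspace_def
proof (intro conjI ballI allI impI)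
  show "Ap \<subseteq> carrier A" "\<zero>\<^bsub>A\<^esub> \<in> Ap" using p'(1) by (auto simp: Ap_def)
  fix x y assume xy: "x \<in> Ap" "y \<in> Ap"
  show "x \<oplus>\<^bsub>A\<^esub> y \<in> Ap" using xy p'(1) by (simp add: Ap_def A.pre.times_add_l A.pre.times_add_r)
  have "p' \<otimes>\<^bsub>A\<^esub> (x \<otimes>\<^bsub>A\<^esub> y) = (p' \<otimes>\<^bsub>A\<^esub> x) \<otimes>\<^bsub>A\<^esub> y" "(x \<otimes>\<^bsub>A\<^esub> y) \<otimes>\<^bsub>A\<^esub> p' = x \<otimes>\<^bsub>A\<^esub> (y \<otimes>\<^bsub>A\<^esub> p')"

    using A.pre.times_assoc[of p' x y] A.pre.times_assoc[of x y p'] Ap_A[OF xy(1)] Ap_A[OF xy(2)] p'(1) by simp_all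
  then show "x \<otimes>\<^bsub>A\<^esub> y \<in> Ap" using xy by (simp add: Ap_def)
next
  fix x c assume x: "x \<in> Ap"
  show "c \<odot>\<^bsub>A\<^esub> x \<in> Ap" using x p'(1) by (simp add: Ap_def A.pre.smult_times_l A.pre.smult_times_r)
  have "cs_star A (x \<otimes>\<^bsub>A\<^esub> p') = p' \<otimes>\<^bsub>A\<^esub> cs_star A x" "cs_star A (p' \<otimes>\<^bsub>A\<^esub> x) = cs_star A x \<otimes>\<^bsub>A\<^esub> p'"
    using p'(1) p'_idem Ap_A[OF x] by (simp_all add: A.pre.adj_times)
  then show "cs_star A x \<in> Ap" using x by (simp add: Ap_def)
next
  fix s x assume H: "(\<forall>n::nat. s n \<in> Ap) \<and> x \<in> carrier A \<and> (\<lambda>n. cs_norm A (s n \<ominus>\<^bsub>A\<^esub> x)) \<longlonglongrightarrow> 0"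
  then have s: "A.pre.conv s x" and e: "\<And>n. p' \<otimes>\<^bsub>A\<^esub> s n = s n" "\<And>n. s n \<otimes>\<^bsub>A\<^esub> p' = s n" by (auto simp: A.pre.conv_def Ap_def)
  have "p' \<otimes>\<^bsub>A\<^esub> x = x" using A.pre.conv_unique[OF A.pre.conv_times[OF A.pre.conv_const[OF p'(1)] s]] s by (simp add: e)
  moreover have "x \<otimes>\<^bsub>A\<^esub> p' = x" using A.pre.conv_unique[OF A.pre.conv_times[OF s A.pre.conv_const[OF p'(1)]]] s by (simp add: e)
  ultimately show "x \<in> Ap" using H by (simp add: Ap_def)
qed

definition t where "t g = p \<otimes>\<^bsub>MA\<^esub> iG g \<otimes>\<^bsub>MA\<^esub> p"

lemma t_Ap: assumes "g \<in> carrier G" obtains z where "z \<in> carrier A" "tm z = p \<otimes>\<^bsub>MA\<^esub> iG g" "z \<otimes>\<^bsub>A\<^esub> p' \<in> Ap" "tm (z \<otimes>\<^bsub>A\<^esub> p') = t g"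
proof -
  obtain z where z: "z \<in> carrier A" "tm z = p \<otimes>\<^bsub>MA\<^esub> iG g" using generators[OF indicator_M_D assms] by (auto simp: p_def)
  have "tm (p' \<otimes>\<^bsub>A\<^esub> z) = tm z"
    using z p' covariant(2)[OF assms] by (simp add: A.tm_ops(1) Q.m_assoc[symmetric] p_idem)
  then have "p' \<otimes>\<^bsub>A\<^esub> z = z" using z p' by (intro A.tm_inj) auto
  then have "z \<otimes>\<^bsub>A\<^esub> p' \<in> Ap" using Ap_compress[OF z(1)] by simp
  moreover have "tm (z \<otimes>\<^bsub>A\<^esub> p') = t g" using z p' by (simp add: A.tm_ops(1) t_def)
  ultimately show thesis using that z by blast
qed

section \<open>Existence\<close>

text \<open>On \<open>pAp\<close> the map \<open>z \<mapsto> \<kappa>(\<Phi> z)\<close> is multiplicative,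
  because \<open>\<Phi> z \<Phi> z' = (\<Phi> z) P (\<Phi> z')\<close> there.\<close>

lemma existence:
  "\<exists>\<Psi>. \<Psi> \<in> extensional (carrier (corner A p)) \<and> star_hom (corner A p) B \<Psi> \<and> (\<forall>w\<in>W. \<Psi> (t w) = T w)"
proof -
  obtain C :: "(nat \<Rightarrow> 'a \<Rightarrow> 'a \<Rightarrow> complex) set cstar" and \<pi>C uC \<kappa>C where
    C: "unital_cstar_algebra C" and cov: "covariant_hom G D act C \<pi>C uC"
    and k: "\<And>z. z \<in> carrier C \<Longrightarrow> \<kappa>C z \<in> carrier B"
    "\<And>z z'. \<lbrakk>z \<in> carrier C; z' \<in> carrier C\<rbrakk> \<Longrightarrow> \<kappa>C (z \<oplus>\<^bsub>C\<^esub> z') = \<kappa>C z \<oplus>\<^bsub>B\<^esub> \<kappa>C z'"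
    "\<And>c z. z \<in> carrier C \<Longrightarrow> \<kappa>C (c \<odot>\<^bsub>C\<^esub> z) = c \<odot>\<^bsub>B\<^esub> \<kappa>C z"
    "\<And>z. z \<in> carrier C \<Longrightarrow> \<kappa>C (cs_star C z) = starB (\<kappa>C z)"
    "\<And>z z'. \<lbrakk>z \<in> carrier C; z' \<in> carrier C\<rbrakk> \<Longrightarrow> \<kappa>C (z \<otimes>\<^bsub>C\<^esub> \<pi>C \<chi> \<otimes>\<^bsub>C\<^esub> z') = \<kappa>C z \<otimes>\<^bsub>B\<^esub> \<kappa>C z'"
    "\<And>w. w \<in> W \<Longrightarrow> \<kappa>C (uC w) = T w" "\<kappa>C \<one>\<^bsub>C\<^esub> = \<one>\<^bsub>B\<^esub>"
    by (rule dilation) (rule that)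
  interpret C: unital_cstar_algebra C by (rule C)
  obtain \<Phi> where \<Phi>: "star_hom A C \<Phi>" and \<Phi>g: "\<And>d g z. \<lbrakk>d \<in> carrier D; g \<in> carrier G; z \<in> carrier A; tm z = iD d \<otimes>\<^bsub>MA\<^esub> iG g\<rbrakk> \<Longrightarrow> \<Phi> z = \<pi>C d \<otimes>\<^bsub>C\<^esub> uC g"

    using crossed_parts[THEN conjunct2, THEN conjunct2, THEN conjunct2, THEN conjunct2, rule_format, OF conjI[OF C cov]]
    by blast
  note \<Phi>h = star_homD[OF \<Phi>]
  have u_in: "uC g \<in> carrier C" if "g \<in> carrier G" for g using cov that by (simp add: covariant_hom_def unitary_elem_def)
  have P_in: "\<pi>C \<chi> \<in> carrier C" using cov indicator_M_D by (auto simp: covariant_hom_def star_hom_def)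
  have u1: "uC \<one> = \<one>\<^bsub>C\<^esub>"
  proof -
    have u: "uC \<one> \<in> carrier C" "cs_star C (uC \<one>) \<otimes>\<^bsub>C\<^esub> uC \<one> = \<one>\<^bsub>C\<^esub>" "uC \<one> \<otimes>\<^bsub>C\<^esub> uC \<one> = uC \<one>"
      using cov one_closed r_one[OF one_closed] unfolding covariant_hom_def unitary_elem_def by metis+
    have "cs_star C (uC \<one>) \<otimes>\<^bsub>C\<^esub> (uC \<one> \<otimes>\<^bsub>C\<^esub> uC \<one>) = uC \<one>" using u(1,2) by (simp add: C.pre.times_assoc[symmetric])
    then show ?thesis unfolding u(3) u(2) by (rule sym)
  qed
  have \<Phi>p: "\<Phi> p' = \<pi>C \<chi>"
    using \<Phi>g[OF indicator_M_D one_closed p'(1)] p'(2) p_in P_in by (simp add: u1 iG_one p_def)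
  \<comment> \<open>Elements of the corner are multipliers; \<open>\<Phi>\<close> is applied to the elements of \<open>A\<close> that induce them.\<close>
  define \<Psi> where "\<Psi> = (\<lambda>y\<in>carrier (corner A p). \<kappa>C (\<Phi> (inv_into Ap tm y)))"
  have inj: "inj_on tm Ap" using A.tm_inj Ap_A by (intro inj_onI) blast
  have \<Psi>: "\<Psi> (tm z) = \<kappa>C (\<Phi> z)" if "z \<in> Ap" for z
    using that inj by (simp add: \<Psi>_def corner_carrier)
  note sub = Ap_subalgebra[unfolded cstar_subalgebra_def closed_subspace_def]
  have Apc: "x \<in> Ap \<Longrightarrow> y \<in> Ap \<Longrightarrow> x \<oplus>\<^bsub>A\<^esub> y \<in> Ap" "x \<in> Ap \<Longrightarrow> c \<odot>\<^bsub>A\<^esub> x \<in> Ap" "x \<in> Ap \<Longrightarrow> y \<in> Ap \<Longrightarrow> x \<otimes>\<^bsub>A\<^esub> y \<in> Ap"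
    "x \<in> Ap \<Longrightarrow> cs_star A x \<in> Ap" for x y c using sub by blast+
  have "star_hom (corner A p) B \<Psi>"
    unfolding star_hom_def corner_ops corner_carrier
  proof (intro conjI ballI allI funcsetI)
    fix y assume "y \<in> tm ` Ap"
    then obtain z where z: "z \<in> Ap" "y = tm z" by blast
    note zA = Ap_A[OF z(1)]
    show "\<Psi> y \<in> carrier B" using z zA by (simp add: \<Psi> k \<Phi>h)
    show "\<Psi> (c \<odot>\<^bsub>MA\<^esub> y) = c \<odot>\<^bsub>B\<^esub> \<Psi> y" for c
      using z zA Apc(2)[OF z(1), of c] A.tm_ops(3)[OF zA zA, of c, symmetric] by (simp add: \<Psi> k \<Phi>h)
    show "\<Psi> (cs_star MA y) = starB (\<Psi> y)"
      using z zA Apc(4)[OF z(1)] A.tm_ops(4)[OF zA zA, symmetric] by (simp add: \<Psi> k \<Phi>h)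
    fix y' assume "y' \<in> tm ` Ap"
    then obtain z' where z': "z' \<in> Ap" "y' = tm z'" by blast
    note zA' = Ap_A[OF z'(1)]
    show "\<Psi> (y \<oplus>\<^bsub>MA\<^esub> y') = \<Psi> y \<oplus>\<^bsub>B\<^esub> \<Psi> y'"
      using z zA z' zA' Apc(1)[OF z(1) z'(1)] A.tm_ops(2)[OF zA zA', symmetric] by (simp add: \<Psi> k \<Phi>h)
    have "z \<otimes>\<^bsub>A\<^esub> z' = z \<otimes>\<^bsub>A\<^esub> p' \<otimes>\<^bsub>A\<^esub> z'" using z(1) by (simp add: Ap_def)
    then have "\<Phi> (z \<otimes>\<^bsub>A\<^esub> z') = \<Phi> z \<otimes>\<^bsub>C\<^esub> \<pi>C \<chi> \<otimes>\<^bsub>C\<^esub> \<Phi> z'"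
      using zA zA' p'(1) by (simp add: \<Phi>h(4) \<Phi>p)
    then show "\<Psi> (y \<otimes>\<^bsub>MA\<^esub> y') = \<Psi> y \<otimes>\<^bsub>B\<^esub> \<Psi> y'"
      using z zA z' zA' Apc(3)[OF z(1) z'(1)] A.tm_ops(1)[OF zA zA', symmetric] by (simp add: \<Psi> k(5) \<Phi>h(1))
  qed
  moreover have "\<Psi> (t w) = T w" if w: "w \<in> W" for w
  proof -
    have wG: "w \<in> carrier G" using w by simp
    obtain z where z: "z \<in> carrier A" "tm z = p \<otimes>\<^bsub>MA\<^esub> iG w" "z \<otimes>\<^bsub>A\<^esub> p' \<in> Ap" "tm (z \<otimes>\<^bsub>A\<^esub> p') = t w" by (rule t_Ap[OF wG])
    have "\<Phi> (z \<otimes>\<^bsub>A\<^esub> p') = \<pi>C \<chi> \<otimes>\<^bsub>C\<^esub> uC w \<otimes>\<^bsub>C\<^esub> \<pi>C \<chi>"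
      using z p' \<Phi>g[OF indicator_M_D wG z(1)] by (simp add: \<Phi>h(4) \<Phi>p p_def)
    also have "\<dots> = \<one>\<^bsub>C\<^esub> \<otimes>\<^bsub>C\<^esub> \<pi>C \<chi> \<otimes>\<^bsub>C\<^esub> (uC w \<otimes>\<^bsub>C\<^esub> \<pi>C \<chi> \<otimes>\<^bsub>C\<^esub> \<one>\<^bsub>C\<^esub>)"
      using P_in u_in[OF wG] by (simp add: C.pre.times_assoc)
    finally have "\<kappa>C (\<Phi> (z \<otimes>\<^bsub>A\<^esub> p')) = \<kappa>C \<one>\<^bsub>C\<^esub> \<otimes>\<^bsub>B\<^esub> (\<kappa>C (uC w) \<otimes>\<^bsub>B\<^esub> \<kappa>C \<one>\<^bsub>C\<^esub>)"
      using P_in u_in[OF wG] k(5)[of "\<one>\<^bsub>C\<^esub>" "uC w \<otimes>\<^bsub>C\<^esub> \<pi>C \<chi> \<otimes>\<^bsub>C\<^esub> \<one>\<^bsub>C\<^esub>"] k(5)[of "uC w" "\<one>\<^bsub>C\<^esub>"] by simp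
    then show ?thesis using \<Psi>[OF z(3)] z(4) w by (simp add: k(6,7))
  qed
  moreover have "\<Psi> \<in> extensional (carrier (corner A p))" by (simp add: \<Psi>_def)
  ultimately show ?thesis by blast
qed

section \<open>Uniqueness\<close>

lemma alpha_\<chi>: assumes g: "g \<in> carrier G" shows "act g \<chi> = indicator (np g <# conj_set G (hp g) M)"
proof
  fix y
  show "act g \<chi> y = indicator (np g <# conj_set G (hp g) M) y"
  proof (cases "y \<in> N")
    case True
    define x h where "x = np g" and "h = hp g"
    have xh: "x \<in> N" "h \<in> H" "g = x \<otimes> h" using g decomp(3) by (simp_all add: x_def h_def)
    have "inv g \<otimes> y = (inv h \<otimes> (inv x \<otimes> y) \<otimes> h) \<otimes> inv h" using xh True by (simp add: inv_mult_group m_assoc)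
    moreover have "inv h \<otimes> (inv x \<otimes> y) \<otimes> h \<in> N"
      using conj_N[of "inv h" "inv x \<otimes> y"] xh True by (simp add: sub_closed)
    ultimately have "np (inv g \<otimes> y) = inv h \<otimes> (inv x \<otimes> y) \<otimes> h"
      using xh(2) H.m_inv_closed by (simp add: hp_eq)
    then show ?thesis
      using True g coset_mem[OF xh(1) True xh(2)] by (simp add: alpha_eq indicator_def x_def h_def)
  next
    case False
    have "y \<notin> np g <# conj_set G (hp g) M"
      using False g by (auto simp: l_coset_def conj_set_def conj_N M_sub_N N.m_closed)
    then show ?thesis using False by (simp add: alpha_def)
  qed
qed

lemma alpha_\<chi>_D: "g \<in> carrier G \<Longrightarrow> act g \<chi> \<in> carrier D"
  unfolding alpha_\<chi> by (rule indicator_coset_D) (auto simp: conj_family_def)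

text \<open>For \<open>w \<in> W\<close> the translate of \<open>M\<close> by \<open>w\<close> lies in
  \<open>M\<close>, hence \<open>\<alpha>\<^sub>w(p) \<le> p\<close>.\<close>

lemma iG_p: assumes w: "w \<in> W" shows "iG w \<otimes>\<^bsub>MA\<^esub> p = p \<otimes>\<^bsub>MA\<^esub> (iG w \<otimes>\<^bsub>MA\<^esub> p)"
proof -
  have wG: "w \<in> carrier G" using w by simp
  note iw = covariant(2)[OF wG] and aD = alpha_\<chi>_D[OF wG] and sw = A.MA_star_closed[OF covariant(2)[OF wG]]
  have "np w <# conj_set G (hp w) M \<subseteq> M" using W_parts[OF w] by (intro coset_sub_M) auto
  then have abs: "(\<lambda>y. \<chi> y * act w \<chi> y) = act w \<chi>" 
    unfolding alpha_\<chi>[OF wG] by (intro ext) (auto split: split_indicator)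
  have "iD (act w \<chi>) \<otimes>\<^bsub>MA\<^esub> iG w = iG w \<otimes>\<^bsub>MA\<^esub> p \<otimes>\<^bsub>MA\<^esub> (cs_star MA (iG w) \<otimes>\<^bsub>MA\<^esub> iG w)"
    unfolding covariant(6)[OF wG indicator_M_D] p_def[symmetric] using iw sw by (simp add: Q.m_assoc)
  then have e: "iG w \<otimes>\<^bsub>MA\<^esub> p = iD (act w \<chi>) \<otimes>\<^bsub>MA\<^esub> iG w" using iw by (simp add: covariant(3)[OF wG])
  have "p \<otimes>\<^bsub>MA\<^esub> iD (act w \<chi>) = iD (act w \<chi>)" unfolding p_def iD_mult[OF indicator_M_D aD] abs ..
  then show ?thesis unfolding e using iw iD_hom(1)[OF aD] by (simp add: Q.m_assoc[symmetric])
qed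

text \<open>The inner projection may be dropped by \<open>w p = p w p\<close>.\<close>

lemma t_mult: assumes "g \<in> carrier G" "w \<in> W" shows "t g \<otimes>\<^bsub>MA\<^esub> t w = t (g \<otimes> w)"
proof -
  have G: "iG g \<in> carrier MA" "iG w \<in> carrier MA" using assms by (simp_all add: covariant(2))
  have "t g \<otimes>\<^bsub>MA\<^esub> t w = p \<otimes>\<^bsub>MA\<^esub> iG g \<otimes>\<^bsub>MA\<^esub> (p \<otimes>\<^bsub>MA\<^esub> p) \<otimes>\<^bsub>MA\<^esub> (iG w \<otimes>\<^bsub>MA\<^esub> p)" using G by (simp add: t_def Q.m_assoc)
  also have "\<dots> = p \<otimes>\<^bsub>MA\<^esub> iG g \<otimes>\<^bsub>MA\<^esub> (p \<otimes>\<^bsub>MA\<^esub> (iG w \<otimes>\<^bsub>MA\<^esub> p))" using G by (simp add: p_idem Q.m_assoc)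
  also have "\<dots> = p \<otimes>\<^bsub>MA\<^esub> iG g \<otimes>\<^bsub>MA\<^esub> (iG w \<otimes>\<^bsub>MA\<^esub> p)" unfolding iG_p[OF assms(2), symmetric] ..
  also have "\<dots> = t (g \<otimes> w)" using G assms by (simp add: t_def covariant(5) Q.m_assoc)
  finally show ?thesis .
qed

lemma t_star: assumes "g \<in> carrier G" shows "cs_star MA (t g) = t (inv g)"
  using assms A.MA_star_mult p_star Q.m_closed by (simp add: t_def covariant(2) iG_inv Q.m_assoc A.MA_star_closed)

lemma t_corner: assumes "g \<in> carrier G" shows "t g \<in> carrier (corner A p)"
  using t_Ap[OF assms] unfolding corner_carrier by (metis image_eqI)

text \<open>Writing \<open>g = b\<^sup>-\<^sup>1 (b g)\<close> with \<open>b \<in> H\<^sup>+\<close> and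
  \<open>b g \<in> W\<close> gives \<open>p g p = (p b p)\<^sup>* (p b g p)\<close>, and
  compressions of elements of \<open>W\<close> are products of an \<open>u(m)\<close> and an
  \<open>s\<^sub>a\<close>.\<close>

lemma star_hom_t:
  assumes h: "star_hom (corner A p) B \<Psi>" and s: "\<And>a. a \<in> Hp \<Longrightarrow> \<Psi> (t a) = S a" and u: "\<And>m. m \<in> M \<Longrightarrow> \<Psi> (t m) = U m"
    and g: "g \<in> carrier G" and b: "b \<in> Hp" "b \<otimes> g \<in> W"
  shows "\<Psi> (t g) = starB (T b) \<otimes>\<^bsub>B\<^esub> T (b \<otimes> g)"
proof -
  note H = star_homD[OF h, unfolded corner_ops]
  have W: "\<Psi> (t w) = T w" if w: "w \<in> W" for w
  proof -
    have "t (np w) \<otimes>\<^bsub>MA\<^esub> t (hp w) = t w"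
      using t_mult[of "np w" "hp w"] W_parts[OF w] Hp_W by simp
    then have "\<Psi> (t w) = \<Psi> (t (np w)) \<otimes>\<^bsub>B\<^esub> \<Psi> (t (hp w))"
      using H(4)[OF t_corner t_corner, of "np w" "hp w"] w by simp
    then show ?thesis using W_parts[OF w] by (simp add: s u T_def)
  qed
  have bG: "b \<in> carrier G" using b by simp
  have "t g = t (inv b) \<otimes>\<^bsub>MA\<^esub> t (b \<otimes> g)" using t_mult[of "inv b" "b \<otimes> g"] b bG g by simp
  then have "\<Psi> (t g) = \<Psi> (cs_star MA (t b)) \<otimes>\<^bsub>B\<^esub> \<Psi> (t (b \<otimes> g))"
    using H(4)[OF t_corner t_corner, of "inv b" "b \<otimes> g"] bG g by (simp add: t_star)
  then show ?thesis using H(5)[OF t_corner[OF bG]] W[OF Hp_W[OF b(1)]] W[OF b(2)] by simp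
qed

lemma iD_corner: assumes d: "d \<in> carrier D" shows "iD (\<lambda>y. \<chi> y * d y) \<in> carrier (corner A p)"
  "iD (\<lambda>y. \<chi> y * d y) = p \<otimes>\<^bsub>MA\<^esub> iD d \<otimes>\<^bsub>MA\<^esub> p"
proof -
  have e: "(\<lambda>y. \<chi> y * d y * \<chi> y) = (\<lambda>y. \<chi> y * d y)" by (auto simp: indicator_def)
  show eq: "iD (\<lambda>y. \<chi> y * d y) = p \<otimes>\<^bsub>MA\<^esub> iD d \<otimes>\<^bsub>MA\<^esub> p"
    unfolding p_def iD_mult[OF indicator_M_D d] iD_mult[OF D_mult[OF indicator_M_D d] indicator_M_D] e ..
  obtain z where "z \<in> carrier A" "tm z = iD d \<otimes>\<^bsub>MA\<^esub> iG \<one>" using generators[OF d one_closed] by blast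
  then show "iD (\<lambda>y. \<chi> y * d y) \<in> carrier (corner A p)"
    unfolding eq corner_carrier using Ap_compress tm_compress iD_hom(1)[OF d] by (simp add: iG_one) (metis image_eqI)
qed

text \<open>Compression by \<open>p\<close> is multiplicative on \<open>D\<close>, as \<open>D\<close> is
  commutative.\<close>

lemma star_hom_D: assumes h: "star_hom (corner A p) B \<Psi>" shows "star_hom D B (\<lambda>d. \<Psi> (iD (\<lambda>y. \<chi> y * d y)))"
proof -
  note H = star_homD[OF h, unfolded corner_ops]
  interpret D: cstar_algebra D by (rule D_cstar)
  have c: "(\<lambda>y. \<chi> y * d y) \<in> carrier D" if "d \<in> carrier D" for d by (rule D_mult[OF indicator_M_D that])
  note ic = iD_corner(1)
  have 1: "(\<lambda>y. \<chi> y * (d y + e y)) = (\<lambda>y. \<chi> y * d y) \<oplus>\<^bsub>D\<^esub> (\<lambda>y. \<chi> y * e y)"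
    "(\<lambda>y. \<chi> y * (a * d y)) = a \<odot>\<^bsub>D\<^esub> (\<lambda>y. \<chi> y * d y)" "(\<lambda>y. \<chi> y * (d y * e y)) = (\<lambda>y. \<chi> y * d y) \<otimes>\<^bsub>D\<^esub> (\<lambda>y. \<chi> y * e y)"
    "(\<lambda>y. \<chi> y * cnj (d y)) = cs_star D (\<lambda>y. \<chi> y * d y)" for d e a
    by (auto simp: D_ops indicator_def)
  show ?thesis
    unfolding star_hom_def
  proof (intro conjI ballI allI funcsetI)
    fix d assume d: "d \<in> carrier D"
    show "\<Psi> (iD (\<lambda>y. \<chi> y * d y)) \<in> carrier B" by (rule H(1)[OF ic[OF d]])
    have "\<Psi> (iD (\<lambda>y. \<chi> y * (a * d y))) = a \<odot>\<^bsub>B\<^esub> \<Psi> (iD (\<lambda>y. \<chi> y * d y))" for a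
      unfolding 1 iD_hom(3)[OF c[OF d]] by (rule H(3)[OF ic[OF d]])
    then show "\<Psi> (iD (\<lambda>y. \<chi> y * (a \<odot>\<^bsub>D\<^esub> d) y)) = a \<odot>\<^bsub>B\<^esub> \<Psi> (iD (\<lambda>y. \<chi> y * d y))" for a by (simp add: D_ops)
    have "\<Psi> (iD (\<lambda>y. \<chi> y * cnj (d y))) = starB (\<Psi> (iD (\<lambda>y. \<chi> y * d y)))"
      unfolding 1 iD_hom(5)[OF c[OF d]] by (rule H(5)[OF ic[OF d]])
    then show "\<Psi> (iD (\<lambda>y. \<chi> y * (cs_star D d) y)) = starB (\<Psi> (iD (\<lambda>y. \<chi> y * d y)))" by (simp add: D_ops)
    fix e assume e: "e \<in> carrier D"
    have "\<Psi> (iD (\<lambda>y. \<chi> y * (d y + e y))) = \<Psi> (iD (\<lambda>y. \<chi> y * d y)) \<oplus>\<^bsub>B\<^esub> \<Psi> (iD (\<lambda>y. \<chi> y * e y))"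
      unfolding 1 iD_hom(2)[OF c[OF d] c[OF e]] by (rule H(2)[OF ic[OF d] ic[OF e]])
    then show "\<Psi> (iD (\<lambda>y. \<chi> y * (d \<oplus>\<^bsub>D\<^esub> e) y)) = \<Psi> (iD (\<lambda>y. \<chi> y * d y)) \<oplus>\<^bsub>B\<^esub> \<Psi> (iD (\<lambda>y. \<chi> y * e y))" by (simp add: D_ops)
    have "\<Psi> (iD (\<lambda>y. \<chi> y * (d y * e y))) = \<Psi> (iD (\<lambda>y. \<chi> y * d y)) \<otimes>\<^bsub>B\<^esub> \<Psi> (iD (\<lambda>y. \<chi> y * e y))"
      unfolding 1 iD_hom(4)[OF c[OF d] c[OF e]] by (rule H(4)[OF ic[OF d] ic[OF e]])
    then show "\<Psi> (iD (\<lambda>y. \<chi> y * (d \<otimes>\<^bsub>D\<^esub> e) y)) = \<Psi> (iD (\<lambda>y. \<chi> y * d y)) \<otimes>\<^bsub>B\<^esub> \<Psi> (iD (\<lambda>y. \<chi> y * e y))" by (simp add: D_ops)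
  qed
qed

text \<open>The coset \<open>x h M h\<^sup>-\<^sup>1\<close> is the translate of \<open>M\<close> by \<open>g =
  x h\<close>, so its characteristic function is \<open>g p g\<^sup>*\<close>.\<close>

lemma iD_coset: assumes "x \<in> N" "h \<in> H"
  shows "iD (\<lambda>y. \<chi> y * indicator (x <# conj_set G h M) y) = t (x \<otimes> h) \<otimes>\<^bsub>MA\<^esub> cs_star MA (t (x \<otimes> h))"
proof -
  let ?g = "x \<otimes> h"
  have g: "?g \<in> carrier G" using assms by simp
  note G = covariant(2)[OF g] A.MA_star_closed[OF covariant(2)[OF g]]
  have e: "act ?g \<chi> = indicator (x <# conj_set G h M)" using alpha_\<chi>[OF g] assms by (simp add: hp_eq)
  have "iD (\<lambda>y. \<chi> y * act ?g \<chi> y) = p \<otimes>\<^bsub>MA\<^esub> (iG ?g \<otimes>\<^bsub>MA\<^esub> p \<otimes>\<^bsub>MA\<^esub> cs_star MA (iG ?g)) \<otimes>\<^bsub>MA\<^esub> p"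
    using iD_corner(2)[OF alpha_\<chi>_D[OF g]] covariant(6)[OF g indicator_M_D] by (simp add: p_def)
  also have "\<dots> = p \<otimes>\<^bsub>MA\<^esub> iG ?g \<otimes>\<^bsub>MA\<^esub> (p \<otimes>\<^bsub>MA\<^esub> p) \<otimes>\<^bsub>MA\<^esub> cs_star MA (iG ?g) \<otimes>\<^bsub>MA\<^esub> p" using G by (simp add: p_idem Q.m_assoc)
  also have "\<dots> = t ?g \<otimes>\<^bsub>MA\<^esub> t (inv ?g)" using G g by (simp add: t_def iG_inv Q.m_assoc del: inv_mult_group)
  finally show ?thesis unfolding e t_star[OF g] .
qed

text \<open>The products \<open>d g\<close> span a dense subspace of \<open>A\<close>, and \<open>p d g p = (p d
  p)(p g p)\<close>. The homomorphisms agree on the second factor by \<open>star_hom_t\<close>, and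
  on the first because they agree on the generators of \<open>D\<close>. Density can be used because
  compression followed by a homomorphism is contractive.\<close>

lemma uniqueness:
  assumes h1: "star_hom (corner A p) B \<Psi>1" and h2: "star_hom (corner A p) B \<Psi>2"
    and 1: "\<And>a. a \<in> Hp \<Longrightarrow> \<Psi>1 (t a) = S a" "\<And>m. m \<in> M \<Longrightarrow> \<Psi>1 (t m) = U m"
    and 2: "\<And>a. a \<in> Hp \<Longrightarrow> \<Psi>2 (t a) = S a" "\<And>m. m \<in> M \<Longrightarrow> \<Psi>2 (t m) = U m"
    and y: "y \<in> carrier (corner A p)"
  shows "\<Psi>1 y = \<Psi>2 y"
proof -
  note H1 = star_homD[OF h1, unfolded corner_ops] and H2 = star_homD[OF h2, unfolded corner_ops]
  have teq: "\<Psi>1 (t g) = \<Psi>2 (t g)" if g: "g \<in> carrier G" for g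
  proof -
    obtain b where b: "b \<in> Hp" "b \<otimes> g \<in> W" using W_fraction[OF g] by blast
    have "\<Psi>1 (t g) = starB (T b) \<otimes>\<^bsub>B\<^esub> T (b \<otimes> g)" by (rule star_hom_t[OF h1 1 g b])
    also have "\<dots> = \<Psi>2 (t g)" by (rule star_hom_t[OF h2 2 g b, symmetric])
    finally show ?thesis .
  qed
  have deq: "\<Psi>1 (iD (\<lambda>y. \<chi> y * d y)) = \<Psi>2 (iD (\<lambda>y. \<chi> y * d y))" if d: "d \<in> carrier D" for d
  proof -
    interpret L: cstar_algebra "linfty N" by (rule linfty_cstar[OF N_ne])
    show ?thesis
    proof (rule L.star_hom_eq_on_generated[OF gens_sub B.unital_cstar_algebra_axioms
          star_hom_D[OF h1, unfolded D_alg_def] star_hom_D[OF h2, unfolded D_alg_def]])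
      fix f :: "'a \<Rightarrow> complex"
      assume "f \<in> {indicator (x <# V) |x V. x \<in> N \<and> V \<in> conj_family G H M}"
      then obtain x k where x: "x \<in> N" "k \<in> H" "f = indicator (x <# conj_set G k M)" by (auto simp: conj_family_def)
      have g: "x \<otimes> k \<in> carrier G" "inv (x \<otimes> k) \<in> carrier G" using x by simp_all
      show "\<Psi>1 (iD (\<lambda>y. \<chi> y * f y)) = \<Psi>2 (iD (\<lambda>y. \<chi> y * f y))"
        unfolding x(3) iD_coset[OF x(1,2)] t_star[OF g(1)]
        using H1(4)[OF t_corner[OF g(1)] t_corner[OF g(2)]] H2(4)[OF t_corner[OF g(1)] t_corner[OF g(2)]] teq g by simp
    next
      show "d \<in> cstar_generated (linfty N) {indicator (x <# V) |x V. x \<in> N \<and> V \<in> conj_family G H M}"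
        using d by (simp add: D_alg_def)
    qed
  qed
  have Apc: "cstar_algebra (A\<lparr>carrier := Ap\<rparr>)" by (rule cstar_subalgebra_cstar[OF A.cstar_algebra_axioms Ap_subalgebra])
  have cin: "tm z \<in> carrier (corner A p)" if "z \<in> Ap" for z using that unfolding corner_carrier by (rule imageI)
  let ?c = "\<lambda>z. p' \<otimes>\<^bsub>A\<^esub> z \<otimes>\<^bsub>A\<^esub> p'"
  have cA [simp]: "?c z \<in> carrier A" if "z \<in> carrier A" for z using that p'(1) by simp
  have comp: "star_hom (A\<lparr>carrier := Ap\<rparr>) B (\<lambda>z. \<Psi> (tm z))" if "star_hom (corner A p) B \<Psi>" for \<Psi>
  proof -
    note H = star_homD[OF that, unfolded corner_ops]
    show ?thesis
      unfolding star_hom_def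
      by (auto simp: A.tm_ops(1,2) A.tm_ops(3,4)[OF _ p'(1)] Ap_A H cin)
  qed
  have np': "cs_norm A p' \<le> 1"
  proof -
    have "cs_norm A p' * cs_norm A p' = cs_norm A p'"
      using A.pre.nrm_adj_times[OF p'(1)] by (simp add: p'_idem power2_eq_square)
    then show ?thesis by auto
  qed
  have nc: "cs_norm A (?c z) \<le> cs_norm A z" if z: "z \<in> carrier A" for z
  proof -
    have "cs_norm A (?c z) \<le> 1 * cs_norm A z * 1"
      using z p'(1) np' by (intro A.pre.nrm_times_le) auto
    then show ?thesis by simp
  qed
  have lin: "\<Psi> (tm (?c (x \<oplus>\<^bsub>A\<^esub> z))) = \<Psi> (tm (?c x)) \<oplus>\<^bsub>B\<^esub> \<Psi> (tm (?c z))" "\<Psi> (tm (?c (c \<odot>\<^bsub>A\<^esub> x))) = c \<odot>\<^bsub>B\<^esub> \<Psi> (tm (?c x))"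
    "\<Psi> (tm (?c x)) \<in> carrier B" "cs_norm B (\<Psi> (tm (?c x))) \<le> cs_norm A x"
    if h: "star_hom (corner A p) B \<Psi>" and x: "x \<in> carrier A" and z: "z \<in> carrier A" for \<Psi> x z c
  proof -
    note C = star_homD[OF comp[OF h]]
    note xA = Ap_compress[OF x] and zA = Ap_compress[OF z]
    have "?c (x \<oplus>\<^bsub>A\<^esub> z) = ?c x \<oplus>\<^bsub>A\<^esub> ?c z" "?c (c \<odot>\<^bsub>A\<^esub> x) = c \<odot>\<^bsub>A\<^esub> ?c x"
      using x z p'(1) by (simp_all add: A.pre.times_add_l A.pre.times_add_r A.pre.smult_times_l A.pre.smult_times_r)
    then show "\<Psi> (tm (?c (x \<oplus>\<^bsub>A\<^esub> z))) = \<Psi> (tm (?c x)) \<oplus>\<^bsub>B\<^esub> \<Psi> (tm (?c z))" "\<Psi> (tm (?c (c \<odot>\<^bsub>A\<^esub> x))) = c \<odot>\<^bsub>B\<^esub> \<Psi> (tm (?c x))"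
      using C(2)[of "?c x" "?c z"] C(3)[of "?c x" c] xA zA by simp_all
    show "\<Psi> (tm (?c x)) \<in> carrier B" using C(1)[of "?c x"] xA by simp
    show "cs_norm B (\<Psi> (tm (?c x))) \<le> cs_norm A x"
      using star_hom_contractive[OF Apc B.unital_cstar_algebra_axioms comp[OF h], of "?c x"] xA nc[OF x] by simp
  qed
  \<comment> \<open>The spanning set lies in \<open>A\<close>, not in the corner, so agreement is studied for compressions of arbitrary elements of \<open>A\<close>.\<close>
  let ?E = "{z \<in> carrier A. \<Psi>1 (tm (?c z)) = \<Psi>2 (tm (?c z))}"
  have conv: "B.pre.conv (\<lambda>n. \<Psi> (tm (?c (s n)))) (\<Psi> (tm (?c x)))"
    if h: "star_hom (corner A p) B \<Psi>" and s: "\<forall>n. s n \<in> carrier A" "x \<in> carrier A" "(\<lambda>n. cs_norm A (s n \<ominus>\<^bsub>A\<^esub> x)) \<longlonglongrightarrow> 0" for \<Psi> s x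
  proof (rule B.pre.conv_bound[where f = "\<lambda>n. cs_norm A (s n \<ominus>\<^bsub>A\<^esub> x)"])
    fix n
    have sn: "s n \<in> carrier A" using s by blast
    have "\<Psi> (tm (?c (s n \<ominus>\<^bsub>A\<^esub> x))) = \<Psi> (tm (?c (s n))) \<ominus>\<^bsub>B\<^esub> \<Psi> (tm (?c x))"
      using lin(1)[OF h sn A.pre.smult_in[OF s(2)], of "-1"] lin(2)[OF h s(2) s(2), of "-1"]
        lin(3)[OF h sn sn] lin(3)[OF h s(2) s(2)] sn s(2)
      by (simp add: A.pre.minus_smult B.pre.minus_smult)
    then show "cs_norm B (\<Psi> (tm (?c (s n))) \<ominus>\<^bsub>B\<^esub> \<Psi> (tm (?c x))) \<le> cs_norm A (s n \<ominus>\<^bsub>A\<^esub> x)"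
      using lin(4)[OF h A.M.minus_closed[OF sn s(2)] s(2)] by simp
  qed (use s lin(3)[OF h] in blast)+
  have "closed_subspace A ?E"
    unfolding closed_subspace_def
  proof (intro conjI ballI allI impI)
    show "?E \<subseteq> carrier A" by blast
    have "\<Psi> (tm (?c \<zero>\<^bsub>A\<^esub>)) = \<zero>\<^bsub>B\<^esub>" if h: "star_hom (corner A p) B \<Psi>" for \<Psi>
      using lin(2)[OF h A.M.zero_closed A.M.zero_closed, of 0] lin(3)[OF h A.M.zero_closed A.M.zero_closed] by simp
    from this[OF h1] this[OF h2] show "\<zero>\<^bsub>A\<^esub> \<in> ?E" by simp
  next
    fix x z assume "x \<in> ?E" "z \<in> ?E"
    then show "x \<oplus>\<^bsub>A\<^esub> z \<in> ?E" using lin(1)[OF h1, of x z] lin(1)[OF h2, of x z] by simp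
  next
    fix c x assume "x \<in> ?E"
    then show "c \<odot>\<^bsub>A\<^esub> x \<in> ?E" using lin(2)[OF h1, of x x c] lin(2)[OF h2, of x x c] by simp
  next
    fix s x assume H: "(\<forall>n::nat. s n \<in> ?E) \<and> x \<in> carrier A \<and> (\<lambda>n. cs_norm A (s n \<ominus>\<^bsub>A\<^esub> x)) \<longlonglongrightarrow> 0"
    then have s: "\<forall>n. s n \<in> carrier A" "\<forall>n. \<Psi>1 (tm (?c (s n))) = \<Psi>2 (tm (?c (s n)))" "x \<in> carrier A"
      "(\<lambda>n. cs_norm A (s n \<ominus>\<^bsub>A\<^esub> x)) \<longlonglongrightarrow> 0" by auto
    show "x \<in> ?E"
      using B.pre.conv_unique[OF conv[OF h1 s(1,3,4)]] conv[OF h2 s(1,3,4)] s(2,3) by simp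
  qed
  moreover have "{z \<in> carrier A. \<exists>d\<in>carrier D. \<exists>g\<in>carrier G. tm z = iD d \<otimes>\<^bsub>MA\<^esub> iG g} \<subseteq> ?E"
  proof
    fix z assume "z \<in> {z \<in> carrier A. \<exists>d\<in>carrier D. \<exists>g\<in>carrier G. tm z = iD d \<otimes>\<^bsub>MA\<^esub> iG g}"
    then obtain d g where z: "z \<in> carrier A" and d: "d \<in> carrier D" and g: "g \<in> carrier G" and e: "tm z = iD d \<otimes>\<^bsub>MA\<^esub> iG g" by blast
    note c = iD_hom(1)[OF d] covariant(2)[OF g]
    have pd: "p \<otimes>\<^bsub>MA\<^esub> iD d = p \<otimes>\<^bsub>MA\<^esub> iD d \<otimes>\<^bsub>MA\<^esub> p"
      using iD_commute[OF indicator_M_D d] c by (simp add: p_def[symmetric] Q.m_assoc p_idem)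
    have "tm (?c z) = p \<otimes>\<^bsub>MA\<^esub> iD d \<otimes>\<^bsub>MA\<^esub> iG g \<otimes>\<^bsub>MA\<^esub> p" using z tm_compress[OF z] c by (simp add: e Q.m_assoc)
    also have "\<dots> = p \<otimes>\<^bsub>MA\<^esub> iD d \<otimes>\<^bsub>MA\<^esub> p \<otimes>\<^bsub>MA\<^esub> iG g \<otimes>\<^bsub>MA\<^esub> p" using pd by simp
    also have "\<dots> = p \<otimes>\<^bsub>MA\<^esub> iD d \<otimes>\<^bsub>MA\<^esub> (p \<otimes>\<^bsub>MA\<^esub> p) \<otimes>\<^bsub>MA\<^esub> iG g \<otimes>\<^bsub>MA\<^esub> p" by (simp add: p_idem)
    also have "\<dots> = (p \<otimes>\<^bsub>MA\<^esub> iD d \<otimes>\<^bsub>MA\<^esub> p) \<otimes>\<^bsub>MA\<^esub> t g" using c by (simp add: t_def Q.m_assoc)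
    finally have "tm (?c z) = iD (\<lambda>y. \<chi> y * d y) \<otimes>\<^bsub>MA\<^esub> t g" unfolding iD_corner(2)[OF d] .
    then have "\<Psi>1 (tm (?c z)) = \<Psi>2 (tm (?c z))"
      using H1(4)[OF iD_corner(1)[OF d] t_corner[OF g]] H2(4)[OF iD_corner(1)[OF d] t_corner[OF g]] deq[OF d] teq[OF g] by simp
    then show "z \<in> ?E" using z by simp
  qed
  ultimately have "closed_span A {z \<in> carrier A. \<exists>d\<in>carrier D. \<exists>g\<in>carrier G. tm z = iD d \<otimes>\<^bsub>MA\<^esub> iG g} \<subseteq> ?E"
    unfolding closed_span_def by blast
  then have "carrier A \<subseteq> ?E" unfolding spanning .
  moreover obtain z where z: "z \<in> Ap" "y = tm z" using y unfolding corner_carrier by blast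
  ultimately have "\<Psi>1 (tm (?c z)) = \<Psi>2 (tm (?c z))" using Ap_A by blast
  moreover have "?c z = z" using z by (simp add: Ap_def)
  ultimately show ?thesis using z by simp
qed

end

theorem theorem9p11:
  fixes G :: "('g, 'm) monoid_scheme" and N H M :: "'g set"
    and A :: "'a cstar"
    and iD :: "('g \<Rightarrow> complex) \<Rightarrow> ('a \<Rightarrow> 'a) \<times> ('a \<Rightarrow> 'a)"
    and iG :: "'g \<Rightarrow> ('a \<Rightarrow> 'a) \<times> ('a \<Rightarrow> 'a)"
    and p :: "('a \<Rightarrow> 'a) \<times> ('a \<Rightarrow> 'a)"
    and s u :: "'g \<Rightarrow> ('a \<Rightarrow> 'a) \<times> ('a \<Rightarrow> 'a)"
    and B :: "'b cstar" and S U :: "'g \<Rightarrow> 'b"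
  assumes "semidirect_system G N H M"
    and "\<And>a b. a \<in> H \<Longrightarrow> b \<in> H \<Longrightarrow> a \<otimes>\<^bsub>G\<^esub> b = b \<otimes>\<^bsub>G\<^esub> a"
    and "N = (\<Union>a\<in>pos_part G H M. conj_set G (inv\<^bsub>G\<^esub> a) M)"
    and "full_crossed_product G (D_alg G N H M) (alpha G N H) A iD iG"
    and "p = iD (indicator M)"
    and "\<And>a. a \<in> pos_part G H M \<Longrightarrow>
      s a = p \<otimes>\<^bsub>multiplier_algebra A\<^esub> iG a \<otimes>\<^bsub>multiplier_algebra A\<^esub> p"
    and "\<And>m. m \<in> M \<Longrightarrow>
      u m = p \<otimes>\<^bsub>multiplier_algebra A\<^esub> iG m \<otimes>\<^bsub>multiplier_algebra A\<^esub> p"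
    and "unital_cstar_algebra B"
    and "SU_family G H M B S U"
  shows "\<exists>!\<Psi>. \<Psi> \<in> extensional (carrier (corner A p)) \<and> star_hom (corner A p) B \<Psi> \<and>
    (\<forall>a\<in>pos_part G H M. \<Psi> (s a) = S a) \<and> (\<forall>m\<in>M. \<Psi> (u m) = U m)"
proof -
  interpret crossed_su G N H M B S U A iD iG
    by (intro crossed_su.intro su_rep.intro abelian_system.intro abelian_system_axioms.intro
        su_rep_axioms.intro crossed_su_axioms.intro assms)
  have p: "p = local.p" by (simp add: assms(5) p_def)
  have su: "a \<in> pos_part G H M \<Longrightarrow> s a = t a" "m \<in> M \<Longrightarrow> u m = t m" for a m
    using assms(6,7) by (simp_all add: t_def p)
  obtain \<Psi> where \<Psi>: "\<Psi> \<in> extensional (carrier (corner A p))" "star_hom (corner A p) B \<Psi>" "\<forall>w\<in>W. \<Psi> (t w) = T w"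
    using existence unfolding p by blast
  show ?thesis
  proof (rule ex1I[of _ \<Psi>])
    show "\<Psi> \<in> extensional (carrier (corner A p)) \<and> star_hom (corner A p) B \<Psi> \<and>
        (\<forall>a\<in>pos_part G H M. \<Psi> (s a) = S a) \<and> (\<forall>m\<in>M. \<Psi> (u m) = U m)"
      using \<Psi> M_W Hp_W by (simp add: su T_M T_Hp)
    fix \<Psi>' assume \<Psi>': "\<Psi>' \<in> extensional (carrier (corner A p)) \<and> star_hom (corner A p) B \<Psi>' \<and>
        (\<forall>a\<in>pos_part G H M. \<Psi>' (s a) = S a) \<and> (\<forall>m\<in>M. \<Psi>' (u m) = U m)"
    show "\<Psi>' = \<Psi>"
    proof (rule extensionalityI[of _ "carrier (corner A p)"])
      fix y assume y: "y \<in> carrier (corner A p)"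
      show "\<Psi>' y = \<Psi> y"
        by (rule uniqueness) (use \<Psi> \<Psi>' y M_W Hp_W in \<open>simp_all add: su T_M T_Hp p\<close>)
    qed (use \<Psi> \<Psi>' in simp_all)
  qed
qed

end
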